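(* Let $d\ge3$ and $q\ge2$, let $L(s,F)$ be an $L$-function of degree $d$ satisfying the framework described in the context, and let $\delta\in(0,1)$. Assume: (A1) $|\lambda_F(n)|\le \tau_d(n)$ for all integers $n\ge 1$. (A2) For some fixed (but arbitrary) $\varepsilon>0$, $\sum_{X\le n\le X+Y}|\lambda_F(n)|^2\ll_F Y$ holds for all large $X\geq 2$ and all $X^{1-\varepsilon}\le Y\le X$. (A3) For any $2\le P_1\le P_2\le X$, $\displaystyle\sum_{n\le X,\ (n,\prod_{P_1\le p\le P_2}p)=1}|\lambda_F(n)|^2\ll_F X\frac{\log P_1}{\log P_2}$. (A5) There are a (large) fixed constant $C_F>0$ depending on $F$ and an (arbitrarily large) constant $A>0$ such that, for all $1-\frac1{2024}<\sigma<1$ and all $1\le T\le q$, $$\sum_{\chi\ (\mathrm{mod}\ q)}^{*}\mathcal{N}_F(\sigma,T;\chi)\ll_F q^{C_F(1-\sigma)}\log^A q.$$ (A6) For all primitive Dirichlet characters $\chi$ modulo $q$, $$L\big(\tfrac12,F\times\chi\big)\ll_F\frac{q^{d/4}}{\exp(\log^{\delta}q)}.$$ Then, for any $\eta<\delta$, $$\sum_{\chi\ (\mathrm{mod}\ q)}^{*}\Big|L\big(\tfrac12,F\times\chi\big)\Big|^2\ll_F\frac{q^{d/2}}{\log^{\eta}q}.$$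
   Context: Framework. $L(s,F)=\sum_{n\ge1}\lambda_F(n)n^{-s}=\prod_p\prod_{j=1}^d(1-\alpha_{j,F}(p)p^{-s})^{-1}$ is a Dirichlet series with Euler product of degree $d$, both absolutely convergent for $\Re(s)>1$; $\lambda_F$ is multiplicative with $\lambda_F(p^r)=\sum_{r_1,\dots,r_d\ge0,\ r_1+\cdots+r_d=r}\prod_{j=1}^d\alpha_{j,F}(p)^{r_j}$. For $q\ge2$ and a primitive Dirichlet character $\chi$ modulo $q$, $$L(s,F\times\chi)=\sum_{n\ge1}\frac{\lambda_F(n)\chi(n)}{n^s}=\prod_p\prod_{j=1}^d\Big(1-\frac{\alpha_{j,F}(p)\chi(p)}{p^s}\Big)^{-1},$$ both absolutely convergent for $\Re(s)>1$. Put $L_\infty(s,F\times\chi)=N^{s/2}\prod_{j=1}^d\Gamma_{\mathbb R}(s+\mu_j)$ with $\Gamma_{\mathbb R}(s)=\pi^{-s/2}\Gamma(s/2)$, where the conductor $N$ (a positive integer) depends only on $F$ and $q$, and the $\mu_j\in\mathbb C$ depend only on $F$ and $\chi(-1)$ and satisfy $\Re(\mu_j)\ge-1+\theta_F$ for some fixed $\theta_F$ with $\frac1{2d}<\theta_F<\frac12$. Let $\Lambda(s,F\times\chi)=L(s,F\times\chi)L_\infty(s,F\times\chi)$. It is assumed that: (1) $\Lambda(s,F\times\chi)$ extends to an entire function of order 1; (2) $\Lambda(s,F\times\chi)=\kappa\,\Lambda(1-s,\tilde F\times\overline\chi)$ for some $\kappa=\kappa_{F,\chi}$ with $|\kappa|=1$,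 where $\tilde F$ is the dual form with $\lambda_{\tilde F}(n)=\overline{\lambda_F(n)}$ (its completed $L$-function is formed in the same way, with the same $N$ and with parameters $\overline{\mu_j}$); (3) with the analytic conductor $C(s,F\times\chi)=N\prod_{j=1}^d(|s+\mu_j+3|)$ and $C(F\times\chi)=C(\frac12,F\times\chi)$, one has $C(F\times\chi)\ll_F N\ll_F q^d$ for large $q$. Notation. $\sum^{*}_{\chi\,(\mathrm{mod}\ q)}$ is the sum over all primitive Dirichlet characters modulo $q$. $\mathcal{N}_F(\sigma,T;\chi)$ is the number of zeros of $L(s,F\times\chi)$ in the region $\Re(s)\ge\sigma$, $|\Im(s)|\le T$. $\tau_d$ is the $d$-fold divisor function, $p$ denotes a prime, $\log^a x=(\log x)^a$. $F$ (and $d,\delta,\eta,A$) are fixed, all constants in the hypotheses are uniform in $q$ and $\chi$, and the implied constant in the conclusion depends on $F$ and the fixed parameters but not on $q$. *)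

theory Defs
  imports "HOL-Complex_Analysis.Complex_Analysis" "HOL-Number_Theory.Number_Theory"
begin

section \<open>Dirichlet characters\<close>

text \<open>Characters are functions on the integers, so that \<open>chi (-1)\<close> needs no representative.\<close>

definition dirichlet_character :: "nat \<Rightarrow> (int \<Rightarrow> complex) \<Rightarrow> bool" where
  "dirichlet_character q chi \<longleftrightarrow>
     (\<forall>a b. chi (a * b) = chi a * chi b) \<and>
     (\<forall>a. chi (a + int q) = chi a) \<and>
     (\<forall>a. chi a \<noteq> 0 \<longleftrightarrow> coprime a (int q))"

definition induced_modulus :: "nat \<Rightarrow> (int \<Rightarrow> complex) \<Rightarrow> nat \<Rightarrow> bool" where
  "induced_modulus q chi m \<longleftrightarrow>
     m dvd q \<and> (\<forall>a. coprime a (int q) \<and> [a = 1] (mod int m) \<longrightarrow> chi a = 1)"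

definition primitive_characters :: "nat \<Rightarrow> (int \<Rightarrow> complex) set" where
  "primitive_characters q =
     {chi. dirichlet_character q chi \<and> \<not> (\<exists>m<q. induced_modulus q chi m)}"

lemma dirichlet_character_mod:
  assumes "dirichlet_character q chi"
  shows "chi (a mod int q) = chi a"
proof -
  have per: "chi (x + int q) = chi x" for x
    using assms by (simp add: dirichlet_character_def)
  have *: "chi (x + int k * int q) = chi x" for x k
  proof (induction k)
    case (Suc k)
    have "chi (x + int (Suc k) * int q) = chi ((x + int k * int q) + int q)"
      by (simp add: algebra_simps)
    then show ?case using per Suc by simp
  qed simp
  show ?thesis
  proof (cases "a div int q \<ge> 0")
    case True
    have "a = a mod int q + int (nat (a div int q)) * int q" using True by simp
    then show ?thesis using * by metis
  next
    case False
    have "a mod int q = a + int (nat (- (a div int q))) * int q"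
      using False by (simp add: minus_div_mult_eq_mod [symmetric])
    then show ?thesis using * by metis
  qed
qed

lemma dirichlet_character_root_of_unity:
  assumes "dirichlet_character q chi" "q > 0" "chi a \<noteq> 0"
  shows "chi a ^ totient q = 1"
proof -
  have mult: "chi (x * y) = chi x * chi y" for x y
    using assms by (simp add: dirichlet_character_def)
  have "chi 1 \<noteq> 0" using assms by (simp add: dirichlet_character_def)
  then have one: "chi 1 = 1" using mult[of 1 1] by simp
  have pow: "chi (x ^ k) = chi x ^ k" for x k
    by (induction k) (simp_all add: one mult)
  define b where "b = nat (a mod int q)"
  have b: "int b = a mod int q" using assms(2) by (simp add: b_def)
  have "coprime a (int q)" using assms by (simp add: dirichlet_character_def)
  then have "coprime (int b) (int q)"
    by (metis b assms(2) coprime_mod_left_iff of_nat_0_less_iff order_less_irrefl)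
  then have "coprime b q" by simp
  then have "[b ^ totient q = 1] (mod q)" by (rule euler_theorem)
  then have "[int b ^ totient q = 1] (mod int q)"
    by (metis cong_int_iff of_nat_1 of_nat_power)
  then have "chi (int b ^ totient q) = chi 1"
    by (metis dirichlet_character_mod[OF assms(1)] cong_def)
  moreover have "chi (int b) = chi a" by (simp add: b dirichlet_character_mod[OF assms(1)])
  ultimately show ?thesis by (simp add: pow one)
qed

lemma finite_primitive_characters:
  assumes "q > 0"
  shows "finite (primitive_characters q)"
proof -
  let ?R = "insert 0 {z::complex. z ^ totient q = 1}"
  let ?r = "\<lambda>chi::int \<Rightarrow> complex. restrict chi {0..<int q}"
  have "finite {z::complex. z ^ totient q = 1}"
    using assms by (intro finite_roots_unity) (simp add: Suc_le_eq)
  then have fin: "finite ({0..<int q} \<rightarrow>\<^sub>E ?R)" by (intro finite_PiE) auto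
  have "?r ` {chi. dirichlet_character q chi} \<subseteq> {0..<int q} \<rightarrow>\<^sub>E ?R"
    using dirichlet_character_root_of_unity assms by fastforce
  then have "finite (?r ` {chi. dirichlet_character q chi})" by (rule finite_subset[OF _ fin])
  moreover have "inj_on ?r {chi. dirichlet_character q chi}"
  proof (rule inj_onI, rule ext)
    fix chi \<psi> and a :: int
    assume *: "chi \<in> {chi. dirichlet_character q chi}" "\<psi> \<in> {chi. dirichlet_character q chi}"
      and eq: "?r chi = ?r \<psi>"
    have "a mod int q \<in> {0..<int q}" using assms by simp
    then have "chi (a mod int q) = \<psi> (a mod int q)" using eq by (metis restrict_apply')
    then show "chi a = \<psi> a" using * by (simp add: dirichlet_character_mod)
  qed
  ultimately have "finite {chi. dirichlet_character q chi}" by (rule finite_imageD)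
  then show ?thesis by (rule rev_finite_subset) (auto simp: primitive_characters_def)
qed

section \<open>Twisted L-functions of degree d\<close>

text \<open>
  The data attached to \<open>F\<close>: \<open>satake F j p\<close> is \<open>\<alpha>\<^sub>j\<^sub>,\<^sub>F(p)\<close> for \<open>j < L_degree F\<close>,
  \<open>conductor F q\<close> is the conductor \<open>N\<close> of \<open>F \<times> chi\<close> for \<open>chi\<close> modulo \<open>q\<close>, and
  \<open>shift F (chi (-1)) j\<close> is \<open>\<mu>\<^sub>j\<close>; the types record that \<open>N\<close> depends only on \<open>F, q\<close> and
  \<open>\<mu>\<^sub>j\<close> only on \<open>F, chi (-1)\<close>.
\<close>

record L_data =
  L_degree :: nat
  satake :: "nat \<Rightarrow> nat \<Rightarrow> complex"
  lam :: "nat \<Rightarrow> complex"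
  conductor :: "nat \<Rightarrow> nat"
  shift :: "complex \<Rightarrow> nat \<Rightarrow> complex"

definition dual :: "L_data \<Rightarrow> L_data" where
  "dual F = F\<lparr>satake := \<lambda>j p. cnj (satake F j p), lam := \<lambda>n. cnj (lam F n),
              shift := \<lambda>e j. cnj (shift F e j)\<rparr>"

definition L_term :: "L_data \<Rightarrow> (int \<Rightarrow> complex) \<Rightarrow> complex \<Rightarrow> nat \<Rightarrow> complex" where
  "L_term F chi s n = lam F n * chi (int n) / of_nat n powr s"

definition L_series :: "L_data \<Rightarrow> (int \<Rightarrow> complex) \<Rightarrow> complex \<Rightarrow> complex" where
  "L_series F chi s = (\<Sum>n. L_term F chi s (Suc n))"

definition euler_factor :: "L_data \<Rightarrow> (int \<Rightarrow> complex) \<Rightarrow> complex \<Rightarrow> nat \<Rightarrow> complex" where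
  "euler_factor F chi s p = (\<Prod>j<L_degree F. inverse (1 - satake F j p * chi (int p) / of_nat p powr s))"

definition abs_convergent_euler_product :: "L_data \<Rightarrow> (int \<Rightarrow> complex) \<Rightarrow> bool" where
  "abs_convergent_euler_product F chi \<longleftrightarrow>
     (\<forall>s. Re s > 1 \<longrightarrow>
        summable (\<lambda>n. norm (L_term F chi s (Suc n))) \<and>
        abs_convergent_prod (\<lambda>p. if prime p then euler_factor F chi s p else 1) \<and>
        L_series F chi s = (\<Prod>p. if prime p then euler_factor F chi s p else 1))"

text \<open>
  By the identity theorem there is at most one entire function extending \<open>f\<close> from the
  half-plane \<open>Re s > 1\<close>, so the choice below is no choice.
\<close>

definition is_entire_extension :: "(complex \<Rightarrow> complex) \<Rightarrow> (complex \<Rightarrow> complex) \<Rightarrow> bool" where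
  "is_entire_extension f g \<longleftrightarrow> g holomorphic_on UNIV \<and> (\<forall>s. Re s > 1 \<longrightarrow> g s = f s)"

definition entire_extension :: "(complex \<Rightarrow> complex) \<Rightarrow> complex \<Rightarrow> complex" where
  "entire_extension f = (SOME g. is_entire_extension f g)"

text \<open>The order of growth of an entire function (infinite if the set below is empty).\<close>

definition entire_order :: "(complex \<Rightarrow> complex) \<Rightarrow> ereal" where
  "entire_order f =
     Inf {ereal r |r. r > 0 \<and> (\<exists>A B. \<forall>z. norm (f z) \<le> A * exp (B * norm z powr r))}"

text \<open>
  \<open>L(s, F \<times> chi)\<close> for all complex \<open>s\<close>. Since \<open>1 / L_inf\<close> is entire, the extension exists whenever
  the completed L-function extends to an entire function.
\<close>

definition L_fun :: "L_data \<Rightarrow> (int \<Rightarrow> complex) \<Rightarrow> complex \<Rightarrow> complex" where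
  "L_fun F chi = entire_extension (L_series F chi)"

definition Gamma_R :: "complex \<Rightarrow> complex" where
  "Gamma_R s = of_real pi powr (- s / 2) * Gamma (s / 2)"

definition L_inf :: "L_data \<Rightarrow> nat \<Rightarrow> (int \<Rightarrow> complex) \<Rightarrow> complex \<Rightarrow> complex" where
  "L_inf F q chi s =
     of_nat (conductor F q) powr (s / 2) * (\<Prod>j<L_degree F. Gamma_R (s + shift F (chi (-1)) j))"

definition completed_series :: "L_data \<Rightarrow> nat \<Rightarrow> (int \<Rightarrow> complex) \<Rightarrow> complex \<Rightarrow> complex" where
  "completed_series F q chi s = L_series F chi s * L_inf F q chi s"

definition completed_L :: "L_data \<Rightarrow> nat \<Rightarrow> (int \<Rightarrow> complex) \<Rightarrow> complex \<Rightarrow> complex" where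
  "completed_L F q chi = entire_extension (completed_series F q chi)"

definition analytic_conductor :: "L_data \<Rightarrow> nat \<Rightarrow> (int \<Rightarrow> complex) \<Rightarrow> complex \<Rightarrow> real" where
  "analytic_conductor F q chi s =
     real (conductor F q) * (\<Prod>j<L_degree F. norm (s + shift F (chi (-1)) j + 3))"

text \<open>\<open>Q\<close> is the set of moduli \<open>q\<close> under consideration; the bounds are uniform over it.\<close>

definition L_framework :: "L_data \<Rightarrow> nat set \<Rightarrow> bool" where
  "L_framework F Q \<longleftrightarrow>
     (\<forall>m n. m > 0 \<and> n > 0 \<and> coprime m n \<longrightarrow> lam F (m * n) = lam F m * lam F n) \<and>
     (\<forall>p r. prime p \<longrightarrow> lam F (p ^ r) =
        (\<Sum>e \<in> {e \<in> {..<L_degree F} \<rightarrow>\<^sub>E {..r}. (\<Sum>j<L_degree F. e j) = r}.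
           \<Prod>j<L_degree F. satake F j p ^ e j)) \<and>
     abs_convergent_euler_product F (\<lambda>_. 1) \<and>
     (\<exists>\<theta>. 1 / (2 * real (L_degree F)) < \<theta> \<and> \<theta> < 1 / 2 \<and>
        (\<forall>e \<in> {1, -1}. \<forall>j<L_degree F. Re (shift F e j) \<ge> -1 + \<theta>)) \<and>
     (\<forall>q\<in>Q. conductor F q > 0) \<and>
     (\<forall>q\<in>Q. \<forall>chi\<in>primitive_characters q.
        abs_convergent_euler_product F chi \<and>
        is_entire_extension (completed_series F q chi) (completed_L F q chi) \<and>
        entire_order (completed_L F q chi) = 1 \<and>
        (\<exists>\<kappa>. norm \<kappa> = 1 \<and>
           (\<forall>s. completed_L F q chi s =
                \<kappa> * completed_L (dual F) q (\<lambda>a. cnj (chi a)) (1 - s)))) \<and>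
     (\<exists>K K' q\<^sub>0. \<forall>q\<in>Q. q \<ge> q\<^sub>0 \<longrightarrow>
        (\<forall>chi\<in>primitive_characters q.
           analytic_conductor F q chi (1 / 2) \<le> K * real (conductor F q)) \<and>
        real (conductor F q) \<le> K' * real q ^ L_degree F)"

section \<open>Divisor function and zero counting\<close>

definition divisor_tau :: "nat \<Rightarrow> nat \<Rightarrow> nat" where
  "divisor_tau d n = card {f \<in> {..<d} \<rightarrow>\<^sub>E {1..n}. (\<Prod>j<d. f j) = n}"

text \<open>
  Zeros are counted with multiplicity. Under the framework the set is finite: the Euler product
  excludes zeros with \<open>Re s > 1\<close>.
\<close>

definition zero_count :: "L_data \<Rightarrow> real \<Rightarrow> real \<Rightarrow> (int \<Rightarrow> complex) \<Rightarrow> nat" where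
  "zero_count F \<sigma> T chi =
     (\<Sum>s | L_fun F chi s = 0 \<and> Re s \<ge> \<sigma> \<and> \<bar>Im s\<bar> \<le> T. nat (zorder (L_fun F chi) s))"

end

theory Submission
  imports Defs "HOL-Probability.Sinc_Integral" "HOL-Real_Asymp.Real_Asymp"
begin

text \<open>
  Put \<open>L = ln q\<close>. Call a character exceptional if its L-function has a zero with \<open>Re s \<ge> 1 - c L powr (\<delta> - 1)\<close> and
  \<open>\<bar>Im s\<bar> \<le> L ^ 10\<close>, where \<open>c = 1 / C\<close>. By the zero density hypothesis there are \<open>O(exp (L powr \<delta>) L powr A)\<close> of these,
  and the pointwise bound saves \<open>exp (2 L powr \<delta>)\<close> for each.

  For the other characters the approximate functional equation reduces the central value to a smooth sum of
  \<open>\<lambda>(n) chi(n) / sqrt n\<close> of length \<open>O(q powr (d / 2))\<close>. As \<open>d \<ge> 3\<close>, this exceeds the modulus by a power of \<open>q\<close>, so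
  that the orthogonality of the characters loses nothing. Fix the primes between \<open>2 ^ a\<close> and \<open>2 ^ b\<close> with \<open>a\<close> about
  \<open>L powr (1 - \<delta> + \<epsilon>)\<close> and \<open>b\<close> about \<open>L powr (1 - \<epsilon>)\<close>. The integers without such a prime factor contribute a proportion
  \<open>a / b\<close>, about \<open>L powr -\<eta>\<close>, by the sieve hypothesis. On the others, Ramare's identity produces a factor
  \<open>\<Sum>\<^sub>p \<lambda>(p) chi(p)\<close> over a dyadic block, in which the zero-free region saves a factor \<open>L ^ 2\<close>: Borel-Caratheodory bounds the
  logarithm of the L-function there, and Perron's formula with a Riesz weight is shifted into that region. The remaining factor is
  estimated in mean square over the characters.
\<close>

section \<open>Vertical integrals\<close>

text \<open>The parameters are dictated by three constraints. A prime sum near 2 ^ i with i \<ge> a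
  gains exp (- const * L powr \<epsilon>) from the zero-free region, more than any power of L,
  because a exceeds L powr (1 - \<delta>) by L powr \<epsilon>. As b \<le> L / 16, the prime
  variable costs at most q powr (1 / 16), which the gap between modulus and length absorbs. Finally
  \<epsilon> = (\<delta> - \<eta>) / 2 makes the quotient a / b equal to L powr -\<eta> up to
  rounding. With c = 1 / C the exceptional characters are left with a saving of exp (- L powr
  \<delta>).

  No asymptotics of Gamma enter. Phragmen-Lindeloef is applied to the completed function, which is
  bounded in a strip; 1 / Gamma is needed away from the central point only through a bound of order
  3 / 2, whose logarithm at height L ^ 10 is a power of L and so harmless.

  The weight in the approximate functional equation depends on chi (-1). Mean squares are therefore
  taken over each parity separately, and as norms (\<open>L2_set\<close>), so that pieces of the
  coefficients combine by Minkowski's inequality.\<close>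

lemma integrable_one_plus_square: "integrable lborel (\<lambda>t::real. 1 / (1 + t\<^sup>2))"
  using integrable_inverse_1_plus_square by (simp add: set_integrable_def einterval_def field_simps)

lemma integral_one_plus_square: "(LINT t|lborel. 1 / (1 + t\<^sup>2)) = pi"
  using LBINT_inverse_1_plus_square by (simp add: interval_lebesgue_integral_def set_lebesgue_integral_def einterval_def field_simps)

text \<open>The majorant K / (1 + t^2) is the common form of the bounds on vertical lines: it is
  integrable with total mass pi, so that each of them gives an explicit constant.\<close>

lemma integrable_decay:
  fixes f :: "real \<Rightarrow> 'a::{banach, second_countable_topology}"
  assumes "continuous_on UNIV f" "\<And>t. norm (f t) \<le> K / (1 + t\<^sup>2)"
  shows "integrable lborel f"
proof (rule Bochner_Integration.integrable_bound)
  show "integrable lborel (\<lambda>t::real. K * (1 / (1 + t\<^sup>2)))"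
    using integrable_one_plus_square by (intro integrable_mult_right)
  show "f \<in> borel_measurable lborel"
    using borel_measurable_continuous_onI[OF assms(1)] by simp
  have "norm (f t) \<le> norm (K * (1 / (1 + t\<^sup>2)))" for t
    using assms(2)[of t] by (metis abs_ge_self mult.right_neutral order.trans real_norm_def times_divide_eq_right)
  then show "AE t in lborel. norm (f t) \<le> norm (K * (1 / (1 + t\<^sup>2)))" by simp
qed

lemma norm_integral_decay:
  fixes f :: "real \<Rightarrow> 'a::{banach, second_countable_topology}"
  assumes "continuous_on UNIV f" "\<And>t. norm (f t) \<le> K / (1 + t\<^sup>2)"
  shows "norm (LINT t|lborel. f t) \<le> K * pi"
proof -
  have "norm (LINT t|lborel. f t) \<le> (LINT t|lborel. K * (1 / (1 + t\<^sup>2)))"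
    using assms(2) by (intro Bochner_Integration.integral_norm_bound_integral integrable_decay[OF assms]
        integrable_mult_right integrable_one_plus_square) auto
  also have "\<dots> = K * pi"
    by (subst integral_mult_right_zero) (simp only: integral_one_plus_square)
  finally show ?thesis .
qed

text \<open>Contour integrals reduce to gauge integrals over finite segments, while the estimates
  concern Lebesgue integrals over the whole line. Dominated convergence connects the two.\<close>

lemma tendsto_integral_symmetric:
  fixes f :: "real \<Rightarrow> complex"
  assumes f: "integrable lborel f" "continuous_on UNIV f"
  shows "(\<lambda>n. integral {-real n..real n} f) \<longlonglongrightarrow> (LINT t|lborel. f t)"
proof -
  have eq: "integral {-real n..real n} f = (LINT t|lborel. indicator {-real n..real n} t *\<^sub>R f t)" for n
  proof -
    have "set_integrable lborel {-real n..real n} f"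
      unfolding set_integrable_def using f(1) integrable_mult_indicator[of "{-real n..real n}" lborel f] by simp
    from set_borel_integral_eq_integral(2)[OF this] show ?thesis
      by (simp add: set_lebesgue_integral_def)
  qed
  show ?thesis unfolding eq
  proof (rule integral_dominated_convergence)
    show "integrable lborel (\<lambda>x. norm (f x))" using f(1) by simp
    show "AE x in lborel. (\<lambda>n. indicator {-real n..real n} x *\<^sub>R f x) \<longlonglongrightarrow> f x"
    proof
      fix x :: real
      obtain m :: nat where "\<bar>x\<bar> \<le> real m" using real_arch_simple by blast
      then have "\<forall>n\<ge>m. indicator {-real n..real n} x *\<^sub>R f x = f x"
        by (auto simp: indicator_def)
      then show "(\<lambda>n. indicator {-real n..real n} x *\<^sub>R f x) \<longlonglongrightarrow> f x"
        by (intro tendsto_eventually) (auto simp: eventually_at_top_linorder)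
    qed
    show "AE x in lborel. norm (indicator {-real n..real n} x *\<^sub>R f x) \<le> norm (f x)" for n
      by (auto split: split_indicator)
  qed (use f in auto)
qed

text \<open>The vertical sides are kept; each of the horizontal sides has length b - a and
  contributes at most (b - a) H.\<close>

lemma contour_integral_rectpath_vertical:
  assumes "a < b" "0 < T"
    and cont: "continuous_on (path_image (rectpath (Complex a (-T)) (Complex b T))) f"
    and le: "\<And>x s. x \<in> {a..b} \<Longrightarrow> \<bar>s\<bar> = T \<Longrightarrow> norm (f (Complex x s)) \<le> H"
  shows "norm (contour_integral (rectpath (Complex a (-T)) (Complex b T)) f -
     \<i> * (integral {-T..T} (\<lambda>t. f (Complex b t)) - integral {-T..T} (\<lambda>t. f (Complex a t)))) \<le> 2 * (b - a) * H"
proof -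
  let ?l1 = "linepath (Complex a (-T)) (Complex b (-T))"
  let ?l2 = "linepath (Complex b (-T)) (Complex b T)"
  let ?l3 = "linepath (Complex b T) (Complex a T)"
  let ?l4 = "linepath (Complex a T) (Complex a (-T))"
  let ?l4' = "linepath (Complex a (-T)) (Complex a T)"
  have im: "path_image (rectpath (Complex a (-T)) (Complex b T)) =
      path_image ?l1 \<union> path_image ?l2 \<union> path_image ?l3 \<union> path_image ?l4"
    by (simp add: rectpath_def Let_def path_image_join Un_assoc)
  have ci: "f contour_integrable_on ?l1" "f contour_integrable_on ?l2"
     "f contour_integrable_on ?l3" "f contour_integrable_on ?l4"
    by (auto intro!: contour_integrable_continuous_linepath continuous_on_subset[OF cont] simp: im)
  have e1: "contour_integral (rectpath (Complex a (-T)) (Complex b T)) f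
      = contour_integral ?l1 f + (contour_integral ?l2 f + (contour_integral ?l3 f + contour_integral ?l4 f))"
    unfolding rectpath_def Let_def using ci by simp
  have e2: "contour_integral ?l2 f = \<i> * integral {-T..T} (\<lambda>t. f (Complex b t))"
    using assms by (intro contour_integral_linepath_same_Re) auto
  have e3: "contour_integral ?l4 f = - contour_integral ?l4' f"
    using contour_integral_reversepath[of ?l4' f] by simp
  have e4: "contour_integral ?l4' f = \<i> * integral {-T..T} (\<lambda>t. f (Complex a t))"
    using assms by (intro contour_integral_linepath_same_Re) auto
  have "0 \<le> norm (f (Complex a T))" by simp
  then have H: "0 \<le> H" using le[of a T] assms by (smt (verit) atLeastAtMost_iff)
  have le': "norm (f z) \<le> H" if "a \<le> Re z" "Re z \<le> b" "\<bar>Im z\<bar> = T" for z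
    using le[of "Re z" "Im z"] that by simp
  have "norm (contour_integral ?l1 f) \<le> H * norm (Complex b (-T) - Complex a (-T))"
    using H assms by (intro contour_integral_bound_linepath ci)
      (auto simp: closed_segment_same_Im closed_segment_eq_real_ivl complex_eq_iff intro!: le')
  moreover have "norm (contour_integral ?l3 f) \<le> H * norm (Complex a T - Complex b T)"
    using H assms by (intro contour_integral_bound_linepath ci)
      (auto simp: closed_segment_same_Im closed_segment_eq_real_ivl complex_eq_iff intro!: le')
  moreover have "norm (Complex b (-T) - Complex a (-T)) = b - a" "norm (Complex a T - Complex b T) = b - a"
    using assms by (simp_all add: complex_diff cmod_def)
  ultimately have "norm (contour_integral ?l1 f + contour_integral ?l3 f) \<le> 2 * (b - a) * H"
    using norm_triangle_ineq[of "contour_integral ?l1 f" "contour_integral ?l3 f"] by (simp add: algebra_simps)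
  moreover have "contour_integral (rectpath (Complex a (-T)) (Complex b T)) f -
     \<i> * (integral {-T..T} (\<lambda>t. f (Complex b t)) - integral {-T..T} (\<lambda>t. f (Complex a t))) = contour_integral ?l1 f + contour_integral ?l3 f"
    using e1 e2 e3 e4 by (simp add: algebra_simps)
  ultimately show ?thesis by (simp only:)
qed

text \<open>The set \<open>S\<close> has to contain both lines and the strip beyond height
  \<open>T0\<close>, but it may leave out poles in between. Hence one lemma serves for Cauchy's
  theorem (R = 0) and for residues. The horizontal sides vanish in the limit like 1 / T^2.\<close>

lemma vertical_integrals_diff:
  assumes ab: "a < b"
    and cont: "continuous_on S f"
    and line: "\<And>z. Re z = a \<or> Re z = b \<Longrightarrow> z \<in> S"
    and strip: "\<And>z. a \<le> Re z \<Longrightarrow> Re z \<le> b \<Longrightarrow> T0 \<le> \<bar>Im z\<bar> \<Longrightarrow> z \<in> S"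
    and bound: "\<And>z. z \<in> S \<Longrightarrow> a \<le> Re z \<Longrightarrow> Re z \<le> b \<Longrightarrow> norm (f z) \<le> K / (1 + (Im z)\<^sup>2)"
    and R: "\<And>T. T \<ge> T0 \<Longrightarrow> T > 0 \<Longrightarrow> contour_integral (rectpath (Complex a (-T)) (Complex b T)) f = R"
  shows "\<i> * ((LINT t|lborel. f (Complex b t)) - (LINT t|lborel. f (Complex a t))) = R"
proof -
  have c: "continuous_on UNIV (\<lambda>t. f (Complex x t))" if "x = a \<or> x = b" for x
  proof (rule continuous_on_compose2[OF cont])
    show "continuous_on UNIV (Complex x)"
      unfolding Complex_eq by (intro continuous_intros)
  qed (use that line in auto)
  have i: "integrable lborel (\<lambda>t. f (Complex x t))" if "x = a \<or> x = b" for x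
    using that ab bound[of "Complex x _"] line by (intro integrable_decay[OF c[OF that], of K]) auto
  define D where "D n = \<i> * (integral {-real n..real n} (\<lambda>t. f (Complex b t)) - integral {-real n..real n} (\<lambda>t. f (Complex a t)))" for n
  have "D \<longlonglongrightarrow> \<i> * ((LINT t|lborel. f (Complex b t)) - (LINT t|lborel. f (Complex a t)))"
    unfolding D_def by (intro tendsto_intros tendsto_integral_symmetric c i) auto
  moreover have "D \<longlonglongrightarrow> R"
  proof -
    obtain m0 :: nat where m0: "T0 \<le> real m0" "m0 > 0"
      by (metis add_pos_nonneg gr0I less_eq_real_def linorder_not_le of_nat_0 of_nat_0_le_iff order.trans real_arch_simple reals_Archimedean2)
    have "norm (R - D n) \<le> 2 * (b - a) * (K / (1 + (real n)\<^sup>2))" if "n \<ge> m0" for n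
    proof -
      have n: "real n \<ge> T0" "real n > 0" using that m0 by auto
      show ?thesis
        unfolding D_def R[OF n, symmetric]
      proof (rule contour_integral_rectpath_vertical)
        show "continuous_on (path_image (rectpath (Complex a (- real n)) (Complex b (real n)))) f"
          using n ab line strip by (intro continuous_on_subset[OF cont]) (auto simp: path_image_rectpath)
      next
        fix x s :: real assume x: "x \<in> {a..b}" "\<bar>s\<bar> = real n"
        then have "s\<^sup>2 = (real n)\<^sup>2" by (metis power2_abs)
        then show "norm (f (Complex x s)) \<le> K / (1 + (real n)\<^sup>2)"
          using bound[of "Complex x s"] strip[of "Complex x s"] x n by auto
      qed (use ab n in auto)
    qed
    moreover have "(\<lambda>n. 2 * (b - a) * (K / (1 + (real n)\<^sup>2))) \<longlonglongrightarrow> 0"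
      by real_asymp
    ultimately have "(\<lambda>n. R - D n) \<longlonglongrightarrow> 0"
      by (intro Lim_null_comparison[of "\<lambda>n. R - D n"]) (auto simp: eventually_at_top_linorder)
    then show ?thesis using tendsto_diff[OF tendsto_const[of R], of "\<lambda>n. R - D n" 0] by simp
  qed
  ultimately show ?thesis by (rule LIMSEQ_unique)
qed

lemma vertical_integral_shift:
  assumes "a < b" "\<alpha> < a"
    and hol: "f holomorphic_on {z. Re z > \<alpha>}"
    and bound: "\<And>z. a \<le> Re z \<Longrightarrow> Re z \<le> b \<Longrightarrow> norm (f z) \<le> K / (1 + (Im z)\<^sup>2)"
  shows "(LINT t|lborel. f (Complex b t)) = (LINT t|lborel. f (Complex a t))"
proof -
  have "\<i> * ((LINT t|lborel. f (Complex b t)) - (LINT t|lborel. f (Complex a t))) = 0"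
  proof (rule vertical_integrals_diff[OF assms(1) holomorphic_on_imp_continuous_on[OF hol] _ _ bound, of 0])
    fix T :: real assume "T > 0"
    then show "contour_integral (rectpath (Complex a (-T)) (Complex b T)) f = 0"
      using assms by (intro contour_integral_unique Cauchy_theorem_convex_simple[OF hol])
        (auto simp: path_image_rectpath convex_halfspace_Re_gt)
  qed (use assms in auto)
  then show ?thesis by simp
qed

lemma contour_integral_rectpath_Cauchy:
  assumes hol: "h holomorphic_on UNIV" and "w \<in> box u v"
  shows "((\<lambda>z. h z / (z - w)) has_contour_integral 2 * pi * \<i> * h w) (rectpath u v)"
proof -
  have "Re u < Re v" "Im u < Im v" using assms by (auto simp: in_box_complex_iff)
  then have "((\<lambda>z. h z / (z - w)) has_contour_integral 2 * pi * \<i> * winding_number (rectpath u v) w * h w) (rectpath u v)"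
    using assms by (intro Cauchy_integral_formula_convex_simple[OF convex_UNIV])
     (auto simp: path_image_rectpath_cbox_minus_box)
  then show ?thesis using winding_number_rectpath[OF assms(2)] by simp
qed

lemma vertical_integrals_Cauchy:
  fixes h :: "complex \<Rightarrow> complex"
  assumes "a < 0" "0 < b"
    and hol: "h holomorphic_on UNIV"
    and bound: "\<And>z. a \<le> Re z \<Longrightarrow> Re z \<le> b \<Longrightarrow> norm (h z) \<le> K / (1 + (Im z)\<^sup>2)"
  shows "(LINT t|lborel. h (Complex b t) / Complex b t) - (LINT t|lborel. h (Complex a t) / Complex a t) = 2 * pi * h 0"
proof -
  \<comment> \<open>The disc of radius m about the pole meets neither line in its interior, and
    outside it 1 / |z| is at most 1 / m.\<close>
  define m where "m = min 1 (min (-a) b)"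
  have m: "0 < m" "m \<le> 1" "m \<le> -a" "m \<le> b" using assms by (auto simp: m_def)
  let ?S = "{z. norm z \<ge> m}"
  have "\<i> * ((LINT t|lborel. h (Complex b t) / Complex b t) - (LINT t|lborel. h (Complex a t) / Complex a t)) = 2 * pi * \<i> * h 0"
  proof (rule vertical_integrals_diff[of a b ?S "\<lambda>z. h z / z" 1 "K / m"])
    show "continuous_on ?S (\<lambda>z. h z / z)"
      using m hol by (intro continuous_on_divide continuous_on_subset[OF holomorphic_on_imp_continuous_on]) (auto)
    show "z \<in> ?S" if "Re z = a \<or> Re z = b" for z
      using that abs_Re_le_cmod[of z] m by auto
    show "z \<in> ?S" if "1 \<le> \<bar>Im z\<bar>" for z
      using that abs_Im_le_cmod[of z] m by auto
    show "norm (h z / z) \<le> K / m / (1 + (Im z)\<^sup>2)" if "z \<in> ?S" "a \<le> Re z" "Re z \<le> b" for z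
    proof -
      have "norm (h z) / norm z \<le> (K / (1 + (Im z)\<^sup>2)) / m"
        using that bound[of z] m by (intro frac_le) (auto intro: order.trans[OF norm_ge_zero])
      then show ?thesis by (simp add: norm_divide field_simps)
    qed
    show "contour_integral (rectpath (Complex a (-T)) (Complex b T)) (\<lambda>z. h z / z) = 2 * pi * \<i> * h 0" if "T > 0" for T
      using that assms contour_integral_rectpath_Cauchy[OF hol, of 0 "Complex a (-T)" "Complex b T"]
      by (intro contour_integral_unique) (auto simp: in_box_complex_iff)
  qed (use assms in auto)
  then have "\<i> * ((LINT t|lborel. h (Complex b t) / Complex b t) - (LINT t|lborel. h (Complex a t) / Complex a t) - 2 * pi * h 0) = 0"
    by (simp add: algebra_simps)
  then show ?thesis by simp
qed

section \<open>Perron's kernel, Gamma bounds and Borel-Caratheodory\<close>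

text \<open>The quadratic decay of 1 / (z (z + 1)) makes Perron's integral absolutely convergent.
  \<open>A\<close> measures the distance of Re z from the poles 0 and -1; where |Im z| \<ge> 1 the
  poles are far away in any case.\<close>

lemma perron_kernel_denominator:
  assumes "A > 0" "A \<le> 1" "A \<le> \<bar>Re z\<bar> \<and> A \<le> \<bar>Re z + 1\<bar> \<or> 1 \<le> \<bar>Im z\<bar>"
  shows "A\<^sup>2 / 2 * (1 + (Im z)\<^sup>2) \<le> norm (z * (z + 1))" "z \<noteq> 0" "z \<noteq> -1"
proof -
  have 1: "A\<^sup>2 \<le> 1" using assms by (simp add: power_le_one)
  have aux: "A\<^sup>2 / 2 * (1 + (Im z)\<^sup>2) \<le> x\<^sup>2 + (Im z)\<^sup>2" if "A \<le> \<bar>x\<bar> \<or> 1 \<le> \<bar>Im z\<bar>" for x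
    using that
  proof
    assume "A \<le> \<bar>x\<bar>"
    then have "A\<^sup>2 \<le> x\<^sup>2" using assms by (simp flip: abs_le_square_iff)
    moreover have "A\<^sup>2 / 2 * (Im z)\<^sup>2 \<le> 1 * (Im z)\<^sup>2" using 1 by (intro mult_right_mono) auto
    moreover have "A\<^sup>2 / 2 \<le> A\<^sup>2" by simp
    ultimately show ?thesis unfolding distrib_left mult_1_right by (intro add_mono) (auto intro: order.trans)
  next
    assume "1 \<le> \<bar>Im z\<bar>"
    then have "1 \<le> (Im z)\<^sup>2" using abs_le_square_iff[of 1 "Im z"] by simp
    moreover have "A\<^sup>2 / 2 * (1 + (Im z)\<^sup>2) \<le> 1 / 2 * (1 + (Im z)\<^sup>2)" using 1 by (intro mult_right_mono) auto
    moreover have "1 / 2 * (1 + (Im z)\<^sup>2) \<le> (Im z)\<^sup>2" using calculation(1) by simp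
    ultimately have "A\<^sup>2 / 2 * (1 + (Im z)\<^sup>2) \<le> (Im z)\<^sup>2" by (meson order.trans)
    then show ?thesis by (rule order.trans) simp
  qed
  have pos: "A\<^sup>2 / 2 * (1 + (Im z)\<^sup>2) > 0" using assms by (intro mult_pos_pos) (auto simp: add_pos_nonneg)
  have n: "A\<^sup>2 / 2 * (1 + (Im z)\<^sup>2) \<le> (norm z)\<^sup>2" "A\<^sup>2 / 2 * (1 + (Im z)\<^sup>2) \<le> (norm (z + 1))\<^sup>2"
    using aux[of "Re z"] aux[of "Re z + 1"] assms by (auto simp: cmod_power2)
  then show "z \<noteq> 0" "z \<noteq> -1" using pos by auto
  have "(A\<^sup>2 / 2 * (1 + (Im z)\<^sup>2)) * (A\<^sup>2 / 2 * (1 + (Im z)\<^sup>2)) \<le> (norm z)\<^sup>2 * (norm (z + 1))\<^sup>2"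
    using pos by (intro mult_mono n) auto
  then have "(A\<^sup>2 / 2 * (1 + (Im z)\<^sup>2))\<^sup>2 \<le> (norm (z * (z + 1)))\<^sup>2"
    unfolding norm_mult power_mult_distrib[of "norm z"] power2_eq_square[of "A\<^sup>2 / 2 * (1 + (Im z)\<^sup>2)"] .
  then show "A\<^sup>2 / 2 * (1 + (Im z)\<^sup>2) \<le> norm (z * (z + 1))"
    by (rule power2_le_imp_le) simp
qed

lemma norm_perron_kernel:
  assumes "A > 0" "A \<le> 1" "A \<le> \<bar>Re z\<bar> \<and> A \<le> \<bar>Re z + 1\<bar> \<or> 1 \<le> \<bar>Im z\<bar>"
  shows "norm (exp (z * of_real l) / (z * (z + 1))) \<le> 2 * exp (Re z * l) / A\<^sup>2 / (1 + (Im z)\<^sup>2)"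
proof -
  note p = perron_kernel_denominator[OF assms]
  have "norm (exp (z * of_real l) / (z * (z + 1))) = exp (Re z * l) / norm (z * (z + 1))"
    by (simp add: norm_divide)
  also have "\<dots> \<le> exp (Re z * l) / (A\<^sup>2 / 2 * (1 + (Im z)\<^sup>2))"
  proof (intro divide_left_mono mult_pos_pos)
    show "0 < A\<^sup>2 / 2" using assms by simp
    show "0 < norm (z * (z + 1))" using p by (simp add: eq_neg_iff_add_eq_0)
  qed (use p in \<open>auto simp: add_pos_nonneg\<close>)
  finally show ?thesis by (simp add: field_simps)
qed

text \<open>For l > 0 the line is moved to the left, across the poles 0 and -1 with residues 1 and -
  exp (- l); for l < 0 it is moved to the right and meets no pole. In both cases the integral over
  the moved line tends to 0.\<close>

lemma perron_kernel:
  fixes c l :: real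
  assumes "c > 0" "l \<noteq> 0"
  shows "(LINT t|lborel. exp (Complex c t * of_real l) / (Complex c t * (Complex c t + 1))) =
         2 * pi * of_real (if l > 0 then 1 - exp (-l) else 0)" (is "?I = _")
proof -
  define f where "f z = exp (z * of_real l) / (z * (z + 1))" for z :: complex
  have cf: "continuous_on {z. z \<noteq> 0 \<and> z \<noteq> -1} f"
    unfolding f_def by (intro continuous_intros) (auto simp: eq_neg_iff_add_eq_0)
  have cl: "continuous_on UNIV (\<lambda>t. f (Complex r t))" if "r \<noteq> 0" "r \<noteq> -1" for r
    using that by (intro continuous_on_compose2[OF cf]) (auto simp: Complex_eq complex_eq_iff intro!: continuous_intros)
  define m where "m = min 1 c"
  have m: "0 < m" "m \<le> 1" "m \<le> c" using assms by (auto simp: m_def)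
  have nl: "norm (LINT t|lborel. f (Complex r t)) \<le> 2 * exp (r * l) * pi" if "\<bar>r\<bar> \<ge> 1" "\<bar>r+1\<bar> \<ge> 1" for r
    using norm_perron_kernel[of 1 "Complex r _" l] that
    by (intro norm_integral_decay cl) (auto simp: f_def)
  show ?thesis
  proof (cases "l > 0")
    case True
    have eq: "(LINT t|lborel. f (Complex c t)) - 2 * pi * (1 - exp (-l)) = (LINT t|lborel. f (Complex (-r) t))" if r: "r \<ge> 2" for r
    proof -
      have "\<i> * ((LINT t|lborel. f (Complex c t)) - (LINT t|lborel. f (Complex (-r) t))) = 2 * pi * \<i> * (1 - exp (-l))"
      proof (rule vertical_integrals_diff[of "-r" c "{z. Re z = -r \<or> Re z = c \<or> 1 \<le> \<bar>Im z\<bar>}" f 1 "2 * exp (c * l) / m\<^sup>2"])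
        show "continuous_on {z. Re z = -r \<or> Re z = c \<or> 1 \<le> \<bar>Im z\<bar>} f"
          using r assms by (intro continuous_on_subset[OF cf]) auto
        fix z assume z: "z \<in> {z. Re z = -r \<or> Re z = c \<or> 1 \<le> \<bar>Im z\<bar>}" "Re z \<le> c"
        have "norm (f z) \<le> 2 * exp (Re z * l) / m\<^sup>2 / (1 + (Im z)\<^sup>2)"
          unfolding f_def using z m r by (intro norm_perron_kernel) auto
        also have "\<dots> \<le> 2 * exp (c * l) / m\<^sup>2 / (1 + (Im z)\<^sup>2)"
          using z True m by (intro divide_right_mono mult_left_mono) auto
        finally show "norm (f z) \<le> 2 * exp (c * l) / m\<^sup>2 / (1 + (Im z)\<^sup>2)" .
      next
        fix T :: real assume T: "T > 0"
        let ?h = "\<lambda>z. exp (z * of_real l) :: complex"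
        let ?p = "rectpath (Complex (-r) (-T)) (Complex c T)"
        \<comment> \<open>Since 1 / (z (z + 1)) = 1 / z - 1 / (z + 1), Cauchy's formula can be
          applied to each pole separately.\<close>
        have "((\<lambda>z. ?h z / (z - 0) - ?h z / (z - (-1))) has_contour_integral
            2 * pi * \<i> * ?h 0 - 2 * pi * \<i> * ?h (-1)) ?p"
          using T r assms by (intro has_contour_integral_diff contour_integral_rectpath_Cauchy)
            (auto simp: in_box_complex_iff intro!: holomorphic_intros)
        then have "(f has_contour_integral 2 * pi * \<i> * ?h 0 - 2 * pi * \<i> * ?h (-1)) ?p"
        proof (rule has_contour_integral_eq)
          fix z assume "z \<in> path_image ?p"
          then have "z \<noteq> 0" "z + 1 \<noteq> 0" using T r assms by (auto simp: path_image_rectpath complex_eq_iff)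
          then show "?h z / (z - 0) - ?h z / (z - (-1)) = f z"
            by (simp add: f_def divide_simps) (simp add: algebra_simps)
        qed
        then have "contour_integral ?p f = 2 * pi * \<i> * ?h 0 - 2 * pi * \<i> * ?h (-1)"
          by (rule contour_integral_unique)
        then show "contour_integral ?p f = 2 * pi * \<i> * (1 - exp (-l))"
          by (simp add: algebra_simps exp_of_real exp_minus)
      qed (use assms r in auto)
      then have "\<i> * ((LINT t|lborel. f (Complex c t)) - 2 * pi * (1 - exp (-l)) - (LINT t|lborel. f (Complex (-r) t))) = 0"
        by (simp add: algebra_simps)
      then show ?thesis by simp
    qed
    have "norm ((LINT t|lborel. f (Complex c t)) - 2 * pi * (1 - exp (-l))) \<le> 0"
    proof (rule tendsto_lowerbound)
      show "((\<lambda>r. 2 * exp (-r * l) * pi) \<longlongrightarrow> 0) at_top" using True by real_asymp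
      show "\<forall>\<^sub>F r in at_top. norm ((LINT t|lborel. f (Complex c t)) - 2 * pi * (1 - exp (-l))) \<le> 2 * exp (-r * l) * pi"
        using eventually_ge_at_top[of 2]
      proof eventually_elim
        case (elim r) then show ?case using eq[of r] nl[of "-r"] by simp
      qed
    qed auto
    then show ?thesis using True by (simp add: f_def)
  next
    case False
    have hf: "f holomorphic_on {z. Re z > 0}"
    proof -
      have "z \<noteq> 0 \<and> z + 1 \<noteq> 0" if "Re z > 0" for z :: complex
        using that by (auto simp: complex_eq_iff)
      then show ?thesis unfolding f_def by (intro holomorphic_intros) auto
    qed
    have eq: "(LINT t|lborel. f (Complex c t)) = (LINT t|lborel. f (Complex r t))" if r: "r > c" for r
    proof (rule vertical_integral_shift[OF r _ hf, of "2 / m\<^sup>2", symmetric])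
      fix z assume z: "c \<le> Re z" "Re z \<le> r"
      have "norm (f z) \<le> 2 * exp (Re z * l) / m\<^sup>2 / (1 + (Im z)\<^sup>2)"
        unfolding f_def using z m assms by (intro norm_perron_kernel) auto
      also have "\<dots> \<le> 2 * 1 / m\<^sup>2 / (1 + (Im z)\<^sup>2)"
        using z False m assms by (intro divide_right_mono mult_left_mono) (auto simp: mult_nonneg_nonpos)
      finally show "norm (f z) \<le> 2 / m\<^sup>2 / (1 + (Im z)\<^sup>2)" by simp
    qed (use assms in auto)
    have "norm (LINT t|lborel. f (Complex c t)) \<le> 0"
    proof (rule tendsto_lowerbound)
      have "l < 0" using False assms by simp
      then show "((\<lambda>r. 2 * exp (r * l) * pi) \<longlongrightarrow> 0) at_top" by real_asymp
      show "\<forall>\<^sub>F r in at_top. norm (LINT t|lborel. f (Complex c t)) \<le> 2 * exp (r * l) * pi"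
        using eventually_gt_at_top[of "max 1 c"]
      proof eventually_elim
        case (elim r) then show ?case using eq[of r] nl[of "r"] by simp
      qed
    qed auto
    then show ?thesis using False by (simp add: f_def)
  qed
qed

section \<open>Growth of Gamma and of its reciprocal\<close>

lemma norm_Gamma_le:
  assumes "Re z > 0"
  shows "norm (Gamma z) \<le> Gamma (Re z)"
proof -
  have 1: "((\<lambda>t. complex_of_real t powr (z - 1) / of_real (exp t)) has_integral Gamma z) {0..}"
    by (rule Gamma_integral_complex[OF assms])
  have 2: "((\<lambda>t. t powr (Re z - 1) / exp t) has_integral Gamma (Re z)) {0..}"
    by (rule Gamma_integral_real[OF assms])
  have "norm (integral {0..} (\<lambda>t. complex_of_real t powr (z - 1) / of_real (exp t))) \<le> integral {0..} (\<lambda>t. t powr (Re z - 1) / exp t)"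
    using 1 2 by (intro integral_norm_bound_integral) (auto simp: has_integral_iff norm_divide norm_powr_real_powr)
  then show ?thesis using 1 2 by (simp add: has_integral_iff)
qed

text \<open>A Weierstrass factor of genus 1 is at most exp (|u|^2 / 2) for small u and exp (2 |u|)
  for large u. An exponent between 1 and 2 majorizes both, and an exponent above 1 lets the sum over
  u = z / k converge.\<close>

lemma norm_one_plus_exp_le:
  fixes u :: complex
  shows "norm ((1 + u) * exp (- u)) \<le> exp (2 * norm u powr (3/2))"
proof (cases "norm u \<le> 1")
  case True
  have "(norm (1 + u))\<^sup>2 = 1 + (2 * Re u + (norm u)\<^sup>2)"
    unfolding cmod_power2 by (simp add: power2_eq_square algebra_simps)
  also have "\<dots> \<le> exp (2 * Re u + (norm u)\<^sup>2)" by (rule exp_ge_add_one_self)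
  also have "\<dots> = (exp (Re u + (norm u)\<^sup>2 / 2))\<^sup>2" by (simp add: exp_double[symmetric] algebra_simps)
  finally have "norm (1 + u) \<le> exp (Re u + (norm u)\<^sup>2 / 2)" by (rule power2_le_imp_le) simp
  then have "norm (1 + u) * exp (- Re u) \<le> exp (Re u + (norm u)\<^sup>2 / 2) * exp (- Re u)" by (intro mult_right_mono) auto
  also have "\<dots> = exp ((norm u)\<^sup>2 / 2)" by (simp add: exp_add[symmetric])
  finally have "norm ((1 + u) * exp (- u)) \<le> exp ((norm u)\<^sup>2 / 2)" by (simp add: norm_mult)
  moreover have "(norm u)\<^sup>2 \<le> norm u powr (3/2)"
    using powr_mono'[of "3/2" 2 "norm u"] True by (simp add: powr_numeral)
  then have "(norm u)\<^sup>2 / 2 \<le> 2 * norm u powr (3/2)" using zero_le_power2[of "norm u"] by linarith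
  then have "exp ((norm u)\<^sup>2 / 2) \<le> exp (2 * norm u powr (3/2))" by simp
  ultimately show ?thesis by linarith
next
  case False
  have "norm ((1 + u) * exp (- u)) \<le> (1 + norm u) * exp (norm u)"
    using norm_triangle_ineq[of 1 u] complex_Re_le_cmod[of "-u"] unfolding norm_mult by (intro mult_mono) auto
  also have "\<dots> \<le> exp (norm u) * exp (norm u)" by (intro mult_right_mono exp_ge_add_one_self) auto
  also have "\<dots> = exp (2 * norm u)" by (simp flip: exp_add)
  also have "\<dots> \<le> exp (2 * norm u powr (3/2))" using False powr_mono[of 1 "3/2" "norm u"] by simp
  finally show ?thesis .
qed

text \<open>The partial products of the Weierstrass product are bounded factor by factor, so that
  the bound passes to the limit. It is a substitute for Stirling's formula that is sufficient
  because later only the logarithm of the bound counts.\<close>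

lemma norm_rGamma_le:
  obtains C where "C > 0" "\<And>z::complex. norm (rGamma z) \<le> exp (C * (1 + norm z) powr (3/2))"
proof -
  define Z where "Z = (\<Sum>k. real (Suc k) powr (-(3/2)))"
  have sm: "summable (\<lambda>k. real (Suc k) powr (-(3/2)))"
    using summable_real_powr_iff[of "-(3/2)"] by (subst summable_Suc_iff) auto
  have Z0: "Z \<ge> 0" unfolding Z_def by (intro suminf_nonneg sm) auto
  define \<gamma> where "\<gamma> = \<bar>euler_mascheroni :: real\<bar>"
  have n_euler: "norm (euler_mascheroni :: complex) = \<bar>euler_mascheroni\<bar>"
    using norm_of_real[of euler_mascheroni, where 'a=complex] by simp
  have "norm (rGamma z) \<le> exp ((1 + \<gamma> + 2 * Z) * (1 + norm z) powr (3/2))" for z :: complex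
  proof (rule tendsto_upperbound[OF tendsto_norm[OF rGamma_Weierstrass_complex[of z]]])
    have "norm (rGamma_series_Weierstrass z n) \<le> exp ((1 + \<gamma> + 2 * Z) * (1 + norm z) powr (3/2))" for n
    proof -
      have "norm (rGamma_series_Weierstrass z n) = norm z * norm (exp (euler_mascheroni * z)) * (\<Prod>k=1..n. norm ((1 + z / of_nat k) * exp (- (z / of_nat k))))"
        by (simp add: rGamma_series_Weierstrass_def norm_mult prod_norm[symmetric])
      also have "\<dots> \<le> exp (norm z) * exp (\<gamma> * norm z) * (\<Prod>k=1..n. exp (2 * norm (z / of_nat k) powr (3/2)))"
      proof (intro mult_mono prod_mono conjI norm_one_plus_exp_le)
        show "norm z \<le> exp (norm z)" using exp_ge_add_one_self[of "norm z"] by linarith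
        have "Re (euler_mascheroni * z) \<le> norm (euler_mascheroni * z)" by (rule complex_Re_le_cmod)
        then show "norm (exp (euler_mascheroni * z)) \<le> exp (\<gamma> * norm z)"
          by (simp add: norm_mult \<gamma>_def n_euler)
      qed (auto intro: prod_nonneg)
      also have "\<dots> = exp (norm z + \<gamma> * norm z + (\<Sum>k=1..n. 2 * norm (z / of_nat k) powr (3/2)))"
        by (simp add: exp_add exp_sum)
      also have "(\<Sum>k=1..n. 2 * norm (z / of_nat k) powr (3/2)) = 2 * norm z powr (3/2) * (\<Sum>k<n. real (Suc k) powr (-(3/2)))"
        unfolding sum_distrib_left
        by (rule sum.reindex_bij_witness[of _ Suc "\<lambda>k. k - 1"]) (auto simp: norm_divide powr_divide powr_minus_divide)
      also have "norm z + \<gamma> * norm z + 2 * norm z powr (3/2) * (\<Sum>k<n. real (Suc k) powr (-(3/2)))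
          \<le> (1 + norm z) powr (3/2) + \<gamma> * (1 + norm z) powr (3/2) + 2 * (1 + norm z) powr (3/2) * Z"
      proof (intro add_mono mult_mono)
        have "(1 + norm z) powr 1 \<le> (1 + norm z) powr (3/2)" by (intro powr_mono) auto
        then show z1: "norm z \<le> (1 + norm z) powr (3/2)" by simp
        then show "norm z \<le> (1 + norm z) powr (3/2)" .
        show "norm z powr (3/2) \<le> (1 + norm z) powr (3/2)" by (rule powr_mono2) auto
        show "(\<Sum>k<n. real (Suc k) powr (-(3/2))) \<le> Z" unfolding Z_def by (intro sum_le_suminf sm) auto
      qed (auto simp: \<gamma>_def intro!: sum_nonneg)
      also have "\<dots> = (1 + \<gamma> + 2 * Z) * (1 + norm z) powr (3/2)" by (simp add: algebra_simps)
      finally show ?thesis by simp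
    qed
    then show "\<forall>\<^sub>F n in sequentially. norm (rGamma_series_Weierstrass z n) \<le> exp ((1 + \<gamma> + 2 * Z) * (1 + norm z) powr (3/2))"
      by simp
  qed auto
  then show ?thesis using that[of "1 + \<gamma> + 2 * Z"] Z0 by (auto simp: \<gamma>_def)
qed

text \<open>After normalization to value 0 at the centre, the map w / (2 A' - w) sends the
  half-plane Re w < A' into the unit disc and fixes 0. Schwarz's lemma applies to the composition
  \<open>h\<close>, and solving for \<open>g\<close> gives the bound.\<close>

lemma Borel_Caratheodory:
  fixes f :: "complex \<Rightarrow> complex"
  assumes hol: "f holomorphic_on ball w R" and re: "\<And>z. z \<in> ball w R \<Longrightarrow> Re (f z) < A"
    and rR: "norm (z - w) \<le> r" "r < R"
  shows "norm (f z - f w) \<le> 2 * r / (R - r) * (A - Re (f w))"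
proof -
  have R: "R > 0" "r \<ge> 0" using rR norm_ge_zero[of "z - w"] by linarith+
  define A' where "A' = A - Re (f w)"
  have A': "A' > 0" using re[of w] R by (simp add: A'_def)
  define g where "g x = f (w + of_real R * x) - f w" for x
  define h where "h x = g x / (2 * of_real A' - g x)" for x
  have inb: "w + of_real R * x \<in> ball w R" if "norm x < 1" for x
    using that R by (simp add: dist_norm norm_mult)
  have reg: "Re (g x) < A'" if "norm x < 1" for x
    using re[OF inb[OF that]] by (simp add: g_def A'_def)
  have nz: "2 * of_real A' - g x \<noteq> 0" if "norm x < 1" for x
  proof
    assume "2 * of_real A' - g x = 0"
    then have "Re (g x) = 2 * A'" by (auto simp: complex_eq_iff)
    then show False using reg[OF that] A' by simp
  qed
  have "(f \<circ> (\<lambda>x. w + of_real R * x)) holomorphic_on ball 0 1"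
    by (rule holomorphic_on_compose_gen[OF _ hol]) (use inb in \<open>auto intro!: holomorphic_intros\<close>)
  then have holg: "g holomorphic_on ball 0 1"
    unfolding g_def o_def by (intro holomorphic_intros)
  have holh: "h holomorphic_on ball 0 1"
    unfolding h_def using nz by (intro holomorphic_intros holg) auto
  have no: "norm (h x) < 1" if "norm x < 1" for x
  proof -
    have "(norm (2 * of_real A' - g x))\<^sup>2 - (norm (g x))\<^sup>2 = 4 * A' * (A' - Re (g x))"
      unfolding cmod_power2 by (simp add: power2_eq_square algebra_simps)
    also have "\<dots> > 0" using A' reg[OF that] by simp
    finally have "(norm (g x))\<^sup>2 < (norm (2 * of_real A' - g x))\<^sup>2" by simp
    then have "norm (g x) < norm (2 * of_real A' - g x)" by (rule power2_less_imp_less) simp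
    then show ?thesis using nz[OF that] by (simp add: h_def norm_divide)
  qed
  define x where "x = (z - w) / of_real R"
  have nx: "norm x \<le> r / R" using rR R by (simp add: x_def norm_divide divide_right_mono)
  have rR1: "r / R < 1" using rR R by simp
  have x1: "norm x < 1" using nx rR1 by linarith
  have "norm (h x) \<le> norm x"
    using Schwarz_Lemma(1)[OF holh _ no x1] by (simp add: h_def g_def)
  then have hx: "norm (h x) \<le> r / R" using nx by linarith
  have "g x = h x * (2 * of_real A' - g x)" using nz[OF x1] by (simp add: h_def)
  from arg_cong[OF this, of norm] have 1: "norm (g x) = norm (h x) * norm (2 * of_real A' - g x)"
    by (simp only: norm_mult)
  have "norm (2 * of_real A' - g x) \<le> 2 * A' + norm (g x)"
    using norm_triangle_ineq4[of "2 * of_real A'" "g x"] A' by (simp add: norm_mult)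
  then have "norm (h x) * norm (2 * of_real A' - g x) \<le> r / R * (2 * A' + norm (g x))"
    using hx R by (intro mult_mono) auto
  with 1 have "norm (g x) \<le> r / R * (2 * A' + norm (g x))" by linarith
  then have "norm (g x) * R \<le> r * (2 * A' + norm (g x))" using R by (simp add: pos_le_divide_eq)
  then have "norm (g x) * (R - r) \<le> 2 * r * A'" by argo
  then have "norm (g x) \<le> 2 * r / (R - r) * A'" using rR by (simp add: pos_le_divide_eq)
  moreover have "g x = f z - f w" using R by (simp add: g_def x_def)
  ultimately show ?thesis unfolding A'_def by metis
qed

section \<open>A Phragmen-Lindeloef principle\<close>

text \<open>The factor exp (e z^2) decays like exp (- e (Im z)^2) in the strip, which defeats exp (B
  |z|^r) because r < 2. The maximum principle on a tall rectangle gives the bound up to exp (e m^2),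
  and then e tends to 0.\<close>

lemma Phragmen_Lindeloef_strip:
  fixes f :: "complex \<Rightarrow> complex"
  assumes hol: "f holomorphic_on UNIV" and ab: "a < b" and r: "0 < r" "r < 2"
    and growth: "\<And>z. norm (f z) \<le> A * exp (B * norm z powr r)"
    and edge: "\<And>z. Re z = a \<or> Re z = b \<Longrightarrow> norm (f z) \<le> M" and "M > 0"
    and z0: "a \<le> Re z0" "Re z0 \<le> b"
  shows "norm (f z0) \<le> M"
proof -
  define m where "m = max \<bar>a\<bar> \<bar>b\<bar>"
  have mx: "x\<^sup>2 \<le> m\<^sup>2" "\<bar>x\<bar> \<le> m" if "a \<le> x" "x \<le> b" for x
  proof -
    show "\<bar>x\<bar> \<le> m" using that by (auto simp: m_def)
    then show "x\<^sup>2 \<le> m\<^sup>2" by (metis abs_ge_zero abs_le_square_iff abs_of_nonneg order.trans)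
  qed
  have ne: "norm (exp (of_real e * z\<^sup>2)) = exp (e * ((Re z)\<^sup>2 - (Im z)\<^sup>2))" for e z
    by (simp add: Re_power2)
  have A0: "A \<ge> 0" using growth[of 0] order.trans[OF norm_ge_zero growth[of 0]] by (simp add: zero_le_mult_iff)
  have key: "norm (f z0) * exp (e * ((Re z0)\<^sup>2 - (Im z0)\<^sup>2)) \<le> M * exp (e * m\<^sup>2)" if e: "e > 0" for e
  proof -
    have "((\<lambda>T. A * exp (\<bar>B\<bar> * (m + T) powr r - e * T\<^sup>2)) \<longlongrightarrow> 0) at_top"
      using e r by real_asymp
    then have "\<forall>\<^sub>F T in at_top. A * exp (\<bar>B\<bar> * (m + T) powr r - e * T\<^sup>2) < M"
      using \<open>M > 0\<close> by (rule order_tendstoD)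
    then obtain T where T: "A * exp (\<bar>B\<bar> * (m + T) powr r - e * T\<^sup>2) < M" "T > \<bar>Im z0\<bar>"
      using eventually_conj[OF _ eventually_gt_at_top[of "\<bar>Im z0\<bar>"]] eventually_happens[of _ at_top] by fastforce
    define S where "S = cbox (Complex a (-T)) (Complex b T)"
    have "norm (f z0 * exp (of_real e * z0\<^sup>2)) \<le> M * exp (e * m\<^sup>2)"
    proof (rule maximum_modulus_frontier[of "\<lambda>z. f z * exp (of_real e * z\<^sup>2)" S])
      show "(\<lambda>z. f z * exp (of_real e * z\<^sup>2)) holomorphic_on interior S"
        by (intro holomorphic_intros holomorphic_on_subset[OF hol]) auto
      show "continuous_on (closure S) (\<lambda>z. f z * exp (of_real e * z\<^sup>2))"
        by (intro continuous_intros holomorphic_on_imp_continuous_on holomorphic_on_subset[OF hol]) auto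
      show "bounded S" by (simp add: S_def)
      show "z0 \<in> S" using z0 T by (auto simp: S_def in_cbox_complex_iff)
      fix z assume "z \<in> frontier S"
      then have z: "z \<in> S" "Re z = a \<or> Re z = b \<or> \<bar>Im z\<bar> = T"
        by (auto simp: S_def frontier_def in_cbox_complex_iff in_box_complex_iff interior_cbox)
      have zab: "a \<le> Re z" "Re z \<le> b" using z(1) by (auto simp: S_def in_cbox_complex_iff)
      show "norm (f z * exp (of_real e * z\<^sup>2)) \<le> M * exp (e * m\<^sup>2)"
      proof (cases "Re z = a \<or> Re z = b")
        case True
        have "exp (e * ((Re z)\<^sup>2 - (Im z)\<^sup>2)) \<le> exp (e * m\<^sup>2)"
        proof -
          have "(Re z)\<^sup>2 - (Im z)\<^sup>2 \<le> m\<^sup>2" using mx(1)[OF zab] zero_le_power2[of "Im z"] by linarith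
          then show ?thesis using e by simp
        qed
        then show ?thesis using edge[OF True] \<open>M > 0\<close> unfolding norm_mult ne by (intro mult_mono) auto
      next
        case False
        then have im: "\<bar>Im z\<bar> = T" using z by auto
        then have im2: "(Im z)\<^sup>2 = T\<^sup>2" by (metis power2_abs)
        have "norm z \<le> m + T" using cmod_le[of z] mx(2)[OF zab] im by linarith
        then have "B * norm z powr r \<le> \<bar>B\<bar> * (m + T) powr r"
          using r by (intro mult_mono powr_mono2) auto
        then have "norm (f z) \<le> A * exp (\<bar>B\<bar> * (m + T) powr r)"
          using growth[of z] A0 by (meson exp_le_cancel_iff mult_left_mono order.trans)
        then have "norm (f z) * exp (e * ((Re z)\<^sup>2 - (Im z)\<^sup>2)) \<le> A * exp (\<bar>B\<bar> * (m + T) powr r) * exp (e * (m\<^sup>2 - T\<^sup>2))"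
          using mx(1)[OF zab] e im2 A0 by (intro mult_mono) (auto intro!: mult_left_mono)
        also have "\<dots> = (A * exp (\<bar>B\<bar> * (m + T) powr r - e * T\<^sup>2)) * exp (e * m\<^sup>2)"
          by (simp add: exp_diff exp_add algebra_simps)
        also have "\<dots> \<le> M * exp (e * m\<^sup>2)" using T by (intro mult_right_mono) auto
        finally show ?thesis unfolding norm_mult ne .
      qed
    qed
    then show ?thesis unfolding norm_mult ne .
  qed
  show ?thesis
  proof (rule tendsto_le[of "at_right (0::real)"])
    show "((\<lambda>e. M * exp (e * m\<^sup>2)) \<longlongrightarrow> M) (at_right 0)" by (auto intro!: tendsto_eq_intros)
    show "((\<lambda>e. norm (f z0) * exp (e * ((Re z0)\<^sup>2 - (Im z0)\<^sup>2))) \<longlongrightarrow> norm (f z0)) (at_right 0)"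
      by (auto intro!: tendsto_eq_intros)
    show "\<forall>\<^sub>F e in at_right 0. norm (f z0) * exp (e * ((Re z0)\<^sup>2 - (Im z0)\<^sup>2)) \<le> M * exp (e * m\<^sup>2)"
      using key by (auto simp: eventually_at_right_less intro: eventually_mono[OF eventually_at_right_less])
  qed auto
qed

section \<open>The large sieve for one modulus\<close>

lemma dirichlet_character_one:
  assumes "dirichlet_character q chi"
  shows "chi 1 = 1"
proof -
  have "chi 1 \<noteq> 0" using assms unfolding dirichlet_character_def by simp
  moreover have "chi (1 * 1) = chi 1 * chi 1" using assms unfolding dirichlet_character_def by blast
  ultimately show ?thesis by simp
qed

lemma dirichlet_character_norm:
  assumes "dirichlet_character q chi" "q > 0" "chi a \<noteq> 0"
  shows "norm (chi a) = 1"
  using dirichlet_character_root_of_unity[OF assms] assms(2)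
  by (metis norm_one norm_power norm_ge_zero power_eq_1_iff totient_gt_0_iff power_eq_iff_eq_base zero_le_one power_one)

lemma dirichlet_character_norm_le:
  assumes "dirichlet_character q chi" "q > 0"
  shows "norm (chi a) \<le> 1"
  using dirichlet_character_norm[OF assms, of a] by (cases "chi a = 0") auto

lemma dirichlet_character_minus_one:
  assumes "dirichlet_character q chi"
  shows "chi (-1) \<in> {1, -1}"
proof -
  have "chi ((-1) * (-1)) = chi (-1) * chi (-1)" using assms unfolding dirichlet_character_def by blast
  then have "chi (-1) * chi (-1) = 1" using dirichlet_character_one[OF assms] by simp
  then show ?thesis by (simp add: square_eq_1_iff)
qed

text \<open>Multiplication by a unit b with chi b different from psi b permutes the residues and
  multiplies the sum by a number other than 1.\<close>

lemma dirichlet_character_orthogonal: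
  assumes chi: "dirichlet_character q chi" and psi: "dirichlet_character q psi" and q: "q > 0" and ne: "chi \<noteq> psi"
  shows "(\<Sum>a\<in>{0..<int q}. chi a * cnj (psi a)) = 0"
proof -
  obtain b where b: "chi b \<noteq> psi b" using ne by auto
  then have cop: "coprime b (int q)" using chi psi unfolding dirichlet_character_def by metis
  define f where "f a = chi a * cnj (psi a)" for a
  have fmult: "f (x * y) = f x * f y" for x y
    using chi psi by (simp add: f_def dirichlet_character_def)
  have fmod: "f (x mod int q) = f x" for x
    by (simp add: f_def dirichlet_character_mod[OF chi] dirichlet_character_mod[OF psi])
  have "psi b \<noteq> 0" using cop psi by (simp add: dirichlet_character_def)
  then have "psi b * cnj (psi b) = 1"
    using dirichlet_character_norm[OF psi q] by (simp add: complex_norm_square[symmetric])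
  then have fb: "f b \<noteq> 1" using b unfolding f_def by (metis mult.assoc mult.commute mult_1_left)
  let ?g = "\<lambda>a. a * b mod int q"
  have inj: "inj_on ?g {0..<int q}"
  proof (rule inj_onI)
    fix x y assume xy: "x \<in> {0..<int q}" "y \<in> {0..<int q}" "x * b mod int q = y * b mod int q"
    then have "[x * b = y * b] (mod int q)" by (simp add: cong_def)
    then have "[x = y] (mod int q)" using cop by (simp add: cong_mult_rcancel)
    then show "x = y" using xy by (simp add: cong_def)
  qed
  have img: "?g ` {0..<int q} = {0..<int q}"
    using q by (intro endo_inj_surj inj) auto
  have "f b * (\<Sum>a\<in>{0..<int q}. f a) = (\<Sum>a\<in>{0..<int q}. f (?g a))"
    by (simp add: sum_distrib_left fmod fmult mult.commute)
  also have "\<dots> = (\<Sum>a\<in>?g ` {0..<int q}. f a)" by (simp add: sum.reindex[OF inj])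
  finally have "(f b - 1) * (\<Sum>a\<in>{0..<int q}. f a) = 0" by (simp only: img) (simp add: algebra_simps)
  then show ?thesis using fb by (simp add: f_def)
qed

text \<open>Duality. With \<open>S\<close> for the left-hand side, \<open>S\<close> is the pairing
  of f with the combination \<open>g\<close> of characters. Orthogonality bounds the square sum of
  \<open>g\<close> by q S, and Cauchy-Schwarz then allows one factor S to be cancelled.\<close>

lemma dirichlet_character_Bessel:
  assumes X: "finite X" "\<And>chi. chi \<in> X \<Longrightarrow> dirichlet_character q chi" and q: "q > 0"
  shows "(\<Sum>chi\<in>X. (norm (\<Sum>a\<in>{0..<int q}. f a * chi a))\<^sup>2) \<le> real q * (\<Sum>a\<in>{0..<int q}. (norm (f a))\<^sup>2)"
proof -
  let ?R = "{0..<int q}"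
  define c where "c chi = (\<Sum>a\<in>?R. f a * chi a)" for chi
  define S where "S = (\<Sum>chi\<in>X. (norm (c chi))\<^sup>2)"
  define g where "g a = (\<Sum>chi\<in>X. cnj (c chi) * chi a)" for a
  have S0: "S \<ge> 0" by (auto simp: S_def intro: sum_nonneg)
  have "complex_of_real S = (\<Sum>chi\<in>X. cnj (c chi) * c chi)"
    unfolding S_def of_real_sum complex_norm_square by (simp only: mult.commute)
  also have "\<dots> = (\<Sum>chi\<in>X. \<Sum>a\<in>?R. f a * (cnj (c chi) * chi a))"
    by (subst c_def, simp add: sum_distrib_left mult_ac)
  also have "\<dots> = (\<Sum>a\<in>?R. f a * g a)"
    by (subst sum.swap) (simp add: g_def sum_distrib_left)
  finally have "S = norm (\<Sum>a\<in>?R. f a * g a)" using S0 by (metis norm_of_real abs_of_nonneg)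
  also have "\<dots> \<le> (\<Sum>a\<in>?R. norm (f a) * norm (g a))"
    by (rule order.trans[OF norm_sum]) (simp add: norm_mult)
  finally have "S\<^sup>2 \<le> (\<Sum>a\<in>?R. norm (f a) * norm (g a))\<^sup>2" using S0 by (rule power_mono)
  also have "\<dots> \<le> (\<Sum>a\<in>?R. (norm (f a))\<^sup>2) * (\<Sum>a\<in>?R. (norm (g a))\<^sup>2)"
    by (rule Cauchy_Schwarz_ineq_sum)
  finally have 1: "S\<^sup>2 \<le> (\<Sum>a\<in>?R. (norm (f a))\<^sup>2) * (\<Sum>a\<in>?R. (norm (g a))\<^sup>2)" .
  have "complex_of_real (\<Sum>a\<in>?R. (norm (g a))\<^sup>2) = (\<Sum>a\<in>?R. g a * cnj (g a))"
    by (simp add: complex_norm_square[symmetric])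
  also have "\<dots> = (\<Sum>a\<in>?R. \<Sum>chi\<in>X. \<Sum>psi\<in>X. cnj (c chi) * c psi * (chi a * cnj (psi a)))"
    by (simp add: g_def sum_product cnj_sum mult_ac)
  also have "\<dots> = (\<Sum>chi\<in>X. \<Sum>psi\<in>X. \<Sum>a\<in>?R. cnj (c chi) * c psi * (chi a * cnj (psi a)))"
    by (subst sum.swap) (intro sum.cong refl sum.swap)
  also have "\<dots> = (\<Sum>chi\<in>X. \<Sum>psi\<in>X. if chi = psi then cnj (c chi) * c psi * (\<Sum>a\<in>?R. chi a * cnj (psi a)) else 0)"
    using X q by (intro sum.cong refl) (auto simp: dirichlet_character_orthogonal simp flip: sum_distrib_left)
  also have "\<dots> = (\<Sum>chi\<in>X. cnj (c chi) * c chi * (\<Sum>a\<in>?R. chi a * cnj (chi a)))"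
    using X by (simp add: sum.delta')
  also have "\<dots> = complex_of_real (\<Sum>chi\<in>X. (norm (c chi))\<^sup>2 * (\<Sum>a\<in>?R. (norm (chi a))\<^sup>2))"
    by (simp add: complex_norm_square[symmetric] mult.commute)
  finally have "(\<Sum>a\<in>?R. (norm (g a))\<^sup>2) = (\<Sum>chi\<in>X. (norm (c chi))\<^sup>2 * (\<Sum>a\<in>?R. (norm (chi a))\<^sup>2))"
    by (simp only: of_real_eq_iff)
  also have "\<dots> \<le> (\<Sum>chi\<in>X. (norm (c chi))\<^sup>2 * (\<Sum>a\<in>?R. 1))"
    using X q by (intro sum_mono mult_left_mono power_le_one) (auto intro: dirichlet_character_norm_le[OF X(2) q])
  also have "\<dots> = real q * S" by (simp add: S_def sum_distrib_left mult.commute)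
  finally have 2: "(\<Sum>a\<in>?R. (norm (g a))\<^sup>2) \<le> real q * S" .
  have "S * S \<le> S * (real q * (\<Sum>a\<in>?R. (norm (f a))\<^sup>2))"
    using order.trans[OF 1 mult_left_mono[OF 2]] by (simp add: sum_nonneg power2_eq_square mult_ac)
  then have "S \<le> real q * (\<Sum>a\<in>?R. (norm (f a))\<^sup>2)"
    using S0 by (cases "S = 0") (auto intro!: sum_nonneg mult_nonneg_nonneg)
  then show ?thesis by (simp add: S_def c_def)
qed

lemma card_residue_class_interval:
  fixes q u M r :: nat
  assumes "q > 0"
  shows "card {n\<in>{u..<u+M}. n mod q = r} \<le> M div q + 1"
proof -
  have "inj_on (\<lambda>n. (n - u) div q) {n\<in>{u..<u+M}. n mod q = r}"
  proof (rule inj_onI)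
    fix x y assume *: "x \<in> {n\<in>{u..<u+M}. n mod q = r}" "y \<in> {n\<in>{u..<u+M}. n mod q = r}" "(x - u) div q = (y - u) div q"
    then have "[x = y] (mod q)" by (simp add: cong_def)
    then have "[(x - u) + u = (y - u) + u] (mod q)" using * by simp
    then have "[x - u = y - u] (mod q)" by (simp only: cong_add_rcancel_nat)
    then have "x - u = y - u" using *(3) by (metis cong_def mod_div_mult_eq)
    then show "x = y" using * by auto
  qed
  moreover have "(\<lambda>n. (n - u) div q) ` {n\<in>{u..<u+M}. n mod q = r} \<subseteq> {..M div q}"
    by (auto intro!: div_le_mono)
  ultimately show ?thesis using card_inj_on_le[of _ _ "{..M div q}"] by fastforce
qed

text \<open>The sum is grouped by residue classes. Each class meets the interval in at most M / q +
  1 points, so that Cauchy-Schwarz inside the classes costs this factor and Bessel's inequality the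
  factor q. For M \<ge> q this is the length of the interval up to a factor 2.\<close>

lemma large_sieve_fixed_modulus:
  fixes a :: "nat \<Rightarrow> complex"
  assumes X: "finite X" "\<And>chi. chi \<in> X \<Longrightarrow> dirichlet_character q chi" and q: "q > 0"
    and I: "I \<subseteq> {u..<u+M}"
  shows "(\<Sum>chi\<in>X. (norm (\<Sum>n\<in>I. a n * chi (int n)))\<^sup>2) \<le> (real q + real M) * (\<Sum>n\<in>I. (norm (a n))\<^sup>2)"
proof -
  let ?R = "{0..<int q}"
  have fI: "finite I" using I finite_subset by blast
  define J where "J r = {n\<in>I. int n mod int q = r}" for r
  define f where "f r = (\<Sum>n\<in>J r. a n)" for r
  have part: "(\<Sum>n\<in>I. h n) = (\<Sum>r\<in>?R. \<Sum>n\<in>J r. h n)" for h :: "nat \<Rightarrow> 'b::comm_monoid_add"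
    unfolding J_def using q fI by (intro sum.group[symmetric]) auto
  have "(\<Sum>n\<in>I. a n * chi (int n)) = (\<Sum>r\<in>?R. f r * chi r)" if "chi \<in> X" for chi
  proof -
    have "(\<Sum>n\<in>I. a n * chi (int n)) = (\<Sum>r\<in>?R. \<Sum>n\<in>J r. a n * chi (int n))" by (rule part)
    also have "\<dots> = (\<Sum>r\<in>?R. \<Sum>n\<in>J r. a n * chi r)"
      using dirichlet_character_mod[OF X(2)[OF that]] by (intro sum.cong refl) (metis (mono_tags, lifting) J_def mem_Collect_eq)
    finally show ?thesis by (simp add: f_def sum_distrib_right)
  qed
  then have "(\<Sum>chi\<in>X. (norm (\<Sum>n\<in>I. a n * chi (int n)))\<^sup>2) = (\<Sum>chi\<in>X. (norm (\<Sum>r\<in>?R. f r * chi r))\<^sup>2)" by simp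
  also have "\<dots> \<le> real q * (\<Sum>r\<in>?R. (norm (f r))\<^sup>2)"
    by (rule dirichlet_character_Bessel[OF X q])
  also have "\<dots> \<le> real q * (\<Sum>r\<in>?R. real (M div q + 1) * (\<Sum>n\<in>J r. (norm (a n))\<^sup>2))"
  proof (intro mult_left_mono sum_mono)
    fix r assume r: "r \<in> ?R"
    have "J r \<subseteq> {n\<in>{u..<u+M}. n mod q = nat r}" using I r by (auto simp: J_def nat_mod_distrib)
    then have "card (J r) \<le> card {n\<in>{u..<u+M}. n mod q = nat r}" by (intro card_mono) auto
    also have "\<dots> \<le> M div q + 1" by (rule card_residue_class_interval[OF q])
    finally have cJ: "card (J r) \<le> M div q + 1" .
    have "(norm (f r))\<^sup>2 \<le> (\<Sum>n\<in>J r. 1 * norm (a n))\<^sup>2"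
      unfolding f_def by (intro power_mono) (auto intro: norm_sum)
    also have "\<dots> \<le> (\<Sum>n\<in>J r. 1\<^sup>2) * (\<Sum>n\<in>J r. (norm (a n))\<^sup>2)"
      by (rule Cauchy_Schwarz_ineq_sum)
    also have "\<dots> \<le> real (M div q + 1) * (\<Sum>n\<in>J r. (norm (a n))\<^sup>2)"
      using cJ by (intro mult_right_mono) (auto intro: sum_nonneg)
    finally show "(norm (f r))\<^sup>2 \<le> real (M div q + 1) * (\<Sum>n\<in>J r. (norm (a n))\<^sup>2)" .
  qed auto
  also have "\<dots> = real (q * (M div q) + q) * (\<Sum>n\<in>I. (norm (a n))\<^sup>2)"
    by (simp add: part[of "\<lambda>n. (norm (a n))\<^sup>2"] sum_distrib_left algebra_simps)
  also have "\<dots> \<le> (real q + real M) * (\<Sum>n\<in>I. (norm (a n))\<^sup>2)"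
    using mult_div_mod_eq[of q M] by (intro mult_right_mono) (auto intro!: sum_nonneg simp flip: of_nat_add of_nat_mult)
  finally show ?thesis .
qed

lemma large_sieve_L2_set:
  fixes a :: "nat \<Rightarrow> complex"
  assumes X: "finite X" "\<And>chi. chi \<in> X \<Longrightarrow> dirichlet_character q chi" and q: "q > 0"
    and I: "I \<subseteq> {u..<u+M}" and a: "(\<Sum>n\<in>I. (norm (a n))\<^sup>2) \<le> A"
  shows "L2_set (\<lambda>chi. norm (\<Sum>n\<in>I. a n * chi (int n))) X \<le> sqrt ((real q + real M) * A)"
  unfolding L2_set_def
  using large_sieve_fixed_modulus[OF X q I, of a] mult_left_mono[OF a, of "real q + real M"]
  by (intro real_sqrt_le_mono) linarith

text \<open>Minkowski's inequality for mean squares over characters; the later decompositions of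
  coefficients and of index ranges all rest on it.\<close>

lemma L2_set_norm_add_le:
  "L2_set (\<lambda>x. norm (f x + g x :: 'a::real_normed_vector)) A \<le> L2_set (\<lambda>x. norm (f x)) A + L2_set (\<lambda>x. norm (g x)) A"
  by (rule order.trans[OF L2_set_mono L2_set_triangle_ineq]) (auto intro: norm_triangle_ineq)

lemma L2_set_norm_sum_le:
  assumes "finite I"
  shows "L2_set (\<lambda>x. norm (\<Sum>i\<in>I. f i x :: 'a::real_normed_vector)) A \<le> (\<Sum>i\<in>I. L2_set (\<lambda>x. norm (f i x)) A)"
  using assms
proof induction
  case (insert i I)
  then show ?case using L2_set_norm_add_le[of "f i" "\<lambda>x. \<Sum>i\<in>I. f i x" A] by simp
qed (simp add: L2_set_def)

section \<open>Coefficients and Satake parameters\<close>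

text \<open>Each factor of p ^ r is one of the r + 1 powers of p up to p ^ r. What matters is that
  the growth in r is polynomial: the local generating functions then converge in the unit
  disc.\<close>

lemma divisor_tau_prime_power:
  assumes "prime p"
  shows "divisor_tau d (p ^ r) \<le> (r + 1) ^ d"
proof -
  have "{f \<in> {..<d} \<rightarrow>\<^sub>E {1..p ^ r}. (\<Prod>j<d. f j) = p ^ r} \<subseteq> {..<d} \<rightarrow>\<^sub>E (\<lambda>i. p ^ i) ` {..r}"
  proof
    fix f assume f: "f \<in> {f \<in> {..<d} \<rightarrow>\<^sub>E {1..p ^ r}. (\<Prod>j<d. f j) = p ^ r}"
    then have pr: "(\<Prod>j<d. f j) = p ^ r" and ext: "f \<in> extensional {..<d}" by (auto simp: PiE_iff)
    have "f j \<in> (\<lambda>i. p ^ i) ` {..r}" if "j < d" for j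
    proof -
      have "f j dvd (\<Prod>j<d. f j)" using that by (intro dvd_prodI) auto
      then show ?thesis unfolding pr divides_primepow_nat[OF assms] by blast
    qed
    then show "f \<in> {..<d} \<rightarrow>\<^sub>E (\<lambda>i. p ^ i) ` {..r}"
      using ext by (simp add: PiE_iff)
  qed
  then have "divisor_tau d (p ^ r) \<le> card ({..<d} \<rightarrow>\<^sub>E (\<lambda>i. p ^ i) ` {..r})"
    unfolding divisor_tau_def by (intro card_mono finite_PiE) auto
  also have "\<dots> = card ((\<lambda>i. p ^ i) ` {..r}) ^ d" by (simp add: card_PiE)
  also have "\<dots> \<le> (r + 1) ^ d"
    using card_image_le[of "{..r}" "\<lambda>i. p ^ i"] by (intro power_mono) auto
  finally show ?thesis .
qed

text \<open>The index set agrees literally with that of \<open>L_framework\<close>, so that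
  unfolding turns the hypothesis on \<open>lam F (p ^ r)\<close> into a statement about these
  polynomials.\<close>

definition complete_homogeneous :: "(nat \<Rightarrow> complex) \<Rightarrow> nat \<Rightarrow> nat \<Rightarrow> complex" where
  "complete_homogeneous a n r =
     (\<Sum>e \<in> {e \<in> {..<n} \<rightarrow>\<^sub>E {..r}. (\<Sum>j<n. e j) = r}. \<Prod>j<n. a j ^ e j)"

lemma complete_homogeneous_index_set:
  "{e \<in> {..<n::nat} \<rightarrow>\<^sub>E {..r}. (\<Sum>j<n. e j) = r} = {e \<in> extensional {..<n}. (\<Sum>j<n. e j) = (r::nat)}"
proof -
  have "e j \<le> (\<Sum>j<n. e j)" if "j < n" for e :: "nat \<Rightarrow> nat" and j
    using that by (intro member_le_sum) auto
  then show ?thesis by (auto simp: PiE_iff)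
qed

lemma finite_complete_homogeneous_index_set:
  "finite {e \<in> extensional {..<n::nat}. (\<Sum>j<n. e j) = (r::nat)}"
  by (subst complete_homogeneous_index_set[symmetric]) (auto intro: finite_subset[OF _ finite_PiE[of "{..<n}" "\<lambda>_. {..r}"]])

lemma complete_homogeneous_0: "complete_homogeneous a n 0 = 1"
proof -
  have *: "{e \<in> extensional {..<n}. (\<Sum>j<n. e j) = (0::nat)} = {\<lambda>j\<in>{..<n}. 0}"
    by (auto simp: extensional_def fun_eq_iff)
  show ?thesis unfolding complete_homogeneous_def complete_homogeneous_index_set * by simp
qed

lemma complete_homogeneous_zero_vars: "complete_homogeneous a 0 r = (if r = 0 then 1 else 0)"
  by (auto simp: complete_homogeneous_def)

text \<open>A monomial either does not contain the last variable, or one power of that variable can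
  be taken out.\<close>

lemma complete_homogeneous_Suc:
  "complete_homogeneous a (Suc n) (Suc r) = complete_homogeneous a n (Suc r) + a n * complete_homogeneous a (Suc n) r"
proof -
  let ?E = "\<lambda>n r. {e \<in> extensional {..<n::nat}. (\<Sum>j<n. e j) = (r::nat)}"
  let ?w = "\<lambda>n e. \<Prod>j<n. a j ^ e j"
  have fin: "finite (?E n r)" for n r by (rule finite_complete_homogeneous_index_set)
  have "complete_homogeneous a (Suc n) (Suc r) = sum (?w (Suc n)) (?E (Suc n) (Suc r))"
    by (simp only: complete_homogeneous_def complete_homogeneous_index_set)
  also have "?E (Suc n) (Suc r) = {e \<in> ?E (Suc n) (Suc r). e n = 0} \<union> {e \<in> ?E (Suc n) (Suc r). e n > 0}" by auto
  also have "sum (?w (Suc n)) \<dots> = sum (?w (Suc n)) {e \<in> ?E (Suc n) (Suc r). e n = 0} + sum (?w (Suc n)) {e \<in> ?E (Suc n) (Suc r). e n > 0}"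
    by (intro sum.union_disjoint finite_subset[OF _ fin[of "Suc n" "Suc r"]]) auto
  also have "sum (?w (Suc n)) {e \<in> ?E (Suc n) (Suc r). e n = 0} = sum (?w n) (?E n (Suc r))"
    \<comment> \<open>An exponent function for n variables is extensional: restricting it means to
      replace its value 0 at n by \<open>undefined\<close>.\<close>
    by (rule sum.reindex_bij_witness[of _ "\<lambda>e. e(n := 0)" "\<lambda>e. e(n := undefined)"])
       (auto simp: extensional_def fun_eq_iff lessThan_Suc)
  also have "sum (?w (Suc n)) {e \<in> ?E (Suc n) (Suc r). e n > 0} = sum (\<lambda>e. a n * ?w (Suc n) e) (?E (Suc n) r)"
  proof (rule sum.reindex_bij_witness[of _ "\<lambda>e. e(n := Suc (e n))" "\<lambda>e. e(n := e n - 1)"])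
    fix e assume e: "e \<in> {e \<in> ?E (Suc n) (Suc r). e n > 0}"
    then show "(e(n := e n - 1))(n := Suc ((e(n := e n - 1)) n)) = e" by auto
    show "e(n := e n - 1) \<in> ?E (Suc n) r" using e by (auto simp: extensional_def)
    obtain k where "e n = Suc k" using e by (auto dest: gr0_implies_Suc)
    then show "a n * (\<Prod>j<Suc n. a j ^ (e(n := e n - 1)) j) = (\<Prod>j<Suc n. a j ^ e j)" by simp
  qed (auto simp: extensional_def)
  finally show ?thesis
    by (simp only: complete_homogeneous_def complete_homogeneous_index_set sum_distrib_left)
qed

lemma complete_homogeneous_1: "complete_homogeneous a n (Suc 0) = (\<Sum>j<n. a j)"
  by (induction n) (auto simp: complete_homogeneous_zero_vars complete_homogeneous_Suc complete_homogeneous_0)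

lemma complete_homogeneous_generating_function:
  "Abs_fps (complete_homogeneous a n) * fps_of_poly (\<Prod>j<n. [:1, - a j:]) = 1"
proof (induction n)
  case 0
  show ?case by (auto simp: fps_eq_iff complete_homogeneous_zero_vars)
next
  case (Suc n)
  have "Abs_fps (complete_homogeneous a (Suc n)) * fps_of_poly [:1, - a n:] = Abs_fps (complete_homogeneous a n)"
  proof (rule fps_ext)
    fix r
    have e: "fps_of_poly [:1, - a n:] = 1 - fps_const (a n) * fps_X"
      by (simp add: fps_of_poly_pCons)
    show "(Abs_fps (complete_homogeneous a (Suc n)) * fps_of_poly [:1, - a n:]) $ r = Abs_fps (complete_homogeneous a n) $ r"
      unfolding e by (cases r) (simp_all add: right_diff_distrib complete_homogeneous_0 complete_homogeneous_Suc mult.assoc[symmetric])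
  qed
  moreover have "Abs_fps (complete_homogeneous a (Suc n)) * fps_of_poly (\<Prod>j<Suc n. [:1, - a j:])
      = (Abs_fps (complete_homogeneous a (Suc n)) * fps_of_poly [:1, - a n:]) * fps_of_poly (\<Prod>j<n. [:1, - a j:])"
    by (simp only: prod.lessThan_Suc fps_of_poly_mult mult.assoc mult.commute[of "fps_of_poly [:1, - a n:]"])
  ultimately show ?case using Suc by simp
qed

text \<open>If the coefficients grow subexponentially, then the generating function converges in the unit
  disc, where it is the inverse of the product over the roots, which hence cannot vanish.\<close>

lemma complete_homogeneous_bounded_roots:
  assumes bound: "\<And>r. norm (complete_homogeneous a n r) \<le> real (r + 1) ^ d" and j: "j < n"
  shows "norm (a j) \<le> 1"
proof (rule ccontr)
  assume "\<not> norm (a j) \<le> 1"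
  then have aj: "norm (a j) > 1" by simp
  define z where "z = inverse (a j)"
  have z: "norm z < 1" "a j \<noteq> 0" using aj by (auto simp: z_def norm_inverse inverse_less_1_iff)
  have "fps_conv_radius (Abs_fps (complete_homogeneous a n)) \<ge> 1"
    unfolding fps_conv_radius_def
  proof (rule conv_radius_geI_ex')
    fix r :: real assume r: "0 < r" "ereal r < 1"
    \<comment> \<open>The gap between r and s absorbs the polynomial factor, since (r / s) ^ k
      decays exponentially.\<close>
    obtain s where s: "r < s" "s < 1" using r dense[of r 1] by auto
    have "summable (\<lambda>k. real (k + 1) ^ d * r ^ k)"
    proof (rule summable_comparison_test_ev)
      define c where "c = - ln (r / s)"
      have c: "c > 0" "\<And>k. (r / s) ^ k = exp (- c * real k)"
      proof -
        show "c > 0" using r s by (simp add: c_def)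
        have "exp (- c) = r / s" using r s by (simp add: c_def)
        then show "(r / s) ^ k = exp (- c * real k)" for k by (simp only: exp_of_nat2_mult)
      qed
      have "((\<lambda>k. real (k + 1) ^ d * (r / s) ^ k) \<longlonglongrightarrow> 0)"
        unfolding c(2) using c(1) by real_asymp
      then have "\<forall>\<^sub>F k in sequentially. real (k + 1) ^ d * (r / s) ^ k < 1" by (rule order_tendstoD) simp
      then show "\<forall>\<^sub>F k in sequentially. norm (real (k + 1) ^ d * r ^ k) \<le> s ^ k"
      proof eventually_elim
        case (elim k)
        have "s ^ k > 0" using r s by simp
        then have "real (k + 1) ^ d * r ^ k < s ^ k"
          using elim unfolding power_divide by (simp add: pos_divide_less_eq)
        then show ?case using r by (simp add: abs_mult)
      qed
      show "summable (\<lambda>k. s ^ k)" using r s by (intro summable_geometric) auto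
    qed
    then show "summable (\<lambda>k. fps_nth (Abs_fps (complete_homogeneous a n)) k * of_real r ^ k)"
      by (rule summable_comparison_test'[where N=0])
         (use bound r in \<open>auto simp: norm_mult norm_power intro!: mult_right_mono\<close>)
  qed
  then have "ereal (norm z) < fps_conv_radius (Abs_fps (complete_homogeneous a n))"
    using z(1) by (metis less_le_trans less_ereal.simps(1) one_ereal_def)
  then have "eval_fps (Abs_fps (complete_homogeneous a n) * fps_of_poly (\<Prod>j<n. [:1, - a j:])) z
      = eval_fps (Abs_fps (complete_homogeneous a n)) z * poly (\<Prod>j<n. [:1, - a j:]) z"
    by (subst eval_fps_mult) auto
  moreover have "poly (\<Prod>j<n. [:1, - a j:]) z = 0"
    unfolding poly_prod using j z(2) by (intro prod_zero) (auto simp: z_def intro!: bexI[of _ j])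
  ultimately show False by (simp add: complete_homogeneous_generating_function)
qed

section \<open>The Ramanujan bound for the parameters\<close>

locale satake_bounds =
  fixes F :: L_data and d :: nat
  assumes degree: "L_degree F = d"
    and mult: "\<And>m n. m > 0 \<Longrightarrow> n > 0 \<Longrightarrow> coprime m n \<Longrightarrow> lam F (m * n) = lam F m * lam F n"
    and lam_pow: "\<And>p r. prime p \<Longrightarrow> lam F (p ^ r) = complete_homogeneous (\<lambda>j. satake F j p) d r"
    and tau: "\<And>n. n \<ge> 1 \<Longrightarrow> norm (lam F n) \<le> real (divisor_tau d n)"
begin

lemma norm_lam_prime_power_le:
  assumes "prime p"
  shows "norm (lam F (p ^ r)) \<le> real (r + 1) ^ d"
proof -
  have "norm (lam F (p ^ r)) \<le> real (divisor_tau d (p ^ r))"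
    using assms by (intro tau) (simp add: prime_gt_0_nat Suc_le_eq)
  also have "\<dots> \<le> real ((r + 1) ^ d)" using divisor_tau_prime_power[OF assms] of_nat_le_iff by blast
  finally show ?thesis by simp
qed

text \<open>The divisor bound at all powers of p excludes a pole of the local generating function in
  the open unit disc, and so controls each parameter by itself. This is what makes the Euler product
  of the higher prime powers converge to the left of Re s = 1.\<close>

lemma norm_satake_le:
  assumes "prime p" "j < d"
  shows "norm (satake F j p) \<le> 1"
  using norm_lam_prime_power_le[OF assms(1)] assms
  by (intro complete_homogeneous_bounded_roots[of "\<lambda>j. satake F j p" d d]) (auto simp flip: lam_pow)

lemma lam_prime:
  assumes "prime p"
  shows "lam F p = (\<Sum>j<d. satake F j p)"
  using lam_pow[OF assms, of 1] by (simp add: complete_homogeneous_1)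

lemma norm_lam_prime_le:
  assumes "prime p"
  shows "norm (lam F p) \<le> real d"
proof -
  have "norm (lam F p) \<le> (\<Sum>j<d. 1)"
    unfolding lam_prime[OF assms] by (rule order.trans[OF norm_sum sum_mono]) (auto intro: norm_satake_le assms)
  then show ?thesis by simp
qed

end

section \<open>The completed L-function\<close>

lemma of_real_powr_exp:
  assumes "x > 0"
  shows "complex_of_real x powr s = exp (s * of_real (ln x))"
  using assms by (simp add: powr_def Ln_of_real)

lemma norm_of_real_powr:
  assumes "x > 0"
  shows "norm (complex_of_real x powr s) = x powr Re s"
  using assms by (simp add: norm_powr_real_powr)

lemma of_nat_powr_exp:
  assumes "n > 0"
  shows "(of_nat n :: complex) powr s = exp (s * of_real (ln (real n)))"
  using of_real_powr_exp[of "real n" s] assms by simp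

lemma norm_of_nat_powr:
  assumes "n > 0"
  shows "norm ((of_nat n :: complex) powr s) = real n powr Re s"
  using norm_of_real_powr[of "real n" s] assms by simp

lemma is_entire_extension_unique:
  assumes "is_entire_extension f g" "is_entire_extension f g'"
  shows "g = g'"
proof
  fix z
  show "g z = g' z"
    by (rule analytic_continuation_open[of "{z. Re z > 1}" UNIV])
       (use assms in \<open>auto simp: is_entire_extension_def open_halfspace_Re_gt intro!: exI[of _ "2::complex"]\<close>)
qed

lemma entire_extension_eqI:
  assumes "is_entire_extension f g"
  shows "entire_extension f = g"
  using is_entire_extension_unique someI[of "is_entire_extension f", OF assms] assms
  unfolding entire_extension_def by blast

text \<open>The infimum in \<open>entire_order\<close> need not be attained at 1, but there is an
  admissible exponent below 2, the range in which \<open>Phragmen_Lindeloef_strip\<close>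
  works.\<close>

lemma entire_order_1_growth:
  assumes "entire_order f = 1"
  obtains A B r where "0 < r" "r < 2" "\<And>z. norm (f z) \<le> A * exp (B * norm z powr r)"
proof -
  have "entire_order f < ereal 2" using assms by simp
  then obtain r A B where "0 < r" "r < 2" "\<forall>z. norm (f z) \<le> A * exp (B * norm z powr r)"
    unfolding entire_order_def Inf_less_iff by auto
  then show ?thesis using that by blast
qed

text \<open>Majorant of the product of the gamma factors on the line Re s = 2, for the parity
  e.\<close>

definition gamma_bound :: "L_data \<Rightarrow> complex \<Rightarrow> real" where
  "gamma_bound F e = (\<Prod>j<L_degree F. pi powr (- (2 + Re (shift F e j)) / 2) * Gamma ((2 + Re (shift F e j)) / 2))"

text \<open>The reciprocal of \<open>L_inf\<close> where that is finite and nonzero. Written with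
  \<open>rGamma\<close> it is entire, also where the gamma factors have poles.\<close>

definition inverse_L_inf :: "L_data \<Rightarrow> nat \<Rightarrow> (int \<Rightarrow> complex) \<Rightarrow> complex \<Rightarrow> complex" where
  "inverse_L_inf F q chi s = of_nat (conductor F q) powr (- s / 2) *
     (\<Prod>j<L_degree F. of_real pi powr ((s + shift F (chi (-1)) j) / 2) * rGamma ((s + shift F (chi (-1)) j) / 2))"

locale L_family = satake_bounds +
  assumes degree_pos: "d > 0"
    and summ: "\<And>\<sigma>. \<sigma> > 1 \<Longrightarrow> summable (\<lambda>n. norm (lam F (Suc n)) / real (Suc n) powr \<sigma>)"
    and shift: "\<And>e j. e \<in> {1, -1} \<Longrightarrow> j < d \<Longrightarrow> Re (shift F e j) > -1"
begin

text \<open>What the framework provides for one modulus and one character, so that the analytic part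
  is free of the set of moduli.\<close>

definition good :: "nat \<Rightarrow> (int \<Rightarrow> complex) \<Rightarrow> bool" where
  "good q chi \<longleftrightarrow> q \<ge> 2 \<and> conductor F q > 0 \<and> dirichlet_character q chi \<and> abs_convergent_euler_product F chi \<and>
     is_entire_extension (completed_series F q chi) (completed_L F q chi) \<and>
     entire_order (completed_L F q chi) = 1 \<and>
     (\<exists>\<kappa>. norm \<kappa> = 1 \<and> (\<forall>s. completed_L F q chi s =
                \<kappa> * completed_L (dual F) q (\<lambda>a. cnj (chi a)) (1 - s)))"

definition lam_sum :: "real \<Rightarrow> real" where
  "lam_sum \<sigma> = (\<Sum>n. norm (lam F (Suc n)) / real (Suc n) powr \<sigma>)"

lemma lam_sum_nonneg: "\<sigma> > 1 \<Longrightarrow> lam_sum \<sigma> \<ge> 0"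
  unfolding lam_sum_def by (intro suminf_nonneg summ) auto

lemma norm_L_term_le:
  assumes "dirichlet_character q chi" "q > 0" "n > 0" "\<sigma> \<le> Re s"
  shows "norm (L_term F chi s n) \<le> norm (lam F n) / real n powr \<sigma>"
proof -
  have "norm (L_term F chi s n) = norm (lam F n) * norm (chi (int n)) / real n powr Re s"
    using assms by (simp add: L_term_def norm_divide norm_mult norm_of_nat_powr)
  also have "\<dots> \<le> norm (lam F n) * 1 / real n powr \<sigma>"
    using assms dirichlet_character_norm_le[OF assms(1,2)]
    by (intro frac_le mult_left_mono powr_mono) auto
  finally show ?thesis by simp
qed

lemma summable_L_term:
  assumes "dirichlet_character q chi" "q > 0" "Re s > 1"
  shows "summable (\<lambda>n. L_term F chi s (Suc n))"
  by (rule summable_comparison_test'[OF summ[OF assms(3)], of 0]) (use norm_L_term_le[OF assms(1,2)] in \<open>auto simp del: of_nat_Suc\<close>)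

lemma norm_L_series_le:
  assumes "dirichlet_character q chi" "q > 0" "1 < \<sigma>" "\<sigma> \<le> Re s"
  shows "norm (L_series F chi s) \<le> lam_sum \<sigma>"
  unfolding L_series_def lam_sum_def using norm_L_term_le[OF assms(1,2)] assms
  by (intro order.trans[OF summable_norm suminf_le] summable_comparison_test'[OF summ[OF assms(3)], of 0] summ) (auto simp del: of_nat_Suc)

lemma inverse_L_inf_holomorphic: "inverse_L_inf F q chi holomorphic_on A"
  unfolding inverse_L_inf_def
  by (cases "conductor F q = 0") (auto intro!: holomorphic_intros)

lemma L_inf_inverse:
  assumes "good q chi" "Re s > 1"
  shows "L_inf F q chi s * inverse_L_inf F q chi s = 1"
proof -
  have e: "chi (-1) \<in> {1, -1}" using assms dirichlet_character_minus_one[of q chi] by (simp add: good_def)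
  have N: "conductor F q > 0" using assms by (simp add: good_def)
  have "of_nat (conductor F q) powr (s / 2) * of_nat (conductor F q) powr (- s / 2) = (1::complex)"
    using N by (simp add: of_nat_powr_exp flip: exp_add)
  moreover have "Gamma_R (s + shift F (chi (-1)) j) * (of_real pi powr ((s + shift F (chi (-1)) j) / 2) * rGamma ((s + shift F (chi (-1)) j) / 2)) = 1"
    if "j < d" for j
  proof -
    let ?z = "(s + shift F (chi (-1)) j) / 2"
    have "Re ?z > 0" using shift[OF e that] assms by simp
    then have "?z \<notin> \<int>\<^sub>\<le>\<^sub>0" by (auto elim!: nonpos_Ints_cases simp: complex_eq_iff)
    then have "Gamma ?z \<noteq> 0" by (simp add: Gamma_eq_zero_iff)
    then show ?thesis by (simp add: Gamma_R_def rGamma_inverse_Gamma of_real_powr_exp field_simps flip: exp_add)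
  qed
  ultimately show ?thesis
    by (simp add: L_inf_def inverse_L_inf_def degree mult_ac flip: prod.distrib)
qed

text \<open>\<open>L_fun\<close> is defined by choice. The completed function times the entire
  reciprocal of the gamma factors is one entire extension of the series, and the identity theorem
  makes it the chosen one.\<close>

lemma
  assumes "good q chi"
  shows L_fun_eq: "L_fun F chi s = completed_L F q chi s * inverse_L_inf F q chi s"
    and L_fun_holomorphic: "L_fun F chi holomorphic_on UNIV"
    and L_fun_series: "Re s > 1 \<Longrightarrow> L_fun F chi s = L_series F chi s"
proof -
  have ext: "is_entire_extension (completed_series F q chi) (completed_L F q chi)" using assms by (simp add: good_def)
  have "is_entire_extension (L_series F chi) (\<lambda>s. completed_L F q chi s * inverse_L_inf F q chi s)"
    unfolding is_entire_extension_def
  proof (intro conjI allI impI)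
    show "(\<lambda>s. completed_L F q chi s * inverse_L_inf F q chi s) holomorphic_on UNIV"
      using ext by (intro holomorphic_intros inverse_L_inf_holomorphic) (simp add: is_entire_extension_def)
    fix s :: complex assume s: "Re s > 1"
    then have "completed_L F q chi s = L_series F chi s * L_inf F q chi s"
      using ext by (simp add: is_entire_extension_def completed_series_def)
    then show "completed_L F q chi s * inverse_L_inf F q chi s = L_series F chi s"
      using L_inf_inverse[OF assms s] by (simp add: mult.assoc)
  qed
  moreover from this have "L_fun F chi = (\<lambda>s. completed_L F q chi s * inverse_L_inf F q chi s)"
    unfolding L_fun_def by (rule entire_extension_eqI)
  ultimately show "L_fun F chi s = completed_L F q chi s * inverse_L_inf F q chi s"
      "L_fun F chi holomorphic_on UNIV" "Re s > 1 \<Longrightarrow> L_fun F chi s = L_series F chi s"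
    by (simp_all only: is_entire_extension_def)
qed

text \<open>Schwarz reflection, checked termwise for Re s > 1 and extended by uniqueness; chi (-1)
  is real, so that the parity does not change. It removes the dual form: the functional equation now
  relates \<open>completed_L F q chi\<close> to itself.\<close>

lemma completed_L_dual:
  assumes "good q chi"
  shows "completed_L (dual F) q (\<lambda>a. cnj (chi a)) s = cnj (completed_L F q chi (cnj s))"
proof -
  have ext: "is_entire_extension (completed_series F q chi) (completed_L F q chi)" using assms by (simp add: good_def)
  have chi: "dirichlet_character q chi" "q > 0" using assms by (auto simp: good_def)
  have e: "cnj (chi (-1)) = chi (-1)" using dirichlet_character_minus_one[OF chi(1)] by auto
  have N: "conductor F q > 0" using assms by (simp add: good_def)
  have [simp]: "L_degree (dual F) = d" "conductor (dual F) = conductor F" "shift (dual F) u j = cnj (shift F u j)"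
     "lam (dual F) n = cnj (lam F n)" for u j n
    by (simp_all add: dual_def degree)
  have "is_entire_extension (completed_series (dual F) q (\<lambda>a. cnj (chi a))) (\<lambda>s. cnj (completed_L F q chi (cnj s)))"
    unfolding is_entire_extension_def
  proof (intro conjI allI impI)
    show "(\<lambda>s. cnj (completed_L F q chi (cnj s))) holomorphic_on UNIV"
    proof -
      have "completed_L F q chi holomorphic_on cnj ` UNIV"
        using ext by (auto simp: is_entire_extension_def intro: holomorphic_on_subset)
      from holomorphic_on_compose_cnj_cnj[OF this] show ?thesis by (simp add: o_def)
    qed
    fix s :: complex assume s: "Re s > 1"
    have "cnj (L_series F chi (cnj s)) = (\<Sum>n. cnj (L_term F chi (cnj s) (Suc n)))"
      unfolding L_series_def using summable_L_term[OF chi, of "cnj s"] s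
      by (intro sums_unique) (simp add: sums_cnj summable_sums)
    also have "\<dots> = L_series (dual F) (\<lambda>a. cnj (chi a)) s"
      unfolding L_series_def by (simp add: L_term_def of_nat_powr_exp exp_cnj del: of_nat_Suc)
    finally have 1: "cnj (L_series F chi (cnj s)) = L_series (dual F) (\<lambda>a. cnj (chi a)) s" .
    have g: "cnj (Gamma_R z) = Gamma_R (cnj z)" for z
      by (simp add: Gamma_R_def cnj_Gamma of_real_powr_exp exp_cnj)
    have 2: "cnj (L_inf F q chi (cnj s)) = L_inf (dual F) q (\<lambda>a. cnj (chi a)) s"
      using N by (simp add: L_inf_def g degree of_nat_powr_exp exp_cnj e)
    show "cnj (completed_L F q chi (cnj s)) = completed_series (dual F) q (\<lambda>a. cnj (chi a)) s"
      using ext s 1 2 by (simp add: is_entire_extension_def completed_series_def)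
  qed
  from entire_extension_eqI[OF this] show ?thesis by (simp add: completed_L_def)
qed

lemma functional_equation:
  assumes "good q chi"
  obtains \<kappa> where "norm \<kappa> = 1" "\<And>s. completed_L F q chi s = \<kappa> * cnj (completed_L F q chi (1 - cnj s))"
  using assms completed_L_dual[OF assms] unfolding good_def by (metis complex_cnj_diff complex_cnj_one)

lemma norm_Gamma_R_le:
  assumes "Re s > 0"
  shows "norm (Gamma_R s) \<le> pi powr (- Re s / 2) * Gamma (Re s / 2)"
  using norm_Gamma_le[of "s / 2"] assms
  by (auto simp: Gamma_R_def norm_mult norm_of_real_powr intro!: mult_left_mono)

text \<open>On Re s = 2 the series and the gamma factors are bounded and the conductor enters to the
  first power. The functional equation transfers this bound to Re s = -1, and the entire function in
  between obeys it uniformly in the height.\<close>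

lemma norm_completed_L_strip:
  assumes good: "good q chi" and s: "-1 \<le> Re s" "Re s \<le> 2"
  shows "norm (completed_L F q chi s) \<le> (lam_sum 2 * (\<bar>gamma_bound F 1\<bar> + \<bar>gamma_bound F (-1)\<bar>) + 1) * real (conductor F q)"
    (is "_ \<le> ?C * _")
proof -
  have chi: "dirichlet_character q chi" "q > 0" using good by (auto simp: good_def)
  have e: "chi (-1) \<in> {1, -1}" using dirichlet_character_minus_one[OF chi(1)] .
  have N: "real (conductor F q) \<ge> 1" using good by (simp add: good_def)
  have ext: "is_entire_extension (completed_series F q chi) (completed_L F q chi)" using good by (simp add: good_def)
  obtain A B r where g: "0 < r" "r < 2" "\<And>z. norm (completed_L F q chi z) \<le> A * exp (B * norm z powr r)"
    using entire_order_1_growth good unfolding good_def by metis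
  have right: "norm (completed_L F q chi z) \<le> ?C * real (conductor F q)" if z: "Re z = 2" for z
  proof -
    have "norm (L_inf F q chi z) = real (conductor F q) * (\<Prod>j<d. norm (Gamma_R (z + shift F (chi (-1)) j)))"
      using N z by (simp add: L_inf_def norm_mult prod_norm[symmetric] norm_of_nat_powr degree)
    also have "\<dots> \<le> real (conductor F q) * gamma_bound F (chi (-1))"
    proof -
      have "norm (Gamma_R (z + shift F (chi (-1)) j)) \<le> pi powr (- (2 + Re (shift F (chi (-1)) j)) / 2) * Gamma ((2 + Re (shift F (chi (-1)) j)) / 2)"
        if "j < d" for j
        using norm_Gamma_R_le[of "z + shift F (chi (-1)) j"] shift[OF e that] z by simp
      then show ?thesis unfolding gamma_bound_def degree by (intro mult_left_mono prod_mono) auto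
    qed
    also have "\<dots> \<le> real (conductor F q) * (\<bar>gamma_bound F 1\<bar> + \<bar>gamma_bound F (-1)\<bar>)"
      using e by (intro mult_left_mono) auto
    finally have "norm (L_inf F q chi z) \<le> real (conductor F q) * (\<bar>gamma_bound F 1\<bar> + \<bar>gamma_bound F (-1)\<bar>)" .
    then have "norm (L_series F chi z) * norm (L_inf F q chi z) \<le> lam_sum 2 * (real (conductor F q) * (\<bar>gamma_bound F 1\<bar> + \<bar>gamma_bound F (-1)\<bar>))"
      using norm_L_series_le[OF chi, of 2 z] z lam_sum_nonneg by (intro mult_mono) auto
    also have "\<dots> \<le> ?C * real (conductor F q)" using N by (simp add: algebra_simps)
    finally show ?thesis using ext z by (simp add: is_entire_extension_def completed_series_def norm_mult)
  qed
  obtain \<kappa> where k: "norm \<kappa> = 1" "\<And>s. completed_L F q chi s = \<kappa> * cnj (completed_L F q chi (1 - cnj s))"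
    using functional_equation[OF good] by blast
  have left: "norm (completed_L F q chi z) \<le> ?C * real (conductor F q)" if z: "Re z = -1" for z
    using right[of "1 - cnj z"] z k(1) by (subst k(2)) (simp add: norm_mult)
  show ?thesis
  proof (rule Phragmen_Lindeloef_strip[where a="-1" and b=2, OF _ _ g])
    show "completed_L F q chi holomorphic_on UNIV" using ext by (simp add: is_entire_extension_def)
    show "?C * real (conductor F q) > 0"
      using N lam_sum_nonneg[of 2] by (intro mult_pos_pos add_nonneg_pos mult_nonneg_nonneg) auto
  qed (use s left right in auto)
qed

text \<open>The strip bound is multiplied by the reciprocal gamma factors, each at most exp (C (1 +
  |s|)^(3/2)), and by a nonpositive power of the conductor. The power of the conductor is of no
  concern, since only the logarithm of this bound is used.\<close>

lemma L_fun_growth: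
  obtains C where "C > 0" "\<And>q chi s. good q chi \<Longrightarrow> Re s \<ge> 1/2 \<Longrightarrow>
      norm (L_fun F chi s) \<le> real (conductor F q) * exp (C * (1 + norm s) powr (3/2))"
proof -
  obtain C0 where C0: "C0 > 0" "\<And>z::complex. norm (rGamma z) \<le> exp (C0 * (1 + norm z) powr (3/2))"
    using norm_rGamma_le by blast
  define M where "M = 1 + (\<Sum>j<d. norm (shift F 1 j)) + (\<Sum>j<d. norm (shift F (-1) j))"
  have M1: "M \<ge> 1" by (auto simp: M_def intro!: add_nonneg_nonneg sum_nonneg)
  have M: "1 + norm (shift F e j) \<le> M" if "e \<in> {1,-1}" "j < d" for e j
  proof -
    have "norm (shift F e j) \<le> (\<Sum>j<d. norm (shift F e j))" using that by (intro member_le_sum) auto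
    moreover have "0 \<le> (\<Sum>j<d. norm (shift F 1 j))" "0 \<le> (\<Sum>j<d. norm (shift F (-1) j))"
      by (auto intro: sum_nonneg)
    moreover have "e = 1 \<or> e = -1" using that by auto
    ultimately show ?thesis unfolding M_def by (elim disjE) simp_all
  qed
  define C1 where "C1 = lam_sum 2 * (\<bar>gamma_bound F 1\<bar> + \<bar>gamma_bound F (-1)\<bar>) + 1 + lam_sum 2"
  have C1: "C1 \<ge> 1" "C1 \<ge> lam_sum 2" using lam_sum_nonneg[of 2] by (auto simp: C1_def)
  define C2 where "C2 = ln C1 + real d * (ln pi * M powr (3/2) + C0 * M powr (3/2))"
  have lnpi: "ln pi \<ge> 0" using pi_gt3 by simp
  have C2: "C2 \<ge> 0" unfolding C2_def using C1 C0 lnpi by auto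
  have "norm (L_fun F chi s) \<le> real (conductor F q) * exp ((C2 + 1) * (1 + norm s) powr (3/2))"
    if good: "good q chi" and s: "Re s \<ge> 1/2" for q chi s
  proof -
    have chi: "dirichlet_character q chi" "q > 0" using good by (auto simp: good_def)
    have e: "chi (-1) \<in> {1, -1}" using dirichlet_character_minus_one[OF chi(1)] .
    have N: "real (conductor F q) \<ge> 1" using good by (simp add: good_def)
    define X where "X = (1 + norm s) powr (3/2)"
    have X: "X \<ge> 1" "1 + norm s \<le> X"
      using ge_one_powr_ge_zero[of "1 + norm s" "3/2"] powr_mono[of 1 "3/2" "1 + norm s"] by (auto simp: X_def)
    have "C1 = exp (ln C1)" using C1 by simp
    also have "\<dots> \<le> exp (C2 * 1)" unfolding C2_def using C0 lnpi by (auto intro!: add_nonneg_nonneg mult_nonneg_nonneg)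
    also have "\<dots> \<le> exp ((C2 + 1) * X)" using X C2 unfolding exp_le_cancel_iff by (intro mult_mono) auto
    finally have C1X: "C1 \<le> exp ((C2 + 1) * X)" .
    show ?thesis
    proof (cases "Re s \<le> 2")
      case False
      then have "norm (L_fun F chi s) \<le> lam_sum 2" using norm_L_series_le[OF chi, of 2 s] L_fun_series[OF good, of s] by simp
      also have "\<dots> \<le> 1 * exp ((C2 + 1) * X)" using C1 C1X by simp
      also have "\<dots> \<le> real (conductor F q) * exp ((C2 + 1) * X)" using N by (intro mult_right_mono) auto
      finally show ?thesis by (simp add: X_def)
    next
      case True
      have fac: "norm (of_real pi powr ((s + shift F (chi (-1)) j) / 2) * rGamma ((s + shift F (chi (-1)) j) / 2))
          \<le> exp ((ln pi * M powr (3/2) + C0 * M powr (3/2)) * X)" if "j < d" for j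
      proof -
        let ?z = "(s + shift F (chi (-1)) j) / 2"
        have nz: "1 + norm ?z \<le> M * (1 + norm s)"
        proof -
          have "norm ?z = norm (s + shift F (chi (-1)) j) / 2" by (simp add: norm_divide)
          then have "norm ?z \<le> norm s + norm (shift F (chi (-1)) j)"
            using norm_triangle_ineq[of s "shift F (chi (-1)) j"] norm_ge_zero[of "s + shift F (chi (-1)) j"] by linarith
          moreover have "(1 + norm (shift F (chi (-1)) j)) * (1 + norm s) \<le> M * (1 + norm s)"
            using M[OF e that] by (intro mult_right_mono) auto
          moreover have "norm (shift F (chi (-1)) j) * norm s \<ge> 0" by simp
          ultimately show ?thesis unfolding distrib_left distrib_right by linarith
        qed
        have p: "(1 + norm ?z) powr (3/2) \<le> M powr (3/2) * X"
          using nz M1 unfolding X_def by (subst powr_mult[symmetric]) (auto intro!: powr_mono2)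
        have "Re ?z \<le> 1 + norm ?z" using complex_Re_le_cmod[of ?z] by linarith
        also have "\<dots> \<le> (1 + norm ?z) powr (3/2)" using powr_mono[of 1 "3/2" "1 + norm ?z"] by simp
        also note p
        finally have "ln pi * Re ?z \<le> ln pi * (M powr (3/2) * X)" using lnpi by (intro mult_left_mono)
        then have 1: "norm (of_real pi powr ?z :: complex) \<le> exp (ln pi * (M powr (3/2) * X))"
          by (simp add: norm_of_real_powr powr_def mult.commute)
        have "C0 * (1 + norm ?z) powr (3/2) \<le> C0 * (M powr (3/2) * X)" using p C0 by (intro mult_left_mono) auto
        then have 2: "norm (rGamma ?z) \<le> exp (C0 * (M powr (3/2) * X))" using C0(2)[of ?z] by (meson exp_le_cancel_iff order.trans)
        show ?thesis
          unfolding norm_mult using mult_mono[OF 1 2] by (simp add: exp_add[symmetric] algebra_simps)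
      qed
      have "norm (inverse_L_inf F q chi s) = real (conductor F q) powr (- Re s / 2) *
          (\<Prod>j<d. norm (of_real pi powr ((s + shift F (chi (-1)) j) / 2) * rGamma ((s + shift F (chi (-1)) j) / 2)))"
        using N by (simp add: inverse_L_inf_def norm_mult prod_norm[symmetric] norm_of_nat_powr degree)
      also have "\<dots> \<le> 1 * (\<Prod>j<d. exp ((ln pi * M powr (3/2) + C0 * M powr (3/2)) * X))"
      proof (intro mult_mono prod_mono)
        show "real (conductor F q) powr (- Re s / 2) \<le> 1"
          using N s powr_mono[of "- Re s / 2" 0 "real (conductor F q)"] by simp
      qed (use fac in \<open>auto intro: prod_nonneg\<close>)
      also have "\<dots> = exp (real d * (ln pi * M powr (3/2) + C0 * M powr (3/2)) * X)"
        by (simp add: exp_of_nat_mult mult.assoc)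
      finally have inv: "norm (inverse_L_inf F q chi s) \<le> exp (real d * (ln pi * M powr (3/2) + C0 * M powr (3/2)) * X)" .
      have "norm (completed_L F q chi s) \<le> C1 * real (conductor F q)"
        using norm_completed_L_strip[OF good, of s] s True lam_sum_nonneg[of 2] N unfolding C1_def
        by (auto simp: algebra_simps intro: order.trans)
      then have "norm (L_fun F chi s) \<le> C1 * real (conductor F q) * exp (real d * (ln pi * M powr (3/2) + C0 * M powr (3/2)) * X)"
        unfolding L_fun_eq[OF good] norm_mult using inv C1 by (intro mult_mono) auto
      also have "\<dots> = real (conductor F q) * exp (ln C1 + real d * (ln pi * M powr (3/2) + C0 * M powr (3/2)) * X)"
        using C1 by (simp add: exp_add)
      also have "\<dots> \<le> real (conductor F q) * exp ((C2 + 1) * X)"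
      proof -
        have "ln C1 * 1 \<le> ln C1 * X" using C1 X by (intro mult_left_mono) auto
        then show ?thesis using X C2 by (intro mult_left_mono) (auto simp: C2_def algebra_simps)
      qed
      finally show ?thesis by (simp add: X_def)
    qed
  qed
  then show ?thesis using C2 that[of "C2 + 1"] by simp
qed

end

section \<open>The approximate functional equation\<close>

text \<open>The comparison of (1 + |t|)^n with the exponential function is made for n = k + 2, the
  extra square paying for 1 + t^2.\<close>

lemma power_gaussian_le:
  obtains K :: real where "K > 0" "\<And>t::real. (1 + \<bar>t\<bar>) ^ k * exp (- t\<^sup>2) \<le> K / (1 + t\<^sup>2)"
proof -
  define n where "n = k + 2"
  have n: "n > 0" by (simp add: n_def)
  have "(1 + \<bar>t\<bar>) ^ k * exp (- t\<^sup>2) \<le> real n ^ n * exp 2 / (1 + t\<^sup>2)" for t :: real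
  proof -
    have "((1 + \<bar>t\<bar>) / real n) ^ n \<le> (1 + (1 + \<bar>t\<bar>) / real n) ^ n" by (intro power_mono) auto
    also have "\<dots> \<le> exp (1 + \<bar>t\<bar>)" using n by (intro exp_ge_one_plus_x_over_n_power_n) auto
    finally have 1: "(1 + \<bar>t\<bar>) ^ n \<le> real n ^ n * exp (1 + \<bar>t\<bar>)"
      using n by (simp add: power_divide pos_divide_le_eq mult.commute)
    have "(1 + \<bar>t\<bar>) ^ k * (1 + t\<^sup>2) \<le> (1 + \<bar>t\<bar>) ^ k * (1 + \<bar>t\<bar>)\<^sup>2"
      by (intro mult_left_mono) (auto simp: power2_sum)
    also have "\<dots> = (1 + \<bar>t\<bar>) ^ n" by (simp only: n_def power_add)
    also note 1
    finally have "(1 + \<bar>t\<bar>) ^ k * (1 + t\<^sup>2) * exp (- t\<^sup>2) \<le> real n ^ n * exp (1 + \<bar>t\<bar>) * exp (- t\<^sup>2)" by (intro mult_right_mono) auto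
    also have "\<dots> = real n ^ n * exp (1 + \<bar>t\<bar> - t\<^sup>2)" by (simp add: exp_diff exp_minus field_simps)
    also have "\<dots> \<le> real n ^ n * exp 2"
    proof -
      have "0 \<le> (\<bar>t\<bar> - 1/2)\<^sup>2" by simp
      then have "\<bar>t\<bar> - t\<^sup>2 \<le> 1" by (simp add: power2_diff power_divide)
      then show ?thesis by (intro mult_left_mono) auto
    qed
    finally show ?thesis by (simp add: pos_le_divide_eq add_pos_nonneg mult_ac)
  qed
  then show ?thesis using n that[of "real n ^ n * exp 2"] by simp
qed

lemma norm_exp_power2: "norm (exp (z\<^sup>2)) = exp ((Re z)\<^sup>2) * exp (- (Im z)\<^sup>2)"
  by (simp add: Re_power2 exp_diff exp_minus field_simps)

lemma continuous_on_Complex [continuous_intros]: "continuous_on A (Complex c)"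
  unfolding Complex_eq by (intro continuous_intros)

context L_family
begin

text \<open>For each j there is one zero at the possible pole - 1/2 - \<mu> of a gamma factor and
  one at its mirror image 1/2 + \<open>cnj\<close> \<mu>. The second makes the reflection z to -
  \<open>cnj\<close> z act by conjugation.\<close>

definition afe_poly :: "complex \<Rightarrow> complex \<Rightarrow> complex" where
  "afe_poly e z = (\<Prod>j<d. (z + 1/2 + shift F e j) * (- z + 1/2 + cnj (shift F e j)))"

text \<open>The gamma factor at 1/2 + z times the two polynomial factors of index j. With u the
  argument of Gamma, the polynomial factor 2 u is absorbed by u Gamma(u) = Gamma(u + 1); hence the 2
  and the shifted argument.\<close>

definition afe_factor :: "complex \<Rightarrow> nat \<Rightarrow> complex \<Rightarrow> complex" where
  "afe_factor e j z = 2 * of_real pi powr (- (1/2 + z + shift F e j) / 2) * Gamma ((1/2 + z + shift F e j) / 2 + 1) * (- z + 1/2 + cnj (shift F e j))"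

text \<open>The factor 1 / z yields the central value as a residue, and exp (z^2) makes all
  integrals absolutely convergent.\<close>

definition afe_kernel :: "complex \<Rightarrow> complex \<Rightarrow> complex" where
  "afe_kernel e z = exp (z\<^sup>2) / z * (\<Prod>j<d. afe_factor e j z)"

lemma afe_kernel_holomorphic:
  assumes "e \<in> {1, -1}"
  shows "afe_kernel e holomorphic_on {z. Re z > 0}"
proof -
  have "(1/2 + z + shift F e j) / 2 + 1 \<notin> \<int>\<^sub>\<le>\<^sub>0" if "j < d" "Re z > 0" for j z
  proof -
    have "Re ((1/2 + z + shift F e j) / 2 + 1) = 5/4 + Re z / 2 + Re (shift F e j) / 2" by (simp add: add_divide_distrib)
    then have "Re ((1/2 + z + shift F e j) / 2 + 1) > 0" using shift[OF assms that(1)] that(2) by linarith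
    then show ?thesis by (metis nonpos_Ints_cases complex_Re_of_int not_le of_int_le_0_iff)
  qed
  then show ?thesis unfolding afe_kernel_def afe_factor_def by (intro holomorphic_intros) auto
qed

lemma continuous_on_afe_kernel:
  assumes "e \<in> {1, -1}" "c > 0"
  shows "continuous_on UNIV (\<lambda>t. afe_kernel e (Complex c t))"
  by (rule continuous_on_compose2[OF holomorphic_on_imp_continuous_on[OF afe_kernel_holomorphic[OF assms(1)]]])
     (use assms in \<open>auto intro!: continuous_intros\<close>)

text \<open>In a strip of bounded width |Gamma| is at most its value at the real part, which stays
  in a compact interval of positive numbers. Only the linear factor grows with the height.\<close>

lemma norm_afe_factor_le:
  assumes e: "e \<in> {1, -1}" and j: "j < d"
  obtains K where "K > 0" "\<And>z. 1/8 \<le> Re z \<Longrightarrow> Re z \<le> 2 \<Longrightarrow> norm (afe_factor e j z) \<le> K * (1 + \<bar>Im z\<bar>)"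
proof -
  let ?m = "shift F e j"
  have m: "Re ?m > -1" using shift[OF e j] .
  \<comment> \<open>The real part of the argument is 5/4 + Re z / 2 + Re \<mu> / 2. For Re z \<ge>
    1/8 and Re \<mu> > -1 it exceeds 5/4 + 1/16 - 1/2 = 13/16; for Re z \<le> 2 it is at most 9/4 +
    Re \<mu> / 2.\<close>
  have "compact (Gamma ` {13/16..9/4 + Re ?m / 2})"
    by (intro compact_continuous_image continuous_on_Gamma) (auto elim!: nonpos_Ints_cases)
  then have "bounded (Gamma ` {13/16..9/4 + Re ?m / 2})" by (rule compact_imp_bounded)
  then obtain B where "B > 0" "\<forall>y\<in>Gamma ` {13/16..9/4 + Re ?m / 2}. norm y \<le> B"
    unfolding bounded_pos by blast
  then have B: "B > 0" "\<And>x. x \<in> {13/16..9/4 + Re ?m / 2} \<Longrightarrow> Gamma x \<le> B"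
    by (auto dest!: bspec simp del: atLeastAtMost_iff)
  have "norm (afe_factor e j z) \<le> 2 * pi * B * (3 + norm ?m) * (1 + \<bar>Im z\<bar>)" if z: "1/8 \<le> Re z" "Re z \<le> 2" for z
  proof -
    have 1: "norm (of_real pi powr (- (1/2 + z + ?m) / 2) :: complex) \<le> pi"
    proof -
      have "pi powr (- (1/2 + Re z + Re ?m) / 2) \<le> pi powr 1" using z m pi_gt3 by (intro powr_mono) auto
      then show ?thesis by (simp add: norm_of_real_powr)
    qed
    have 2: "norm (Gamma ((1/2 + z + ?m) / 2 + 1)) \<le> B"
    proof -
      have re: "Re ((1/2 + z + ?m) / 2 + 1) = 5/4 + Re z / 2 + Re ?m / 2" by (simp add: add_divide_distrib)
      have "Re ((1/2 + z + ?m) / 2 + 1) > 0" unfolding re using z m by linarith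
      then have "norm (Gamma ((1/2 + z + ?m) / 2 + 1)) \<le> Gamma (Re ((1/2 + z + ?m) / 2 + 1))"
        by (rule norm_Gamma_le)
      also have "\<dots> \<le> B"
      proof (rule B(2))
        have "13/16 \<le> 5/4 + Re z / 2 + Re ?m / 2" "5/4 + Re z / 2 + Re ?m / 2 \<le> 9/4 + Re ?m / 2"
          using z m by linarith+
        then show "Re ((1/2 + z + ?m) / 2 + 1) \<in> {13/16..9/4 + Re ?m / 2}" unfolding re by simp
      qed
      finally show ?thesis .
    qed
    have 3: "norm (- z + 1/2 + cnj ?m) \<le> (3 + norm ?m) * (1 + \<bar>Im z\<bar>)"
    proof -
      have "norm (- z + 1/2 + cnj ?m) \<le> norm (- z + 1/2) + norm ?m"
        using norm_triangle_ineq[of "- z + 1/2" "cnj ?m"] by simp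
      also have "norm (- z + 1/2) \<le> \<bar>Re (- z + 1/2)\<bar> + \<bar>Im (- z + 1/2)\<bar>" by (rule cmod_le)
      finally have "norm (- z + 1/2 + cnj ?m) \<le> 3 + norm ?m + \<bar>Im z\<bar>" using z by simp
      moreover have "0 \<le> 2 * \<bar>Im z\<bar> + norm ?m * \<bar>Im z\<bar>" by simp
      ultimately show ?thesis unfolding distrib_left distrib_right by linarith
    qed
    have "norm (afe_factor e j z) \<le> 2 * pi * B * ((3 + norm ?m) * (1 + \<bar>Im z\<bar>))"
      unfolding afe_factor_def norm_mult using 1 2 3 B by (intro mult_mono) auto
    then show ?thesis by (simp add: mult.assoc)
  qed
  then show ?thesis using that[of "2 * pi * B * (3 + norm ?m)"] B by (simp add: add_pos_nonneg)
qed

text \<open>The factor (1 + |Im z|)^2 is kept in reserve for the bilinear sums, where partial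
  summation over the primes loses a factor of the size of |s|.\<close>

lemma afe_kernel_bound_aux:
  assumes e: "e \<in> {1, -1}"
  obtains K where "K > 0" "\<And>z. 1/8 \<le> Re z \<Longrightarrow> Re z \<le> 2 \<Longrightarrow> norm (afe_kernel e z) * (1 + \<bar>Im z\<bar>)\<^sup>2 \<le> K / (1 + (Im z)\<^sup>2)"
proof -
  have "\<forall>j\<in>{..<d}. \<exists>K>0. \<forall>z. 1/8 \<le> Re z \<longrightarrow> Re z \<le> 2 \<longrightarrow> norm (afe_factor e j z) \<le> K * (1 + \<bar>Im z\<bar>)"
    using norm_afe_factor_le[OF e] by (metis lessThan_iff)
  then obtain K where K: "\<And>j. j < d \<Longrightarrow> K j > 0"
      "\<And>j z. j < d \<Longrightarrow> 1/8 \<le> Re z \<Longrightarrow> Re z \<le> 2 \<Longrightarrow> norm (afe_factor e j z) \<le> K j * (1 + \<bar>Im z\<bar>)"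
    unfolding bchoice_iff by (metis lessThan_iff)
  obtain G where G: "G > 0" "\<And>t::real. (1 + \<bar>t\<bar>) ^ (d + 2) * exp (- t\<^sup>2) \<le> G / (1 + t\<^sup>2)"
    using power_gaussian_le[of "d + 2"] by blast
  define C where "C = exp 4 * 8 * (\<Prod>j<d. K j)"
  have C: "C > 0" unfolding C_def using K(1) by (intro mult_pos_pos prod_pos) auto
  have "norm (afe_kernel e z) * (1 + \<bar>Im z\<bar>)\<^sup>2 \<le> C * G / (1 + (Im z)\<^sup>2)" if z: "1/8 \<le> Re z" "Re z \<le> 2" for z
  proof -
    have "norm (exp (z\<^sup>2)) \<le> exp 4 * exp (- (Im z)\<^sup>2)"
      unfolding norm_exp_power2 using z power_mono[of "Re z" 2 2] by (intro mult_right_mono) auto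
    moreover have "1/8 \<le> norm z" using complex_Re_le_cmod[of z] z by linarith
    ultimately have "norm (exp (z\<^sup>2)) / norm z \<le> exp 4 * exp (- (Im z)\<^sup>2) / (1/8)"
      by (intro frac_le) auto
    moreover have "(\<Prod>j<d. norm (afe_factor e j z)) \<le> (\<Prod>j<d. K j * (1 + \<bar>Im z\<bar>))"
      using K z by (intro prod_mono) auto
    ultimately have "norm (afe_kernel e z) \<le> exp 4 * exp (- (Im z)\<^sup>2) / (1/8) * (\<Prod>j<d. K j * (1 + \<bar>Im z\<bar>))"
      unfolding afe_kernel_def norm_mult norm_divide prod_norm[symmetric] by (intro mult_mono) (auto intro: prod_nonneg)
    also have "\<dots> = C * ((1 + \<bar>Im z\<bar>) ^ d * exp (- (Im z)\<^sup>2))" by (simp add: C_def prod.distrib)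
    finally have "norm (afe_kernel e z) * (1 + \<bar>Im z\<bar>)\<^sup>2 \<le> C * ((1 + \<bar>Im z\<bar>) ^ d * exp (- (Im z)\<^sup>2)) * (1 + \<bar>Im z\<bar>)\<^sup>2"
      by (intro mult_right_mono) auto
    also have "\<dots> = C * ((1 + \<bar>Im z\<bar>) ^ (d + 2) * exp (- (Im z)\<^sup>2))" by (simp only: power_add mult_ac)
    also have "\<dots> \<le> C * (G / (1 + (Im z)\<^sup>2))" using G C by (intro mult_left_mono) auto
    finally show ?thesis by simp
  qed
  then show ?thesis using that[of "C * G"] C G by simp
qed

lemma afe_kernel_bound:
  obtains K where "K > 0" "\<And>e z. e \<in> {1, -1} \<Longrightarrow> 1/8 \<le> Re z \<Longrightarrow> Re z \<le> 2 \<Longrightarrow>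
     norm (afe_kernel e z) * (1 + \<bar>Im z\<bar>)\<^sup>2 \<le> K / (1 + (Im z)\<^sup>2)"
proof -
  obtain K1 where K1: "K1 > 0" "\<And>z. 1/8 \<le> Re z \<Longrightarrow> Re z \<le> 2 \<Longrightarrow> norm (afe_kernel 1 z) * (1 + \<bar>Im z\<bar>)\<^sup>2 \<le> K1 / (1 + (Im z)\<^sup>2)"
    using afe_kernel_bound_aux[of 1] by blast
  obtain K2 where K2: "K2 > 0" "\<And>z. 1/8 \<le> Re z \<Longrightarrow> Re z \<le> 2 \<Longrightarrow> norm (afe_kernel (-1) z) * (1 + \<bar>Im z\<bar>)\<^sup>2 \<le> K2 / (1 + (Im z)\<^sup>2)"
    using afe_kernel_bound_aux[of "-1"] by blast
  have "K1 / (1 + t\<^sup>2) \<le> (K1 + K2) / (1 + t\<^sup>2)" "K2 / (1 + t\<^sup>2) \<le> (K1 + K2) / (1 + t\<^sup>2)" for t :: real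
    using K1 K2 by (auto intro!: divide_right_mono)
  then have "norm (afe_kernel e z) * (1 + \<bar>Im z\<bar>)\<^sup>2 \<le> (K1 + K2) / (1 + (Im z)\<^sup>2)"
    if "e \<in> {1, -1}" "1/8 \<le> Re z" "Re z \<le> 2" for e z
    using that K1(2)[of z] K2(2)[of z] by (auto intro: order.trans)
  moreover have "K1 + K2 > 0" using K1(1) K2(1) by simp
  ultimately show ?thesis using that by blast
qed

text \<open>One constant for both parities, so that all later bounds can refer to it.\<close>

definition kernel_const :: real where
  "kernel_const = (SOME K. K > 0 \<and> (\<forall>e z. e \<in> {1, -1} \<longrightarrow> 1/8 \<le> Re z \<longrightarrow> Re z \<le> 2 \<longrightarrow>
     norm (afe_kernel e z) * (1 + \<bar>Im z\<bar>)\<^sup>2 \<le> K / (1 + (Im z)\<^sup>2)))"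

lemma
  shows kernel_const_pos: "kernel_const > 0"
    and kernel_const_bound: "e \<in> {1, -1} \<Longrightarrow> 1/8 \<le> Re z \<Longrightarrow> Re z \<le> 2 \<Longrightarrow>
     norm (afe_kernel e z) * (1 + \<bar>Im z\<bar>)\<^sup>2 \<le> kernel_const / (1 + (Im z)\<^sup>2)"
proof -
  have "\<exists>K. K > 0 \<and> (\<forall>e z. e \<in> {1, -1} \<longrightarrow> 1/8 \<le> Re z \<longrightarrow> Re z \<le> 2 \<longrightarrow>
     norm (afe_kernel e z) * (1 + \<bar>Im z\<bar>)\<^sup>2 \<le> K / (1 + (Im z)\<^sup>2))"
    using afe_kernel_bound by metis
  from someI_ex[OF this, folded kernel_const_def]
  show "kernel_const > 0" "e \<in> {1, -1} \<Longrightarrow> 1/8 \<le> Re z \<Longrightarrow> Re z \<le> 2 \<Longrightarrow>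
     norm (afe_kernel e z) * (1 + \<bar>Im z\<bar>)\<^sup>2 \<le> kernel_const / (1 + (Im z)\<^sup>2)" by blast+
qed

lemma norm_afe_kernel_le:
  assumes "e \<in> {1, -1}" "1/8 \<le> Re z" "Re z \<le> 2"
  shows "norm (afe_kernel e z) \<le> kernel_const / (1 + (Im z)\<^sup>2)"
proof -
  have "norm (afe_kernel e z) * 1 \<le> norm (afe_kernel e z) * (1 + \<bar>Im z\<bar>)\<^sup>2" by (intro mult_left_mono) auto
  then show ?thesis using kernel_const_bound[OF assms] by linarith
qed

text \<open>Up to the factor 2 pi this is the inverse Mellin transform of \<open>afe_kernel\<close>,
  taken along Re z = c.\<close>

definition afe_weight :: "complex \<Rightarrow> real \<Rightarrow> real \<Rightarrow> complex" where
  "afe_weight e c x = (LINT t|lborel. afe_kernel e (Complex c t) * exp (- Complex c t * of_real (ln x)))"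

lemma afe_weight_integrand:
  assumes "e \<in> {1, -1}" "1/8 \<le> c" "c \<le> 2" "x > 0"
  shows "continuous_on UNIV (\<lambda>t. afe_kernel e (Complex c t) * exp (- Complex c t * of_real (ln x)))"
    and "norm (afe_kernel e (Complex c t) * exp (- Complex c t * of_real (ln x))) \<le> (kernel_const * x powr (-c)) / (1 + t\<^sup>2)"
proof -
  show "continuous_on UNIV (\<lambda>t. afe_kernel e (Complex c t) * exp (- Complex c t * of_real (ln x)))"
    using assms by (intro continuous_intros continuous_on_afe_kernel) auto
  have "norm (exp (- Complex c t * of_real (ln x))) = x powr (-c)" using assms by (simp add: powr_def)
  then have "norm (afe_kernel e (Complex c t) * exp (- Complex c t * of_real (ln x))) = norm (afe_kernel e (Complex c t)) * x powr (-c)"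
    by (simp add: norm_mult)
  also have "\<dots> \<le> kernel_const / (1 + t\<^sup>2) * x powr (-c)"
    using norm_afe_kernel_le[of e "Complex c t"] assms by (intro mult_right_mono) auto
  finally show "norm (afe_kernel e (Complex c t) * exp (- Complex c t * of_real (ln x))) \<le> (kernel_const * x powr (-c)) / (1 + t\<^sup>2)"
    by (simp add: mult.commute)
qed

lemma integrable_afe_weight:
  assumes "e \<in> {1, -1}" "1/8 \<le> c" "c \<le> 2" "x > 0"
  shows "integrable lborel (\<lambda>t. afe_kernel e (Complex c t) * exp (- Complex c t * of_real (ln x)))"
  by (rule integrable_decay[OF afe_weight_integrand[OF assms]])

lemma norm_afe_weight_le:
  assumes "e \<in> {1, -1}" "1/8 \<le> c" "c \<le> 2" "x > 0"
  shows "norm (afe_weight e c x) \<le> kernel_const * pi * x powr (-c)"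
  using norm_integral_decay[OF afe_weight_integrand[OF assms]] by (simp add: afe_weight_def mult_ac)

text \<open>The pole at 0 is not crossed. Independence of c permits the choice of the line after the
  size of x: c = 1/8 for small x and c = 2 for large x.\<close>

lemma afe_weight_shift:
  assumes e: "e \<in> {1, -1}" and c: "1/8 \<le> c" "c \<le> c'" "c' \<le> 2" "x > 0"
  shows "afe_weight e c' x = afe_weight e c x"
proof (cases "c = c'")
  case False
  then have cc: "c < c'" using c by simp
  show ?thesis unfolding afe_weight_def
  proof (rule vertical_integral_shift[OF cc, of 0 "\<lambda>z. afe_kernel e z * exp (- z * of_real (ln x))" "kernel_const * exp (2 * \<bar>ln x\<bar>)"])
    show "(\<lambda>z. afe_kernel e z * exp (- z * of_real (ln x))) holomorphic_on {z. 0 < Re z}"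
      by (intro holomorphic_intros afe_kernel_holomorphic e)
    fix z assume z: "c \<le> Re z" "Re z \<le> c'"
    have "x powr (- Re z) \<le> exp (2 * \<bar>ln x\<bar>)"
    proof -
      have "- Re z * ln x \<le> \<bar>Re z\<bar> * \<bar>ln x\<bar>" by (metis abs_ge_self abs_minus_cancel abs_mult)
      also have "\<dots> \<le> 2 * \<bar>ln x\<bar>" using z c by (intro mult_right_mono) auto
      finally show ?thesis using c by (simp add: powr_def)
    qed
    then have "kernel_const * x powr (- Re z) / (1 + (Im z)\<^sup>2) \<le> kernel_const * exp (2 * \<bar>ln x\<bar>) / (1 + (Im z)\<^sup>2)"
      using kernel_const_pos by (intro divide_right_mono mult_left_mono) auto
    then show "norm (afe_kernel e z * exp (- z * of_real (ln x))) \<le> kernel_const * exp (2 * \<bar>ln x\<bar>) / (1 + (Im z)\<^sup>2)"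
      using afe_weight_integrand(2)[OF e, of "Re z" x "Im z"] z c by simp
  qed (use c in auto)
qed simp

lemma norm_afe_poly_le:
  obtains K where "K > 0" "\<And>e z. e \<in> {1, -1} \<Longrightarrow> -1 \<le> Re z \<Longrightarrow> Re z \<le> 1 \<Longrightarrow> norm (afe_poly e z) \<le> K * (1 + \<bar>Im z\<bar>) ^ (2 * d)"
proof -
  define M where "M = 3 + (\<Sum>e\<in>{1,-1}. \<Sum>j<d. norm (shift F e j))"
  have M: "3 + norm (shift F e j) \<le> M" if "e \<in> {1,-1}" "j < d" for e j
  proof -
    have "norm (shift F e j) \<le> (\<Sum>j<d. norm (shift F e j))" using that by (intro member_le_sum) auto
    also have "\<dots> \<le> (\<Sum>e\<in>{1,-1}. \<Sum>j<d. norm (shift F e j))"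
      using that by (intro member_le_sum[of e "{1,-1}" "\<lambda>e. \<Sum>j<d. norm (shift F e j)"]) (auto intro: sum_nonneg)
    finally show ?thesis by (simp add: M_def)
  qed
  have M3: "M \<ge> 3" unfolding M_def by (simp add: sum_nonneg)
  have "norm (afe_poly e z) \<le> M ^ (2 * d) * (1 + \<bar>Im z\<bar>) ^ (2 * d)" if e: "e \<in> {1, -1}" and z: "-1 \<le> Re z" "Re z \<le> 1" for e z
  proof -
    have fac: "norm (u * z + 1/2 + m) \<le> M * (1 + \<bar>Im z\<bar>)" if "norm m = norm (shift F e j)" "j < d" "u = 1 \<or> u = -1" for u m j
    proof -
      have "norm (u * z + 1/2 + m) \<le> norm (u * z) + norm (1/2 :: complex) + norm m"
        by (rule order.trans[OF norm_triangle_ineq add_right_mono[OF norm_triangle_ineq]])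
      moreover have "norm (u * z) \<le> 1 + \<bar>Im z\<bar>" using cmod_le[of z] z that by (auto simp: norm_mult)
      ultimately have "norm (u * z + 1/2 + m) \<le> 3 + norm (shift F e j) + \<bar>Im z\<bar>" using that by simp
      also have "\<dots> \<le> M + M * \<bar>Im z\<bar>"
        using M[OF e that(2)] M3 mult_right_mono[of 1 M "\<bar>Im z\<bar>"] by linarith
      finally show ?thesis by (simp add: distrib_left)
    qed
    have "norm (afe_poly e z) = (\<Prod>j<d. norm (1 * z + 1/2 + shift F e j) * norm ((-1) * z + 1/2 + cnj (shift F e j)))"
      by (simp add: afe_poly_def prod_norm[symmetric] norm_mult)
    also have "\<dots> \<le> (\<Prod>j<d. (M * (1 + \<bar>Im z\<bar>)) * (M * (1 + \<bar>Im z\<bar>)))"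
      using M3 by (intro prod_mono conjI mult_mono fac) auto
    also have "\<dots> = M ^ (2 * d) * (1 + \<bar>Im z\<bar>) ^ (2 * d)"
      by (simp add: power_mult power_mult_distrib power2_eq_square)
    finally show ?thesis .
  qed
  then show ?thesis using that[of "M ^ (2 * d)"] M3 by simp
qed

text \<open>The factor \<open>afe_poly\<close> removes the poles which the gamma factors may have in the critical strip;
  it is real up to conjugation under the reflection \<open>z \<mapsto> - cnj z\<close>, so that the functional equation
  identifies the integrals over the two edges of the strip up to conjugation.\<close>

lemma completed_L_central_le:
  assumes good: "good q chi"
  shows "pi * norm (completed_L F q chi (1/2) * afe_poly (chi (-1)) 0) \<le>
     norm (LINT t|lborel. completed_L F q chi (1/2 + Complex 1 t) * afe_poly (chi (-1)) (Complex 1 t) * exp ((Complex 1 t)\<^sup>2) / Complex 1 t)"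
proof -
  have chi: "dirichlet_character q chi" "q > 0" using good by (auto simp: good_def)
  let ?e = "chi (-1)"
  have e: "?e \<in> {1, -1}" using dirichlet_character_minus_one[OF chi(1)] .
  define h where "h z = completed_L F q chi (1/2 + z) * afe_poly ?e z * exp (z\<^sup>2)" for z
  have holL: "completed_L F q chi holomorphic_on UNIV" using good by (simp add: good_def is_entire_extension_def)
  have "(completed_L F q chi \<circ> (\<lambda>z. 1/2 + z)) holomorphic_on UNIV"
    by (rule holomorphic_on_compose_gen[OF _ holL]) (auto intro!: holomorphic_intros)
  then have hol: "h holomorphic_on UNIV"
    unfolding h_def afe_poly_def o_def by (intro holomorphic_intros)
  obtain K where K: "K > 0" "\<And>e z. e \<in> {1, -1} \<Longrightarrow> -1 \<le> Re z \<Longrightarrow> Re z \<le> 1 \<Longrightarrow> norm (afe_poly e z) \<le> K * (1 + \<bar>Im z\<bar>) ^ (2 * d)"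
    using norm_afe_poly_le by blast
  obtain G where G: "G > 0" "\<And>t::real. (1 + \<bar>t\<bar>) ^ (2 * d) * exp (- t\<^sup>2) \<le> G / (1 + t\<^sup>2)"
    using power_gaussian_le[of "2 * d"] by blast
  define B where "B = (lam_sum 2 * (\<bar>gamma_bound F 1\<bar> + \<bar>gamma_bound F (-1)\<bar>) + 1) * real (conductor F q)"
  have B: "B \<ge> 0" unfolding B_def using lam_sum_nonneg[of 2] by simp
  define I where "I = (LINT t|lborel. h (Complex 1 t) / Complex 1 t)"
  have main: "(LINT t|lborel. h (Complex 1 t) / Complex 1 t) - (LINT t|lborel. h (Complex (-1) t) / Complex (-1) t) = 2 * pi * h 0"
  proof (rule vertical_integrals_Cauchy[OF _ _ hol, of _ _ "B * K * exp 1 * G"])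
    fix z assume z: "-1 \<le> Re z" "Re z \<le> 1"
    have "norm (completed_L F q chi (1/2 + z)) \<le> B"
    proof (cases "Re z \<ge> 0")
      case True
      then show ?thesis using norm_completed_L_strip[OF good, of "1/2 + z"] z by (simp add: B_def)
    next
      case False
      then show ?thesis using norm_completed_L_strip[OF good, of "1/2 + z"] z by (simp add: B_def)
    qed
    moreover have "norm (exp (z\<^sup>2)) \<le> exp 1 * exp (- (Im z)\<^sup>2)"
      unfolding norm_exp_power2 using z by (intro mult_right_mono) (auto simp: abs_square_le_1 abs_le_iff)
    ultimately have "norm (h z) \<le> B * (K * (1 + \<bar>Im z\<bar>) ^ (2 * d)) * (exp 1 * exp (- (Im z)\<^sup>2))"
      unfolding h_def norm_mult using K(2)[OF e z] K(1) B by (intro mult_mono) auto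
    also have "\<dots> = (B * K * exp 1) * ((1 + \<bar>Im z\<bar>) ^ (2 * d) * exp (- (Im z)\<^sup>2))" by simp
    also have "\<dots> \<le> (B * K * exp 1) * (G / (1 + (Im z)\<^sup>2))" using G K B by (intro mult_left_mono) auto
    finally show "norm (h z) \<le> B * K * exp 1 * G / (1 + (Im z)\<^sup>2)" by simp
  qed auto
  obtain \<kappa> where k: "norm \<kappa> = 1" "\<And>s. completed_L F q chi s = \<kappa> * cnj (completed_L F q chi (1 - cnj s))"
    using functional_equation[OF good] by blast
  have "h (Complex (-1) t) / Complex (-1) t = - \<kappa> * cnj (h (Complex 1 t) / Complex 1 t)" for t
  proof -
    have 1: "completed_L F q chi (1/2 + Complex (-1) t) = \<kappa> * cnj (completed_L F q chi (1/2 + Complex 1 t))"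
    proof -
      have "1 - cnj (1/2 + Complex (-1) t) = 1/2 + Complex 1 t" by (simp add: complex_eq_iff)
      then show ?thesis using k(2)[of "1/2 + Complex (-1) t"] by simp
    qed
    have 2: "afe_poly ?e (Complex (-1) t) = cnj (afe_poly ?e (Complex 1 t))"
    proof -
      have c: "Complex (-1) t = - cnj (Complex 1 t)" by (simp add: complex_eq_iff)
      show ?thesis unfolding c by (simp add: afe_poly_def mult.commute)
    qed
    have 3: "exp ((Complex (-1) t)\<^sup>2) = cnj (exp ((Complex 1 t)\<^sup>2))"
      unfolding exp_cnj by (intro arg_cong[of _ _ exp]) (simp add: power2_eq_square complex_eq_iff)
    have 4: "Complex (-1) t = - cnj (Complex 1 t)" by (simp add: complex_eq_iff)
    show ?thesis unfolding h_def 1 2 3 by (simp add: 4)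
  qed
  then have "(LINT t|lborel. h (Complex (-1) t) / Complex (-1) t) = (LINT t|lborel. - \<kappa> * cnj (h (Complex 1 t) / Complex 1 t))" by presburger
  also have "\<dots> = - \<kappa> * (LINT t|lborel. cnj (h (Complex 1 t) / Complex 1 t))" by (rule integral_mult_right_zero)
  also have "\<dots> = - \<kappa> * cnj I" by (simp only: I_def Bochner_Integration.integral_cnj)
  \<comment> \<open>Under z to - \<open>cnj\<close> z the factor 1 / z changes sign, so the left
    edge contributes with the same sign as the right one. Both have the same modulus, which turns 2
    pi into pi in the conclusion.\<close>
  finally have "2 * pi * h 0 = I + \<kappa> * cnj I" using main by (simp add: I_def)
  then have "norm (2 * pi * h 0) \<le> norm I + norm (\<kappa> * cnj I)" by (metis norm_triangle_ineq)
  then have "pi * norm (h 0) \<le> norm I" using k(1) by (simp add: norm_mult)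
  then show ?thesis by (simp add: I_def h_def)
qed

text \<open>The exponent 3/2 is split into 5/4, for convergence, and 1/4, for the gain from n \<ge>
  Y.\<close>

lemma L_series_tail:
  assumes chi: "dirichlet_character q chi" "q > 0" and Y: "Y \<ge> 1" and s: "Re s = 3/2"
  shows "norm (L_series F chi s - (\<Sum>n\<in>{1..<Y}. L_term F chi s n)) \<le> real Y powr (-1/4) * lam_sum (5/4)"
proof -
  have sm: "summable (\<lambda>n. L_term F chi s (Suc n))" using summable_L_term[OF chi] s by simp
  have "(\<Sum>n\<in>{1..<Y}. L_term F chi s n) = (\<Sum>n<Y-1. L_term F chi s (Suc n))"
    by (rule sum.reindex_bij_witness[of _ Suc "\<lambda>n. n - 1"]) auto
  then have "L_series F chi s - (\<Sum>n\<in>{1..<Y}. L_term F chi s n) = (\<Sum>n. L_term F chi s (Suc (n + (Y-1))))"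
    using suminf_minus_initial_segment[OF sm, of "Y-1"] by (simp add: L_series_def)
  also have "norm \<dots> \<le> (\<Sum>n. real Y powr (-1/4) * (norm (lam F (Suc (n + (Y-1)))) / real (Suc (n + (Y-1))) powr (5/4)))"
  proof (rule norm_suminf_le)
    show "summable (\<lambda>n. real Y powr (-1/4) * (norm (lam F (Suc (n + (Y-1)))) / real (Suc (n + (Y-1))) powr (5/4)))"
      by (intro summable_mult summable_ignore_initial_segment[OF summ]) simp
    fix n
    let ?m = "Suc (n + (Y-1))"
    have m: "real ?m \<ge> real Y" using Y by simp
    have "norm (L_term F chi s ?m) \<le> norm (lam F ?m) / real ?m powr (3/2)"
      using norm_L_term_le[OF chi, of ?m "3/2" s] s by simp
    also have "real ?m powr (3/2) = real ?m powr (5/4) * real ?m powr (1/4)" by (simp flip: powr_add)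
    also have "norm (lam F ?m) / (real ?m powr (5/4) * real ?m powr (1/4)) \<le> norm (lam F ?m) / (real ?m powr (5/4) * real Y powr (1/4))"
      using m Y by (intro divide_left_mono mult_left_mono powr_mono2 mult_pos_pos) auto
    also have "\<dots> = real Y powr (-1/4) * (norm (lam F ?m) / real ?m powr (5/4))"
      by (simp add: powr_minus field_simps)
    finally show "norm (L_term F chi s ?m) \<le> real Y powr (-1/4) * (norm (lam F ?m) / real ?m powr (5/4))" .
  qed
  also have "\<dots> = real Y powr (-1/4) * (\<Sum>n. norm (lam F (Suc (n + (Y-1)))) / real (Suc (n + (Y-1))) powr (5/4))"
    by (intro suminf_mult summable_ignore_initial_segment[OF summ]) simp
  also have "\<dots> \<le> real Y powr (-1/4) * lam_sum (5/4)"
  proof (intro mult_left_mono)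
    have s54: "summable (\<lambda>n. norm (lam F (Suc n)) / real (Suc n) powr (5/4))" by (rule summ) simp
    show "(\<Sum>n. norm (lam F (Suc (n + (Y-1)))) / real (Suc (n + (Y-1))) powr (5/4)) \<le> lam_sum (5/4)"
      unfolding lam_sum_def suminf_minus_initial_segment[OF s54, of "Y-1"]
      by (simp add: sum_nonneg)
  qed auto
  finally show ?thesis .
qed

text \<open>At 1/2 + z the conductor factor is N powr (1/4) times sqrt N powr z. The second part is
  why sqrt N is the effective length of the sum.\<close>

lemma completed_L_kernel:
  fixes t :: real
  assumes good: "good q chi"
  defines "z \<equiv> Complex 1 t"
  shows "completed_L F q chi (1/2 + z) * afe_poly (chi (-1)) z * exp (z\<^sup>2) / z =
     of_real (real (conductor F q) powr (1/4)) * (afe_kernel (chi (-1)) z * exp (z * of_real (ln (sqrt (real (conductor F q))))) * L_series F chi (1/2 + z))"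
proof -
  have chi: "dirichlet_character q chi" "q > 0" using good by (auto simp: good_def)
  let ?e = "chi (-1)" and ?N = "conductor F q"
  have e: "?e \<in> {1, -1}" using dirichlet_character_minus_one[OF chi(1)] .
  have N: "?N > 0" using good by (simp add: good_def)
  have "completed_L F q chi (1/2 + z) = L_series F chi (1/2 + z) * L_inf F q chi (1/2 + z)"
    using good by (simp add: good_def is_entire_extension_def completed_series_def z_def)
  moreover have "of_nat ?N powr ((1/2 + z) / 2) = of_real (real ?N powr (1/4)) * exp (z * of_real (ln (sqrt (real ?N))))"
  proof -
    have "complex_of_real (real ?N powr (1/4)) = exp (of_real (ln (real ?N)) / 4)"
      using N by (simp add: powr_def exp_of_real[symmetric])
    then show ?thesis using N by (simp add: of_nat_powr_exp ln_sqrt add_divide_distrib algebra_simps flip: exp_add)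
  qed
  moreover have "Gamma_R (1/2 + z + shift F ?e j) * ((z + 1/2 + shift F ?e j) * (- z + 1/2 + cnj (shift F ?e j))) = afe_factor ?e j z"
    if "j < d" for j
  proof -
    let ?u = "(1/2 + z + shift F ?e j) / 2"
    have "Re ?u = 3/4 + Re (shift F ?e j) / 2" by (simp add: z_def add_divide_distrib)
    then have "Re ?u > 0" using shift[OF e that] by linarith
    then have "?u \<notin> \<int>\<^sub>\<le>\<^sub>0" by (metis nonpos_Ints_cases complex_Re_of_int not_le of_int_le_0_iff)
    then have G: "Gamma (?u + 1) = ?u * Gamma ?u" by (rule Gamma_plus1)
    show ?thesis unfolding Gamma_R_def afe_factor_def G by (simp add: algebra_simps)
  qed
  then have "(\<Prod>j<d. Gamma_R (1/2 + z + shift F ?e j)) * afe_poly ?e z = (\<Prod>j<d. afe_factor ?e j z)"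
    unfolding afe_poly_def by (simp flip: prod.distrib)
  ultimately show ?thesis
    unfolding L_inf_def afe_kernel_def degree by (simp add: mult_ac)
qed

text \<open>The completed value can be divided by the polynomial unless the latter vanishes at 0. In
  that case \<mu> = -1/2 for some parameter, a reciprocal gamma factor vanishes at 1/2, and the
  central value is 0.\<close>

lemma L_half_le_completed:
  obtains C where "C > 0" "\<And>q chi. good q chi \<Longrightarrow> norm (L_fun F chi (1/2)) \<le>
     C * real (conductor F q) powr (-1/4) * norm (completed_L F q chi (1/2) * afe_poly (chi (-1)) 0)"
proof -
  define r where "r e = norm (\<Prod>j<d. of_real pi powr ((1/2 + shift F e j) / 2) * rGamma ((1/2 + shift F e j) / 2))" for e
  \<comment> \<open>If \<open>afe_poly e 0\<close> is 0, this quotient is 0 by the convention for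
    division, in accordance with the vanishing of \<open>r e\<close>.\<close>
  define c where "c e = r e / norm (afe_poly e 0)" for e
  have rz: "r e = 0" if "afe_poly e 0 = 0" for e
  proof -
    have "\<exists>j<d. 1/2 + shift F e j = 0 \<or> 1/2 + cnj (shift F e j) = 0"
    proof -
      have "\<exists>j\<in>{..<d}. (0 + 1/2 + shift F e j) * (- 0 + 1/2 + cnj (shift F e j)) = 0"
        using that unfolding afe_poly_def prod_zero_iff[OF finite_lessThan] .
      then show ?thesis by (auto simp only: mult_eq_0_iff add_0 minus_zero lessThan_iff)
    qed
    then obtain j where j: "j < d" "1/2 + shift F e j = 0 \<or> 1/2 + cnj (shift F e j) = 0" by blast
    have "1/2 + shift F e j = 0"
    proof (cases "1/2 + shift F e j = 0")
      case False
      then have "cnj (1/2 + shift F e j) = 0" using j by simp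
      then show ?thesis by (simp only: complex_cnj_zero_iff)
    qed
    then have "rGamma ((1/2 + shift F e j) / 2) = 0" by (simp add: rGamma_eq_zero_iff)
    then show ?thesis using j(1) by (auto simp: r_def)
  qed
  have "norm (L_fun F chi (1/2)) \<le> (c 1 + c (-1) + 1) * real (conductor F q) powr (-1/4) * norm (completed_L F q chi (1/2) * afe_poly (chi (-1)) 0)"
    if good: "good q chi" for q chi
  proof -
    have chi: "dirichlet_character q chi" "q > 0" using good by (auto simp: good_def)
    let ?e = "chi (-1)" and ?N = "conductor F q"
    have e: "?e \<in> {1, -1}" using dirichlet_character_minus_one[OF chi(1)] .
    have N: "?N > 0" using good by (simp add: good_def)
    have "norm (inverse_L_inf F q chi (1/2)) = real ?N powr (-1/4) * r ?e"
      using N by (simp add: inverse_L_inf_def norm_mult norm_of_nat_powr r_def degree)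
    then have "norm (L_fun F chi (1/2)) = real ?N powr (-1/4) * r ?e * norm (completed_L F q chi (1/2))"
      unfolding L_fun_eq[OF good] by (simp add: norm_mult)
    also have "\<dots> = c ?e * real ?N powr (-1/4) * norm (completed_L F q chi (1/2) * afe_poly ?e 0)"
      using rz[of ?e] by (cases "afe_poly ?e 0 = 0") (auto simp: c_def norm_mult)
    also have "\<dots> \<le> (c 1 + c (-1) + 1) * real ?N powr (-1/4) * norm (completed_L F q chi (1/2) * afe_poly ?e 0)"
      using e by (intro mult_right_mono) (auto simp: c_def r_def)
    finally show ?thesis .
  qed
  moreover have "c 1 + c (-1) + 1 > 0" by (auto simp: c_def r_def intro!: add_nonneg_pos)
  ultimately show ?thesis using that by blast
qed

text \<open>Coefficients and index set are left free because the sum will be cut up in both: into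
  rough, bilinear and square parts, and into dyadic blocks.\<close>

definition afe_sum :: "nat \<Rightarrow> (int \<Rightarrow> complex) \<Rightarrow> (nat \<Rightarrow> complex) \<Rightarrow> nat set \<Rightarrow> complex" where
  "afe_sum q chi a I = (\<Sum>n\<in>I. a n * chi (int n) * of_real (real n powr (-1/2)) *
      afe_weight (chi (-1)) 1 (real n / sqrt (real (conductor F q))))"

text \<open>The central value is controlled by the integral over Re z = 1, where the series is cut
  at Y and integrated term by term. Y is independent of the conductor and will be taken so large
  that the truncation error is bounded.\<close>

lemma approximate_functional_equation:
  obtains C where "C > 0" "\<And>q chi Y. good q chi \<Longrightarrow> Y \<ge> 1 \<Longrightarrow> norm (L_fun F chi (1/2)) \<le>
     C * (norm (afe_sum q chi (lam F) {1..<Y}) + sqrt (real (conductor F q)) * real Y powr (-1/4))"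
proof -
  obtain C where C: "C > 0" "\<And>q chi. good q chi \<Longrightarrow> norm (L_fun F chi (1/2)) \<le>
     C * real (conductor F q) powr (-1/4) * norm (completed_L F q chi (1/2) * afe_poly (chi (-1)) 0)"
    using L_half_le_completed by blast
  define D where "D = C / pi * (1 + kernel_const * pi * lam_sum (5/4))"
  have ls: "lam_sum (5/4) \<ge> 0" by (rule lam_sum_nonneg) simp
  have "norm (L_fun F chi (1/2)) \<le> D * (norm (afe_sum q chi (lam F) {1..<Y}) + sqrt (real (conductor F q)) * real Y powr (-1/4))"
    if good: "good q chi" and Y: "Y \<ge> 1" for q chi Y
  proof -
    have chi: "dirichlet_character q chi" "q > 0" using good by (auto simp: good_def)
    let ?e = "chi (-1)" and ?N = "conductor F q"
    have e: "?e \<in> {1, -1}" using dirichlet_character_minus_one[OF chi(1)] .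
    have N: "real ?N > 0" using good by (simp add: good_def)
    define R where "R = sqrt (real ?N)"
    have R: "R > 0" using N by (simp add: R_def)
    define k where "k t = afe_kernel ?e (Complex 1 t) * exp (Complex 1 t * of_real (ln R))" for t
    define A where "A t = (\<Sum>n\<in>{1..<Y}. L_term F chi (1/2 + Complex 1 t) n)" for t
    define B where "B t = L_series F chi (1/2 + Complex 1 t) - A t" for t
    have k: "continuous_on UNIV k" "norm (k t) \<le> (kernel_const * R) / (1 + t\<^sup>2)" for t
    proof -
      have "k = (\<lambda>t. afe_kernel ?e (Complex 1 t) * exp (- Complex 1 t * of_real (ln (1/R))))"
        using R by (auto simp: k_def ln_div)
      then show "continuous_on UNIV k" "norm (k t) \<le> (kernel_const * R) / (1 + t\<^sup>2)"
        using afe_weight_integrand[OF e, of 1 "1/R"] R by (simp_all add: powr_minus)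
    qed
    have Lc: "continuous_on UNIV (\<lambda>t. L_series F chi (1/2 + Complex 1 t))"
    proof -
      have "continuous_on UNIV (\<lambda>t. L_fun F chi (1/2 + Complex 1 t))"
        by (rule continuous_on_compose2[OF holomorphic_on_imp_continuous_on[OF L_fun_holomorphic[OF good]]])
           (auto intro!: continuous_intros)
      then show ?thesis using L_fun_series[OF good, of "1/2 + Complex 1 _"] by simp
    qed
    have Lt: "L_term F chi (1/2 + Complex 1 t) n = lam F n * chi (int n) * of_real (real n powr (-1/2)) * exp (- Complex 1 t * of_real (ln (real n)))"
      if "n > 0" for n t
    proof -
      have "complex_of_real (real n powr (-1/2)) = exp (- of_real (ln (real n)) / 2)"
        using that by (simp add: powr_def exp_of_real[symmetric])
      then have 1: "exp (- ((1/2 + Complex 1 t) * of_real (ln (real n)))) = of_real (real n powr (-1/2)) * exp (- Complex 1 t * of_real (ln (real n)))"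
        by (simp add: distrib_right flip: exp_add)
      have 2: "u / exp x = u * exp (- x)" for u x :: complex by (simp add: exp_minus divide_inverse)
      show ?thesis unfolding L_term_def of_nat_powr_exp[OF that] 2 1 by (simp only: mult.assoc)
    qed
    have Ac: "continuous_on UNIV A"
      unfolding A_def by (simp add: Lt cong: sum.cong_simp) (intro continuous_intros)
    have B: "continuous_on UNIV B" "norm (B t) \<le> real Y powr (-1/4) * lam_sum (5/4)" for t
      unfolding B_def A_def using L_series_tail[OF chi Y, of "1/2 + Complex 1 t"] Lc Ac
      by (auto intro!: continuous_intros simp: A_def[abs_def])
    have kt: "k t * L_term F chi (1/2 + Complex 1 t) n = lam F n * chi (int n) * of_real (real n powr (-1/2)) *
          (afe_kernel ?e (Complex 1 t) * exp (- Complex 1 t * of_real (ln (real n / R))))" if "n > 0" for n t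
    proof -
      have "exp (Complex 1 t * of_real (ln R)) * exp (- Complex 1 t * of_real (ln (real n))) = exp (- Complex 1 t * of_real (ln (real n / R)))"
        using that R by (simp add: ln_div algebra_simps flip: exp_add)
      moreover have "k t * L_term F chi (1/2 + Complex 1 t) n = lam F n * chi (int n) * of_real (real n powr (-1/2)) *
          (afe_kernel ?e (Complex 1 t) * (exp (Complex 1 t * of_real (ln R)) * exp (- Complex 1 t * of_real (ln (real n)))))"
        unfolding Lt[OF that] k_def by (simp only: mult.assoc mult.commute mult.left_commute)
      ultimately show ?thesis by (simp only:)
    qed
    have kA: "integrable lborel (\<lambda>t. k t * A t)" "(LINT t|lborel. k t * A t) = afe_sum q chi (lam F) {1..<Y}"
    proof -
      have *: "(\<lambda>t. k t * A t) = (\<lambda>t. \<Sum>n\<in>{1..<Y}. lam F n * chi (int n) * of_real (real n powr (-1/2)) *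
          (afe_kernel ?e (Complex 1 t) * exp (- Complex 1 t * of_real (ln (real n / R)))))"
        unfolding A_def sum_distrib_left by (intro ext sum.cong refl kt) auto
      have i: "integrable lborel (\<lambda>t. lam F n * chi (int n) * of_real (real n powr (-1/2)) *
          (afe_kernel ?e (Complex 1 t) * exp (- Complex 1 t * of_real (ln (real n / R)))))" if "n \<in> {1..<Y}" for n
        using that R by (intro integrable_mult_right integrable_afe_weight e) auto
      show "integrable lborel (\<lambda>t. k t * A t)" unfolding * by (intro Bochner_Integration.integrable_sum i)
      show "(LINT t|lborel. k t * A t) = afe_sum q chi (lam F) {1..<Y}"
        unfolding * afe_sum_def afe_weight_def R_def[symmetric]
        by (subst Bochner_Integration.integral_sum[OF i]) (auto intro!: sum.cong integral_mult_right_zero)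
    qed
    have kB: "continuous_on UNIV (\<lambda>t. k t * B t)" "norm (k t * B t) \<le> (kernel_const * R * (real Y powr (-1/4) * lam_sum (5/4))) / (1 + t\<^sup>2)" for t
    proof -
      show "continuous_on UNIV (\<lambda>t. k t * B t)" using k B by (intro continuous_intros)
      have "norm (k t * B t) \<le> (kernel_const * R) / (1 + t\<^sup>2) * (real Y powr (-1/4) * lam_sum (5/4))"
        unfolding norm_mult using k(2)[of t] B(2)[of t] ls by (intro mult_mono) (auto intro: order.trans[OF norm_ge_zero])
      then show "norm (k t * B t) \<le> (kernel_const * R * (real Y powr (-1/4) * lam_sum (5/4))) / (1 + t\<^sup>2)" by simp
    qed
    have "(LINT t|lborel. completed_L F q chi (1/2 + Complex 1 t) * afe_poly ?e (Complex 1 t) * exp ((Complex 1 t)\<^sup>2) / Complex 1 t)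
      = (LINT t|lborel. of_real (real ?N powr (1/4)) * (k t * A t + k t * B t))"
      unfolding completed_L_kernel[OF good] by (simp add: k_def B_def R_def algebra_simps)
    also have "\<dots> = of_real (real ?N powr (1/4)) * ((LINT t|lborel. k t * A t) + (LINT t|lborel. k t * B t))"
      by (subst integral_mult_right_zero, subst Bochner_Integration.integral_add[OF kA(1) integrable_decay[OF kB]]) simp
    finally have "pi * norm (completed_L F q chi (1/2) * afe_poly ?e 0) \<le>
       real ?N powr (1/4) * norm (afe_sum q chi (lam F) {1..<Y} + (LINT t|lborel. k t * B t))"
      using completed_L_central_le[OF good] by (simp add: norm_mult kA(2))
    also have "\<dots> \<le> real ?N powr (1/4) * (norm (afe_sum q chi (lam F) {1..<Y}) + kernel_const * R * (real Y powr (-1/4) * lam_sum (5/4)) * pi)"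
    proof (rule mult_left_mono)
      show "norm (afe_sum q chi (lam F) {1..<Y} + (LINT t|lborel. k t * B t))
          \<le> norm (afe_sum q chi (lam F) {1..<Y}) + kernel_const * R * (real Y powr (-1/4) * lam_sum (5/4)) * pi"
        using norm_triangle_ineq[of "afe_sum q chi (lam F) {1..<Y}" "LINT t|lborel. k t * B t"] norm_integral_decay[OF kB] by linarith
    qed simp
    finally have main: "norm (completed_L F q chi (1/2) * afe_poly ?e 0) \<le>
       real ?N powr (1/4) * (norm (afe_sum q chi (lam F) {1..<Y}) + kernel_const * R * (real Y powr (-1/4) * lam_sum (5/4)) * pi) / pi"
      by (simp add: pos_le_divide_eq mult.commute)
    define S where "S = norm (afe_sum q chi (lam F) {1..<Y})"
    have "norm (L_fun F chi (1/2)) \<le> C * real ?N powr (-1/4) * (real ?N powr (1/4) * (S + kernel_const * R * (real Y powr (-1/4) * lam_sum (5/4)) * pi) / pi)"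
      using C(1) main unfolding S_def by (intro order.trans[OF C(2)[OF good]] mult_left_mono) auto
    also have "\<dots> = (real ?N powr (-1/4) * real ?N powr (1/4)) * (C / pi * (S + (kernel_const * pi * lam_sum (5/4)) * (R * real Y powr (-1/4))))"
      by (simp add: add_divide_distrib algebra_simps)
    also have "real ?N powr (-1/4) * real ?N powr (1/4) = 1" using N by (simp flip: powr_add)
    also have "1 * (C / pi * (S + (kernel_const * pi * lam_sum (5/4)) * (R * real Y powr (-1/4)))) \<le> D * (S + R * real Y powr (-1/4))"
    proof -
      have "S + (kernel_const * pi * lam_sum (5/4)) * (R * real Y powr (-1/4)) \<le> (1 + kernel_const * pi * lam_sum (5/4)) * (S + R * real Y powr (-1/4))"
        using R ls kernel_const_pos by (simp add: algebra_simps S_def)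
      then show ?thesis using C unfolding D_def by (simp add: mult.assoc mult_left_mono divide_right_mono)
    qed
    finally show ?thesis by (simp add: S_def R_def)
  qed
  moreover have "D > 0" unfolding D_def using C(1) ls kernel_const_pos
    by (intro mult_pos_pos add_pos_nonneg divide_pos_pos mult_nonneg_nonneg) auto
  ultimately show ?thesis using that by blast
qed

end

section \<open>The logarithm of the L-function\<close>

lemma holomorphic_on_half_plane_series:
  fixes f :: "nat \<Rightarrow> complex \<Rightarrow> complex"
  assumes hol: "\<And>n. f n holomorphic_on {s. Re s > \<alpha>}"
    and M: "\<And>\<beta>. \<beta> > \<alpha> \<Longrightarrow> \<exists>M. summable M \<and> (\<forall>n s. Re s \<ge> \<beta> \<longrightarrow> norm (f n s) \<le> M n)"
  shows "(\<lambda>s. \<Sum>n. f n s) holomorphic_on {s. Re s > \<alpha>}"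
proof (rule holomorphic_uniform_sequence[where f="\<lambda>N s. \<Sum>n<N. f n s"])
  show "open {s. Re s > \<alpha>}" by (rule open_halfspace_Re_gt)
  show "(\<lambda>s. \<Sum>n<N. f n s) holomorphic_on {s. Re s > \<alpha>}" for N by (intro holomorphic_on_sum hol)
  fix x assume x: "x \<in> {s. Re s > \<alpha>}"
  define r where "r = (Re x - \<alpha>) / 2"
  have r: "r > 0" using x by (simp add: r_def)
  have ge: "Re s \<ge> \<alpha> + r" if "s \<in> cball x r" for s
  proof -
    have "\<bar>Re (x - s)\<bar> \<le> r" using that abs_Re_le_cmod[of "x - s"] by (simp add: dist_norm)
    then show ?thesis by (simp add: r_def) argo
  qed
  obtain M where "summable M" "\<And>n s. Re s \<ge> \<alpha> + r \<Longrightarrow> norm (f n s) \<le> M n"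
    using M[of "\<alpha> + r"] r by auto
  then have "uniform_limit (cball x r) (\<lambda>N s. \<Sum>n<N. f n s) (\<lambda>s. \<Sum>n. f n s) sequentially"
    using ge by (intro Weierstrass_m_test[where M=M]) auto
  moreover have "cball x r \<subseteq> {s. Re s > \<alpha>}" using ge r by force
  ultimately show "\<exists>r>0. cball x r \<subseteq> {s. Re s > \<alpha>} \<and>
      uniform_limit (cball x r) (\<lambda>N s. \<Sum>n<N. f n s) (\<lambda>s. \<Sum>n. f n s) sequentially"
    using r by blast
qed

section \<open>Linear and higher terms of the logarithm of the Euler product\<close>

context L_family
begin

definition prime_coeff :: "(int \<Rightarrow> complex) \<Rightarrow> nat \<Rightarrow> complex" where
  "prime_coeff chi n = (if prime n then lam F n * chi (int n) else 0)"

definition log_prime_part :: "(int \<Rightarrow> complex) \<Rightarrow> complex \<Rightarrow> complex" where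
  "log_prime_part chi s = (\<Sum>n. prime_coeff chi n / of_nat n powr s)"

text \<open>The logarithm of the local factor without its linear terms, which make up
  \<open>log_prime_part\<close>. Being quadratic in p powr -s it is summable down to Re s =
  3/4.\<close>

definition log_rest_term :: "(int \<Rightarrow> complex) \<Rightarrow> nat \<Rightarrow> complex \<Rightarrow> complex" where
  "log_rest_term chi p s = (if prime p then \<Sum>j<d. - Ln (1 - satake F j p * chi (int p) / of_nat p powr s)
       - satake F j p * chi (int p) / of_nat p powr s else 0)"

definition log_rest :: "(int \<Rightarrow> complex) \<Rightarrow> complex \<Rightarrow> complex" where
  "log_rest chi s = (\<Sum>p. log_rest_term chi p s)"

definition rest_const :: real where
  "rest_const = real d * (\<Sum>n. real n powr (-(3/2))) / (1 - 2 powr (-(3/4)))"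

lemma norm_prime_coeff_le:
  assumes "dirichlet_character q chi" "q > 0"
  shows "norm (prime_coeff chi n) \<le> real d"
  using mult_mono[OF norm_lam_prime_le[of n] dirichlet_character_norm_le[OF assms, of "int n"]]
  by (auto simp: prime_coeff_def norm_mult)

lemma norm_prime_term_le:
  assumes "dirichlet_character q chi" "q > 0" "\<sigma> \<le> Re s"
  shows "norm (prime_coeff chi n / of_nat n powr s) \<le> real d * real n powr (-\<sigma>)"
proof (cases "n = 0")
  case False
  then have n: "real n \<ge> 1" by simp
  have "norm (prime_coeff chi n / of_nat n powr s) \<le> real d / real n powr \<sigma>"
    unfolding norm_divide using norm_prime_coeff_le[OF assms(1,2)] n assms(3)
    by (intro frac_le) (auto simp: norm_of_nat_powr intro: powr_mono)
  then show ?thesis by (simp add: powr_minus divide_inverse)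
qed (simp add: prime_coeff_def)

lemma summable_powr_neg: "\<sigma> > 1 \<Longrightarrow> summable (\<lambda>n. real n powr (-\<sigma>))"
  using summable_real_powr_iff[of "-\<sigma>"] by simp

lemma summable_prime_terms:
  assumes "dirichlet_character q chi" "q > 0" "Re s > 1"
  shows "summable (\<lambda>n. prime_coeff chi n / of_nat n powr s)"
  by (rule summable_comparison_test'[OF summable_mult[OF summable_powr_neg[OF assms(3)], of "real d"], of 0])
     (use norm_prime_term_le[OF assms(1,2)] in auto)

lemma log_prime_part_holomorphic:
  assumes "dirichlet_character q chi" "q > 0"
  shows "log_prime_part chi holomorphic_on {s. Re s > 1}"
  unfolding log_prime_part_def
proof (rule holomorphic_on_half_plane_series)
  show "(\<lambda>s. prime_coeff chi n / of_nat n powr s) holomorphic_on {s. Re s > 1}" for n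
    by (cases "n = 0") (auto simp: prime_coeff_def intro!: holomorphic_intros)
  show "\<exists>M. summable M \<and> (\<forall>n s. Re s \<ge> \<beta> \<longrightarrow> norm (prime_coeff chi n / of_nat n powr s) \<le> M n)" if "\<beta> > 1" for \<beta> :: real
    using norm_prime_term_le[OF assms] summable_mult[OF summable_powr_neg[OF that], of "real d"] by blast
qed

lemma norm_satake_term_le:
  assumes "dirichlet_character q chi" "q > 0" "prime p" "j < d" "\<sigma> \<le> Re s"
  shows "norm (satake F j p * chi (int p) / of_nat p powr s) \<le> real p powr (-\<sigma>)"
proof -
  have p: "real p \<ge> 1" using prime_ge_1_nat[OF assms(3)] by simp
  have "norm (satake F j p) * norm (chi (int p)) / norm (of_nat p powr s :: complex) \<le> (1 * 1) / real p powr \<sigma>"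
    using norm_satake_le[OF assms(3,4)] dirichlet_character_norm_le[OF assms(1,2), of "int p"] p assms(5)
    by (intro frac_le mult_mono) (auto simp: norm_of_nat_powr intro: powr_mono)
  then show ?thesis by (simp add: norm_mult norm_divide powr_minus_divide)
qed

lemma norm_satake_term_less:
  assumes "dirichlet_character q chi" "q > 0" "prime p" "j < d" "3/4 \<le> Re s"
  shows "norm (satake F j p * chi (int p) / of_nat p powr s) \<le> 2 powr (-(3/4))"
proof -
  have "real p powr (-(3/4)) \<le> 2 powr (-(3/4))" using prime_ge_2_nat[OF assms(3)] by (intro powr_mono2') auto
  then show ?thesis using norm_satake_term_le[OF assms] by linarith
qed

lemma two_powr_less: "2 powr (-(3/4)) < (1::real)"
  using powr_less_mono[of "-(3/4)" 0 "2::real"] by simp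

text \<open>Ln (1 - u) + u is at most |u|^2 / (1 - |u|), and the Ramanujan bound gives |u| \<le> p
  powr (-3/4) \<le> 2 powr (-3/4).\<close>

lemma norm_log_rest_term_le:
  assumes "dirichlet_character q chi" "q > 0" "3/4 \<le> Re s"
  shows "norm (log_rest_term chi p s) \<le> real d / (1 - 2 powr (-(3/4))) * real p powr (-(3/2))"
proof (cases "prime p")
  case True
  let ?u = "\<lambda>j. satake F j p * chi (int p) / of_nat p powr s"
  have p: "real p > 0" using prime_gt_0_nat[OF True] by simp
  have "norm (- Ln (1 - ?u j) - ?u j) \<le> real p powr (-(3/2)) / (1 - 2 powr (-(3/4)))" if "j < d" for j
  proof -
    have u: "norm (?u j) \<le> 2 powr (-(3/4))" "norm (?u j) \<le> real p powr (-(3/4))"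
      using norm_satake_term_less[OF assms(1,2) True that assms(3)] norm_satake_term_le[OF assms(1,2) True that assms(3)] by auto
    have "norm (- ?u j) < 1" using u(1) two_powr_less by simp
    from Ln_approx_linear[OF this]
    have "norm (Ln (1 - ?u j) + ?u j) \<le> (norm (?u j))\<^sup>2 / (1 - norm (?u j))" by simp
    also have "\<dots> \<le> (real p powr (-(3/4)))\<^sup>2 / (1 - 2 powr (-(3/4)))"
      using u two_powr_less by (intro frac_le power_mono) auto
    also have "(real p powr (-(3/4)))\<^sup>2 = real p powr (-(3/2))"
      using p by (simp add: power2_eq_square flip: powr_add)
    also have "norm (Ln (1 - ?u j) + ?u j) = norm (- Ln (1 - ?u j) - ?u j)"
      by (metis minus_add_distrib norm_minus_cancel add_uminus_conv_diff)
    finally show ?thesis .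
  qed
  then have "norm (\<Sum>j<d. - Ln (1 - ?u j) - ?u j) \<le> (\<Sum>j<d. real p powr (-(3/2)) / (1 - 2 powr (-(3/4))))"
    by (intro order.trans[OF norm_sum sum_mono]) auto
  then show ?thesis using True by (simp add: log_rest_term_def)
qed (use two_powr_less in \<open>auto simp: log_rest_term_def\<close>)

lemma summable_rest_bound: "summable (\<lambda>p. real d / (1 - 2 powr (-(3/4))) * real p powr (-(3/2)))"
  by (intro summable_mult summable_powr_neg) auto

lemma summable_log_rest:
  assumes "dirichlet_character q chi" "q > 0" "3/4 \<le> Re s"
  shows "summable (\<lambda>p. log_rest_term chi p s)"
  by (rule summable_comparison_test'[OF summable_rest_bound, of 0]) (use norm_log_rest_term_le[OF assms] in auto)

lemma norm_log_rest_le: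
  assumes "dirichlet_character q chi" "q > 0" "3/4 \<le> Re s"
  shows "norm (log_rest chi s) \<le> rest_const"
proof -
  have "norm (log_rest chi s) \<le> (\<Sum>p. real d / (1 - 2 powr (-(3/4))) * real p powr (-(3/2)))"
    unfolding log_rest_def by (rule norm_suminf_le[OF norm_log_rest_term_le[OF assms] summable_rest_bound])
  also have "\<dots> = real d / (1 - 2 powr (-(3/4))) * (\<Sum>p. real p powr (-(3/2)))"
    by (intro suminf_mult summable_powr_neg) auto
  finally show ?thesis by (simp add: rest_const_def)
qed

lemma log_rest_holomorphic:
  assumes "dirichlet_character q chi" "q > 0"
  shows "log_rest chi holomorphic_on {s. Re s > 3/4}"
  unfolding log_rest_def
proof (rule holomorphic_on_half_plane_series)
  show "log_rest_term chi p holomorphic_on {s. Re s > 3/4}" for p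
  proof (cases "prime p")
    case True
    then have p: "p > 0" by (rule prime_gt_0_nat)
    have "1 - satake F j p * chi (int p) / of_nat p powr s \<notin> \<real>\<^sub>\<le>\<^sub>0" if "j < d" "Re s > 3/4" for j s
    proof -
      let ?u = "satake F j p * chi (int p) / of_nat p powr s"
      have "norm ?u < 1" using norm_satake_term_less[OF assms True that(1), of s] that(2) two_powr_less by simp
      then have "Re ?u < 1" using complex_Re_le_cmod[of ?u] by linarith
      then show ?thesis by (auto simp: complex_nonpos_Reals_iff)
    qed
    then show ?thesis using True p unfolding log_rest_term_def
      by (auto intro!: holomorphic_intros)
  next
    case False
    then have "log_rest_term chi p = (\<lambda>_. 0)" by (auto simp: log_rest_term_def fun_eq_iff)
    then show ?thesis by simp
  qed
  show "\<exists>M. summable M \<and> (\<forall>n s. Re s \<ge> \<beta> \<longrightarrow> norm (log_rest_term chi n s) \<le> M n)" if "\<beta> > 3/4" for \<beta> :: real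
    by (intro exI[of _ "\<lambda>p. real d / (1 - 2 powr (-(3/4))) * real p powr (-(3/2))"] conjI allI impI summable_rest_bound
          norm_log_rest_term_le[OF assms]) (use that in linarith)
qed

text \<open>Only exponentials of sums of logarithms occur, so that the identity holds for the
  partial products without regard to branches and passes to the limit.\<close>

lemma L_series_exp:
  assumes good: "good q chi" and s: "Re s > 1"
  shows "L_series F chi s = exp (log_prime_part chi s + log_rest chi s)"
proof -
  have chi: "dirichlet_character q chi" "q > 0" using good by (auto simp: good_def)
  let ?f = "\<lambda>p. if prime p then euler_factor F chi s p else 1"
  have f: "?f p = exp (prime_coeff chi p / of_nat p powr s + log_rest_term chi p s)" for p
  proof (cases "prime p")
    case True
    let ?u = "\<lambda>j. satake F j p * chi (int p) / of_nat p powr s"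
    have nz: "1 - ?u j \<noteq> 0" if "j < d" for j
    proof -
      have "norm (?u j) < 1" using norm_satake_term_less[OF chi True that, of s] s two_powr_less by simp
      then show ?thesis by (metis eq_iff_diff_eq_0 norm_one order_less_irrefl)
    qed
    have "prime_coeff chi p / of_nat p powr s = (\<Sum>j<d. ?u j)"
      using True by (simp add: prime_coeff_def lam_prime sum_distrib_right sum_divide_distrib)
    then have "exp (prime_coeff chi p / of_nat p powr s + log_rest_term chi p s) = exp (\<Sum>j<d. - Ln (1 - ?u j))"
      using True by (simp add: log_rest_term_def sum_subtractf)
    also have "\<dots> = (\<Prod>j<d. inverse (1 - ?u j))"
      using nz by (simp add: exp_sum exp_minus)
    finally show ?thesis using True by (simp add: euler_factor_def degree)
  qed (simp add: prime_coeff_def log_rest_term_def)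
  have "convergent_prod ?f" "L_series F chi s = prodinf ?f"
    using good s by (auto simp: good_def abs_convergent_euler_product_def intro: abs_convergent_prod_imp_convergent_prod)
  then have "(\<lambda>n. \<Prod>i\<le>n. ?f i) \<longlonglongrightarrow> L_series F chi s" using convergent_prod_LIMSEQ by metis
  moreover have "(\<lambda>n. \<Prod>i\<le>n. ?f i) = (\<lambda>n. exp (\<Sum>i\<le>n. prime_coeff chi i / of_nat i powr s + log_rest_term chi i s))"
    unfolding f by (simp add: exp_sum)
  moreover have "(\<lambda>n. \<Sum>i\<le>n. prime_coeff chi i / of_nat i powr s + log_rest_term chi i s) \<longlonglongrightarrow> log_prime_part chi s + log_rest chi s"
    unfolding log_prime_part_def log_rest_def
    using summable_prime_terms[OF chi s] summable_log_rest[OF chi, of s] s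
    by (subst suminf_add) (auto intro!: summable_LIMSEQ' summable_add)
  then have "(\<lambda>n. exp (\<Sum>i\<le>n. prime_coeff chi i / of_nat i powr s + log_rest_term chi i s)) \<longlonglongrightarrow> exp (log_prime_part chi s + log_rest chi s)"
    by (rule tendsto_exp)
  ultimately show ?thesis using LIMSEQ_unique by metis
qed

lemma L_fun_nonzero:
  assumes "good q chi" "Re s > 1"
  shows "L_fun F chi s \<noteq> 0"
  using L_fun_series[OF assms] L_series_exp[OF assms] by simp

definition prime_zeta_const :: real where
  "prime_zeta_const = real d * (\<Sum>n. real n powr (-2))"

lemma norm_log_prime_part_le:
  assumes "dirichlet_character q chi" "q > 0" "1 < \<sigma>" "\<sigma> \<le> Re s"
  shows "norm (log_prime_part chi s) \<le> real d * (\<Sum>n. real n powr (-\<sigma>))"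
proof -
  have "norm (log_prime_part chi s) \<le> (\<Sum>n. real d * real n powr (-\<sigma>))"
    unfolding log_prime_part_def
    by (rule norm_suminf_le[OF norm_prime_term_le[OF assms(1,2,4)] summable_mult[OF summable_powr_neg[OF assms(3)]]])
  also have "\<dots> = real d * (\<Sum>n. real n powr (-\<sigma>))"
    by (intro suminf_mult summable_powr_neg assms)
  finally show ?thesis .
qed

lemma rest_const_nonneg: "rest_const \<ge> 0"
  unfolding rest_const_def using two_powr_less
  by (intro divide_nonneg_pos mult_nonneg_nonneg suminf_nonneg summable_powr_neg) auto

lemma prime_zeta_const_nonneg: "prime_zeta_const \<ge> 0"
  unfolding prime_zeta_const_def by (intro mult_nonneg_nonneg suminf_nonneg summable_powr_neg) auto

text \<open>In a zero-free rectangle the logarithm of L exists and is bounded by Borel-Caratheodory on discs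
  centred at \<open>2 + i t\<close>; subtracting the contribution of the prime powers extends the sum over primes.\<close>

lemma log_prime_part_extension:
  fixes C :: real
  assumes growth: "\<And>q chi s. good q chi \<Longrightarrow> Re s \<ge> 1/2 \<Longrightarrow>
      norm (L_fun F chi s) \<le> real (conductor F q) * exp (C * (1 + norm s) powr (3/2))"
    and C: "C > 0"
    and good: "good q chi" and \<sigma>: "3/4 \<le> \<sigma>" "\<sigma> < 1" and T: "T \<ge> 3"
    and free: "\<And>s. Re s \<ge> \<sigma> \<Longrightarrow> \<bar>Im s\<bar> \<le> T \<Longrightarrow> L_fun F chi s \<noteq> 0"
  obtains G where "G holomorphic_on {s. Re s > \<sigma> \<and> \<bar>Im s\<bar> < T}"
    "\<And>s. Re s > 1 \<Longrightarrow> \<bar>Im s\<bar> < T \<Longrightarrow> G s = log_prime_part chi s"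
    "\<And>s. (1 + \<sigma>) / 2 \<le> Re s \<Longrightarrow> Re s \<le> 2 \<Longrightarrow> \<bar>Im s\<bar> \<le> T - 2 \<Longrightarrow>
       norm (G s) \<le> 10 / (1 - \<sigma>) * (ln (real (conductor F q)) + C * (5 + T) powr (3/2) + 1 + 2 * (prime_zeta_const + rest_const))"
proof -
  have chi: "dirichlet_character q chi" "q > 0" using good by (auto simp: good_def)
  have N: "real (conductor F q) \<ge> 1" using good by (simp add: good_def)
  let ?D = "{s. Re s > \<sigma> \<and> \<bar>Im s\<bar> < T}"
  have Deq: "?D = {s. Re s > \<sigma>} \<inter> {s. Im s < T} \<inter> {s. Im s > - T}" by auto
  have D: "convex ?D" "open ?D"
    unfolding Deq by (intro convex_Int convex_halfspace_Re_gt convex_halfspace_Im_lt convex_halfspace_Im_gt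
        open_Int open_halfspace_Re_gt open_halfspace_Im_lt open_halfspace_Im_gt)+
  have "2 \<in> ?D" using \<sigma> T by simp
  then obtain g where g: "g holomorphic_on ?D" "\<And>s. s \<in> ?D \<Longrightarrow> exp (g s) = L_fun F chi s"
  proof (rule holomorphic_logarithm_exists[OF D, rotated 2])
    show "L_fun F chi holomorphic_on ?D" by (rule holomorphic_on_subset[OF L_fun_holomorphic[OF good]]) simp
    show "L_fun F chi s \<noteq> 0" if "s \<in> ?D" for s using free[of s] that by simp
  qed blast
  let ?D1 = "?D \<inter> {s. Re s > 1}"
  define h where "h s = g s - log_prime_part chi s - log_rest chi s" for s
  have eh: "exp (h s) = 1" if "s \<in> ?D1" for s
  proof -
    have "exp (g s) = exp (log_prime_part chi s + log_rest chi s)"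
      using g(2)[of s] that L_fun_series[OF good, of s] L_series_exp[OF good, of s] by simp
    then show ?thesis by (simp add: h_def exp_diff exp_add)
  qed
  \<comment> \<open>The values of \<open>h\<close> are multiples of 2 pi i, hence either equal or at
    least 2 pi apart; on a connected set \<open>h\<close> is a single one of them. Subtracting it
    from \<open>g\<close> selects the branch that agrees with the Euler product.\<close>
  have "h constant_on ?D1"
  proof (rule continuous_discrete_range_constant)
    show "connected ?D1" using D(1) by (intro convex_connected convex_Int convex_halfspace_Re_gt)
    show "continuous_on ?D1 h"
      unfolding h_def
      by (intro continuous_intros holomorphic_on_imp_continuous_on holomorphic_on_subset[OF g(1)]
            holomorphic_on_subset[OF log_prime_part_holomorphic[OF chi]] holomorphic_on_subset[OF log_rest_holomorphic[OF chi]]) auto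
    fix x assume x: "x \<in> ?D1"
    show "\<exists>e>0. \<forall>y. y \<in> ?D1 \<and> h y \<noteq> h x \<longrightarrow> e \<le> norm (h y - h x)"
    proof (intro exI[of _ "2 * pi"] conjI allI impI)
      fix y assume y: "y \<in> ?D1 \<and> h y \<noteq> h x"
      show "2 * pi \<le> norm (h y - h x)"
      proof (rule ccontr)
        assume "\<not> 2 * pi \<le> norm (h y - h x)"
        then have "\<bar>Im (h y) - Im (h x)\<bar> < 2 * pi" using abs_Im_le_cmod[of "h y - h x"] by simp
        moreover have "exp (h y) = exp (h x)" using eh[of x] eh[of y] x y by simp
        ultimately have "h y = h x" by (rule exp_complex_eqI)
        then show False using y by simp
      qed
    qed simp
  qed
  then obtain k where k: "\<And>s. s \<in> ?D1 \<Longrightarrow> h s = k" unfolding constant_on_def by blast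
  have "2 \<in> ?D1" using \<open>2 \<in> ?D\<close> by simp
  then have ek: "exp k = 1" using k eh by metis
  define f where "f s = g s - k" for s
  define G where "G s = f s - log_rest chi s" for s
  have f: "f holomorphic_on ?D" "\<And>s. s \<in> ?D \<Longrightarrow> exp (f s) = L_fun F chi s"
    unfolding f_def using g ek by (auto simp: exp_diff intro!: holomorphic_intros)
  have Gl: "G s = log_prime_part chi s" if "Re s > 1" "\<bar>Im s\<bar> < T" for s
    using k[of s] that \<sigma> by (simp add: G_def f_def h_def algebra_simps)
  define A where "A = ln (real (conductor F q)) + C * (5 + T) powr (3/2) + 1"
  define c where "c = prime_zeta_const + rest_const"
  have c: "c \<ge> 0" using rest_const_nonneg prime_zeta_const_nonneg by (simp add: c_def)
  have A: "A \<ge> 1" using N C by (simp add: A_def)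
  have bound: "norm (G s) \<le> 10 / (1 - \<sigma>) * (A + 2 * c)" if s: "(1 + \<sigma>) / 2 \<le> Re s" "Re s \<le> 2" "\<bar>Im s\<bar> \<le> T - 2" for s
  proof -
    define w where "w = Complex 2 (Im s)"
    define R where "R = 2 - \<sigma>"
    define r where "r = 2 - (1 + \<sigma>) / 2"
    have in_D: "z \<in> ?D" "Re z \<ge> 1/2" "norm z \<le> 4 + T" if z: "z \<in> ball w R" for z
    proof -
      have 1: "\<bar>Re z - 2\<bar> < R" "\<bar>Im z - Im s\<bar> < R"
        using z abs_Re_le_cmod[of "w - z"] abs_Im_le_cmod[of "w - z"] by (auto simp: w_def dist_norm)
      then show "z \<in> ?D" "Re z \<ge> 1/2" using s(3) \<sigma> by (auto simp: R_def)
      have "\<bar>Re z\<bar> \<le> 4" "\<bar>Im z\<bar> \<le> T" using 1 s(3) \<sigma> by (auto simp: R_def)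
      then show "norm z \<le> 4 + T" using cmod_le[of z] by linarith
    qed
    have Ref: "Re (f z) < A" if z: "z \<in> ball w R" for z
    proof -
      have "exp (Re (f z)) = norm (L_fun F chi z)" using f(2)[OF in_D(1)[OF z]] by (metis norm_exp_eq_Re)
      also have "\<dots> \<le> real (conductor F q) * exp (C * (1 + norm z) powr (3/2))" by (rule growth[OF good in_D(2)[OF z]])
      also have "\<dots> \<le> real (conductor F q) * exp (C * (5 + T) powr (3/2))"
        using in_D(3)[OF z] C N by (intro mult_left_mono) (auto intro!: powr_mono2)
      also have "\<dots> = exp (A - 1)" using N by (simp add: A_def exp_add)
      finally show ?thesis by simp
    qed
    have "norm (s - w) = 2 - Re s" using s by (simp add: w_def cmod_def complex_diff)
    then have sw: "norm (s - w) \<le> r" using s by (simp add: r_def)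
    have rR: "r < R" "R - r = (1 - \<sigma>) / 2" "r \<le> 2" using \<sigma> by (auto simp: r_def R_def field_simps)
    have fw: "norm (f w) \<le> c"
    proof -
      have "f w = log_prime_part chi w + log_rest chi w"
        using Gl[of w] s T by (simp add: w_def G_def algebra_simps)
      also have "norm \<dots> \<le> norm (log_prime_part chi w) + norm (log_rest chi w)" by (rule norm_triangle_ineq)
      also have "\<dots> \<le> prime_zeta_const + rest_const"
        using norm_log_prime_part_le[OF chi, of 2 w] norm_log_rest_le[OF chi, of w]
        by (intro add_mono) (auto simp: w_def prime_zeta_const_def)
      finally show ?thesis by (simp add: c_def)
    qed
    have "norm (f s - f w) \<le> 2 * r / (R - r) * (A - Re (f w))"
      by (rule Borel_Caratheodory[OF holomorphic_on_subset[OF f(1)] Ref sw rR(1)]) (use in_D in auto)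
    also have "\<dots> \<le> 4 / ((1 - \<sigma>) / 2) * (A + c)"
    proof (rule mult_mono)
      show "2 * r / (R - r) \<le> 4 / ((1 - \<sigma>) / 2)" unfolding rR(2) using rR(3) \<sigma> by (intro divide_right_mono) auto
      show "A - Re (f w) \<le> A + c" using fw abs_Re_le_cmod[of "f w"] by linarith
      show "0 \<le> A - Re (f w)" using Ref[of w] \<sigma> by (simp add: R_def)
    qed (use \<sigma> in auto)
    finally have 1: "norm (f s - f w) \<le> 8 / (1 - \<sigma>) * (A + c)" by simp
    have 2: "norm (log_rest chi s) \<le> c"
      using norm_log_rest_le[OF chi, of s] s \<sigma> prime_zeta_const_nonneg by (simp add: c_def)
    have "norm (G s) \<le> norm (f s - f w) + norm (f w) + norm (log_rest chi s)"
      using norm_triangle_ineq[of "f s - f w" "f w - log_rest chi s"] norm_triangle_ineq4[of "f w" "log_rest chi s"]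
      by (simp add: G_def)
    also have "\<dots> \<le> 8 / (1 - \<sigma>) * (A + c) + 2 * c" using 1 2 fw by simp
    also have "\<dots> \<le> 8 / (1 - \<sigma>) * (A + 2 * c) + 2 / (1 - \<sigma>) * (A + 2 * c)"
    proof (rule add_mono)
      show "8 / (1 - \<sigma>) * (A + c) \<le> 8 / (1 - \<sigma>) * (A + 2 * c)" using c \<sigma> by (intro mult_left_mono) auto
      have "2 * c \<le> 1 * (A + 2 * c)" using A by simp
      also have "\<dots> \<le> 2 / (1 - \<sigma>) * (A + 2 * c)" using \<sigma> A c by (intro mult_right_mono) (auto simp: field_simps)
      finally show "2 * c \<le> 2 / (1 - \<sigma>) * (A + 2 * c)" .
    qed
    also have "\<dots> = 10 / (1 - \<sigma>) * (A + 2 * c)" by (simp add: add_divide_distrib[symmetric] distrib_right[symmetric])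
    finally show ?thesis .
  qed
  have "G holomorphic_on ?D"
    unfolding G_def using \<sigma> by (intro holomorphic_intros f(1) holomorphic_on_subset[OF log_rest_holomorphic[OF chi]]) auto
  then show ?thesis using that[OF _ Gl] bound unfolding A_def c_def by blast
qed

end

section \<open>Prime sums in a zero-free region\<close>

lemma arctan_le_self:
  assumes "x \<ge> 0"
  shows "arctan x \<le> (x::real)"
proof -
  have "0 - arctan 0 \<le> x - arctan x"
  proof (rule DERIV_nonneg_imp_nondecreasing[OF assms])
    fix t :: real
    have "((\<lambda>t. t - arctan t) has_real_derivative 1 - inverse (1 + t\<^sup>2)) (at t)"
      by (auto intro!: derivative_eq_intros)
    moreover have "inverse (1 + t\<^sup>2) \<le> 1" by (simp add: inverse_le_1_iff add_nonneg_eq_0_iff)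
    ultimately show "\<exists>y. ((\<lambda>t. t - arctan t) has_real_derivative y) (at t) \<and> 0 \<le> y" by force
  qed
  then show ?thesis by simp
qed

lemma integral_one_plus_square_interval:
  assumes "T > 0"
  shows "((\<lambda>t. 1 / (1 + t\<^sup>2)) has_integral 2 * arctan T) {-T..T}"
proof -
  have "((\<lambda>t. 1 / (1 + t\<^sup>2)) has_integral arctan T - arctan (-T)) {-T..T}"
    using assms by (intro fundamental_theorem_of_calculus)
      (auto simp: has_real_derivative_iff_has_vector_derivative[symmetric] inverse_eq_divide intro!: derivative_eq_intros)
  then show ?thesis by (simp add: arctan_minus)
qed

text \<open>The mass of 1 / (1 + t^2) beyond T is 2 arctan (1 / T) \<le> 2 / T.\<close>

lemma integral_decay_truncate:
  fixes f :: "real \<Rightarrow> complex"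
  assumes cont: "continuous_on UNIV f" and bound: "\<And>t. norm (f t) \<le> K / (1 + t\<^sup>2)" and T: "T > 0"
  shows "norm ((LINT t|lborel. f t) - integral {-T..T} f) \<le> 2 * K / T"
proof -
  let ?g = "\<lambda>t::real. 1 / (1 + t\<^sup>2)"
  let ?I = "indicator {-T..T} :: real \<Rightarrow> real"
  have K: "K \<ge> 0" using order.trans[OF norm_ge_zero bound[of 0]] by simp
  have f: "integrable lborel f" by (rule integrable_decay[OF cont bound])
  have iI: "integrable lborel (\<lambda>t. ?I t *\<^sub>R h t)" "integral {-T..T} h = (LINT t|lborel. ?I t *\<^sub>R h t)"
    if "integrable lborel h" for h :: "real \<Rightarrow> 'a::euclidean_space"
  proof -
    have "set_integrable lborel {-T..T} h"
      unfolding set_integrable_def using integrable_mult_indicator[of "{-T..T}" lborel h] that by simp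
    from set_borel_integral_eq_integral(2)[OF this] this
    show "integrable lborel (\<lambda>t. ?I t *\<^sub>R h t)" "integral {-T..T} h = (LINT t|lborel. ?I t *\<^sub>R h t)"
      by (simp_all add: set_lebesgue_integral_def set_integrable_def)
  qed
  have "norm ((LINT t|lborel. f t) - integral {-T..T} f) = norm (LINT t|lborel. f t - ?I t *\<^sub>R f t)"
    using f iI[OF f] by simp
  also have "\<dots> \<le> (LINT t|lborel. K * (?g t - ?I t *\<^sub>R ?g t))"
  proof (rule Bochner_Integration.integral_norm_bound_integral)
    show "integrable lborel (\<lambda>t. f t - ?I t *\<^sub>R f t)" using f iI[OF f] by simp
    show "integrable lborel (\<lambda>t. K * (?g t - ?I t *\<^sub>R ?g t))"
      using integrable_one_plus_square iI(1)[OF integrable_one_plus_square] by (intro integrable_mult_right Bochner_Integration.integrable_diff)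
    show "norm (f t - ?I t *\<^sub>R f t) \<le> K * (?g t - ?I t *\<^sub>R ?g t)" for t
      using bound[of t] by (auto simp: indicator_def)
  qed
  also have "\<dots> = K * (pi - integral {-T..T} ?g)"
    using integrable_one_plus_square iI[OF integrable_one_plus_square] integral_one_plus_square by simp
  also have "integral {-T..T} ?g = 2 * arctan T"
    by (rule integral_unique[OF integral_one_plus_square_interval[OF T]])
  also have "pi - 2 * arctan T = 2 * arctan (1 / T)" using arctan_inverse[of T] T by (simp add: inverse_eq_divide)
  also have "K * (2 * arctan (1 / T)) \<le> K * (2 * (1 / T))"
    using arctan_le_self[of "1 / T"] T K by (intro mult_left_mono) auto
  finally show ?thesis by (simp add: mult.commute)
qed

lemma norm_integral_interval_decay:
  fixes f :: "real \<Rightarrow> complex"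
  assumes "continuous_on {-T..T} f" "\<And>t. t \<in> {-T..T} \<Longrightarrow> norm (f t) \<le> K / (1 + t\<^sup>2)" "T > 0"
  shows "norm (integral {-T..T} f) \<le> K * pi"
proof -
  have K: "K \<ge> 0" using order.trans[OF norm_ge_zero assms(2)[of 0]] assms(3) by simp
  have i: "((\<lambda>t. K * (1 / (1 + t\<^sup>2))) has_integral K * (2 * arctan T)) {-T..T}"
    by (intro has_integral_mult_right integral_one_plus_square_interval assms)
  have "norm (integral {-T..T} f) \<le> integral {-T..T} (\<lambda>t. K * (1 / (1 + t\<^sup>2)))"
    using assms(2) by (intro integral_norm_bound_integral[OF integrable_continuous_interval[OF assms(1)] has_integral_integrable[OF i]]) auto
  also have "\<dots> = K * (2 * arctan T)" by (rule integral_unique[OF i])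
  also have "\<dots> \<le> K * pi" using arctan_ubound[of T] K by (intro mult_left_mono) auto
  finally show ?thesis .
qed

text \<open>Comparison with a telescoping sum through the mean value theorem. The explicit 1 / (c -
  1) matters: with c = 1 + 1 / L it costs one factor L.\<close>

lemma sum_powr_neg_le:
  assumes "c > 1"
  shows "(\<Sum>n. real n powr (-c)) \<le> 1 + 1 / (c - 1)"
proof -
  have sm: "summable (\<lambda>n. real n powr (-c))" using summable_real_powr_iff[of "-c"] assms by simp
  have step: "real (Suc (Suc n)) powr (-c) \<le> (real (Suc n) powr (1 - c) - real (Suc (Suc n)) powr (1 - c)) / (c - 1)" for n
  proof -
    have "\<exists>z. real (Suc n) < z \<and> z < real (Suc (Suc n)) \<and>
       real (Suc (Suc n)) powr (1 - c) - real (Suc n) powr (1 - c) = (real (Suc (Suc n)) - real (Suc n)) * ((1 - c) * z powr (1 - c - 1))"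
      by (rule MVT2) (auto intro!: derivative_eq_intros)
    then obtain z where z: "real (Suc n) < z" "z < real (Suc (Suc n))"
       "real (Suc (Suc n)) powr (1 - c) - real (Suc n) powr (1 - c) = (real (Suc (Suc n)) - real (Suc n)) * ((1 - c) * z powr (1 - c - 1))" by blast
    have "real (Suc (Suc n)) powr (-c) \<le> z powr (-c)" using z assms by (intro powr_mono2') auto
    moreover have "z powr (-c) = (real (Suc n) powr (1 - c) - real (Suc (Suc n)) powr (1 - c)) / (c - 1)"
      using z(3) assms by (simp add: field_simps)
    ultimately show ?thesis by simp
  qed
  have lim: "(\<lambda>n. real (Suc n) powr (1 - c)) \<longlonglongrightarrow> 0"
    using assms by real_asymp
  have tel: "(\<lambda>n. real (Suc n) powr (1 - c) - real (Suc (Suc n)) powr (1 - c)) sums (real (Suc 0) powr (1 - c) - 0)"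
    by (rule telescope_sums'[OF lim])
  have "(\<Sum>n. real (Suc (Suc n)) powr (-c)) \<le> (\<Sum>n. (real (Suc n) powr (1 - c) - real (Suc (Suc n)) powr (1 - c)) / (c - 1))"
  proof (intro suminf_le step)
    show "summable (\<lambda>n. real (Suc (Suc n)) powr (-c))"
      using summable_ignore_initial_segment[OF sm, of 2] by (simp add: numeral_2_eq_2)
    show "summable (\<lambda>n. (real (Suc n) powr (1 - c) - real (Suc (Suc n)) powr (1 - c)) / (c - 1))"
      using tel by (intro summable_divide sums_summable)
  qed
  also have "\<dots> = 1 / (c - 1)"
    using sums_unique[OF sums_divide[OF tel, of "c - 1"]] by simp
  finally have "(\<Sum>n. real (n + 2) powr (-c)) \<le> 1 / (c - 1)" by simp
  moreover have "(\<Sum>n. real n powr (-c)) = (\<Sum>n. real (n + 2) powr (-c)) + (\<Sum>n<2. real n powr (-c))"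
    by (rule suminf_split_initial_segment[OF sm])
  ultimately show ?thesis by (simp add: numeral_2_eq_2)
qed

context L_family
begin

text \<open>The weight x - n corresponds to the kernel 1 / (s (s + 1)) on the Mellin side, whereas
  the sharp cutoff would lead to a conditionally convergent integral.\<close>

definition prime_riesz :: "(int \<Rightarrow> complex) \<Rightarrow> real \<Rightarrow> complex" where
  "prime_riesz chi x = (\<Sum>n | real n \<le> x. prime_coeff chi n * of_real (x - real n))"

text \<open>For a partial sum of the Dirichlet series the integral is evaluated term by term; once Y
  exceeds x it does not depend on Y any more. The remainder is small uniformly in t. That x is no
  natural number keeps the logarithm in \<open>perron_kernel\<close> different from 0.\<close>

lemma prime_riesz_perron:
  assumes chi: "dirichlet_character q chi" "q > 0" and c: "1 < c" and x: "x > 1" "x \<notin> \<nat>"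
  shows "of_real (2 * pi / x) * prime_riesz chi x =
    (LINT t|lborel. log_prime_part chi (Complex c t) * (exp (Complex c t * of_real (ln x)) / (Complex c t * (Complex c t + 1))))"
    (is "?L = (LINT t|lborel. log_prime_part chi (?s t) * ?K t)")
proof -
  define l where "l Y t = (\<Sum>n<Y. prime_coeff chi n / of_nat n powr (?s t))" for Y t
  have Kc: "continuous_on UNIV (\<lambda>t. exp (?s t * of_real l) / (?s t * (?s t + 1)))" for l :: real
  proof (intro continuous_intros ballI)
    fix t have "?s t \<noteq> 0" "?s t + 1 \<noteq> 0" using c by (auto simp: complex_eq_iff)
    then show "?s t * (?s t + 1) \<noteq> 0" by simp
  qed
  have Kb: "norm (exp (?s t * of_real l) / (?s t * (?s t + 1))) \<le> 2 * exp (c * l) / (1 + t\<^sup>2)" for l t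
    using norm_perron_kernel[of 1 "?s t" l] c by simp
  have fin: "{n. real n \<le> x} = {..nat \<lfloor>x\<rfloor>}"
    using x by (auto simp: le_nat_iff le_floor_iff)
  have eqY: "(LINT t|lborel. l Y t * ?K t) = ?L" if Y: "Y > nat \<lfloor>x\<rfloor>" for Y
  proof -
    have trm: "prime_coeff chi n / of_nat n powr (?s t) * ?K t =
        prime_coeff chi n * (exp (?s t * of_real (ln x - ln (real n))) / (?s t * (?s t + 1)))" for n t
    proof (cases "n = 0")
      case False
      have "exp (?s t * of_real (ln x)) / of_nat n powr (?s t) = exp (?s t * of_real (ln x - ln (real n)))"
        using False by (simp add: of_nat_powr_exp right_diff_distrib exp_diff)
      moreover have "a / b * (e / D) = a * ((e / b) / D)" for a b e D :: complex by simp
      ultimately show ?thesis by (simp only:)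
    qed (simp add: prime_coeff_def)
    have int: "integrable lborel (\<lambda>t. prime_coeff chi n * (exp (?s t * of_real (ln x - ln (real n))) / (?s t * (?s t + 1))))" for n
      by (intro integrable_mult_right integrable_decay[OF Kc Kb])
    have "(LINT t|lborel. l Y t * ?K t) = (LINT t|lborel. (\<Sum>n<Y. prime_coeff chi n * (exp (?s t * of_real (ln x - ln (real n))) / (?s t * (?s t + 1)))))"
      unfolding l_def sum_distrib_right trm ..
    also have "\<dots> = (\<Sum>n<Y. prime_coeff chi n * (LINT t|lborel. exp (?s t * of_real (ln x - ln (real n))) / (?s t * (?s t + 1))))"
      by (subst Bochner_Integration.integral_sum[OF int]) (intro sum.cong refl integral_mult_right_zero)
    also have "\<dots> = (\<Sum>n<Y. if real n \<le> x then of_real (2 * pi / x) * (prime_coeff chi n * of_real (x - real n)) else 0)"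
    proof (intro sum.cong refl)
      fix n
      show "prime_coeff chi n * (LINT t|lborel. exp (?s t * of_real (ln x - ln (real n))) / (?s t * (?s t + 1))) =
         (if real n \<le> x then of_real (2 * pi / x) * (prime_coeff chi n * of_real (x - real n)) else 0)"
      proof (cases "prime n")
        case True
        then have n: "real n > 0" using prime_gt_0_nat by simp
        have ne: "real n \<noteq> x" using x by auto
        then have "ln x - ln (real n) \<noteq> 0" using n x by simp
        then have "(LINT t|lborel. exp (?s t * of_real (ln x - ln (real n))) / (?s t * (?s t + 1))) =
           2 * pi * of_real (if ln x - ln (real n) > 0 then 1 - exp (-(ln x - ln (real n))) else 0)"
          using c by (intro perron_kernel) auto
        also have "ln x - ln (real n) > 0 \<longleftrightarrow> real n \<le> x" using n x ne by auto
        also have "exp (-(ln x - ln (real n))) = real n / x" using n x by (simp add: exp_diff)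
        finally show ?thesis using x by (simp add: field_simps)
      qed (simp add: prime_coeff_def)
    qed
    also have "\<dots> = (\<Sum>n\<in>{..<Y} \<inter> {n. real n \<le> x}. of_real (2 * pi / x) * (prime_coeff chi n * of_real (x - real n)))"
      by (simp only: sum.inter_restrict[OF finite_lessThan] mem_Collect_eq)
    also have "{..<Y} \<inter> {n. real n \<le> x} = {n. real n \<le> x}" unfolding fin using Y by auto
    finally show ?thesis by (simp add: prime_riesz_def sum_distrib_left)
  qed
  have s1: "Re (?s t) > 1" for t using c by simp
  define tail where "tail Y = (\<Sum>n. real d * real (n + Y) powr (-c))" for Y
  have sm: "summable (\<lambda>n. real d * real n powr (-c))" by (intro summable_mult summable_powr_neg c)
  have tl: "norm (log_prime_part chi (?s t) - l Y t) \<le> tail Y" for Y t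
  proof -
    have "log_prime_part chi (?s t) - l Y t = (\<Sum>n. prime_coeff chi (n + Y) / of_nat (n + Y) powr (?s t))"
      unfolding log_prime_part_def l_def by (rule suminf_minus_initial_segment[symmetric, OF summable_prime_terms[OF chi s1]])
    also have "norm \<dots> \<le> tail Y"
      unfolding tail_def by (rule norm_suminf_le[OF norm_prime_term_le[OF chi] summable_ignore_initial_segment[OF sm]]) simp
    finally show ?thesis .
  qed
  have t0: "tail \<longlonglongrightarrow> 0" unfolding tail_def by (rule suminf_exist_split2[OF sm])
  have lc: "continuous_on UNIV (\<lambda>t. l Y t)" for Y
  proof -
    have "continuous_on UNIV (\<lambda>t. prime_coeff chi n / of_nat n powr (?s t))" for n
      by (cases "n = 0") (auto simp: prime_coeff_def of_nat_powr_exp intro!: continuous_intros)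
    then show ?thesis unfolding l_def by (intro continuous_on_sum)
  qed
  have Lc: "continuous_on UNIV (\<lambda>t. log_prime_part chi (?s t))"
    by (rule continuous_on_compose2[OF holomorphic_on_imp_continuous_on[OF log_prime_part_holomorphic[OF chi]]])
       (use c in \<open>auto intro!: continuous_intros\<close>)
  let ?J = "LINT t|lborel. log_prime_part chi (?s t) * ?K t"
  have db: "norm ((log_prime_part chi (?s t) - l Y t) * ?K t) \<le> (tail Y * (2 * exp (c * ln x))) / (1 + t\<^sup>2)" for Y t
  proof -
    have "norm ((log_prime_part chi (?s t) - l Y t) * ?K t) = norm (log_prime_part chi (?s t) - l Y t) * norm (?K t)"
      by (rule norm_mult)
    also have "\<dots> \<le> tail Y * (2 * exp (c * ln x) / (1 + t\<^sup>2))"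
      using tl[of t Y] Kb[of t "ln x"] by (intro mult_mono) (auto intro: order.trans[OF norm_ge_zero])
    also have "\<dots> = (tail Y * (2 * exp (c * ln x))) / (1 + t\<^sup>2)" by (rule times_divide_eq_right)
    finally show ?thesis .
  qed
  have dc: "continuous_on UNIV (\<lambda>t. (log_prime_part chi (?s t) - l Y t) * ?K t)" for Y
    by (intro continuous_on_mult continuous_on_diff Lc lc Kc)
  have lK: "integrable lborel (\<lambda>t. l Y t * ?K t)" for Y
  proof (rule integrable_decay[OF continuous_on_mult[OF lc Kc]])
    fix t
    have "norm (l Y t) \<le> (\<Sum>n<Y. real d * real n powr (-c))"
      unfolding l_def by (rule order.trans[OF norm_sum sum_mono]) (use norm_prime_term_le[OF chi, of c "?s t"] in auto)
    then have "norm (l Y t) * norm (?K t) \<le> (\<Sum>n<Y. real d * real n powr (-c)) * (2 * exp (c * ln x) / (1 + t\<^sup>2))"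
      using Kb[of t "ln x"] by (intro mult_mono) (auto intro!: sum_nonneg)
    also have "\<dots> = ((\<Sum>n<Y. real d * real n powr (-c)) * (2 * exp (c * ln x))) / (1 + t\<^sup>2)" by (rule times_divide_eq_right)
    finally show "norm (l Y t * ?K t) \<le> ((\<Sum>n<Y. real d * real n powr (-c)) * (2 * exp (c * ln x))) / (1 + t\<^sup>2)"
      unfolding norm_mult[of "l Y t"] .
  qed
  have "norm (?J - ?L) \<le> (tail Y * (2 * exp (c * ln x))) * pi" if Y: "Y > nat \<lfloor>x\<rfloor>" for Y
  proof -
    have "(LINT t|lborel. log_prime_part chi (?s t) * ?K t) = (LINT t|lborel. (log_prime_part chi (?s t) - l Y t) * ?K t + l Y t * ?K t)"
      by (simp only: left_diff_distrib diff_add_cancel)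
    also have "\<dots> = (LINT t|lborel. (log_prime_part chi (?s t) - l Y t) * ?K t) + (LINT t|lborel. l Y t * ?K t)"
      by (rule Bochner_Integration.integral_add[OF integrable_decay[OF dc db] lK])
    finally have "?J - ?L = (LINT t|lborel. (log_prime_part chi (?s t) - l Y t) * ?K t)" using eqY[OF Y] by simp
    then show ?thesis using norm_integral_decay[OF dc db, of Y] by simp
  qed
  then have "\<forall>\<^sub>F Y in sequentially. norm (?J - ?L) \<le> (tail Y * (2 * exp (c * ln x))) * pi"
    using eventually_gt_at_top[of "nat \<lfloor>x\<rfloor>"] by (rule eventually_mono[rotated])
  moreover have "(\<lambda>Y. (tail Y * (2 * exp (c * ln x))) * pi) \<longlonglongrightarrow> (0 * (2 * exp (c * ln x))) * pi"
    by (intro tendsto_intros t0)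
  ultimately have "norm (?J - ?L) \<le> 0"
    by (intro tendsto_lowerbound[of "\<lambda>Y. (tail Y * (2 * exp (c * ln x))) * pi" 0 sequentially]) auto
  then show ?thesis by simp
qed

text \<open>The bound of \<open>log_prime_part_extension\<close> for the continued prime part on and
  to the right of Re s = (1 + \<sigma>) / 2.\<close>

definition log_bound :: "real \<Rightarrow> nat \<Rightarrow> real \<Rightarrow> real \<Rightarrow> real" where
  "log_bound C q \<sigma> T = 10 / (1 - \<sigma>) * (ln (real (conductor F q)) + C * (5 + T) powr (3/2) + 1 + 2 * (prime_zeta_const + rest_const))"

text \<open>The three terms come from the part of the line Re s = c above height T - 2, where the
  absolutely convergent series is used; from the horizontal sides of the contour; and from its left
  side on Re s = (1 + \<sigma>) / 2.\<close>

lemma norm_prime_riesz_le: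
  fixes C :: real
  assumes growth: "\<And>q chi s. good q chi \<Longrightarrow> Re s \<ge> 1/2 \<Longrightarrow>
      norm (L_fun F chi s) \<le> real (conductor F q) * exp (C * (1 + norm s) powr (3/2))"
    and C: "C > 0"
    and good: "good q chi" and \<sigma>: "3/4 \<le> \<sigma>" "\<sigma> < 1" and T: "T \<ge> 3"
    and free: "\<And>s. Re s \<ge> \<sigma> \<Longrightarrow> \<bar>Im s\<bar> \<le> T \<Longrightarrow> L_fun F chi s \<noteq> 0"
    and c: "1 < c" "c \<le> 3/2" and x: "x > 1" "x \<notin> \<nat>"
  shows "norm (prime_riesz chi x) \<le> x * (real d * (1 + 1 / (c - 1)) * x powr c / (T - 2) +
     log_bound C q \<sigma> T * x powr c / (T - 2)\<^sup>2 + 2 * log_bound C q \<sigma> T * x powr ((1 + \<sigma>) / 2))"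
proof -
  have chi: "dirichlet_character q chi" "q > 0" using good by (auto simp: good_def)
  obtain G where G: "G holomorphic_on {s. Re s > \<sigma> \<and> \<bar>Im s\<bar> < T}"
    "\<And>s. Re s > 1 \<Longrightarrow> \<bar>Im s\<bar> < T \<Longrightarrow> G s = log_prime_part chi s"
    "\<And>s. (1 + \<sigma>) / 2 \<le> Re s \<Longrightarrow> Re s \<le> 2 \<Longrightarrow> \<bar>Im s\<bar> \<le> T - 2 \<Longrightarrow> norm (G s) \<le> log_bound C q \<sigma> T"
    unfolding log_bound_def using log_prime_part_extension[OF growth C good \<sigma> T free] by blast
  define B where "B = log_bound C q \<sigma> T"
  define Z where "Z = real d * (1 + 1 / (c - 1))"
  define H where "H = T - 2"
  define \<sigma>1 where "\<sigma>1 = (1 + \<sigma>) / 2"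
  have H: "H \<ge> 1" using T by (simp add: H_def)
  have s1: "7/8 \<le> \<sigma>1" "\<sigma>1 < 1" "\<sigma> < \<sigma>1" using \<sigma> by (auto simp: \<sigma>1_def)
  have Z: "Z \<ge> 0" using c by (simp add: Z_def)
  have B: "B \<ge> 0" using order.trans[OF norm_ge_zero G(3)[of \<sigma>1]] s1 T unfolding B_def \<sigma>1_def by simp
  define K where "K s = exp (s * of_real (ln x)) / (s * (s + 1))" for s :: complex
  have ex: "exp (a * ln x) = x powr a" for a using x by (simp add: powr_def)
  have Kb: "norm (K s) \<le> 2 * x powr Re s / (1 + (Im s)\<^sup>2)" if "Re s \<ge> 1 \<or> \<bar>Im s\<bar> \<ge> 1" for s
    using norm_perron_kernel[of 1 s "ln x"] that ex unfolding K_def by auto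
  have Kb2: "norm (K s) \<le> 32/9 * x powr Re s / (1 + (Im s)\<^sup>2)" if "Re s \<ge> 3/4" for s
    using norm_perron_kernel[of "3/4" s "ln x"] that ex unfolding K_def by (simp add: power2_eq_square)
  have Khol: "K holomorphic_on {s. Re s > 0}"
  proof -
    have "s * (s + 1) \<noteq> 0" if "Re s > 0" for s :: complex
    proof -
      have "s \<noteq> 0" "s + 1 \<noteq> 0" using that by (auto simp: complex_eq_iff)
      then show ?thesis by simp
    qed
    then show ?thesis unfolding K_def by (intro holomorphic_intros) auto
  qed
  let ?D = "{s. Re s > \<sigma> \<and> \<bar>Im s\<bar> < T}"
  define f where "f s = G s * K s" for s
  have Deq: "?D = {s. Re s > \<sigma>} \<inter> {s. Im s < T} \<inter> {s. Im s > - T}" by auto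
  have D: "convex ?D"
    unfolding Deq by (intro convex_Int convex_halfspace_Re_gt convex_halfspace_Im_lt convex_halfspace_Im_gt)
  have fhol: "f holomorphic_on ?D"
    unfolding f_def using \<sigma> by (intro holomorphic_intros G(1) holomorphic_on_subset[OF Khol]) auto
  let ?p = "rectpath (Complex \<sigma>1 (-H)) (Complex c H)"
  have pD: "path_image ?p \<subseteq> ?D" using s1 c H T by (auto simp: path_image_rectpath H_def)
  have "contour_integral ?p f = 0"
    by (intro contour_integral_unique Cauchy_theorem_convex_simple[OF fhol D _ pD]) auto
  moreover have "norm (contour_integral ?p f - \<i> * (integral {-H..H} (\<lambda>t. f (Complex c t)) - integral {-H..H} (\<lambda>t. f (Complex \<sigma>1 t))))
      \<le> 2 * (c - \<sigma>1) * (B * (2 * x powr c / (1 + H\<^sup>2)))"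
  proof (rule contour_integral_rectpath_vertical)
    show "continuous_on (path_image ?p) f"
      by (rule continuous_on_subset[OF holomorphic_on_imp_continuous_on[OF fhol] pD])
    fix y s assume ys: "y \<in> {\<sigma>1..c}" "\<bar>s\<bar> = H"
    have s2: "s\<^sup>2 = H\<^sup>2" using ys(2) by (metis power2_abs)
    have "norm (K (Complex y s)) \<le> 2 * x powr y / (1 + H\<^sup>2)" using Kb[of "Complex y s"] ys H s2 by simp
    also have "\<dots> \<le> 2 * x powr c / (1 + H\<^sup>2)" using x ys by (intro divide_right_mono mult_left_mono powr_mono) auto
    finally have "norm (K (Complex y s)) \<le> 2 * x powr c / (1 + H\<^sup>2)" .
    moreover have "norm (G (Complex y s)) \<le> B" using G(3)[of "Complex y s"] ys c by (simp add: B_def \<sigma>1_def H_def)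
    ultimately show "norm (f (Complex y s)) \<le> B * (2 * x powr c / (1 + H\<^sup>2))"
      unfolding f_def norm_mult using B by (intro mult_mono) auto
  qed (use s1 c H in auto)
  ultimately have 1: "norm (integral {-H..H} (\<lambda>t. f (Complex c t)) - integral {-H..H} (\<lambda>t. f (Complex \<sigma>1 t)))
      \<le> 2 * (c - \<sigma>1) * (B * (2 * x powr c / (1 + H\<^sup>2)))"
    by (simp add: norm_mult)
  have "2 * (c - \<sigma>1) * (B * (2 * x powr c / (1 + H\<^sup>2))) \<le> 2 * 1 * (B * (2 * x powr c / H\<^sup>2))"
    using c s1 B H by (intro mult_mono mult_left_mono frac_le) (auto intro!: divide_nonneg_nonneg mult_nonneg_nonneg)
  then have 1: "norm (integral {-H..H} (\<lambda>t. f (Complex c t)) - integral {-H..H} (\<lambda>t. f (Complex \<sigma>1 t))) \<le> 4 * (B * x powr c / H\<^sup>2)"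
    using 1 by simp
  have 2: "norm (integral {-H..H} (\<lambda>t. f (Complex \<sigma>1 t))) \<le> (B * (32/9 * x powr \<sigma>1)) * pi"
  proof (rule norm_integral_interval_decay)
    show "continuous_on {-H..H} (\<lambda>t. f (Complex \<sigma>1 t))"
      by (rule continuous_on_compose2[OF holomorphic_on_imp_continuous_on[OF fhol]])
         (use s1 T in \<open>auto intro!: continuous_intros simp: H_def\<close>)
    fix t assume t: "t \<in> {-H..H}"
    have "norm (G (Complex \<sigma>1 t)) \<le> B" using G(3)[of "Complex \<sigma>1 t"] t s1 by (simp add: B_def \<sigma>1_def H_def abs_le_iff)
    moreover have "norm (K (Complex \<sigma>1 t)) \<le> 32/9 * x powr \<sigma>1 / (1 + t\<^sup>2)" using Kb2[of "Complex \<sigma>1 t"] s1 by simp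
    ultimately have "norm (f (Complex \<sigma>1 t)) \<le> B * (32/9 * x powr \<sigma>1 / (1 + t\<^sup>2))"
      unfolding f_def norm_mult using B by (intro mult_mono) auto
    then show "norm (f (Complex \<sigma>1 t)) \<le> (B * (32/9 * x powr \<sigma>1)) / (1 + t\<^sup>2)" by simp
  qed (use H in auto)
  define g where "g t = log_prime_part chi (Complex c t) * K (Complex c t)" for t
  have gc: "continuous_on UNIV g"
    unfolding g_def
  proof (intro continuous_on_mult)
    show "continuous_on UNIV (\<lambda>t. log_prime_part chi (Complex c t))"
      by (rule continuous_on_compose2[OF holomorphic_on_imp_continuous_on[OF log_prime_part_holomorphic[OF chi]]])
         (use c in \<open>auto intro!: continuous_intros\<close>)
    show "continuous_on UNIV (\<lambda>t. K (Complex c t))"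
      by (rule continuous_on_compose2[OF holomorphic_on_imp_continuous_on[OF Khol]])
         (use c in \<open>auto intro!: continuous_intros\<close>)
  qed
  have gb: "norm (g t) \<le> (Z * (2 * x powr c)) / (1 + t\<^sup>2)" for t
  proof -
    have "norm (log_prime_part chi (Complex c t)) \<le> real d * (\<Sum>n. real n powr (-c))"
      using norm_log_prime_part_le[OF chi c(1), of "Complex c t"] by simp
    also have "\<dots> \<le> Z" unfolding Z_def by (intro mult_left_mono sum_powr_neg_le c) auto
    finally have "norm (g t) \<le> Z * (2 * x powr c / (1 + t\<^sup>2))"
      unfolding g_def norm_mult using Kb[of "Complex c t"] c Z by (intro mult_mono) auto
    then show ?thesis by simp
  qed
  have 3: "norm ((LINT t|lborel. g t) - integral {-H..H} g) \<le> 2 * (Z * (2 * x powr c)) / H"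
    using H by (intro integral_decay_truncate gc gb) auto
  have "integral {-H..H} g = integral {-H..H} (\<lambda>t. f (Complex c t))"
    using c T by (intro integral_cong) (auto simp: g_def f_def G(2) H_def)
  then have "norm (LINT t|lborel. g t) \<le> 4 * (Z * x powr c / H) + 4 * (B * x powr c / H\<^sup>2) + 32/9 * pi * (B * x powr \<sigma>1)"
    using 1 2 3 norm_triangle_ineq[of "(LINT t|lborel. g t) - integral {-H..H} g" "integral {-H..H} g"]
      norm_triangle_ineq[of "integral {-H..H} (\<lambda>t. f (Complex c t)) - integral {-H..H} (\<lambda>t. f (Complex \<sigma>1 t))" "integral {-H..H} (\<lambda>t. f (Complex \<sigma>1 t))"]
    by (simp add: mult_ac)
  moreover have "of_real (2 * pi / x) * prime_riesz chi x = (LINT t|lborel. g t)"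
    unfolding g_def K_def by (rule prime_riesz_perron[OF chi c(1) x])
  then have "norm (LINT t|lborel. g t) = 2 * pi / x * norm (prime_riesz chi x)"
    using x by (metis norm_mult norm_of_real abs_of_nonneg divide_nonneg_nonneg less_imp_le mult_nonneg_nonneg pi_ge_zero zero_le_numeral zero_less_one order.strict_trans)
  ultimately have "2 * pi / x * norm (prime_riesz chi x) \<le> 4 * (Z * x powr c / H) + 4 * (B * x powr c / H\<^sup>2) + 32/9 * pi * (B * x powr \<sigma>1)" by simp
  also have "\<dots> \<le> 2 * pi * (Z * x powr c / H) + 2 * pi * (B * x powr c / H\<^sup>2) + 2 * pi * (2 * (B * x powr \<sigma>1))"
    using pi_gt3 B Z H x by (intro add_mono mult_right_mono) (auto intro!: mult_right_mono)
  finally have "2 * pi / x * norm (prime_riesz chi x) \<le> 2 * pi * (Z * x powr c / H + B * x powr c / H\<^sup>2 + 2 * (B * x powr \<sigma>1))"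
    by (simp only: distrib_left)
  then have "2 * pi * (norm (prime_riesz chi x) / x) \<le> 2 * pi * (Z * x powr c / H + B * x powr c / H\<^sup>2 + 2 * (B * x powr \<sigma>1))"
    by simp
  then have "norm (prime_riesz chi x) / x \<le> Z * x powr c / H + B * x powr c / H\<^sup>2 + 2 * (B * x powr \<sigma>1)"
    by (rule mult_left_le_imp_le) simp
  then show ?thesis
    using x unfolding B_def Z_def H_def \<sigma>1_def by (simp add: pos_divide_le_eq mult_ac)
qed

text \<open>The difference of the Riesz means at m + h and m is h times the plain sum, up to h terms
  of size d h each. Half-integers are used as arguments since Perron's formula excludes
  integers.\<close>

lemma prime_sum_differencing:
  assumes chi: "dirichlet_character q chi" "q > 0" and h: "h > 0"
    and V: "norm (prime_riesz chi (real m + 1/2)) \<le> V" "norm (prime_riesz chi (real (m + h) + 1/2)) \<le> V"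
  shows "norm (\<Sum>n\<le>m. prime_coeff chi n) \<le> 2 * V / real h + real d * real h"
proof -
  have set: "{n. real n \<le> real k + 1/2} = {..k}" for k
  proof -
    have "real n \<le> real k + 1/2 \<longleftrightarrow> n \<le> k" for n by linarith
    then show ?thesis by auto
  qed
  have r: "prime_riesz chi (real k + 1/2) = (\<Sum>n\<le>k. prime_coeff chi n * of_real (real k + 1/2 - real n))" for k
    unfolding prime_riesz_def set ..
  define E where "E = (\<Sum>n\<in>{m<..m+h}. prime_coeff chi n * of_real (real (m + h) + 1/2 - real n))"
  have un: "{..m+h} = {..m} \<union> {m<..m+h}" by auto
  have "prime_riesz chi (real (m + h) + 1/2) = (\<Sum>n\<le>m. prime_coeff chi n * of_real (real (m + h) + 1/2 - real n)) + E"
    unfolding r E_def un by (rule sum.union_disjoint) auto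
  also have "(\<Sum>n\<le>m. prime_coeff chi n * of_real (real (m + h) + 1/2 - real n)) =
     prime_riesz chi (real m + 1/2) + of_nat h * (\<Sum>n\<le>m. prime_coeff chi n)"
    unfolding r sum_distrib_left sum.distrib[symmetric] by (intro sum.cong) (auto simp: algebra_simps)
  finally have "of_nat h * (\<Sum>n\<le>m. prime_coeff chi n) = prime_riesz chi (real (m + h) + 1/2) - prime_riesz chi (real m + 1/2) - E"
    by simp
  then have "norm (of_nat h * (\<Sum>n\<le>m. prime_coeff chi n)) \<le> norm (prime_riesz chi (real (m + h) + 1/2)) + norm (prime_riesz chi (real m + 1/2)) + norm E"
    using norm_triangle_ineq4[of "prime_riesz chi (real (m + h) + 1/2) - prime_riesz chi (real m + 1/2)" E]
      norm_triangle_ineq4[of "prime_riesz chi (real (m + h) + 1/2)" "prime_riesz chi (real m + 1/2)"] by simp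
  moreover have "norm E \<le> (\<Sum>n\<in>{m<..m+h}. real d * real h)"
    unfolding E_def
  proof (rule order.trans[OF norm_sum sum_mono])
    fix n assume n: "n \<in> {m<..m+h}"
    then have n': "real m + 1 \<le> real n" "real n \<le> real m + real h" by auto
    have "\<bar>real (m + h) + 1/2 - real n\<bar> \<le> real h" unfolding of_nat_add abs_le_iff using n' by (intro conjI; linarith)
    then show "norm (prime_coeff chi n * of_real (real (m + h) + 1/2 - real n)) \<le> real d * real h"
      unfolding norm_mult norm_of_real by (intro mult_mono norm_prime_coeff_le[OF chi]) auto
  qed
  ultimately have "real h * norm (\<Sum>n\<le>m. prime_coeff chi n) \<le> 2 * V + real h * (real d * real h)"
    using V by (simp add: norm_mult)
  then have "norm (\<Sum>n\<le>m. prime_coeff chi n) \<le> (2 * V + real h * (real d * real h)) / real h"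
    using h by (simp add: pos_le_divide_eq mult.commute)
  then show ?thesis using h by (simp add: add_divide_distrib)
qed

lemma prime_sum_bound:
  fixes C :: real
  assumes growth: "\<And>q chi s. good q chi \<Longrightarrow> Re s \<ge> 1/2 \<Longrightarrow>
      norm (L_fun F chi s) \<le> real (conductor F q) * exp (C * (1 + norm s) powr (3/2))"
    and C: "C > 0"
    and good: "good q chi" and \<sigma>: "3/4 \<le> \<sigma>" "\<sigma> < 1" and T: "T \<ge> 3"
    and free: "\<And>s. Re s \<ge> \<sigma> \<Longrightarrow> \<bar>Im s\<bar> \<le> T \<Longrightarrow> L_fun F chi s \<noteq> 0"
    and c: "1 < c" "c \<le> 3/2" and h: "0 < h" and m: "1 \<le> m" and X: "X = real (m + h) + 1/2"
  shows "norm (\<Sum>n\<le>m. prime_coeff chi n) \<le> 2 * X / real h * (real d * (1 + 1 / (c - 1)) * X powr c / (T - 2) +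
     log_bound C q \<sigma> T * X powr c / (T - 2)\<^sup>2 + 2 * log_bound C q \<sigma> T * X powr ((1 + \<sigma>) / 2)) + real d * real h"
proof -
  have chi: "dirichlet_character q chi" "q > 0" using good by (auto simp: good_def)
  define B where "B = log_bound C q \<sigma> T"
  have N: "real (conductor F q) \<ge> 1" using good by (simp add: good_def)
  have B: "B \<ge> 0" unfolding B_def log_bound_def
    using \<sigma> N C rest_const_nonneg prime_zeta_const_nonneg by (intro mult_nonneg_nonneg add_nonneg_nonneg) auto
  define W where "W y = y * (real d * (1 + 1 / (c - 1)) * y powr c / (T - 2) + B * y powr c / (T - 2)\<^sup>2 + 2 * B * y powr ((1 + \<sigma>) / 2))" for y
  have notnat: "real k + 1/2 \<notin> \<nat>" for k
  proof
    assume "real k + 1/2 \<in> \<nat>"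
    then obtain j where "real k + 1/2 = real j" by (auto elim: Nats_cases)
    then have "real (2 * k + 1) = real (2 * j)" by simp
    then have "2 * k + 1 = 2 * j" by (simp only: of_nat_eq_iff)
    then show False by presburger
  qed
  have w: "norm (prime_riesz chi (real k + 1/2)) \<le> W (real k + 1/2)" if "k \<ge> 1" for k
    unfolding W_def B_def using that
    by (intro norm_prime_riesz_le[OF growth C good \<sigma> T free c] notnat) auto
  have mono: "W y \<le> W X" if "0 \<le> y" "y \<le> X" for y
    unfolding W_def using that B c T \<sigma>
    by (intro mult_mono add_mono divide_right_mono mult_left_mono powr_mono2) (auto intro!: add_nonneg_nonneg mult_nonneg_nonneg divide_nonneg_nonneg)
  have "norm (prime_riesz chi (real m + 1/2)) \<le> W X" using w[of m] mono[of "real m + 1/2"] m by (simp add: X)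
  moreover have "norm (prime_riesz chi (real (m + h) + 1/2)) \<le> W X" using w[of "m + h"] m by (simp add: X)
  ultimately have "norm (\<Sum>n\<le>m. prime_coeff chi n) \<le> 2 * W X / real h + real d * real h"
    by (rule prime_sum_differencing[OF chi h])
  then show ?thesis by (simp add: W_def B_def)
qed

end

section \<open>Partial summation over a dyadic block\<close>

lemma norm_powr_neg_diff_le:
  fixes n :: nat
  assumes n: "n > 0" and s: "Re s \<ge> 0"
  shows "norm (1 / of_nat n powr s - 1 / of_nat (Suc n) powr s) \<le> norm s * real n powr (- Re s - 1)"
proof -
  let ?S = "closed_segment (of_nat n) (of_nat (Suc n) :: complex)"
  have S: "z \<in> ?S \<Longrightarrow> z \<in> \<real> \<and> Re z \<ge> real n" for z
    by (auto simp: closed_segment_def complex_is_Real_iff algebra_simps scaleR_conv_of_real)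
  have "norm ((of_nat n :: complex) powr (-s) - of_nat (Suc n) powr (-s)) \<le> norm s * real n powr (- Re s - 1) * norm (of_nat n - of_nat (Suc n) :: complex)"
  proof (rule field_differentiable_bound[of ?S _ "\<lambda>z. - s * z powr (-s - 1)"])
    fix z assume z: "z \<in> ?S"
    then have z': "z \<in> \<real>" "Re z \<ge> real n" "Re z > 0" using S n by force+
    then have "z \<notin> \<real>\<^sub>\<le>\<^sub>0" by (auto simp: complex_nonpos_Reals_iff)
    then show "((\<lambda>z. z powr (-s)) has_field_derivative - s * z powr (-s - 1)) (at z within ?S)"
      by (rule has_field_derivative_at_within[OF has_field_derivative_powr])
    have "norm (z powr (-s - 1)) = Re z powr (- Re s - 1)"
      using z' by (simp add: norm_powr_real_powr)
    also have "\<dots> \<le> real n powr (- Re s - 1)" using z' n s by (intro powr_mono2') auto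
    finally show "norm (- s * z powr (-s - 1)) \<le> norm s * real n powr (- Re s - 1)"
      unfolding norm_mult norm_minus_cancel by (intro mult_left_mono) auto
  qed auto
  then show ?thesis by (simp add: powr_minus_divide)
qed

text \<open>The two boundary terms account for the 2. Over a block of length at most u the function
  n powr -s has total variation at most |s| u powr (- Re s).\<close>

lemma abel_summation_dyadic:
  fixes a :: "nat \<Rightarrow> complex"
  assumes u: "u > 0" and v: "v \<le> 2 * u" and s: "Re s \<ge> 0"
    and A: "\<And>m. u - 1 \<le> m \<Longrightarrow> m < v \<Longrightarrow> norm (\<Sum>n\<le>m. a n) \<le> \<beta>"
    and uv: "u < v"
  shows "norm (\<Sum>n\<in>{u..<v}. a n / of_nat n powr s) \<le> \<beta> * real u powr (- Re s) * (2 + norm s)"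
proof -
  define S where "S m = (\<Sum>n\<le>m. a n)" for m
  define g where "g n = 1 / of_nat n powr s" for n :: nat
  have eq: "(\<Sum>n\<in>{u..<u+1+k}. a n * g n) = S (u+k) * g (u+k) - S (u-1) * g u + (\<Sum>n\<in>{u..<u+k}. S n * (g n - g (Suc n)))" for k
  proof (induction k)
    case 0
    obtain u' where "u = Suc u'" using u gr0_implies_Suc by blast
    then show ?case by (simp add: S_def algebra_simps)
  next
    case (Suc k)
    have "S (u + Suc k) = S (u + k) + a (u + Suc k)" by (simp add: S_def)
    then show ?case using Suc by (simp add: algebra_simps)
  qed
  define k where "k = v - u - 1"
  have k: "v = u + 1 + k" "k \<le> u" using uv v by (auto simp: k_def)
  have b0: "\<beta> \<ge> 0" using order.trans[OF norm_ge_zero A[of "u - 1"]] uv by simp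
  have gn: "norm (g n) \<le> real u powr (- Re s)" if "n \<ge> u" for n
  proof -
    have "norm (g n) = real n powr (- Re s)" using that u by (simp add: g_def norm_divide norm_of_nat_powr powr_minus_divide)
    also have "\<dots> \<le> real u powr (- Re s)" using that u s by (intro powr_mono2') auto
    finally show ?thesis .
  qed
  have Sb: "norm (S m) \<le> \<beta>" if "u - 1 \<le> m" "m < v" for m using A[OF that] by (simp add: S_def)
  have "norm (\<Sum>n\<in>{u..<u+k}. S n * (g n - g (Suc n))) \<le> (\<Sum>n\<in>{u..<u+k}. \<beta> * (norm s * real u powr (- Re s - 1)))"
  proof (rule order.trans[OF norm_sum sum_mono])
    fix n assume n: "n \<in> {u..<u+k}"
    have "norm (g n - g (Suc n)) \<le> norm s * real n powr (- Re s - 1)"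
      unfolding g_def using n u s by (intro norm_powr_neg_diff_le) auto
    also have "\<dots> \<le> norm s * real u powr (- Re s - 1)" using n u s by (intro mult_left_mono powr_mono2') auto
    finally show "norm (S n * (g n - g (Suc n))) \<le> \<beta> * (norm s * real u powr (- Re s - 1))"
      unfolding norm_mult using n k(1) b0 by (intro mult_mono Sb) auto
  qed
  also have "\<dots> = \<beta> * norm s * (real k * real u powr (- Re s - 1))" by simp
  also have "\<dots> \<le> \<beta> * norm s * (real u * real u powr (- Re s - 1))"
    using k b0 by (intro mult_left_mono mult_right_mono) auto
  also have "real u * real u powr (- Re s - 1) = real u powr (- Re s)"
    using u powr_add[of "real u" 1 "- Re s - 1"] by simp
  finally have 1: "norm (\<Sum>n\<in>{u..<u+k}. S n * (g n - g (Suc n))) \<le> \<beta> * norm s * real u powr (- Re s)" .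
  have 2: "norm (S (u+k) * g (u+k)) \<le> \<beta> * real u powr (- Re s)"
    unfolding norm_mult using k b0 by (intro mult_mono Sb gn) auto
  have 3: "norm (S (u-1) * g u) \<le> \<beta> * real u powr (- Re s)"
    unfolding norm_mult using k b0 by (intro mult_mono Sb gn) auto
  have "(\<Sum>n\<in>{u..<v}. a n / of_nat n powr s) = (\<Sum>n\<in>{u..<u+1+k}. a n * g n)" by (simp add: g_def k(1))
  then have "norm (\<Sum>n\<in>{u..<v}. a n / of_nat n powr s) \<le> \<beta> * real u powr (- Re s) + \<beta> * real u powr (- Re s) + \<beta> * norm s * real u powr (- Re s)"
    unfolding eq using 1 2 3 norm_triangle_ineq[of "S (u+k) * g (u+k) - S (u-1) * g u" "\<Sum>n\<in>{u..<u+k}. S n * (g n - g (Suc n))"]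
      norm_triangle_ineq4[of "S (u+k) * g (u+k)" "S (u-1) * g u"] by simp
  then show ?thesis by (simp add: algebra_simps)
qed

section \<open>The saving for characters without zeros near Re s = 1\<close>

context L_family
begin

text \<open>By the lower bound on ln m the left edge of the contour gains exp (- (c0 \<kappa> / 2) L
  powr \<epsilon>). The logarithm of the L-function costs L ^ 16: a factor L from 1 / (1 - \<sigma>)
  and L ^ 15 from T powr (3/2). The three terms for the Riesz mean become O(X^2 / L ^ 4), of which
  differencing loses L ^ 2.\<close>

lemma prime_sum_saving:
  assumes c0: "c0 > 0" and \<kappa>: "\<kappa> > 0" and \<epsilon>: "\<epsilon> > 0" and \<delta>: "0 < \<delta>" "\<delta> < 1"
  obtains A L0 where "A > 0"
    "\<And>q chi m. good q chi \<Longrightarrow> ln (real q) \<ge> L0 \<Longrightarrow> real (conductor F q) \<le> K' * real q ^ d \<Longrightarrow>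
       (\<And>s. Re s \<ge> 1 - c0 * ln (real q) powr (\<delta> - 1) \<Longrightarrow> \<bar>Im s\<bar> \<le> ln (real q) ^ 10 \<Longrightarrow> L_fun F chi s \<noteq> 0) \<Longrightarrow>
       \<kappa> * ln (real q) powr (1 - \<delta> + \<epsilon>) \<le> ln (real m) \<Longrightarrow> m > 0 \<Longrightarrow> real m \<le> sqrt (real q) \<Longrightarrow>
       norm (\<Sum>n\<le>m. prime_coeff chi n) \<le> A * real m / ln (real q) ^ 2"
proof -
  obtain C where C: "C > 0" and growth: "\<And>q chi s. good q chi \<Longrightarrow> Re s \<ge> 1/2 \<Longrightarrow>
      norm (L_fun F chi s) \<le> real (conductor F q) * exp (C * (1 + norm s) powr (3/2))"
    using L_fun_growth by blast
  define R where "R = 1 + 2 * (prime_zeta_const + rest_const)"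
  define B1 where "B1 = 10 / c0 * (\<bar>ln K'\<bar> + real d + 6 * C + \<bar>R\<bar> + 1)"
  have B1: "B1 > 0" unfolding B1_def using c0 C by (intro mult_pos_pos add_pos_nonneg add_nonneg_pos) auto
  have "eventually (\<lambda>L. 1 - c0 * L powr (\<delta> - 1) \<ge> 3/4) at_top" using \<delta> by real_asymp
  \<comment> \<open>L ^ 16 for the bound of the logarithm and L ^ 4 for the desired saving.\<close>
  moreover have "eventually (\<lambda>L. L ^ 20 * exp (- (c0 * \<kappa> / 2) * L powr \<epsilon>) \<le> 1) at_top"
  proof -
    have "((\<lambda>L. L ^ 20 * exp (- (c0 * \<kappa> / 2) * L powr \<epsilon>)) \<longlongrightarrow> 0) at_top"
    proof -
      define k where "k = c0 * \<kappa> / 2"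
      have "k > 0" using c0 \<kappa> by (simp add: k_def)
      then show ?thesis unfolding k_def[symmetric] using \<epsilon> by real_asymp
    qed
    then have "eventually (\<lambda>L. L ^ 20 * exp (- (c0 * \<kappa> / 2) * L powr \<epsilon>) < 1) at_top" by (rule order_tendstoD) simp
    then show ?thesis by eventually_elim simp
  qed
  moreover have "eventually (\<lambda>L. L ^ 2 \<le> exp (\<kappa> * L powr (1 - \<delta> + \<epsilon>))) at_top"
  proof -
    define r where "r = 1 - \<delta> + \<epsilon>"
    have "r > 0" using \<delta> \<epsilon> by (simp add: r_def)
    then show ?thesis unfolding r_def[symmetric] using \<kappa> by real_asymp
  qed
  moreover have "eventually (\<lambda>L::real. L \<ge> 4) at_top" by (rule eventually_ge_at_top)
  ultimately have "eventually (\<lambda>L. 1 - c0 * L powr (\<delta> - 1) \<ge> 3/4 \<and> L ^ 20 * exp (- (c0 * \<kappa> / 2) * L powr \<epsilon>) \<le> 1 \<and>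
      L ^ 2 \<le> exp (\<kappa> * L powr (1 - \<delta> + \<epsilon>)) \<and> L \<ge> 4) at_top"
    by eventually_elim simp
  then obtain L0 where L0: "\<And>L. L \<ge> L0 \<Longrightarrow> 1 - c0 * L powr (\<delta> - 1) \<ge> 3/4 \<and> L ^ 20 * exp (- (c0 * \<kappa> / 2) * L powr \<epsilon>) \<le> 1 \<and>
      L ^ 2 \<le> exp (\<kappa> * L powr (1 - \<delta> + \<epsilon>)) \<and> L \<ge> 4"
    unfolding eventually_at_top_linorder by blast
  define A where "A = 18 * (4 * exp 1 * real d + 4 * exp 1 * B1 + 2 * B1) + 2 * real d"
  have "norm (\<Sum>n\<le>m. prime_coeff chi n) \<le> A * real m / ln (real q) ^ 2"
    if good: "good q chi" and Lq: "ln (real q) \<ge> L0" and N: "real (conductor F q) \<le> K' * real q ^ d" and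
       free: "\<And>s. Re s \<ge> 1 - c0 * ln (real q) powr (\<delta> - 1) \<Longrightarrow> \<bar>Im s\<bar> \<le> ln (real q) ^ 10 \<Longrightarrow> L_fun F chi s \<noteq> 0" and
       m: "\<kappa> * ln (real q) powr (1 - \<delta> + \<epsilon>) \<le> ln (real m)" "m > 0" "real m \<le> sqrt (real q)" for q chi m
  proof -
    define L where "L = ln (real q)"
    define \<sigma> where "\<sigma> = 1 - c0 * L powr (\<delta> - 1)"
    \<comment> \<open>The horizontal sides carry L ^ 16 / T^2, so T = L ^ 10 leaves exactly L ^
      -4.\<close>
    define T where "T = L ^ 10"
    have L: "\<sigma> \<ge> 3/4" "L ^ 20 * exp (- (c0 * \<kappa> / 2) * L powr \<epsilon>) \<le> 1" "L ^ 2 \<le> exp (\<kappa> * L powr (1 - \<delta> + \<epsilon>))" "L \<ge> 4"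
      using L0[OF Lq] by (auto simp: L_def \<sigma>_def)
    have q: "q \<ge> 2" using good by (simp add: good_def)
    have N1: "real (conductor F q) \<ge> 1" using good by (simp add: good_def)
    have qL: "real q = exp L" using q by (simp add: L_def)
    have \<sigma>1: "\<sigma> < 1" using c0 L(4) by (simp add: \<sigma>_def)
    have pw: "L ^ j \<le> L ^ k" if "j \<le> k" for j k using L(4) that by (intro power_increasing) auto
    have T: "T \<ge> 4 * L" "T \<ge> 16" "T - 2 \<ge> T / 2"
    proof -
      have "4 * L \<le> L ^ 1 * L" using L by (simp add: mult_right_mono)
      also have "\<dots> = L ^ 2" by (simp add: power2_eq_square)
      also have "\<dots> \<le> T" unfolding T_def by (rule pw) simp
      finally show "T \<ge> 4 * L" .
      then show "T \<ge> 16" "T - 2 \<ge> T / 2" using L by auto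
    qed
    have K': "K' > 0"
    proof (rule ccontr)
      assume "\<not> K' > 0"
      then have "K' * real q ^ d \<le> 0" by (intro mult_nonpos_nonneg) auto
      then show False using N N1 by linarith
    qed
    have mL: "real m \<ge> L ^ 2"
    proof -
      have "L ^ 2 \<le> exp (\<kappa> * L powr (1 - \<delta> + \<epsilon>))" by (rule L(3))
      also have "\<dots> \<le> exp (ln (real m))" using m(1) by (simp add: L_def)
      finally show ?thesis using m(2) by simp
    qed
    \<comment> \<open>With h about m / L ^ 2 the error d h of the differencing has the size of the
      claim, and 2 X / h costs only L ^ 2.\<close>
    define h where "h = nat \<lceil>real m / L ^ 2\<rceil>"
    have mL1: "real m / L ^ 2 \<ge> 1" using mL L(4) by (simp add: pos_le_divide_eq)
    have h: "real h \<ge> real m / L ^ 2" "real h \<le> 2 * (real m / L ^ 2)" "0 < h"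
    proof -
      have "real h = of_int \<lceil>real m / L ^ 2\<rceil>" using mL1 by (simp add: h_def)
      then show *: "real h \<ge> real m / L ^ 2" "real h \<le> 2 * (real m / L ^ 2)"
        using mL1 ceiling_correct[of "real m / L ^ 2"] by linarith+
      then have "real h \<ge> 1" using mL1 by linarith
      then show "0 < h" by simp
    qed
    have hm: "real h \<le> real m"
    proof -
      have "2 * (real m / L ^ 2) \<le> real m * (2 / L ^ 2)" by (simp add: mult.commute)
      also have "\<dots> \<le> real m * 1"
      proof (intro mult_left_mono)
        have "2 \<le> L ^ 2" using pw[of 1 2] L(4) by simp
        then show "2 / L ^ 2 \<le> 1" using L(4) by (simp add: pos_divide_le_eq)
      qed auto
      finally show ?thesis using h(2) by simp
    qed
    define X where "X = real (m + h) + 1/2"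
    have X: "X \<le> 3 * real m" "X \<ge> real m" "X > 0" using hm m(2) by (auto simp: X_def)
    have Xq: "X \<le> real q"
    proof -
      have "3 \<le> sqrt (real q)"
      proof -
        have "(9::real) \<le> exp L" using exp_ge_one_plus_x_over_n_power_n[where x=L and n=4] L(4)
          power_mono[of 2 "1 + L / 4" 4] by simp
        then have "9 \<le> real q" using qL by simp
        then show ?thesis by (simp add: real_le_rsqrt)
      qed
      then have "3 * real m \<le> sqrt (real q) * sqrt (real q)" using m(3) by (intro mult_mono) auto
      then show ?thesis using X(1) by simp
    qed
    \<comment> \<open>X \<le> q implies X powr (1 / L) \<le> e, so that X powr c is of size X. This
      is where m \<le> sqrt q enters.\<close>
    define c where "c = 1 + 1 / L"
    have c: "1 < c" "c \<le> 3/2" "1 / (c - 1) = L" using L(4) by (auto simp: c_def)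
    have Xc: "X powr c \<le> exp 1 * X"
    proof -
      have "X powr (1 / L) = exp (ln X / L)" using X by (simp add: powr_def)
      also have "\<dots> \<le> exp 1"
      proof -
        have "ln X \<le> L" using X Xq q unfolding L_def by (subst ln_le_cancel_iff) auto
        then show ?thesis using L(4) by simp
      qed
      finally have "X * X powr (1 / L) \<le> X * exp 1" using X by (intro mult_left_mono) auto
      then show ?thesis using X by (simp add: c_def powr_add mult.commute)
    qed
    define B where "B = log_bound C q \<sigma> T"
    have lnN: "ln (real (conductor F q)) \<le> \<bar>ln K'\<bar> + real d * L"
    proof -
      have "ln (real (conductor F q)) \<le> ln (K' * real q ^ d)" using N N1 by simp
      also have "\<dots> = ln K' + real d * L" using K' q by (simp add: ln_mult ln_realpow L_def)
      finally show ?thesis by simp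
    qed
    have T32: "(5 + T) powr (3/2) \<le> 6 * L ^ 15"
    proof -
      have "(5 + T) powr (3/2) \<le> (2 * T) powr (3/2)" using T by (intro powr_mono2) auto
      also have "\<dots> = 2 powr (3/2) * T powr (3/2)" using T by (simp add: powr_mult)
      also have "T powr (3/2) = L ^ 15"
      proof -
        have "T = L powr 10" "L ^ 15 = L powr 15" using L(4) by (simp_all add: T_def powr_numeral)
        then show ?thesis by (simp only: powr_powr) simp
      qed
      also have "2 powr (3/2) \<le> (2::real) powr 2" by (intro powr_mono) auto
      finally have "(5 + T) powr (3/2) \<le> 4 * L ^ 15" using L(4) by (simp add: mult_right_mono powr_numeral)
      also have "\<dots> \<le> 6 * L ^ 15" using L(4) by (intro mult_right_mono) auto
      finally show ?thesis .
    qed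
    have L15: "1 \<le> L ^ 15" "L \<le> L ^ 15" using pw[of 0 15] pw[of 1 15] by auto
    have B: "0 \<le> B" "B \<le> B1 * L ^ 16"
    proof -
      have B': "B = 10 / (c0 * L powr (\<delta> - 1)) * (ln (real (conductor F q)) + C * (5 + T) powr (3/2) + R)"
        by (simp add: B_def log_bound_def R_def \<sigma>_def)
      have in0: "0 \<le> ln (real (conductor F q)) + C * (5 + T) powr (3/2) + R"
        using N1 C rest_const_nonneg prime_zeta_const_nonneg by (simp add: R_def)
      have "1 / L powr (\<delta> - 1) = L powr (1 - \<delta>)" using powr_minus_divide[of L "\<delta> - 1"] by simp
      also have "\<dots> \<le> L powr 1" using L(4) \<delta> by (intro powr_mono) auto
      finally have "1 / L powr (\<delta> - 1) \<le> L" using L(4) by simp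
      then have 1: "10 / (c0 * L powr (\<delta> - 1)) \<le> 10 / c0 * L"
        using c0 mult_left_mono[of "1 / L powr (\<delta> - 1)" L "10 / c0"] by simp
      show "0 \<le> B" unfolding B' using c0 in0 by (intro mult_nonneg_nonneg) auto
      have "ln (real (conductor F q)) + C * (5 + T) powr (3/2) + R \<le> \<bar>ln K'\<bar> * L ^ 15 + real d * L ^ 15 + C * (6 * L ^ 15) + \<bar>R\<bar> * L ^ 15"
      proof (intro add_mono order.trans[OF lnN])
        show "\<bar>ln K'\<bar> \<le> \<bar>ln K'\<bar> * L ^ 15" "real d * L \<le> real d * L ^ 15"
          using mult_left_mono[OF L15(1), of "\<bar>ln K'\<bar>"] mult_left_mono[OF L15(2), of "real d"] by auto
        show "C * (5 + T) powr (3/2) \<le> C * (6 * L ^ 15)" using T32 C by (intro mult_left_mono) auto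
        show "R \<le> \<bar>R\<bar> * L ^ 15" using mult_left_mono[OF L15(1), of "\<bar>R\<bar>"] by linarith
      qed
      also have "\<dots> \<le> (\<bar>ln K'\<bar> + real d + 6 * C + \<bar>R\<bar> + 1) * L ^ 15" using L15 L(4) by (simp add: algebra_simps)
      finally have 2: "ln (real (conductor F q)) + C * (5 + T) powr (3/2) + R \<le> (\<bar>ln K'\<bar> + real d + 6 * C + \<bar>R\<bar> + 1) * L ^ 15" .
      have "B \<le> 10 / c0 * L * ((\<bar>ln K'\<bar> + real d + 6 * C + \<bar>R\<bar> + 1) * L ^ 15)"
        unfolding B' using 1 2 in0 c0 L(4) by (intro mult_mono) auto
      also have "\<dots> = B1 * (L * L ^ 15)" by (simp add: B1_def)
      also have "L * L ^ 15 = L ^ 16" by (simp add: power_Suc[symmetric])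
      finally show "B \<le> B1 * L ^ 16" .
    qed
    have main: "norm (\<Sum>n\<le>m. prime_coeff chi n) \<le> 2 * X / real h * (real d * (1 + 1 / (c - 1)) * X powr c / (T - 2) +
       B * X powr c / (T - 2)\<^sup>2 + 2 * B * X powr ((1 + \<sigma>) / 2)) + real d * real h"
      unfolding B_def
      using free T m by (intro prime_sum_bound[OF growth C good L(1) \<sigma>1 _ _ c(1,2) h(3) _ X_def]) (auto simp: \<sigma>_def L_def T_def)
    have Lp: "L > 0" using L(4) by simp
    have t1: "real d * (1 + 1 / (c - 1)) * X powr c / (T - 2) \<le> (4 * exp 1 * real d) * X / L ^ 4"
    proof -
      have "real d * (1 + 1 / (c - 1)) * X powr c / (T - 2) \<le> real d * (2 * L) * (exp 1 * X) / (T / 2)"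
        using c L(4) Xc T X by (intro frac_le mult_mono) (auto intro!: mult_nonneg_nonneg)
      also have "\<dots> = (4 * exp 1 * real d) * X * (L / T)" by simp
      also have "L / T = 1 / L ^ 9"
      proof -
        have "T = L * L ^ 9" by (simp add: T_def flip: power_Suc)
        then show ?thesis using nonzero_divide_mult_cancel_left[of L "L ^ 9"] Lp by (metis less_irrefl)
      qed
      also have "\<dots> \<le> 1 / L ^ 4" using Lp pw[of 4 9] by (intro divide_left_mono) auto
      finally show ?thesis using X by (simp add: mult_left_mono)
    qed
    have t2: "B * X powr c / (T - 2)\<^sup>2 \<le> (4 * exp 1 * B1) * X / L ^ 4"
    proof -
      have "B * X powr c / (T - 2)\<^sup>2 \<le> (B1 * L ^ 16) * (exp 1 * X) / (T / 2)\<^sup>2"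
        using B Xc T X B1 Lp by (intro frac_le mult_mono power_mono) (auto intro!: mult_nonneg_nonneg)
      also have "\<dots> = (4 * exp 1 * B1) * X * (L ^ 16 / T\<^sup>2)" by (simp add: power_divide)
      also have "L ^ 16 / T\<^sup>2 = 1 / L ^ 4"
      proof -
        have "T\<^sup>2 = L ^ 16 * L ^ 4" by (simp add: T_def flip: power_mult power_add)
        then show ?thesis using nonzero_divide_mult_cancel_left[of "L ^ 16" "L ^ 4"] Lp by (simp only:) simp
      qed
      finally show ?thesis by simp
    qed
    have t3: "2 * B * X powr ((1 + \<sigma>) / 2) \<le> (2 * B1) * X / L ^ 4"
    proof -
      have "(1 + \<sigma>) / 2 = 1 + - (c0 / 2 * L powr (\<delta> - 1))" by (simp add: \<sigma>_def)
      then have "X powr ((1 + \<sigma>) / 2) = X * X powr (- (c0 / 2 * L powr (\<delta> - 1)))"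
        using X by (simp only: powr_add) simp
      also have "X powr (- (c0 / 2 * L powr (\<delta> - 1))) \<le> exp (- (c0 * \<kappa> / 2) * L powr \<epsilon>)"
      proof -
        have "\<kappa> * L powr (1 - \<delta> + \<epsilon>) \<le> ln X"
          using m(1,2) X by (intro order.trans[OF m(1)[folded L_def]]) auto
        then have e1: "(c0 / 2 * L powr (\<delta> - 1)) * (\<kappa> * L powr (1 - \<delta> + \<epsilon>)) \<le> (c0 / 2 * L powr (\<delta> - 1)) * ln X"
          using c0 by (intro mult_left_mono) auto
        have e2: "(c0 / 2 * L powr (\<delta> - 1)) * (\<kappa> * L powr (1 - \<delta> + \<epsilon>)) = (c0 * \<kappa> / 2) * L powr \<epsilon>"
        proof -
          have "L powr (\<delta> - 1) * L powr (1 - \<delta> + \<epsilon>) = L powr \<epsilon>" by (simp flip: powr_add)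
          then show ?thesis by simp
        qed
        have "X powr (- u) = exp (- (u * ln X))" for u using X by (simp add: powr_def)
        then show ?thesis using e1 unfolding e2 by (simp only: exp_le_cancel_iff minus_mult_left[symmetric] neg_le_iff_le)
      qed
      finally have "X powr ((1 + \<sigma>) / 2) \<le> X * exp (- (c0 * \<kappa> / 2) * L powr \<epsilon>)" using X by simp
      then have "2 * B * X powr ((1 + \<sigma>) / 2) \<le> 2 * (B1 * L ^ 16) * (X * exp (- (c0 * \<kappa> / 2) * L powr \<epsilon>))"
        using B by (intro mult_mono) auto
      also have "\<dots> = 2 * B1 * X * (L ^ 16 * exp (- (c0 * \<kappa> / 2) * L powr \<epsilon>))" by simp
      also have "L ^ 16 * exp (- (c0 * \<kappa> / 2) * L powr \<epsilon>) = (L ^ 20 * exp (- (c0 * \<kappa> / 2) * L powr \<epsilon>)) / L ^ 4"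
        proof -
        have p: "L ^ 20 = L ^ 16 * L ^ 4" by simp
        have "L ^ 20 * e = (L ^ 16 * e) * L ^ 4" for e unfolding p by (simp only: mult.assoc mult.commute[of e])
        then show ?thesis using nonzero_mult_div_cancel_right[of "L ^ 4"] Lp by (simp only:) simp
      qed
      also have "2 * B1 * X * ((L ^ 20 * exp (- (c0 * \<kappa> / 2) * L powr \<epsilon>)) / L ^ 4) \<le> 2 * B1 * X * (1 / L ^ 4)"
        using L(2) B1 X Lp by (intro mult_left_mono divide_right_mono) auto
      finally show ?thesis by simp
    qed
    have "2 * X / real h \<le> 6 * L ^ 2"
    proof -
      have "2 * X / real h \<le> 2 * (3 * real m) / (real m / L ^ 2)" using X h mL1 m(2) Lp by (intro frac_le) auto
      then show ?thesis using m(2) by simp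
    qed
    then have "2 * X / real h * (real d * (1 + 1 / (c - 1)) * X powr c / (T - 2) +
       B * X powr c / (T - 2)\<^sup>2 + 2 * B * X powr ((1 + \<sigma>) / 2)) \<le>
       6 * L ^ 2 * ((4 * exp 1 * real d) * X / L ^ 4 + (4 * exp 1 * B1) * X / L ^ 4 + (2 * B1) * X / L ^ 4)"
      using t1 t2 t3 B c T X L(4) by (intro mult_mono add_mono) (auto intro!: add_nonneg_nonneg mult_nonneg_nonneg divide_nonneg_nonneg)
    also have "\<dots> = 6 * (4 * exp 1 * real d + 4 * exp 1 * B1 + 2 * B1) * (X * (L ^ 2 / L ^ 4))"
      by (simp add: add_divide_distrib algebra_simps)
    also have "L ^ 2 / L ^ 4 = 1 / L ^ 2"
    proof -
      have "L ^ 4 = L ^ 2 * L ^ 2" by simp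
      then show ?thesis using nonzero_divide_mult_cancel_left[of "L ^ 2" "L ^ 2"] Lp by (simp only:) simp
    qed
    also have "6 * (4 * exp 1 * real d + 4 * exp 1 * B1 + 2 * B1) * (X * (1 / L ^ 2)) \<le>
        6 * (4 * exp 1 * real d + 4 * exp 1 * B1 + 2 * B1) * ((3 * real m) * (1 / L ^ 2))"
      using X B1 by (intro mult_left_mono mult_right_mono) auto
    finally have "norm (\<Sum>n\<le>m. prime_coeff chi n) \<le> 6 * (4 * exp 1 * real d + 4 * exp 1 * B1 + 2 * B1) * ((3 * real m) * (1 / L ^ 2)) + real d * (2 * (real m / L ^ 2))"
      using main h(2) mult_left_mono[OF h(2), of "real d"] by simp
    also have "\<dots> = A * real m / L ^ 2" by (simp add: A_def add_divide_distrib algebra_simps)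
    finally show ?thesis by (simp add: L_def)
  qed
  moreover have "A > 0" using B1 degree_pos unfolding A_def
    by (intro add_pos_pos mult_pos_pos) auto
  ultimately show ?thesis using that by blast
qed

end

section \<open>Decomposition of the coefficients by their prime factors\<close>

lemma sum_inverse_squares_le:
  assumes "finite A" "\<And>n. n \<in> A \<Longrightarrow> n \<ge> u" "u > (0::nat)"
  shows "(\<Sum>n\<in>A. 1 / (real n)\<^sup>2) \<le> 2 / real u"
proof -
  have aux: "(\<Sum>n\<in>{u..u+k}. 1 / (real n)\<^sup>2) \<le> 2 / real u - 1 / real (u + k)" for k
  proof (induction k)
    case 0
    have "1 / (real u)\<^sup>2 \<le> 1 / real u" using assms(3) by (simp add: power2_eq_square divide_simps)
    then show ?case by simp
  next
    case (Suc k)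
    have "1 / (real (u + Suc k))\<^sup>2 \<le> 1 / (real (u + k) * real (u + Suc k))"
      unfolding power2_eq_square using assms(3) by (intro divide_left_mono mult_right_mono) auto
    also have "\<dots> = 1 / real (u + k) - 1 / real (u + Suc k)" using assms(3) by (simp add: field_simps)
    finally show ?case using Suc by simp
  qed
  define k where "k = Max (insert u A)"
  have "x \<le> k" if "x \<in> A" for x using that assms(1) by (simp add: k_def)
  then have "A \<subseteq> {u..u+k}" using assms(2) by (force intro: trans_le_add2)
  then have "(\<Sum>n\<in>A. 1 / (real n)\<^sup>2) \<le> (\<Sum>n\<in>{u..u+k}. 1 / (real n)\<^sup>2)" by (intro sum_mono2) auto
  also have "\<dots> \<le> 2 / real u - 1 / real (u + k)" by (rule aux)
  finally show ?thesis by (simp add: order.trans)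
qed

context satake_bounds
begin

text \<open>Powers of two as end points: sums over this range split exactly into dyadic
  blocks.\<close>

definition prime_range :: "nat \<Rightarrow> nat \<Rightarrow> nat set" where
  "prime_range a b = {p. prime p \<and> 2 ^ a \<le> p \<and> p < 2 ^ b}"

definition range_omega :: "nat \<Rightarrow> nat \<Rightarrow> nat \<Rightarrow> nat" where
  "range_omega a b n = card {p \<in> prime_range a b. p dvd n}"

definition rough_part :: "nat \<Rightarrow> nat \<Rightarrow> nat \<Rightarrow> complex" where
  "rough_part a b n = (if range_omega a b n = 0 then lam F n else 0)"

text \<open>Ramare's identity \<open>\<Sum>\<^sub>p 1 / (\<omega>(n / p) + 1) = 1\<close>, the sum being over the primes of the range which divide
  \<open>n\<close>, is exact when each of them divides \<open>n\<close> only once. It replaces the coefficient by a bilinear form with a prime variable,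
  up to the error \<open>square_part\<close>.\<close>

definition ramare_part :: "nat \<Rightarrow> nat \<Rightarrow> nat \<Rightarrow> complex" where
  "ramare_part a b n = (\<Sum>p | p \<in> prime_range a b \<and> p dvd n. lam F p * lam F (n div p) / of_nat (range_omega a b (n div p) + 1))"

definition square_part :: "nat \<Rightarrow> nat \<Rightarrow> nat \<Rightarrow> complex" where
  "square_part a b n = lam F n - rough_part a b n - ramare_part a b n"

text \<open>The contribution of p to the error with the power of p in n replaced by a polynomial in
  the multiplicity. The remaining coefficient at the cofactor can then be averaged by the second
  moment.\<close>

definition square_weight :: "nat \<Rightarrow> nat \<Rightarrow> real" where
  "square_weight p n = (1 + real d) * real (multiplicity p n + 1) ^ d * norm (lam F (n div p ^ multiplicity p n))"

lemma finite_prime_range: "finite (prime_range a b)"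
  by (rule finite_subset[of _ "{..<2^b}"]) (auto simp: prime_range_def)

lemma norm_lam_multiplicity:
  assumes p: "prime p" and n: "n > 0" and k: "k \<le> multiplicity p n"
  shows "norm (lam F (n div p ^ k)) \<le> real (multiplicity p n - k + 1) ^ d * norm (lam F (n div p ^ multiplicity p n))"
proof -
  let ?M = "multiplicity p n" and ?m = "n div p ^ multiplicity p n"
  have n_eq: "n = p ^ ?M * ?m" by (simp add: multiplicity_dvd)
  have m0: "?m > 0" using n n_eq by (metis gr0I mult_0_right not_less_iff_gr_or_eq)
  have cop: "coprime p ?m"
    using multiplicity_decompose[of n p] p n by (intro prime_imp_coprime) (auto simp: prime_nat_iff)
  have p0: "p > 0" using p by (rule prime_gt_0_nat)
  have "n div p ^ k = p ^ (?M - k) * ?m"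
  proof -
    have "p ^ ?M = p ^ k * p ^ (?M - k)" using k by (simp flip: power_add)
    then have "n = p ^ k * (p ^ (?M - k) * ?m)" using n_eq by (metis mult.assoc)
    then show ?thesis using p0 by (metis nonzero_mult_div_cancel_left power_not_zero not_less_iff_gr_or_eq)
  qed
  then have "lam F (n div p ^ k) = lam F (p ^ (?M - k)) * lam F ?m"
    using mult[of "p ^ (?M - k)" ?m] p0 m0 cop by (simp add: coprime_power_left_iff)
  then have "norm (lam F (n div p ^ k)) = norm (lam F (p ^ (?M - k))) * norm (lam F ?m)" by (simp add: norm_mult)
  also have "\<dots> \<le> real (?M - k + 1) ^ d * norm (lam F ?m)"
    using norm_lam_prime_power_le[OF p] by (intro mult_right_mono) auto
  finally show ?thesis .
qed

lemma range_omega_div: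
  assumes p: "p \<in> prime_range a b" "p dvd n" and n: "n > 0"
  shows "range_omega a b (n div p) + (if p\<^sup>2 dvd n then 0 else 1) = range_omega a b n"
proof -
  have pr: "prime p" using p by (simp add: prime_range_def)
  have iff: "r dvd n div p \<longleftrightarrow> r dvd n" if "prime r" "r \<noteq> p" for r
  proof -
    have "coprime r p" using that pr by (simp add: primes_coprime)
    moreover have "n = n div p * p" using p by simp
    ultimately show ?thesis by (metis coprime_dvd_mult_left_iff)
  qed
  have iffp: "p dvd n div p \<longleftrightarrow> p\<^sup>2 dvd n"
    using p prime_gt_0_nat[OF pr] unfolding power2_eq_square by (metis dvd_div_iff_mult less_not_refl)
  let ?A = "{r \<in> prime_range a b. r dvd n}" and ?B = "{r \<in> prime_range a b. r dvd n div p}"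
  have fin: "finite ?A" using finite_prime_range by simp
  show ?thesis
  proof (cases "p\<^sup>2 dvd n")
    case True
    then have "?B = ?A" using iff iffp p by (auto simp: prime_range_def)
    then show ?thesis using True by (simp add: range_omega_def)
  next
    case False
    then have "?B = ?A - {p}" using iff iffp p by (auto simp: prime_range_def)
    then have "card ?B = card ?A - 1" using p fin by simp
    moreover have "card ?A > 0" using p fin by (auto simp: card_gt_0_iff)
    ultimately show ?thesis using False by (simp add: range_omega_def)
  qed
qed

text \<open>Where \<open>n\<close> is divisible by \<open>p\<close> but not by \<open>p\<^sup>2\<close>, the summand of \<open>p\<close> in the Ramare-type identity is exact.\<close>

lemma norm_square_part_le:
  assumes n: "n > 0"
  shows "(norm (square_part a b n))\<^sup>2 \<le> (\<Sum>p | p \<in> prime_range a b \<and> p\<^sup>2 dvd n. (square_weight p n)\<^sup>2)"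
proof -
  let ?w = "range_omega a b n"
  let ?P = "{p. p \<in> prime_range a b \<and> p dvd n}" and ?S = "{p. p \<in> prime_range a b \<and> p\<^sup>2 dvd n}"
  have finP: "finite ?P" "finite ?S" using finite_prime_range by auto
  have SP: "?S \<subseteq> ?P" by (auto simp: power2_eq_square elim: dvd_mult_left)
  have cardP: "card ?P = ?w" by (simp add: range_omega_def)
  show ?thesis
  proof (cases "?w = 0")
    case True
    then have "?P = {}" using cardP finP by simp
    then have "ramare_part a b n = 0" unfolding ramare_part_def by (simp only: sum.empty)
    then have "square_part a b n = 0" using True by (simp add: square_part_def rough_part_def)
    then show ?thesis by (simp add: sum_nonneg)
  next
    case False
    \<comment> \<open>The coefficient at n is spread evenly over its prime divisors in the range;
      \<open>t p\<close> is the error at p when the share is replaced by the Ramare summand.\<close>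
    define t where "t p = lam F n / of_nat ?w - lam F p * lam F (n div p) / of_nat (range_omega a b (n div p) + 1)" for p
    have "lam F n = (\<Sum>p\<in>?P. lam F n / of_nat ?w)" using cardP False by simp
    then have "square_part a b n = (\<Sum>p\<in>?P. t p)"
      using False by (simp add: square_part_def rough_part_def ramare_part_def t_def sum_subtractf)
    also have "\<dots> = (\<Sum>p\<in>?S. t p)"
    proof (rule sum.mono_neutral_right[OF finP(1) SP], rule ballI)
      fix p assume p: "p \<in> ?P - ?S"
      then have pr: "prime p" "p dvd n" "\<not> p\<^sup>2 dvd n" "p \<in> prime_range a b" by (auto simp: prime_range_def)
      have "coprime p (n div p)"
        using pr by (intro prime_imp_coprime) (auto simp: power2_eq_square dvd_div_iff_mult prime_gt_0_nat)
      moreover have "n div p > 0" using pr n by (auto simp: dvd_div_eq_0_iff)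
      ultimately have "lam F (p * (n div p)) = lam F p * lam F (n div p)" using pr prime_gt_0_nat by (intro mult) auto
      then have "lam F n = lam F p * lam F (n div p)" using pr by simp
      moreover have "range_omega a b (n div p) + 1 = ?w" using range_omega_div[OF pr(4,2) n] pr(3) by simp
      ultimately show "t p = 0" by (simp only: t_def) simp
    qed
    finally have eq: "square_part a b n = (\<Sum>p\<in>?S. t p)" .
    have t: "norm (t p) \<le> square_weight p n / real ?w" if p: "p \<in> ?S" for p
    proof -
      have pr: "prime p" "p dvd n" "p\<^sup>2 dvd n" "p \<in> prime_range a b" using p SP by (auto simp: prime_range_def)
      let ?M = "multiplicity p n"
      have M: "?M \<ge> 2" using pr n by (intro multiplicity_geI) (auto simp: prime_gt_0_nat)
      let ?l = "norm (lam F (n div p ^ ?M))"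
      have w: "range_omega a b (n div p) = ?w" using range_omega_div[OF pr(4,2) n] pr(3) by simp
      have 1: "norm (lam F n) \<le> real (?M + 1) ^ d * ?l" using norm_lam_multiplicity[OF pr(1) n, of 0] by simp
      have "norm (lam F (n div p)) \<le> real (?M - 1 + 1) ^ d * ?l" using norm_lam_multiplicity[OF pr(1) n, of 1] M by simp
      also have "\<dots> \<le> real (?M + 1) ^ d * ?l" by (intro mult_right_mono power_mono) auto
      finally have "norm (lam F p) * norm (lam F (n div p)) \<le> real d * (real (?M + 1) ^ d * ?l)"
        by (intro mult_mono norm_lam_prime_le pr) auto
      then have 2: "norm (lam F p * lam F (n div p)) / real (?w + 1) \<le> real d * (real (?M + 1) ^ d * ?l) / real ?w"
        unfolding norm_mult using False by (intro frac_le) auto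
      have "norm (t p) \<le> norm (lam F n / of_nat ?w) + norm (lam F p * lam F (n div p) / of_nat (?w + 1))"
        unfolding t_def w by (rule norm_triangle_ineq4)
      also have "\<dots> = norm (lam F n) / real ?w + norm (lam F p * lam F (n div p)) / real (?w + 1)"
        by (simp only: norm_divide norm_of_nat)
      also have "\<dots> \<le> real (?M + 1) ^ d * ?l / real ?w + real d * (real (?M + 1) ^ d * ?l) / real ?w"
        using 1 2 by (intro add_mono divide_right_mono) auto
      also have "\<dots> = square_weight p n / real ?w" by (simp add: square_weight_def add_divide_distrib algebra_simps)
      finally show ?thesis .
    qed
    have "norm (square_part a b n) \<le> (\<Sum>p\<in>?S. 1 * (square_weight p n / real ?w))"
      unfolding eq using t by (intro order.trans[OF norm_sum sum_mono]) auto
    then have "(norm (square_part a b n))\<^sup>2 \<le> (\<Sum>p\<in>?S. 1 * (square_weight p n / real ?w))\<^sup>2" by (rule power_mono) simp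
    also have "\<dots> \<le> (\<Sum>p\<in>?S. 1\<^sup>2) * (\<Sum>p\<in>?S. (square_weight p n / real ?w)\<^sup>2)" by (rule Cauchy_Schwarz_ineq_sum)
    also have "\<dots> = (real (card ?S) / (real ?w)\<^sup>2) * (\<Sum>p\<in>?S. (square_weight p n)\<^sup>2)"
      by (simp add: power_divide sum_divide_distrib[symmetric])
    \<comment> \<open>Cauchy-Schwarz costs the number of terms, which is at most \<open>?w\<close>;
      the averaging has supplied the factor 1 / \<open>?w\<close>^2.\<close>
    also have "\<dots> \<le> 1 * (\<Sum>p\<in>?S. (square_weight p n)\<^sup>2)"
    proof (intro mult_right_mono sum_nonneg)
      have "card ?S \<le> ?w" using card_mono[OF finP(1) SP] cardP by simp
      also have "?w \<le> ?w\<^sup>2" by (simp add: power2_eq_square)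
      finally have "real (card ?S) \<le> (real ?w)\<^sup>2" by (simp flip: of_nat_power)
      then show "real (card ?S) / (real ?w)\<^sup>2 \<le> 1" using False by (simp add: pos_divide_le_eq)
    qed auto
    finally show ?thesis by simp
  qed
qed

definition square_const :: real where
  "square_const = (\<Sum>k. real (k + 1) ^ (2 * d) * (1/2) ^ k)"

lemma summable_square_const: "summable (\<lambda>k. real (k + 1) ^ (2 * d) * (1/2) ^ k)"
proof (rule summable_comparison_test_ev)
  have "((\<lambda>k. real (k + 1) ^ (2 * d) * (2/3) ^ k) \<longlonglongrightarrow> 0)" by real_asymp
  then have "\<forall>\<^sub>F k in sequentially. real (k + 1) ^ (2 * d) * (2/3) ^ k < 1" by (rule order_tendstoD) simp
  then show "\<forall>\<^sub>F k in sequentially. norm (real (k + 1) ^ (2 * d) * (1/2) ^ k) \<le> (3/4) ^ k"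
  proof eventually_elim
    case (elim k)
    have "(1/2) ^ k = (2/3) ^ k * (3/4::real) ^ k" by (simp flip: power_mult_distrib)
    then have "real (k + 1) ^ (2 * d) * (1/2) ^ k = (real (k + 1) ^ (2 * d) * (2/3) ^ k) * (3/4) ^ k" by simp
    also have "\<dots> \<le> 1 * (3/4) ^ k" using elim by (intro mult_right_mono) auto
    finally show ?case by (simp add: abs_mult)
  qed
qed (intro summable_geometric, simp)

text \<open>The integers are sorted by the exact power p ^ k dividing them, with k \<ge> 2. The
  second moment of the cofactors gives N / p ^ k, and summing over k leaves 1 / p^2.\<close>

lemma sum_square_weight_le:
  assumes p: "prime p" and K: "\<And>N. (\<Sum>n\<in>{1..N}. (norm (lam F n))\<^sup>2) \<le> K * real N"
  shows "(\<Sum>n | n \<in> {1..N} \<and> p\<^sup>2 dvd n. (square_weight p n)\<^sup>2) \<le> 4 * K * (1 + real d)\<^sup>2 * square_const * real N * (1 / (real p)\<^sup>2)"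
proof -
  have p2: "p \<ge> 2" using p by (rule prime_ge_2_nat)
  have K0: "K \<ge> 0" using order.trans[OF sum_nonneg K[of 1]] by simp
  let ?A = "{n. n \<in> {1..N} \<and> p\<^sup>2 dvd n}"
  have Msub: "(multiplicity p) ` ?A \<subseteq> {2..N}"
  proof (clarsimp)
    fix n assume n: "Suc 0 \<le> n" "n \<le> N" "p\<^sup>2 dvd n"
    have "multiplicity p n \<ge> 2" using n p2 by (intro multiplicity_geI) auto
    moreover have "multiplicity p n < p ^ multiplicity p n" using p2 by (intro power_gt_expt) auto
    moreover have "p ^ multiplicity p n \<le> n" using n by (intro dvd_imp_le multiplicity_dvd) auto
    ultimately show "2 \<le> multiplicity p n \<and> multiplicity p n \<le> N" using n by linarith
  qed
  have "(\<Sum>n\<in>?A. (square_weight p n)\<^sup>2) = (\<Sum>k\<in>{2..N}. \<Sum>n | n \<in> ?A \<and> multiplicity p n = k. (square_weight p n)\<^sup>2)"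
    using Msub by (intro sum.group[symmetric]) auto
  also have "\<dots> \<le> (\<Sum>k\<in>{2..N}. 4 * K * (1 + real d)\<^sup>2 * real N * (1 / (real p)\<^sup>2) * (real (k + 1) ^ (2 * d) * (1/2) ^ k))"
  proof (rule sum_mono)
    fix k assume k: "k \<in> {2..N}"
    let ?B = "{n. n \<in> ?A \<and> multiplicity p n = k}"
    have inj: "inj_on (\<lambda>n. n div p ^ k) ?B"
    proof (rule inj_onI)
      fix x y assume "x \<in> ?B" "y \<in> ?B" and e: "x div p ^ k = y div p ^ k"
      then have "p ^ k dvd x" "p ^ k dvd y" using multiplicity_dvd[of p x] multiplicity_dvd[of p y] by auto
      then show "x = y" using e by (metis dvd_div_mult_self)
    qed
    have im: "(\<lambda>n. n div p ^ k) ` ?B \<subseteq> {1..N div p ^ k}"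
    proof
      fix y assume "y \<in> (\<lambda>n. n div p ^ k) ` ?B"
      then obtain n where n: "n \<in> ?B" "y = n div p ^ k" by blast
      then have dv: "p ^ k dvd n" using multiplicity_dvd[of p n] by auto
      have "p ^ k \<le> n" using dv n by (intro dvd_imp_le) auto
      then have "y > 0" using n p2 by (simp add: div_greater_zero_iff)
      moreover have "y \<le> N div p ^ k" using n by (auto intro: div_le_mono)
      ultimately show "y \<in> {1..N div p ^ k}" by simp
    qed
    have "(\<Sum>n\<in>?B. (square_weight p n)\<^sup>2) = (\<Sum>n\<in>?B. ((1 + real d) * real (k + 1) ^ d)\<^sup>2 * (norm (lam F (n div p ^ k)))\<^sup>2)"
      by (intro sum.cong) (auto simp: square_weight_def power_mult_distrib)
    also have "\<dots> = ((1 + real d) * real (k + 1) ^ d)\<^sup>2 * (\<Sum>m\<in>(\<lambda>n. n div p ^ k) ` ?B. (norm (lam F m))\<^sup>2)"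
      by (simp only: sum.reindex[OF inj] o_def sum_distrib_left)
    also have "\<dots> \<le> ((1 + real d) * real (k + 1) ^ d)\<^sup>2 * (K * (real N * (1 / real p ^ k)))"
    proof (rule mult_left_mono)
      have "(\<Sum>m\<in>(\<lambda>n. n div p ^ k) ` ?B. (norm (lam F m))\<^sup>2) \<le> (\<Sum>m\<in>{1..N div p ^ k}. (norm (lam F m))\<^sup>2)"
        by (rule sum_mono2[OF _ im]) auto
      also have "\<dots> \<le> K * real (N div p ^ k)" by (rule K)
      also have "real (N div p ^ k) \<le> real N / real (p ^ k)" by (rule of_nat_div_le_of_nat)
      finally show "(\<Sum>m\<in>(\<lambda>n. n div p ^ k) ` ?B. (norm (lam F m))\<^sup>2) \<le> K * (real N * (1 / real p ^ k))"
        using K0 by (simp add: mult_left_mono)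
    qed simp
    \<comment> \<open>Two of the k factors 1 / p are kept for the sum over p, the others are bounded
      by 1/2; this makes the sum over k converge uniformly in p.\<close>
    also have "\<dots> \<le> ((1 + real d) * real (k + 1) ^ d)\<^sup>2 * (K * (real N * (4 * (1/2) ^ k * (1 / (real p)\<^sup>2))))"
    proof (intro mult_left_mono)
      obtain j where j: "k = j + 2" using k by (metis add.commute atLeastAtMost_iff le_Suc_ex)
      have "1 / real p ^ j \<le> 1 / 2 ^ j" using p2 by (intro divide_left_mono power_mono) auto
      then have "1 / real p ^ j * (1 / (real p)\<^sup>2) \<le> 1 / 2 ^ j * (1 / (real p)\<^sup>2)" by (intro mult_right_mono) auto
      moreover have "1 / real p ^ k = 1 / real p ^ j * (1 / (real p)\<^sup>2)" unfolding j power_add by simp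
      moreover have "4 * (1/2) ^ k = 1 / (2::real) ^ j" unfolding j power_add by (simp add: power_one_over power2_eq_square)
      ultimately show "1 / real p ^ k \<le> 4 * (1/2) ^ k * (1 / (real p)\<^sup>2)" by (simp only:)
    qed (use K0 in auto)
    also have "\<dots> = 4 * K * (1 + real d)\<^sup>2 * real N * (1 / (real p)\<^sup>2) * (real (k + 1) ^ (2 * d) * (1/2) ^ k)"
    proof -
      have "real (k + 1) ^ (2 * d) = (real (k + 1) ^ d)\<^sup>2" by (simp add: power_mult[symmetric] mult.commute)
      then show ?thesis by (simp only: power_mult_distrib mult.assoc mult.commute mult.left_commute)
    qed
    finally show "(\<Sum>n\<in>?B. (square_weight p n)\<^sup>2) \<le> 4 * K * (1 + real d)\<^sup>2 * real N * (1 / (real p)\<^sup>2) * (real (k + 1) ^ (2 * d) * (1/2) ^ k)" .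
  qed
  also have "\<dots> = 4 * K * (1 + real d)\<^sup>2 * real N * (1 / (real p)\<^sup>2) * (\<Sum>k\<in>{2..N}. real (k + 1) ^ (2 * d) * (1/2) ^ k)"
    by (simp add: sum_distrib_left)
  also have "\<dots> \<le> 4 * K * (1 + real d)\<^sup>2 * real N * (1 / (real p)\<^sup>2) * square_const"
    unfolding square_const_def using K0 by (intro mult_left_mono sum_le_suminf summable_square_const) auto
  finally show ?thesis by (simp add: mult_ac)
qed

text \<open>The sum of 1 / p^2 over p \<ge> 2 ^ a produces the saving 2 ^ -a.\<close>

lemma sum_square_part_le:
  assumes K: "\<And>N. (\<Sum>n\<in>{1..N}. (norm (lam F n))\<^sup>2) \<le> K * real N"
  shows "(\<Sum>n\<in>{1..N}. (norm (square_part a b n))\<^sup>2) \<le> 8 * K * (1 + real d)\<^sup>2 * square_const * real N / 2 ^ a"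
proof -
  have K0: "K \<ge> 0" using order.trans[OF sum_nonneg K[of 1]] by simp
  have s0: "square_const \<ge> 0" unfolding square_const_def by (intro suminf_nonneg summable_square_const) auto
  have "(\<Sum>n\<in>{1..N}. (norm (square_part a b n))\<^sup>2) \<le> (\<Sum>n\<in>{1..N}. \<Sum>p | p \<in> prime_range a b \<and> p\<^sup>2 dvd n. (square_weight p n)\<^sup>2)"
    by (intro sum_mono norm_square_part_le) auto
  also have "\<dots> = (\<Sum>p\<in>prime_range a b. \<Sum>n | n \<in> {1..N} \<and> p\<^sup>2 dvd n. (square_weight p n)\<^sup>2)"
    by (rule sum.swap_restrict) (auto simp: finite_prime_range)
  also have "\<dots> \<le> (\<Sum>p\<in>prime_range a b. 4 * K * (1 + real d)\<^sup>2 * square_const * real N * (1 / (real p)\<^sup>2))"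
    by (intro sum_mono sum_square_weight_le K) (auto simp: prime_range_def)
  also have "\<dots> = 4 * K * (1 + real d)\<^sup>2 * square_const * real N * (\<Sum>p\<in>prime_range a b. 1 / (real p)\<^sup>2)"
    by (simp add: sum_distrib_left)
  also have "\<dots> \<le> 4 * K * (1 + real d)\<^sup>2 * square_const * real N * (2 / real (2 ^ a))"
    using K0 s0 by (intro mult_left_mono sum_inverse_squares_le finite_prime_range) (auto simp: prime_range_def)
  finally show ?thesis by simp
qed

text \<open>(A2) with X = Y = N / 2 covers the upper half of the range and induction the lower half.
  The integers up to the threshold of (A2) are absorbed into the constant.\<close>

lemma second_moment:
  assumes A2: "\<exists>\<epsilon>>0. \<exists>K X\<^sub>0. \<forall>X Y :: real.
               X \<ge> 2 \<and> X \<ge> X\<^sub>0 \<and> X powr (1 - \<epsilon>) \<le> Y \<and> Y \<le> X \<longrightarrow>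
               (\<Sum>n | X \<le> real n \<and> real n \<le> X + Y. (norm (lam F n))\<^sup>2) \<le> K * Y"
  obtains K where "K > 0" "\<And>N. (\<Sum>n\<in>{1..N}. (norm (lam F n))\<^sup>2) \<le> K * real N"
proof -
  obtain \<epsilon> K X0 where *: "\<epsilon> > 0" "\<And>X Y :: real. X \<ge> 2 \<Longrightarrow> X \<ge> X0 \<Longrightarrow> X powr (1 - \<epsilon>) \<le> Y \<Longrightarrow> Y \<le> X \<Longrightarrow>
               (\<Sum>n | X \<le> real n \<and> real n \<le> X + Y. (norm (lam F n))\<^sup>2) \<le> K * Y"
    using A2 by blast
  obtain N0 :: nat where N0: "max 4 (2 * X0) \<le> real N0" using real_arch_simple by blast
  define M where "M = (\<Sum>n\<in>{1..N0}. (norm (lam F n))\<^sup>2)"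
  define K' where "K' = 1 + \<bar>K\<bar> + M"
  have M0: "M \<ge> 0" by (simp add: M_def sum_nonneg)
  have "(\<Sum>n\<in>{1..N}. (norm (lam F n))\<^sup>2) \<le> K' * real N" for N
  proof (induction N rule: less_induct)
    case (less N)
    show ?case
    proof (cases "N \<le> N0")
      case True
      show ?thesis
      proof (cases "N = 0")
        case False
        have "(\<Sum>n\<in>{1..N}. (norm (lam F n))\<^sup>2) \<le> M" unfolding M_def using True by (intro sum_mono2) auto
        also have "\<dots> \<le> K' * 1" by (simp add: K'_def)
        also have "\<dots> \<le> K' * real N" using False M0 by (intro mult_left_mono) (auto simp: K'_def)
        finally show ?thesis .
      qed simp
    next
      case False
      define X where "X = real N / 2"
      have X: "X \<ge> 2" "X \<ge> X0" using N0 False by (auto simp: X_def)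
      have "X powr (1 - \<epsilon>) \<le> X powr 1" using X *(1) by (intro powr_mono) auto
      then have 1: "(\<Sum>n | X \<le> real n \<and> real n \<le> X + X. (norm (lam F n))\<^sup>2) \<le> K * X" using X by (intro *(2)) auto
      have fin: "finite {n. X \<le> real n \<and> real n \<le> X + X}" by (rule finite_subset[of _ "{..N}"]) (auto simp: X_def)
      have "{1..N} \<subseteq> {1..N div 2} \<union> {n. X \<le> real n \<and> real n \<le> X + X}"
      proof
        fix n assume n: "n \<in> {1..N}"
        show "n \<in> {1..N div 2} \<union> {n. X \<le> real n \<and> real n \<le> X + X}"
        proof (cases "n \<le> N div 2")
          case False
          then have "N \<le> 2 * n" by linarith
          then have "real N \<le> 2 * real n" by linarith
          then show ?thesis using n by (simp add: X_def)
        qed (use n in auto)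
      qed
      then have "(\<Sum>n\<in>{1..N}. (norm (lam F n))\<^sup>2) \<le> (\<Sum>n\<in>{1..N div 2} \<union> {n. X \<le> real n \<and> real n \<le> X + X}. (norm (lam F n))\<^sup>2)"
        using fin by (intro sum_mono2) auto
      also have "\<dots> \<le> (\<Sum>n\<in>{1..N div 2}. (norm (lam F n))\<^sup>2) + (\<Sum>n | X \<le> real n \<and> real n \<le> X + X. (norm (lam F n))\<^sup>2)"
        using fin by (subst sum.union_inter[symmetric]) (auto intro: sum_nonneg)
      also have "\<dots> \<le> K' * real (N div 2) + K * X" using less[of "N div 2"] False N0 1 by (intro add_mono) auto
      also have "\<dots> \<le> K' * (real N / 2) + K' * X"
        using M0 X by (intro add_mono mult_mono) (use of_nat_div_le_of_nat[of N 2, where 'a=real] in \<open>auto simp: K'_def\<close>)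
      also have "\<dots> = K' * real N" by (simp add: X_def)
      finally show ?thesis .
    qed
  qed
  moreover have "K' > 0" using M0 by (simp add: K'_def)
  ultimately show ?thesis using that by blast
qed

text \<open>(A3) between 2 ^ a and 2 ^ b, where the quotient of the logarithms is a / b.\<close>

lemma rough_second_moment:
  assumes A3: "\<exists>K. \<forall>P\<^sub>1 P\<^sub>2 X :: real. 2 \<le> P\<^sub>1 \<and> P\<^sub>1 \<le> P\<^sub>2 \<and> P\<^sub>2 \<le> X \<longrightarrow>
               (\<Sum>n | 1 \<le> n \<and> real n \<le> X \<and>
                      coprime n (\<Prod>p | prime p \<and> P\<^sub>1 \<le> real p \<and> real p \<le> P\<^sub>2. p).
                  (norm (lam F n))\<^sup>2)
               \<le> K * (X * ln P\<^sub>1 / ln P\<^sub>2)"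
  obtains K where "K > 0" "\<And>a b N. 1 \<le> a \<Longrightarrow> 2 \<le> b \<Longrightarrow> a \<le> b \<Longrightarrow> 2 ^ b \<le> N \<Longrightarrow>
     (\<Sum>n\<in>{1..N}. (norm (rough_part a b n))\<^sup>2) \<le> K * real N * (real a / real b)"
proof -
  obtain K where K: "\<And>P\<^sub>1 P\<^sub>2 X :: real. 2 \<le> P\<^sub>1 \<Longrightarrow> P\<^sub>1 \<le> P\<^sub>2 \<Longrightarrow> P\<^sub>2 \<le> X \<Longrightarrow>
               (\<Sum>n | 1 \<le> n \<and> real n \<le> X \<and>
                      coprime n (\<Prod>p | prime p \<and> P\<^sub>1 \<le> real p \<and> real p \<le> P\<^sub>2. p).
                  (norm (lam F n))\<^sup>2)
               \<le> K * (X * ln P\<^sub>1 / ln P\<^sub>2)"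
    using A3 by blast
  have "(\<Sum>n\<in>{1..N}. (norm (rough_part a b n))\<^sup>2) \<le> (\<bar>K\<bar> + 1) * real N * (real a / real b)"
    if ab: "1 \<le> a" "2 \<le> b" "a \<le> b" "2 ^ b \<le> N" for a b N :: nat
  proof -
    have pe: "{p. prime p \<and> (2::real) ^ a \<le> real p \<and> real p \<le> 2 ^ b} = prime_range a b"
    proof -
      \<comment> \<open>The closed interval of (A3) and the half-open \<open>prime_range\<close>
        contain the same primes, because 2 ^ b is composite for b \<ge> 2.\<close>
      have np: "\<not> prime ((2::nat) ^ b)" using ab prime_power_iff[of "2::nat" b] by auto
      have "(2::real) ^ a \<le> real p \<longleftrightarrow> 2 ^ a \<le> p" "real p \<le> 2 ^ b \<longleftrightarrow> p \<le> 2 ^ b" for p :: nat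
        by (metis of_nat_le_iff of_nat_numeral of_nat_power)+
      then show ?thesis unfolding prime_range_def using np by (auto simp: order_le_less)
    qed
    have cop: "coprime n (\<Prod>p\<in>prime_range a b. p)" if "range_omega a b n = 0" for n
    proof (rule prod_coprime_right)
      fix p assume p: "p \<in> prime_range a b"
      have "{p \<in> prime_range a b. p dvd n} = {}"
        using that finite_prime_range unfolding range_omega_def by simp
      then have "\<not> p dvd n" using p by blast
      then show "coprime n p" using p unfolding prime_range_def by (metis (no_types, lifting) coprime_commute mem_Collect_eq prime_imp_coprime)
    qed
    have "(\<Sum>n\<in>{1..N}. (norm (rough_part a b n))\<^sup>2) = (\<Sum>n | n \<in> {1..N} \<and> range_omega a b n = 0. (norm (lam F n))\<^sup>2)"
      unfolding rough_part_def by (auto simp: sum.If_cases if_distrib[of "\<lambda>x. (norm x)\<^sup>2"] Int_def cong: if_cong)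
    also have "\<dots> \<le> (\<Sum>n | 1 \<le> n \<and> real n \<le> real N \<and> coprime n (\<Prod>p\<in>prime_range a b. p). (norm (lam F n))\<^sup>2)"
      using cop by (intro sum_mono2) auto
    also have "\<dots> \<le> K * (real N * ln (2 ^ a) / ln (2 ^ b))"
    proof -
      have "(2::real) ^ 1 \<le> 2 ^ a" "(2::real) ^ a \<le> 2 ^ b" using ab by (intro power_increasing; simp)+
      moreover have "(2::real) ^ b \<le> real N" using ab(4) by (metis of_nat_le_iff of_nat_numeral of_nat_power)
      ultimately show ?thesis using K[of "2 ^ a" "2 ^ b" "real N"] unfolding pe by simp
    qed
    also have "real N * ln (2 ^ a) / ln (2 ^ b) = real N * (real a / real b)" by (simp add: ln_realpow)
    also have "K * (real N * (real a / real b)) \<le> (\<bar>K\<bar> + 1) * (real N * (real a / real b))" by (intro mult_right_mono) auto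
    finally show ?thesis by (simp add: mult.assoc)
  qed
  then show ?thesis using that[of "\<bar>K\<bar> + 1"] by simp
qed

end

section \<open>Mean squares of dyadic blocks\<close>

text \<open>The size of \<open>afe_weight\<close> on the block of 2 ^ j for the length R, up to a
  constant; the two entries come from the lines c = 1/8 and c = 2. The exponent 1/8 keeps the cost
  of the blocks below the length small, the exponent 2 makes the blocks beyond it summable.\<close>

definition dyadic_weight :: "real \<Rightarrow> nat \<Rightarrow> real" where
  "dyadic_weight R j = min ((R / 2 ^ j) powr (1/8)) ((R / 2 ^ j)\<^sup>2)"

lemma dyadic_weight_nonneg: "dyadic_weight R j \<ge> 0"
  by (simp add: dyadic_weight_def)

definition geom_const :: real where
  "geom_const = 1 / (1 - 2 powr (-(1/8)))"

lemma geom_const_pos: "geom_const > 0"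
  using powr_less_mono[of "-(1/8)" 0 "2::real"] by (simp add: geom_const_def)

lemma two_power_powr: "(2 ^ j :: real) powr x = (2 powr x) ^ j"
  by (induction j) (auto simp: powr_mult)

lemma sum_dyadic_weight_le:
  assumes R: "R > 0" and A: "finite A"
  shows "(\<Sum>j\<in>A. dyadic_weight R j) \<le> geom_const * R powr (1/8)"
proof -
  define \<theta> where "\<theta> = 2 powr (-(1/8::real))"
  have \<theta>: "0 < \<theta>" "\<theta> < 1" using powr_less_mono[of "-(1/8)" 0 "2::real"] by (auto simp: \<theta>_def)
  have "(\<Sum>j\<in>A. dyadic_weight R j) \<le> (\<Sum>j\<in>A. R powr (1/8) * \<theta> ^ j)"
  proof (rule sum_mono)
    fix j
    have "(R / 2 ^ j) powr (1/8) = R powr (1/8) * \<theta> ^ j"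
      using R by (simp add: powr_divide two_power_powr \<theta>_def powr_minus_divide power_divide)
    then show "dyadic_weight R j \<le> R powr (1/8) * \<theta> ^ j" by (simp add: dyadic_weight_def)
  qed
  also have "\<dots> = R powr (1/8) * (\<Sum>j\<in>A. \<theta> ^ j)" by (simp add: sum_distrib_left)
  also have "\<dots> \<le> R powr (1/8) * (\<Sum>j. \<theta> ^ j)"
    using \<theta> A by (intro mult_left_mono sum_le_suminf summable_geometric) auto
  also have "(\<Sum>j. \<theta> ^ j) = geom_const" using \<theta> by (simp add: suminf_geometric geom_const_def \<theta>_def)
  finally show ?thesis by (simp add: mult.commute)
qed

definition peak_const :: real where
  "peak_const = 2 powr (3/8) * (2 / (1 - 2 powr (-(3/8))))"

lemma peak_const_pos: "peak_const > 0"
  using powr_less_mono[of "-(3/8)" 0 "2::real"] by (simp add: peak_const_def)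

lemma sum_geometric_two_sided:
  fixes \<theta> :: real
  assumes \<theta>: "0 < \<theta>" "\<theta> < 1" and A: "finite A"
  shows "(\<Sum>j\<in>A. \<theta> ^ nat \<bar>int j - int l\<bar>) \<le> 2 / (1 - \<theta>)"
proof -
  have g: "(\<Sum>j\<in>B. \<theta> ^ f j) \<le> 1 / (1 - \<theta>)" if "finite B" "inj_on f B" for B and f :: "nat \<Rightarrow> nat"
  proof -
    have "(\<Sum>j\<in>B. \<theta> ^ f j) = (\<Sum>k\<in>f ` B. \<theta> ^ k)" using that by (simp add: sum.reindex)
    also have "\<dots> \<le> (\<Sum>k. \<theta> ^ k)" using \<theta> that by (intro sum_le_suminf summable_geometric) auto
    finally show ?thesis using \<theta> by (simp add: suminf_geometric)
  qed
  have "(\<Sum>j\<in>A. \<theta> ^ nat \<bar>int j - int l\<bar>) = (\<Sum>j\<in>A \<inter> {..<l}. \<theta> ^ nat \<bar>int j - int l\<bar>) + (\<Sum>j\<in>A - {..<l}. \<theta> ^ nat \<bar>int j - int l\<bar>)"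
    by (rule sum.Int_Diff[OF A])
  also have "\<dots> \<le> 1 / (1 - \<theta>) + 1 / (1 - \<theta>)"
    using A by (intro add_mono g) (auto simp: inj_on_def)
  finally show ?thesis by simp
qed

text \<open>The terms peak at 2 ^ j about R. Below the peak they decay with exponent 1/2 - 1/8 =
  3/8, above it with 2 - 1/2 = 3/2, so that a two-sided geometric series bounds the sum without a
  logarithmic loss.\<close>

lemma sum_sqrt_dyadic_weight_le:
  assumes R: "R \<ge> 1" and A: "finite A"
  shows "(\<Sum>j\<in>A. sqrt (2 ^ j) * dyadic_weight R j) \<le> peak_const * sqrt R"
proof -
  define \<theta> where "\<theta> = 2 powr (-(3/8::real))"
  have \<theta>: "0 < \<theta>" "\<theta> < 1" using powr_less_mono[of "-(3/8)" 0 "2::real"] by (auto simp: \<theta>_def)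
  define l where "l = nat \<lfloor>log 2 R\<rfloor>"
  have l0: "log 2 R \<ge> 0" using R by simp
  have l: "real l \<le> log 2 R" "log 2 R \<le> real l + 1" using l0 floor_correct[of "log 2 R"] by (auto simp: l_def)
  have "(\<Sum>j\<in>A. sqrt (2 ^ j) * dyadic_weight R j) \<le> (\<Sum>j\<in>A. sqrt R * (2 powr (3/8) * \<theta> ^ nat \<bar>int j - int l\<bar>))"
  proof (rule sum_mono)
    fix j
    define y where "y = real j - log 2 R"
    have R2: "R = 2 powr log 2 R" using R by simp
    have q: "R / 2 ^ j = 2 powr (- y)" unfolding y_def using R2 by (simp add: powr_diff powr_realpow)
    have s: "sqrt (2 ^ j) = sqrt R * 2 powr (y / 2)"
    proof -
      have s1: "sqrt (2 ^ j :: real) = 2 powr (real j / 2)"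
        using powr_half_sqrt[of "2 ^ j"] powr_realpow[of 2 j] powr_powr[of 2 "real j" "1/2"] by simp
      have s2: "sqrt R = 2 powr (log 2 R / 2)" using R powr_half_sqrt[of R] powr_powr[of 2 "log 2 R" "1/2"] by simp
      have "real j / 2 = log 2 R / 2 + y / 2" by (simp add: y_def diff_divide_distrib)
      then show ?thesis unfolding s1 s2 by (simp only: powr_add)
    qed
    have "2 powr (y / 2) * dyadic_weight R j \<le> 2 powr (- (3/8) * \<bar>y\<bar>)"
    proof (cases "y \<ge> 0")
      case True
      have "dyadic_weight R j \<le> (R / 2 ^ j)\<^sup>2" by (simp add: dyadic_weight_def)
      also have "\<dots> = 2 powr (- y - y)" unfolding q power2_eq_square by (simp flip: powr_add)
      finally have "2 powr (y / 2) * dyadic_weight R j \<le> 2 powr (y / 2) * 2 powr (- y - y)" by (intro mult_left_mono) auto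
      also have "\<dots> = 2 powr (- (3/2) * y)" by (simp flip: powr_add)
      also have "\<dots> \<le> 2 powr (- (3/8) * \<bar>y\<bar>)" using True by (intro powr_mono) auto
      finally show ?thesis .
    next
      case False
      have "dyadic_weight R j \<le> (R / 2 ^ j) powr (1/8)" by (simp add: dyadic_weight_def)
      also have "\<dots> = 2 powr (- y / 8)" unfolding q by (simp add: powr_powr)
      finally have "2 powr (y / 2) * dyadic_weight R j \<le> 2 powr (y / 2) * 2 powr (- y / 8)" by (intro mult_left_mono) auto
      also have "\<dots> = 2 powr (- (3/8) * \<bar>y\<bar>)" using False by (simp flip: powr_add)
      finally show ?thesis .
    qed
    \<comment> \<open>The peak is moved to the integer l below log 2 R, a shift by at most 1, which
      costs 2 powr (3/8).\<close>
    also have "\<dots> \<le> 2 powr (3/8 - (3/8) * real (nat \<bar>int j - int l\<bar>))"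
    proof (rule powr_mono)
      have "real (nat \<bar>int j - int l\<bar>) = \<bar>real j - real l\<bar>" by simp
      moreover have "\<bar>real j - real l\<bar> \<le> \<bar>y\<bar> + 1" using l unfolding y_def by linarith
      ultimately show "- (3/8) * \<bar>y\<bar> \<le> 3/8 - (3/8) * real (nat \<bar>int j - int l\<bar>)" by linarith
    qed simp
    also have "\<dots> = 2 powr (3/8) * \<theta> ^ nat \<bar>int j - int l\<bar>"
    proof -
      have "\<theta> ^ k = 2 powr (- (3/8) * real k)" for k
        using powr_realpow[of \<theta> k] \<theta> by (simp add: \<theta>_def powr_powr)
      moreover have "2 powr (3/8 - (3/8) * x) = 2 powr (3/8) * 2 powr (- (3/8) * x)" for x :: real
        using powr_add[of 2 "3/8" "- (3/8) * x"] by simp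
      ultimately show ?thesis by simp
    qed
    finally have "2 powr (y / 2) * dyadic_weight R j \<le> 2 powr (3/8) * \<theta> ^ nat \<bar>int j - int l\<bar>" .
    then show "sqrt (2 ^ j) * dyadic_weight R j \<le> sqrt R * (2 powr (3/8) * \<theta> ^ nat \<bar>int j - int l\<bar>)"
      unfolding s mult.assoc using R by (intro mult_left_mono) auto
  qed
  also have "\<dots> = sqrt R * 2 powr (3/8) * (\<Sum>j\<in>A. \<theta> ^ nat \<bar>int j - int l\<bar>)" by (simp add: sum_distrib_left mult.assoc)
  also have "\<dots> \<le> sqrt R * 2 powr (3/8) * (2 / (1 - \<theta>))"
    using R by (intro mult_left_mono sum_geometric_two_sided \<theta> A) auto
  finally show ?thesis by (simp add: peak_const_def \<theta>_def mult_ac)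
qed

text \<open>The variance of f under the measure dt / (1 + t^2) of total mass pi is nonnegative;
  \<open>m\<close> is the mean.\<close>

lemma Cauchy_Schwarz_cauchy_weight:
  fixes f :: "real \<Rightarrow> real"
  assumes c: "continuous_on UNIV f" and b: "\<And>t. \<bar>f t\<bar> \<le> B"
  shows "(LINT t|lborel. f t / (1 + t\<^sup>2))\<^sup>2 \<le> pi * (LINT t|lborel. (f t)\<^sup>2 / (1 + t\<^sup>2))"
proof -
  have nz: "1 + t\<^sup>2 \<noteq> 0" for t :: real using zero_le_power2[of t] by linarith
  have B: "B \<ge> 0" using b[of 0] by linarith
  have i1: "integrable lborel (\<lambda>t. f t / (1 + t\<^sup>2))"
    using nz b by (intro integrable_decay[of _ B] continuous_intros c) (auto simp: abs_divide divide_right_mono)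
  have i2: "integrable lborel (\<lambda>t. (f t)\<^sup>2 / (1 + t\<^sup>2))"
  proof (rule integrable_decay[of _ "B\<^sup>2"])
    show "continuous_on UNIV (\<lambda>t. (f t)\<^sup>2 / (1 + t\<^sup>2))" using nz by (intro continuous_intros c) auto
    have "(f t)\<^sup>2 \<le> B\<^sup>2" for t using b[of t] B by (simp add: abs_le_square_iff[symmetric])
    then show "norm ((f t)\<^sup>2 / (1 + t\<^sup>2)) \<le> B\<^sup>2 / (1 + t\<^sup>2)" for t by (simp add: divide_right_mono)
  qed
  define m where "m = (LINT t|lborel. f t / (1 + t\<^sup>2)) / pi"
  have eq: "(f t - m)\<^sup>2 / (1 + t\<^sup>2) = (f t)\<^sup>2 / (1 + t\<^sup>2) - 2 * m * (f t / (1 + t\<^sup>2)) + m\<^sup>2 * (1 / (1 + t\<^sup>2))" for t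
    using nz[of t] by (simp add: power2_diff add_divide_distrib diff_divide_distrib)
  have "0 \<le> (LINT t|lborel. (f t - m)\<^sup>2 / (1 + t\<^sup>2))" by (rule integral_nonneg_AE) simp
  also have "\<dots> = (LINT t|lborel. (f t)\<^sup>2 / (1 + t\<^sup>2) - 2 * m * (f t / (1 + t\<^sup>2))) + (LINT t|lborel. m\<^sup>2 * (1 / (1 + t\<^sup>2)))"
    unfolding eq using i1 i2 integrable_one_plus_square
    by (intro Bochner_Integration.integral_add Bochner_Integration.integrable_diff integrable_mult_right)
  also have "(LINT t|lborel. (f t)\<^sup>2 / (1 + t\<^sup>2) - 2 * m * (f t / (1 + t\<^sup>2))) =
      (LINT t|lborel. (f t)\<^sup>2 / (1 + t\<^sup>2)) - (LINT t|lborel. 2 * m * (f t / (1 + t\<^sup>2)))"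
    using i1 i2 by (intro Bochner_Integration.integral_diff integrable_mult_right)
  also have "(LINT t|lborel. 2 * m * (f t / (1 + t\<^sup>2))) = 2 * m * (m * pi)"
    by (subst integral_mult_right_zero) (simp add: m_def)
  also have "(LINT t|lborel. m\<^sup>2 * (1 / (1 + t\<^sup>2))) = m\<^sup>2 * pi"
    by (subst integral_mult_right_zero) (simp only: integral_one_plus_square)
  finally have "m\<^sup>2 * pi \<le> (LINT t|lborel. (f t)\<^sup>2 / (1 + t\<^sup>2))" by (simp add: power2_eq_square algebra_simps)
  then have "pi * (m\<^sup>2 * pi) \<le> pi * (LINT t|lborel. (f t)\<^sup>2 / (1 + t\<^sup>2))" by (intro mult_left_mono) auto
  moreover have "pi * (m\<^sup>2 * pi) = (LINT t|lborel. f t / (1 + t\<^sup>2))\<^sup>2"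
    by (simp add: m_def power_divide power2_eq_square)
  ultimately show ?thesis by simp
qed

section \<open>Mean squares of the approximate functional equation\<close>

context L_family
begin

abbreviation cond_root :: "nat \<Rightarrow> real" where
  "cond_root q \<equiv> sqrt (real (conductor F q))"

lemma norm_afe_weight_dyadic_le:
  assumes e: "e \<in> {1, -1}" and R: "R > 0" and n: "real n \<ge> 2 ^ j"
  shows "norm (afe_weight e 1 (real n / R)) \<le> kernel_const * pi * dyadic_weight R j"
proof -
  have n0: "real n > 0" using n less_le_trans[of 0 "2 ^ j" "real n"] by simp
  have x: "real n / R > 0" using n0 R by simp
  have inv: "(real n / R) powr (-c) \<le> (R / 2 ^ j) powr c" if "c \<ge> 0" for c
  proof -
    have "(real n / R) powr (-c) = (R / real n) powr c" using n0 R by (simp add: powr_minus_divide powr_divide)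
    also have "\<dots> \<le> (R / 2 ^ j) powr c" using n n0 R that by (intro powr_mono2 divide_left_mono) auto
    finally show ?thesis .
  qed
  have bound: "norm (afe_weight e c (real n / R)) \<le> kernel_const * pi * (R / 2 ^ j) powr c" if "1/8 \<le> c" "c \<le> 2" for c
  proof -
    have "norm (afe_weight e c (real n / R)) \<le> kernel_const * pi * (real n / R) powr (-c)"
      by (rule norm_afe_weight_le[OF e that x])
    also have "\<dots> \<le> kernel_const * pi * (R / 2 ^ j) powr c"
      using kernel_const_pos that by (intro mult_left_mono inv) auto
    finally show ?thesis .
  qed
  have "afe_weight e 1 (real n / R) = afe_weight e (1/8) (real n / R)"
    by (rule afe_weight_shift[OF e _ _ _ x]) auto
  then have "norm (afe_weight e 1 (real n / R)) \<le> kernel_const * pi * (R / 2 ^ j) powr (1/8)" using bound[of "1/8"] by simp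
  moreover have "norm (afe_weight e 1 (real n / R)) \<le> kernel_const * pi * (R / 2 ^ j)\<^sup>2"
  proof -
    have "afe_weight e 2 (real n / R) = afe_weight e 1 (real n / R)" by (rule afe_weight_shift[OF e _ _ _ x]) auto
    then show ?thesis using bound[of 2] R by (simp add: powr_numeral)
  qed
  ultimately show ?thesis unfolding dyadic_weight_def min_def by auto
qed

text \<open>The weight depends on the character through chi (-1) alone. For a fixed parity it
  becomes part of the coefficients, and the large sieve applies directly.\<close>

lemma L2_afe_block:
  assumes X: "finite X" "\<And>chi. chi \<in> X \<Longrightarrow> good q chi" "\<And>chi. chi \<in> X \<Longrightarrow> chi (-1) = e"
    and e: "e \<in> {1, -1}" and q: "q > 0" and N: "conductor F q > 0"
    and \<kappa>: "(\<Sum>n\<in>{2^j..<2^Suc j}. (norm (c n))\<^sup>2) \<le> \<kappa> * 2 ^ j"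
  shows "L2_set (\<lambda>chi. norm (afe_sum q chi c {2^j..<2^Suc j})) X \<le>
     kernel_const * pi * sqrt \<kappa> * sqrt (real q + 2 ^ j) * dyadic_weight (cond_root q) j"
proof -
  let ?R = "cond_root q" and ?w = "kernel_const * pi * dyadic_weight (cond_root q) j"
  have R: "?R > 0" using N by simp
  have w0: "?w \<ge> 0" using kernel_const_pos dyadic_weight_nonneg by simp
  define a where "a n = c n * of_real (real n powr (-1/2)) * afe_weight e 1 (real n / ?R)" for n
  have "(\<Sum>n\<in>{2^j..<2^Suc j}. (norm (a n))\<^sup>2) \<le> (\<Sum>n\<in>{2^j..<2^Suc j}. (norm (c n))\<^sup>2 * (?w\<^sup>2 / 2 ^ j))"
  proof (rule sum_mono)
    fix n assume n: "n \<in> {2^j..<2^Suc j::nat}"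
    then have n': "real n \<ge> 2 ^ j" by (metis atLeastLessThan_iff of_nat_le_iff of_nat_numeral of_nat_power)
    have n0: "real n > 0" using n' less_le_trans[of 0 "2 ^ j" "real n"] by simp
    have "(real n powr (-1/2))\<^sup>2 = real n powr (-1)" using n0 by (simp add: power2_eq_square flip: powr_add)
    also have "\<dots> = 1 / real n" using n0 by (simp add: powr_minus_divide)
    also have "\<dots> \<le> 1 / 2 ^ j" using n' n0 by (intro divide_left_mono) auto
    finally have 1: "(real n powr (-1/2))\<^sup>2 \<le> 1 / 2 ^ j" .
    have 2: "(norm (afe_weight e 1 (real n / ?R)))\<^sup>2 \<le> ?w\<^sup>2"
      by (intro power_mono norm_afe_weight_dyadic_le e R n') auto
    have "(norm (a n))\<^sup>2 = (norm (c n))\<^sup>2 * ((real n powr (-1/2))\<^sup>2 * (norm (afe_weight e 1 (real n / ?R)))\<^sup>2)"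
      by (simp add: a_def norm_mult power_mult_distrib)
    also have "\<dots> \<le> (norm (c n))\<^sup>2 * ((1 / 2 ^ j) * ?w\<^sup>2)"
      using 1 2 by (intro mult_left_mono mult_mono) auto
    finally show "(norm (a n))\<^sup>2 \<le> (norm (c n))\<^sup>2 * (?w\<^sup>2 / 2 ^ j)" by simp
  qed
  also have "\<dots> = (\<Sum>n\<in>{2^j..<2^Suc j}. (norm (c n))\<^sup>2) * (?w\<^sup>2 / 2 ^ j)" by (simp only: sum_distrib_right)
  also have "\<dots> \<le> (\<kappa> * 2 ^ j) * (?w\<^sup>2 / 2 ^ j)" using \<kappa> by (intro mult_right_mono) auto
  finally have A: "(\<Sum>n\<in>{2^j..<2^Suc j}. (norm (a n))\<^sup>2) \<le> \<kappa> * ?w\<^sup>2" by simp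
  have "L2_set (\<lambda>chi. norm (afe_sum q chi c {2^j..<2^Suc j})) X = L2_set (\<lambda>chi. norm (\<Sum>n\<in>{2^j..<2^Suc j}. a n * chi (int n))) X"
    using X(3) by (intro L2_set_cong refl) (simp add: afe_sum_def a_def mult_ac)
  also have "\<dots> \<le> sqrt ((real q + real (2 ^ j)) * (\<kappa> * ?w\<^sup>2))"
  proof (rule large_sieve_L2_set[OF X(1) _ q _ A])
    show "dirichlet_character q chi" if "chi \<in> X" for chi using X(2)[OF that] by (simp add: good_def)
    show "{2^j..<2^Suc j} \<subseteq> {2^j..<2^j + 2^j::nat}" by simp
  qed
  also have "\<dots> = ?w * sqrt \<kappa> * sqrt (real q + 2 ^ j)"
    using w0 by (simp add: real_sqrt_mult mult_ac)
  finally show ?thesis by (simp add: mult_ac)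
qed

lemma L2_afe_blocks:
  assumes X: "finite X" "\<And>chi. chi \<in> X \<Longrightarrow> good q chi" "\<And>chi. chi \<in> X \<Longrightarrow> chi (-1) = e"
    and e: "e \<in> {1, -1}" and q: "q > 0" and N: "conductor F q > 0" and uv: "u \<le> v"
    and \<kappa>: "\<And>j. u \<le> j \<Longrightarrow> j < v \<Longrightarrow> (\<Sum>n\<in>{2^j..<2^Suc j}. (norm (c n))\<^sup>2) \<le> \<kappa> * 2 ^ j"
  shows "L2_set (\<lambda>chi. norm (afe_sum q chi c {2^u..<2^v})) X \<le>
     kernel_const * pi * sqrt \<kappa> * (\<Sum>j\<in>{u..<v}. sqrt (real q + 2 ^ j) * dyadic_weight (cond_root q) j)"
proof -
  have split: "afe_sum q chi c {2^u..<2^v} = (\<Sum>j\<in>{u..<v}. afe_sum q chi c {2^j..<2^Suc j})" for chi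
    using uv
  proof (induction v rule: dec_induct)
    case (step v)
    have "{2^u..<2^Suc v} = {2^u..<2^v} \<union> {2^v..<2^Suc v::nat}"
      using step(1) by (intro ivl_disj_un_two(3)[symmetric]) (auto intro: power_increasing)
    then have "afe_sum q chi c {2^u..<2^Suc v} = afe_sum q chi c {2^u..<2^v} + afe_sum q chi c {2^v..<2^Suc v}"
      unfolding afe_sum_def by (simp only:) (intro sum.union_disjoint, auto)
    then show ?case using step by simp
  qed (simp add: afe_sum_def)
  have "L2_set (\<lambda>chi. norm (afe_sum q chi c {2^u..<2^v})) X \<le> (\<Sum>j\<in>{u..<v}. L2_set (\<lambda>chi. norm (afe_sum q chi c {2^j..<2^Suc j})) X)"
    unfolding split by (rule L2_set_norm_sum_le) simp
  also have "\<dots> \<le> (\<Sum>j\<in>{u..<v}. kernel_const * pi * sqrt \<kappa> * sqrt (real q + 2 ^ j) * dyadic_weight (cond_root q) j)"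
  proof (rule sum_mono)
    fix j assume "j \<in> {u..<v}"
    then show "L2_set (\<lambda>chi. norm (afe_sum q chi c {2^j..<2^Suc j})) X
        \<le> kernel_const * pi * sqrt \<kappa> * sqrt (real q + 2 ^ j) * dyadic_weight (cond_root q) j"
      by (intro L2_afe_block[where e = e] X e q N \<kappa>) auto
  qed
  finally show ?thesis by (simp add: sum_distrib_left mult.assoc)
qed

text \<open>In sqrt (q + 2 ^ j) the part sqrt q is charged to all blocks and gives sqrt q R powr
  (1/8). The part sqrt (2 ^ j) concentrates at the length R and gives the main size sqrt R, the
  fourth root of the conductor.\<close>

lemma L2_afe_blocks_long:
  assumes X: "finite X" "\<And>chi. chi \<in> X \<Longrightarrow> good q chi" "\<And>chi. chi \<in> X \<Longrightarrow> chi (-1) = e"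
    and e: "e \<in> {1, -1}" and q: "q > 0" and N: "conductor F q > 0" and uv: "u \<le> v" and \<kappa>0: "\<kappa> \<ge> 0"
    and \<kappa>: "\<And>j. u \<le> j \<Longrightarrow> j < v \<Longrightarrow> (\<Sum>n\<in>{2^j..<2^Suc j}. (norm (c n))\<^sup>2) \<le> \<kappa> * 2 ^ j"
  shows "L2_set (\<lambda>chi. norm (afe_sum q chi c {2^u..<2^v})) X \<le>
     kernel_const * pi * sqrt \<kappa> * (sqrt (real q) * (geom_const * cond_root q powr (1/8)) + peak_const * sqrt (cond_root q))"
    (is "_ \<le> kernel_const * pi * sqrt \<kappa> * ?B")
proof -
  have R: "cond_root q \<ge> 1" using N by simp
  have "(\<Sum>j\<in>{u..<v}. sqrt (real q + 2 ^ j) * dyadic_weight (cond_root q) j)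
      \<le> (\<Sum>j\<in>{u..<v}. sqrt (real q) * dyadic_weight (cond_root q) j + sqrt (2 ^ j) * dyadic_weight (cond_root q) j)"
    unfolding distrib_right[symmetric] by (intro sum_mono mult_right_mono sqrt_add_le_add_sqrt dyadic_weight_nonneg) auto
  also have "\<dots> = sqrt (real q) * (\<Sum>j\<in>{u..<v}. dyadic_weight (cond_root q) j) + (\<Sum>j\<in>{u..<v}. sqrt (2 ^ j) * dyadic_weight (cond_root q) j)"
    by (simp only: sum.distrib sum_distrib_left)
  also have "\<dots> \<le> sqrt (real q) * (geom_const * cond_root q powr (1/8)) + peak_const * sqrt (cond_root q)"
    using R by (intro add_mono mult_left_mono sum_dyadic_weight_le sum_sqrt_dyadic_weight_le) auto
  finally have bound: "(\<Sum>j\<in>{u..<v}. sqrt (real q + 2 ^ j) * dyadic_weight (cond_root q) j) \<le> ?B" .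
  have "L2_set (\<lambda>chi. norm (afe_sum q chi c {2^u..<2^v})) X \<le>
      kernel_const * pi * sqrt \<kappa> * (\<Sum>j\<in>{u..<v}. sqrt (real q + 2 ^ j) * dyadic_weight (cond_root q) j)"
    by (rule L2_afe_blocks) (use X e q N uv \<kappa> in auto)
  also have "\<dots> \<le> kernel_const * pi * sqrt \<kappa> * ?B" using kernel_const_pos \<kappa>0 bound by (intro mult_left_mono) auto
  finally show ?thesis .
qed

text \<open>For blocks well below the length the modulus dominates, and every block may be charged
  sqrt (q + 2 ^ v).\<close>

lemma L2_afe_blocks_short:
  assumes X: "finite X" "\<And>chi. chi \<in> X \<Longrightarrow> good q chi" "\<And>chi. chi \<in> X \<Longrightarrow> chi (-1) = e"
    and e: "e \<in> {1, -1}" and q: "q > 0" and N: "conductor F q > 0" and uv: "u \<le> v" and \<kappa>0: "\<kappa> \<ge> 0"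
    and \<kappa>: "\<And>j. u \<le> j \<Longrightarrow> j < v \<Longrightarrow> (\<Sum>n\<in>{2^j..<2^Suc j}. (norm (c n))\<^sup>2) \<le> \<kappa> * 2 ^ j"
  shows "L2_set (\<lambda>chi. norm (afe_sum q chi c {2^u..<2^v})) X \<le>
     kernel_const * pi * sqrt \<kappa> * (sqrt (real q + 2 ^ v) * (geom_const * cond_root q powr (1/8)))"
    (is "_ \<le> kernel_const * pi * sqrt \<kappa> * ?B")
proof -
  have R: "cond_root q > 0" using N by simp
  have "(\<Sum>j\<in>{u..<v}. sqrt (real q + 2 ^ j) * dyadic_weight (cond_root q) j)
      \<le> (\<Sum>j\<in>{u..<v}. sqrt (real q + 2 ^ v) * dyadic_weight (cond_root q) j)"
    by (intro sum_mono mult_right_mono dyadic_weight_nonneg) (auto intro: power_increasing)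
  also have "\<dots> = sqrt (real q + 2 ^ v) * (\<Sum>j\<in>{u..<v}. dyadic_weight (cond_root q) j)" by (simp only: sum_distrib_left)
  also have "\<dots> \<le> sqrt (real q + 2 ^ v) * (geom_const * cond_root q powr (1/8))"
    using R by (intro mult_left_mono sum_dyadic_weight_le) auto
  finally have bound: "(\<Sum>j\<in>{u..<v}. sqrt (real q + 2 ^ j) * dyadic_weight (cond_root q) j) \<le> ?B" .
  have "L2_set (\<lambda>chi. norm (afe_sum q chi c {2^u..<2^v})) X \<le>
      kernel_const * pi * sqrt \<kappa> * (\<Sum>j\<in>{u..<v}. sqrt (real q + 2 ^ j) * dyadic_weight (cond_root q) j)"
    by (rule L2_afe_blocks) (use X e q N uv \<kappa> in auto)
  also have "\<dots> \<le> kernel_const * pi * sqrt \<kappa> * ?B" using kernel_const_pos \<kappa>0 bound by (intro mult_left_mono) auto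
  finally show ?thesis .
qed

end

section \<open>Bilinear sums with a prime variable\<close>

lemma continuous_on_cauchy_weight:
  fixes f :: "real \<Rightarrow> real"
  assumes "continuous_on UNIV f"
  shows "continuous_on UNIV (\<lambda>t. f t / (1 + t\<^sup>2))"
proof (rule continuous_on_divide[OF assms])
  show "continuous_on UNIV (\<lambda>t::real. 1 + t\<^sup>2)" by (intro continuous_intros)
  show "\<forall>t\<in>UNIV. 1 + t\<^sup>2 \<noteq> (0::real)"
  proof
    fix t :: real
    show "1 + t\<^sup>2 \<noteq> 0" using zero_le_power2[of t] by linarith
  qed
qed

context L_family
begin

text \<open>Since (n m / R) powr -z factorizes, the Mellin integral separates the two
  variables.\<close>

lemma afe_bilinear:
  assumes e: "e \<in> {1, -1}" and c: "1/8 \<le> c" "c \<le> 2" and R: "R > 0"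
    and I: "finite I" "\<And>n. n \<in> I \<Longrightarrow> n > 0" and J: "finite J" "\<And>m. m \<in> J \<Longrightarrow> m > 0"
  shows "(\<Sum>n\<in>I. \<Sum>m\<in>J. f n * g m * of_real (real (n * m) powr (-1/2)) * afe_weight e c (real (n * m) / R)) =
    (LINT t|lborel. afe_kernel e (Complex c t) * exp (Complex c t * of_real (ln R)) *
       (\<Sum>n\<in>I. f n / of_nat n powr (1/2 + Complex c t)) * (\<Sum>m\<in>J. g m / of_nat m powr (1/2 + Complex c t)))"
proof -
  let ?h = "\<lambda>x t. afe_kernel e (Complex c t) * exp (- Complex c t * of_real (ln x))"
  let ?k = "\<lambda>n m. f n * g m * of_real (real (n * m) powr (-1/2))"
  have pos: "real (n * m) / R > 0" if "n \<in> I" "m \<in> J" for n m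
    using I(2)[OF that(1)] J(2)[OF that(2)] R by simp
  have eq: "?k n m * ?h (real (n * m) / R) t = afe_kernel e (Complex c t) * exp (Complex c t * of_real (ln R)) *
      (f n / of_nat n powr (1/2 + Complex c t)) * (g m / of_nat m powr (1/2 + Complex c t))"
    if nm: "n \<in> I" "m \<in> J" for n m t
  proof -
    define z where "z = Complex c t"
    have n: "n > 0" and m: "m > 0" using I(2)[OF nm(1)] J(2)[OF nm(2)] .
    have pw: "of_nat k powr (1/2 + z) = exp ((1/2 + z) * of_real (ln (real k)))" if "k > 0" for k
      using that by (simp add: powr_def)
    have lnx: "ln (real (n * m) / R) = ln (real n) + ln (real m) - ln R"
      using n m R by (simp add: ln_div ln_mult)
    have "real (n * m) powr (-1/2) = exp (- (ln (real n) + ln (real m)) / 2)"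
    proof -
      have l: "ln (real (n * m)) = ln (real n) + ln (real m)" using n m by (simp add: ln_mult)
      have "real (n * m) powr (-1/2) = exp ((-1/2) * ln (real (n * m)))" using n m by (simp add: powr_def)
      also have "(-1/2) * ln (real (n * m)) = - (ln (real n) + ln (real m)) / 2" unfolding l by (simp only: minus_divide_left times_divide_eq_left mult_minus_left mult_1)
      finally show ?thesis .
    qed
    then have "of_real (real (n * m) powr (-1/2)) = (exp (of_real (- (ln (real n) + ln (real m)) / 2)) :: complex)"
      by (simp only: exp_of_real)
    then have "of_real (real (n * m) powr (-1/2)) * exp (- z * of_real (ln (real (n * m) / R))) =
       exp (of_real (- (ln (real n) + ln (real m)) / 2) + - z * of_real (ln (real n) + ln (real m) - ln R))"
      unfolding lnx by (simp only: exp_add)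
    also have "\<dots> = exp (z * of_real (ln R) + (- ((1/2 + z) * of_real (ln (real n)))) + (- ((1/2 + z) * of_real (ln (real m)))))"
      by (rule arg_cong[where f = exp]) (simp add: field_simps)
    also have "\<dots> = exp (z * of_real (ln R)) * (1 / of_nat n powr (1/2 + z)) * (1 / of_nat m powr (1/2 + z))"
      by (simp only: pw[OF n] pw[OF m] exp_add exp_minus inverse_eq_divide)
    finally have "of_real (real (n * m) powr (-1/2)) * exp (- z * of_real (ln (real (n * m) / R))) =
       exp (z * of_real (ln R)) * (1 / of_nat n powr (1/2 + z)) * (1 / of_nat m powr (1/2 + z))" .
    moreover have "?k n m * ?h (real (n * m) / R) t =
       afe_kernel e z * f n * g m * (of_real (real (n * m) powr (-1/2)) * exp (- z * of_real (ln (real (n * m) / R))))"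
      by (simp only: z_def mult_ac)
    ultimately show ?thesis unfolding z_def[symmetric] by simp
  qed
  have "(\<Sum>n\<in>I. \<Sum>m\<in>J. ?k n m * afe_weight e c (real (n * m) / R)) =
      (\<Sum>n\<in>I. \<Sum>m\<in>J. (LINT t|lborel. ?k n m * ?h (real (n * m) / R) t))"
    unfolding afe_weight_def by (simp only: integral_mult_right_zero)
  also have "\<dots> = (LINT t|lborel. (\<Sum>n\<in>I. \<Sum>m\<in>J. ?k n m * ?h (real (n * m) / R) t))"
  proof -
    have int: "integrable lborel (\<lambda>t. ?k n m * ?h (real (n * m) / R) t)" if "n \<in> I" "m \<in> J" for n m
      by (intro integrable_mult_right integrable_afe_weight e c pos that)
    have "(\<Sum>m\<in>J. (LINT t|lborel. ?k n m * ?h (real (n * m) / R) t)) = (LINT t|lborel. (\<Sum>m\<in>J. ?k n m * ?h (real (n * m) / R) t))"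
      if "n \<in> I" for n
      by (rule Bochner_Integration.integral_sum[symmetric]) (rule int[OF that])
    then have "(\<Sum>n\<in>I. \<Sum>m\<in>J. (LINT t|lborel. ?k n m * ?h (real (n * m) / R) t)) =
        (\<Sum>n\<in>I. (LINT t|lborel. (\<Sum>m\<in>J. ?k n m * ?h (real (n * m) / R) t)))" by (intro sum.cong refl)
    also have "\<dots> = (LINT t|lborel. (\<Sum>n\<in>I. \<Sum>m\<in>J. ?k n m * ?h (real (n * m) / R) t))"
      by (rule Bochner_Integration.integral_sum[symmetric]) (rule Bochner_Integration.integrable_sum, rule int)
    finally show ?thesis .
  qed
  also have "\<dots> =
     (LINT t|lborel. afe_kernel e (Complex c t) * exp (Complex c t * of_real (ln R)) *
       (\<Sum>n\<in>I. f n / of_nat n powr (1/2 + Complex c t)) * (\<Sum>m\<in>J. g m / of_nat m powr (1/2 + Complex c t)))"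
  proof (rule Bochner_Integration.integral_cong[OF refl])
    fix t
    have "(\<Sum>n\<in>I. \<Sum>m\<in>J. ?k n m * ?h (real (n * m) / R) t) =
      (\<Sum>n\<in>I. \<Sum>m\<in>J. afe_kernel e (Complex c t) * exp (Complex c t * of_real (ln R)) *
      (f n / of_nat n powr (1/2 + Complex c t)) * (g m / of_nat m powr (1/2 + Complex c t)))"
      by (intro sum.cong refl eq)
    also have "\<dots> = afe_kernel e (Complex c t) * exp (Complex c t * of_real (ln R)) *
       ((\<Sum>n\<in>I. f n / of_nat n powr (1/2 + Complex c t)) * (\<Sum>m\<in>J. g m / of_nat m powr (1/2 + Complex c t)))"
      unfolding sum_product unfolding sum_distrib_left by (simp only: mult.assoc)
    finally show "(\<Sum>n\<in>I. \<Sum>m\<in>J. ?k n m * ?h (real (n * m) / R) t) =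
      afe_kernel e (Complex c t) * exp (Complex c t * of_real (ln R)) *
       (\<Sum>n\<in>I. f n / of_nat n powr (1/2 + Complex c t)) * (\<Sum>m\<in>J. g m / of_nat m powr (1/2 + Complex c t))"
      by (simp only: mult.assoc)
  qed
  finally show ?thesis .
qed

lemma continuous_on_Dirichlet_polynomial:
  assumes "\<And>m. m \<in> J \<Longrightarrow> m > 0"
  shows "continuous_on UNIV (\<lambda>t. \<Sum>m\<in>J. g m / of_nat m powr (1/2 + Complex c t))"
proof (rule continuous_on_sum)
  fix m assume "m \<in> J"
  then have m: "m > 0" by (rule assms)
  have "(\<lambda>t. g m / of_nat m powr (1/2 + Complex c t)) = (\<lambda>t. g m / exp ((1/2 + Complex c t) * of_real (ln (real m))))"
    using m by (simp add: powr_def)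
  then show "continuous_on UNIV (\<lambda>t. g m / of_nat m powr (1/2 + Complex c t))"
    by (simp only:) (intro continuous_intros, auto)
qed

lemma norm_Dirichlet_polynomial_le:
  assumes "\<And>m. m \<in> J \<Longrightarrow> m > 0"
  shows "norm (\<Sum>m\<in>J. g m / of_nat m powr (1/2 + Complex c t)) \<le> (\<Sum>m\<in>J. norm (g m) / real m powr (1/2 + c))"
proof (rule sum_norm_le)
  fix m assume "m \<in> J"
  then show "norm (g m / of_nat m powr (1/2 + Complex c t)) \<le> norm (g m) / real m powr (1/2 + c)"
    using assms[of m] by (simp add: norm_divide norm_of_nat_powr)
qed

text \<open>One polynomial is bounded pointwise, its growth in t being absorbed by the reserve in
  \<open>kernel_const_bound\<close>. The other stays under the integral and is left in mean square
  over t.\<close>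

lemma afe_bilinear_bound:
  assumes e: "e \<in> {1, -1}" and c: "1/8 \<le> c" "c \<le> 2" and R: "R > 0"
    and I: "finite I" "\<And>n. n \<in> I \<Longrightarrow> n > 0" and J: "finite J" "\<And>m. m \<in> J \<Longrightarrow> m > 0"
    and B: "\<And>t. norm (\<Sum>n\<in>I. f n / of_nat n powr (1/2 + Complex c t)) \<le> B * (1 + \<bar>t\<bar>)\<^sup>2" "B \<ge> 0"
  shows "(norm (\<Sum>n\<in>I. \<Sum>m\<in>J. f n * g m * of_real (real (n * m) powr (-1/2)) * afe_weight e c (real (n * m) / R)))\<^sup>2 \<le>
    (kernel_const * R powr c * B)\<^sup>2 * (pi * (LINT t|lborel. (norm (\<Sum>m\<in>J. g m / of_nat m powr (1/2 + Complex c t)))\<^sup>2 / (1 + t\<^sup>2)))"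
proof -
  let ?f = "\<lambda>t. \<Sum>n\<in>I. f n / of_nat n powr (1/2 + Complex c t)"
  let ?g = "\<lambda>t. \<Sum>m\<in>J. g m / of_nat m powr (1/2 + Complex c t)"
  let ?F = "\<lambda>t. afe_kernel e (Complex c t) * exp (Complex c t * of_real (ln R)) * ?f t * ?g t"
  let ?G = "kernel_const * R powr c * B"
  define M where "M = (\<Sum>m\<in>J. norm (g m) / real m powr (1/2 + c))"
  have G0: "?G \<ge> 0" using kernel_const_pos B by simp
  have nz: "1 + t\<^sup>2 > 0" for t :: real using zero_le_power2[of t] by linarith
  have gM: "norm (?g t) \<le> M" for t unfolding M_def by (rule norm_Dirichlet_polynomial_le[OF J(2)])
  have cg: "continuous_on UNIV ?g" by (rule continuous_on_Dirichlet_polynomial[OF J(2)])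
  have cF: "continuous_on UNIV ?F"
  proof (intro continuous_on_mult[OF continuous_on_mult[OF continuous_on_mult]] cg)
    show "continuous_on UNIV (\<lambda>t. afe_kernel e (Complex c t))" using c by (intro continuous_on_afe_kernel[OF e]) simp
    show "continuous_on UNIV (\<lambda>t. exp (Complex c t * of_real (ln R)))" by (intro continuous_intros)
    show "continuous_on UNIV ?f" by (rule continuous_on_Dirichlet_polynomial[OF I(2)])
  qed
  have bound: "norm (?F t) \<le> ?G * (norm (?g t) / (1 + t\<^sup>2))" for t
  proof -
    have ex: "norm (exp (Complex c t * of_real (ln R))) = R powr c" using R by (simp add: powr_def)
    have kb: "norm (afe_kernel e (Complex c t)) * (1 + \<bar>t\<bar>)\<^sup>2 \<le> kernel_const / (1 + t\<^sup>2)"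
      using kernel_const_bound[OF e, of "Complex c t"] c by simp
    have "norm (?F t) = norm (afe_kernel e (Complex c t)) * R powr c * norm (?f t) * norm (?g t)"
      by (simp only: norm_mult ex)
    also have "\<dots> \<le> norm (afe_kernel e (Complex c t)) * R powr c * (B * (1 + \<bar>t\<bar>)\<^sup>2) * norm (?g t)"
      by (intro mult_right_mono mult_left_mono B) auto
    also have "\<dots> = (norm (afe_kernel e (Complex c t)) * (1 + \<bar>t\<bar>)\<^sup>2) * (R powr c * B * norm (?g t))" by (simp only: mult_ac)
    also have "\<dots> \<le> kernel_const / (1 + t\<^sup>2) * (R powr c * B * norm (?g t))"
      using B by (intro mult_right_mono kb) auto
    finally show ?thesis by (simp add: mult_ac)
  qed
  have dec: "norm (norm (?g t) / (1 + t\<^sup>2)) \<le> M / (1 + t\<^sup>2)" for t using gM[of t] nz[of t] by (simp add: divide_right_mono)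
  have cgn: "continuous_on UNIV (\<lambda>t. norm (?g t) / (1 + t\<^sup>2))"
    by (rule continuous_on_cauchy_weight[OF continuous_on_norm[OF cg]])
  have intg: "integrable lborel (\<lambda>t. norm (?g t) / (1 + t\<^sup>2))" by (rule integrable_decay[OF cgn dec])
  have "norm (?F t) \<le> (?G * M) / (1 + t\<^sup>2)" for t
  proof -
    have "norm (?F t) \<le> ?G * (norm (?g t) / (1 + t\<^sup>2))" by (rule bound)
    also have "\<dots> \<le> ?G * (M / (1 + t\<^sup>2))" using gM[of t] nz[of t] by (intro mult_left_mono G0 divide_right_mono) auto
    finally show ?thesis by simp
  qed
  then have intF: "integrable lborel ?F" by (rule integrable_decay[OF cF])
  have "norm (LINT t|lborel. ?F t) \<le> (LINT t|lborel. ?G * (norm (?g t) / (1 + t\<^sup>2)))"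
    by (intro Bochner_Integration.integral_norm_bound_integral intF integrable_mult_right intg bound)
  also have "\<dots> = ?G * (LINT t|lborel. norm (?g t) / (1 + t\<^sup>2))" by (rule integral_mult_right_zero)
  finally have "(norm (LINT t|lborel. ?F t))\<^sup>2 \<le> (?G * (LINT t|lborel. norm (?g t) / (1 + t\<^sup>2)))\<^sup>2"
    by (intro power_mono) auto
  also have "\<dots> = ?G\<^sup>2 * (LINT t|lborel. norm (?g t) / (1 + t\<^sup>2))\<^sup>2" by (rule power_mult_distrib)
  also have "\<dots> \<le> ?G\<^sup>2 * (pi * (LINT t|lborel. (norm (?g t))\<^sup>2 / (1 + t\<^sup>2)))"
  proof (rule mult_left_mono)
    have "continuous_on UNIV (\<lambda>t. norm (?g t))" by (rule continuous_on_norm[OF cg])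
    then show "(LINT t|lborel. norm (?g t) / (1 + t\<^sup>2))\<^sup>2 \<le> pi * (LINT t|lborel. (norm (?g t))\<^sup>2 / (1 + t\<^sup>2))"
      by (rule Cauchy_Schwarz_cauchy_weight[of _ M]) (simp add: gM)
  qed simp
  finally have "(norm (LINT t|lborel. ?F t))\<^sup>2 \<le>
      ?G\<^sup>2 * (pi * (LINT t|lborel. (norm (?g t))\<^sup>2 / (1 + t\<^sup>2)))" .
  moreover have eq: "(\<Sum>n\<in>I. \<Sum>m\<in>J. f n * g m * of_real (real (n * m) powr (-1/2)) * afe_weight e c (real (n * m) / R)) = (LINT t|lborel. ?F t)"
    by (rule afe_bilinear[OF e c R I J])
  ultimately show ?thesis by (simp only: eq)
qed

text \<open>Summing over the characters inside the integral reduces the claim to a mean square at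
  each fixed t, which is what the large sieve estimates. The first polynomial may depend on the
  character in an arbitrary way.\<close>

lemma L2_afe_bilinear:
  assumes e: "e \<in> {1, -1}" and c: "1/8 \<le> c" "c \<le> 2" and R: "R > 0" and X: "finite X"
    and I: "finite I" "\<And>n. n \<in> I \<Longrightarrow> n > 0" and J: "finite J" "\<And>m. m \<in> J \<Longrightarrow> m > 0"
    and B: "\<And>x t. x \<in> X \<Longrightarrow> norm (\<Sum>n\<in>I. f x n / of_nat n powr (1/2 + Complex c t)) \<le> B * (1 + \<bar>t\<bar>)\<^sup>2" "B \<ge> 0"
    and H: "\<And>t. (\<Sum>x\<in>X. (norm (\<Sum>m\<in>J. g x m / of_nat m powr (1/2 + Complex c t)))\<^sup>2) \<le> H" "H \<ge> 0"
  shows "L2_set (\<lambda>x. norm (\<Sum>n\<in>I. \<Sum>m\<in>J. f x n * g x m * of_real (real (n * m) powr (-1/2)) * afe_weight e c (real (n * m) / R))) X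
    \<le> kernel_const * pi * R powr c * B * sqrt H"
proof -
  let ?G = "kernel_const * R powr c * B"
  let ?g = "\<lambda>x t. \<Sum>m\<in>J. g x m / of_nat m powr (1/2 + Complex c t)"
  have nz: "1 + t\<^sup>2 > 0" for t :: real using zero_le_power2[of t] by linarith
  have G0: "?G \<ge> 0" using kernel_const_pos B by simp
  have cg: "continuous_on UNIV (\<lambda>t. (norm (?g x t))\<^sup>2 / (1 + t\<^sup>2))" for x
    by (rule continuous_on_cauchy_weight[OF continuous_on_power[OF continuous_on_norm[OF continuous_on_Dirichlet_polynomial[OF J(2)]]]])
  have int: "integrable lborel (\<lambda>t. (norm (?g x t))\<^sup>2 / (1 + t\<^sup>2))" for x
  proof (rule integrable_decay[OF cg])
    fix t
    have "(norm (?g x t))\<^sup>2 \<le> (\<Sum>m\<in>J. norm (g x m) / real m powr (1/2 + c))\<^sup>2"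
      by (intro power_mono norm_Dirichlet_polynomial_le J) auto
    then show "norm ((norm (?g x t))\<^sup>2 / (1 + t\<^sup>2)) \<le> (\<Sum>m\<in>J. norm (g x m) / real m powr (1/2 + c))\<^sup>2 / (1 + t\<^sup>2)"
      using nz[of t] by (simp add: divide_right_mono)
  qed
  have "(\<Sum>x\<in>X. (norm (\<Sum>n\<in>I. \<Sum>m\<in>J. f x n * g x m * of_real (real (n * m) powr (-1/2)) * afe_weight e c (real (n * m) / R)))\<^sup>2)
     \<le> (\<Sum>x\<in>X. ?G\<^sup>2 * (pi * (LINT t|lborel. (norm (?g x t))\<^sup>2 / (1 + t\<^sup>2))))"
    by (intro sum_mono afe_bilinear_bound e c R I J B)
  also have "\<dots> = ?G\<^sup>2 * (pi * (\<Sum>x\<in>X. (LINT t|lborel. (norm (?g x t))\<^sup>2 / (1 + t\<^sup>2))))" by (simp only: sum_distrib_left)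
  also have "(\<Sum>x\<in>X. (LINT t|lborel. (norm (?g x t))\<^sup>2 / (1 + t\<^sup>2))) = (LINT t|lborel. (\<Sum>x\<in>X. (norm (?g x t))\<^sup>2 / (1 + t\<^sup>2)))"
    by (rule Bochner_Integration.integral_sum[symmetric]) (rule int)
  also have "?G\<^sup>2 * (pi * (LINT t|lborel. (\<Sum>x\<in>X. (norm (?g x t))\<^sup>2 / (1 + t\<^sup>2)))) \<le> ?G\<^sup>2 * (pi * (H * pi))"
  proof (intro mult_left_mono)
    have "norm (LINT t|lborel. (\<Sum>x\<in>X. (norm (?g x t))\<^sup>2 / (1 + t\<^sup>2))) \<le> H * pi"
    proof (rule norm_integral_decay)
      show "continuous_on UNIV (\<lambda>t. \<Sum>x\<in>X. (norm (?g x t))\<^sup>2 / (1 + t\<^sup>2))" by (intro continuous_on_sum cg)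
      show "norm (\<Sum>x\<in>X. (norm (?g x t))\<^sup>2 / (1 + t\<^sup>2)) \<le> H / (1 + t\<^sup>2)" for t
        using H(1)[of t] nz[of t] by (simp add: sum_divide_distrib[symmetric] sum_nonneg divide_right_mono)
    qed
    then show "(LINT t|lborel. (\<Sum>x\<in>X. (norm (?g x t))\<^sup>2 / (1 + t\<^sup>2))) \<le> H * pi"
      unfolding real_norm_def by (rule order.trans[OF abs_ge_self])
  qed auto
  also have "\<dots> = (?G * pi * sqrt H)\<^sup>2" using H(2) by (simp add: power_mult_distrib power2_eq_square)
  finally have "L2_set (\<lambda>x. norm (\<Sum>n\<in>I. \<Sum>m\<in>J. f x n * g x m * of_real (real (n * m) powr (-1/2)) * afe_weight e c (real (n * m) / R))) X
      \<le> sqrt ((?G * pi * sqrt H)\<^sup>2)" unfolding L2_set_def by (rule real_sqrt_le_mono)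
  also have "\<dots> = ?G * pi * sqrt H" using G0 H(2) by simp
  finally show ?thesis by (simp add: mult_ac)
qed

lemma sqrt_two_power_powr: "sqrt (2 ^ i) * 2 powr (- (real i * c)) = (2 ^ i :: real) * (2 ^ i) powr (- (1/2 + c))"
proof -
  have "(2 ^ i :: real) = 2 powr real i" by (simp add: powr_realpow)
  moreover have "sqrt (2 powr real i) = 2 powr (real i / 2)" using powr_half_sqrt[of "2 powr real i"] powr_powr[of 2 "real i" "1/2"] by simp
  moreover have "real i / 2 + - (real i * c) = real i + real i * (- (1/2 + c))" by (simp add: algebra_simps)
  ultimately show ?thesis by (simp only: powr_powr flip: powr_add)
qed

text \<open>Partial summation turns the bound \<beta> for prime sums into one for the prime
  polynomial, and the large sieve treats the other variable. Carried out on the lines c = 1/8 and c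
  = 2, both available by \<open>afe_weight_shift\<close>, this gives the dyadic weight at i +
  k.\<close>

lemma L2_bilinear_block:
  assumes e: "e \<in> {1, -1}" and R: "R > 0" and X: "finite X" "\<And>chi. chi \<in> X \<Longrightarrow> dirichlet_character q chi" and q: "q > 0"
    and f: "\<And>chi m. chi \<in> X \<Longrightarrow> 2 ^ i - 1 \<le> m \<Longrightarrow> m < 2 ^ Suc i \<Longrightarrow> norm (\<Sum>n\<le>m. f chi n) \<le> \<beta> * 2 ^ i" and \<beta>: "\<beta> \<ge> 0"
    and g: "(\<Sum>m\<in>{2^k..<2^Suc k}. (norm (g m))\<^sup>2) \<le> \<kappa> * 2 ^ k"
  shows "L2_set (\<lambda>chi. norm (\<Sum>n\<in>{2^i..<2^Suc i}. \<Sum>m\<in>{2^k..<2^Suc k}. f chi n * (g m * chi (int m)) *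
       of_real (real (n * m) powr (-1/2)) * afe_weight e 1 (real (n * m) / R))) X
    \<le> kernel_const * pi * (5 * \<beta>) * sqrt \<kappa> * sqrt ((real q + 2 ^ k) * 2 ^ i) * dyadic_weight R (i + k)"
proof -
  let ?D = "\<lambda>c chi. \<Sum>n\<in>{2^i..<2^Suc i}. \<Sum>m\<in>{2^k..<2^Suc k}. f chi n * (g m * chi (int m)) *
       of_real (real (n * m) powr (-1/2)) * afe_weight e c (real (n * m) / R)"
  have pos: "n > 0" if "n \<in> {2 ^ j..<2 ^ Suc j}" for n j :: nat
    using that by (metis atLeastLessThan_iff gr0I less_numeral_extra(3) not_less zero_less_numeral zero_less_power)
  have \<kappa>0: "\<kappa> \<ge> 0"
  proof -
    have "0 \<le> \<kappa> * 2 ^ k" by (rule order.trans[OF sum_nonneg g]) auto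
    then show ?thesis using mult_neg_pos[of \<kappa> "2 ^ k"] by (cases "\<kappa> < 0") auto
  qed
  have key: "L2_set (\<lambda>chi. norm (?D c chi)) X \<le> kernel_const * pi * (5 * \<beta>) * sqrt \<kappa> * sqrt ((real q + 2 ^ k) * 2 ^ i) * (R / 2 ^ (i + k)) powr c"
    if c: "1/8 \<le> c" "c \<le> 2" for c
  proof -
    let ?B = "5 * \<beta> * (sqrt (2 ^ i) * 2 powr (- (real i * c)))" and ?H = "(real q + 2 ^ k) * (\<kappa> * 2 powr (- (2 * (real k * c))))"
    have "L2_set (\<lambda>chi. norm (?D c chi)) X \<le> kernel_const * pi * R powr c * ?B * sqrt ?H"
    proof (rule L2_afe_bilinear[OF e c R X(1) finite_atLeastLessThan pos finite_atLeastLessThan pos, where f = f and g = "\<lambda>chi m. g m * chi (int m)"])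
      fix chi t assume chi: "chi \<in> X"
      have "norm (\<Sum>n\<in>{2^i..<2^Suc i}. f chi n / of_nat n powr (1/2 + Complex c t)) \<le>
          \<beta> * 2 ^ i * real (2 ^ i) powr (- Re (1/2 + Complex c t)) * (2 + norm (1/2 + Complex c t))"
      proof (rule abel_summation_dyadic)
        show "norm (\<Sum>n\<le>m. f chi n) \<le> \<beta> * 2 ^ i" if "2 ^ i - 1 \<le> m" "m < 2 ^ Suc i" for m by (rule f[OF chi that])
        show "Re (1/2 + Complex c t) \<ge> 0" using c by simp
      qed simp_all
      also have "\<dots> \<le> \<beta> * 2 ^ i * real (2 ^ i) powr (- Re (1/2 + Complex c t)) * (5 * (1 + \<bar>t\<bar>)\<^sup>2)"
      proof (intro mult_left_mono)
        have "norm (1/2 + Complex c t) \<le> \<bar>1/2 + c\<bar> + \<bar>t\<bar>" using cmod_le[of "1/2 + Complex c t"] by simp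
        also have "\<dots> \<le> 3 + \<bar>t\<bar>" using c by simp
        finally show "2 + norm (1/2 + Complex c t) \<le> 5 * (1 + \<bar>t\<bar>)\<^sup>2"
          using self_le_power[of "1 + \<bar>t\<bar>" 2] by simp
      qed (use \<beta> in auto)
      also have "\<dots> = 5 * \<beta> * (2 ^ i * (2 ^ i) powr (- (1/2 + c))) * (1 + \<bar>t\<bar>)\<^sup>2" by simp
      finally show "norm (\<Sum>n\<in>{2^i..<2^Suc i}. f chi n / of_nat n powr (1/2 + Complex c t)) \<le> ?B * (1 + \<bar>t\<bar>)\<^sup>2"
        unfolding sqrt_two_power_powr .
    next
      fix t
      have sq: "(\<Sum>m\<in>{2^k..<2^Suc k}. (norm (g m / of_nat m powr (1/2 + Complex c t)))\<^sup>2) \<le> \<kappa> * 2 powr (- (2 * (real k * c)))"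
      proof -
        have "(\<Sum>m\<in>{2^k..<2^Suc k}. (norm (g m / of_nat m powr (1/2 + Complex c t)))\<^sup>2) \<le>
            (\<Sum>m\<in>{2^k..<2^Suc k}. (norm (g m))\<^sup>2 * (2 powr (- (2 * (real k * c))) / 2 ^ k))"
        proof (rule sum_mono)
          fix m assume m: "m \<in> {2^k..<2^Suc k::nat}"
          then have m': "real m \<ge> 2 ^ k" by (metis atLeastLessThan_iff of_nat_le_iff of_nat_numeral of_nat_power)
          have m0: "m > 0" by (rule pos[OF m])
          have "(norm (g m / of_nat m powr (1/2 + Complex c t)))\<^sup>2 = (norm (g m))\<^sup>2 * (real m powr (- (1/2 + c)))\<^sup>2"
          proof -
            have "norm (of_nat m powr (1/2 + Complex c t) :: complex) = real m powr (1/2 + c)" using norm_of_nat_powr[OF m0] by simp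
            then show ?thesis by (simp only: norm_divide powr_minus) (simp only: divide_inverse power_mult_distrib)
          qed
          also have "(real m powr (- (1/2 + c)))\<^sup>2 = real m powr (- (1 + 2 * c))"
            by (simp add: power2_eq_square flip: powr_add)
          also have "real m powr (- (1 + 2 * c)) \<le> (2 ^ k) powr (- (1 + 2 * c))"
            using m' c by (intro powr_mono2') auto
          also have "(2 ^ k :: real) powr (- (1 + 2 * c)) = 2 powr (- (2 * (real k * c)) - real k)"
          proof -
            have "real k * (- (1 + 2 * c)) = - (2 * (real k * c)) - real k" by (simp add: algebra_simps)
            then show ?thesis using powr_powr[of 2 "real k" "- (1 + 2 * c)"] by (simp only: powr_realpow)
          qed
          also have "\<dots> = 2 powr (- (2 * (real k * c))) / 2 ^ k" by (simp add: powr_diff powr_realpow)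
          finally show "(norm (g m / of_nat m powr (1/2 + Complex c t)))\<^sup>2 \<le> (norm (g m))\<^sup>2 * (2 powr (- (2 * (real k * c))) / 2 ^ k)"
            by (simp add: mult_left_mono)
        qed
        also have "\<dots> = (\<Sum>m\<in>{2^k..<2^Suc k}. (norm (g m))\<^sup>2) * (2 powr (- (2 * (real k * c))) / 2 ^ k)" by (simp only: sum_distrib_right)
        also have "\<dots> \<le> \<kappa> * 2 ^ k * (2 powr (- (2 * (real k * c))) / 2 ^ k)" by (intro mult_right_mono g) auto
        finally show ?thesis by simp
      qed
      have sub: "{2^k..<2^Suc k} \<subseteq> {2^k..<2^k + 2^k::nat}" by simp
      have "(\<Sum>chi\<in>X. (norm (\<Sum>m\<in>{2^k..<2^Suc k}. g m * chi (int m) / of_nat m powr (1/2 + Complex c t)))\<^sup>2) =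
         (\<Sum>chi\<in>X. (norm (\<Sum>m\<in>{2^k..<2^Suc k}. (g m / of_nat m powr (1/2 + Complex c t)) * chi (int m)))\<^sup>2)"
        by (simp only: times_divide_eq_left)
      also have "\<dots> \<le> (real q + real (2 ^ k)) * (\<Sum>m\<in>{2^k..<2^Suc k}. (norm (g m / of_nat m powr (1/2 + Complex c t)))\<^sup>2)"
        by (rule large_sieve_fixed_modulus[OF X q sub])
      also have "\<dots> \<le> (real q + real (2 ^ k)) * (\<kappa> * 2 powr (- (2 * (real k * c))))" by (intro mult_left_mono sq) auto
      finally show "(\<Sum>chi\<in>X. (norm (\<Sum>m\<in>{2^k..<2^Suc k}. g m * chi (int m) / of_nat m powr (1/2 + Complex c t)))\<^sup>2) \<le> ?H" by simp
    qed (use \<beta> \<kappa>0 in auto)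
    also have "\<dots> = kernel_const * pi * (5 * \<beta>) * sqrt \<kappa> * sqrt ((real q + 2 ^ k) * 2 ^ i) * (R / 2 ^ (i + k)) powr c"
    proof -
      have h: "sqrt (2 powr (- (2 * (real k * c)))) = 2 powr (- (real k * c))"
        using powr_half_sqrt[of "2 powr (- (2 * (real k * c)))"] powr_powr[of 2 "- (2 * (real k * c))" "1/2"] by simp
      have p: "(R / 2 ^ (i + k)) powr c = R powr c * (2 powr (- (real i * c)) * 2 powr (- (real k * c)))"
      proof -
        have "(2 ^ (i + k) :: real) powr c = 2 powr (real (i + k) * c)" using powr_realpow[of 2 "i + k"] powr_powr[of 2 "real (i + k)" c] by simp
        also have "\<dots> = 2 powr (real i * c) * 2 powr (real k * c)" by (simp add: algebra_simps powr_add)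
        finally have "(2 ^ (i + k) :: real) powr c = 2 powr (real i * c) * 2 powr (real k * c)" .
        moreover have "(R / 2 ^ (i + k)) powr c = R powr c / (2 ^ (i + k)) powr c" by (rule powr_divide)
        ultimately show ?thesis by (simp only: powr_minus divide_inverse inverse_mult_distrib)
      qed
      have "sqrt ?H = sqrt (real q + 2 ^ k) * (sqrt \<kappa> * 2 powr (- (real k * c)))" unfolding real_sqrt_mult h ..
      then show ?thesis unfolding p by (simp only: real_sqrt_mult mult_ac)
    qed
    finally show ?thesis .
  qed
  have shift: "?D 1 chi = ?D c chi" if "c \<in> {1/8, 2}" for c chi
  proof (intro sum.cong refl)
    fix n m assume nm: "n \<in> {2^i..<2^Suc i::nat}" "m \<in> {2^k..<2^Suc k::nat}"
    have x: "real (n * m) / R > 0" using pos[OF nm(1)] pos[OF nm(2)] R by simp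
    have "afe_weight e 1 (real (n * m) / R) = afe_weight e (1/8) (real (n * m) / R)" by (rule afe_weight_shift[OF e _ _ _ x]) auto
    moreover have "afe_weight e 2 (real (n * m) / R) = afe_weight e 1 (real (n * m) / R)" by (rule afe_weight_shift[OF e _ _ _ x]) auto
    moreover have "c = 1/8 \<or> c = 2" using that by blast
    ultimately have "afe_weight e 1 (real (n * m) / R) = afe_weight e c (real (n * m) / R)" by metis
    then show "f chi n * (g m * chi (int m)) * of_real (real (n * m) powr (-1/2)) * afe_weight e 1 (real (n * m) / R) =
       f chi n * (g m * chi (int m)) * of_real (real (n * m) powr (-1/2)) * afe_weight e c (real (n * m) / R)" by (simp only:)
  qed
  have p2: "(R / 2 ^ (i + k)) powr 2 = (R / 2 ^ (i + k))\<^sup>2" using R by (simp add: powr_numeral)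
  have D1: "L2_set (\<lambda>chi. norm (?D 1 chi)) X \<le> kernel_const * pi * (5 * \<beta>) * sqrt \<kappa> * sqrt ((real q + 2 ^ k) * 2 ^ i) * (R / 2 ^ (i + k)) powr c"
    if "c \<in> {1/8, 2}" for c
  proof -
    have "L2_set (\<lambda>chi. norm (?D 1 chi)) X = L2_set (\<lambda>chi. norm (?D c chi)) X"
      by (rule L2_set_cong[OF refl]) (rule arg_cong[where f = norm, OF shift[OF that]])
    moreover have "1/8 \<le> c" "c \<le> 2" using that by auto
    ultimately show ?thesis using key by (simp only:)
  qed
  show ?thesis
  proof (cases "(R / 2 ^ (i + k)) powr (1/8) \<le> (R / 2 ^ (i + k))\<^sup>2")
    case True
    then show ?thesis using D1[of "1/8"] by (simp only: dyadic_weight_def min_def if_True insertI1)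
  next
    case False
    then show ?thesis using D1[of 2] by (simp only: dyadic_weight_def min_def if_False p2 insertI1 insertI2)
  qed
qed

end

lemma sum_dyadic_blocks:
  fixes h :: "nat \<Rightarrow> 'a::comm_monoid_add"
  assumes "u \<le> v"
  shows "(\<Sum>j\<in>{u..<v}. \<Sum>n\<in>{2^j..<2^Suc j}. h n) = (\<Sum>n\<in>{2^u..<2^v}. h n)"
  using assms
proof (induction v rule: dec_induct)
  case (step v)
  have "{2^u..<2^Suc v} = {2^u..<2^v} \<union> {2^v..<2^Suc v::nat}"
    using step(1) by (intro ivl_disj_un_two(3)[symmetric]) (auto intro: power_increasing)
  moreover have "sum h ({2^u..<2^v} \<union> {2^v..<2^Suc v}) = sum h {2^u..<2^v} + sum h {2^v..<2^Suc v}"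
    by (intro sum.union_disjoint) auto
  ultimately have "sum h {2^u..<2^Suc v} = sum h {2^u..<2^v} + sum h {2^v..<2^Suc v}" by (simp only:)
  then show ?case using step by simp
qed simp

text \<open>Bessel's inequality for the point mass at 1, as chi 1 = 1 for every character.\<close>

lemma card_characters_le:
  assumes X: "finite X" "\<And>chi. chi \<in> X \<Longrightarrow> dirichlet_character q chi" and q: "q \<ge> 2"
  shows "card X \<le> q"
proof -
  have one: "(\<Sum>a\<in>{0..<int q}. (if a = 1 then 1 else 0) * chi a) = chi 1" for chi :: "int \<Rightarrow> complex"
  proof -
    have "(\<Sum>a\<in>{0..<int q}. (if a = 1 then 1 else 0) * chi a) = (\<Sum>a\<in>{0..<int q}. if a = 1 then chi a else 0)"
      by (intro sum.cong refl) auto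
    then show ?thesis using q by simp
  qed
  have c1: "norm (chi 1) = 1" if "chi \<in> X" for chi using dirichlet_character_one[OF X(2)[OF that]] by simp
  have "real (card X) = (\<Sum>chi\<in>X. (norm (chi 1))\<^sup>2)" using c1 by simp
  also have "\<dots> = (\<Sum>chi\<in>X. (norm (\<Sum>a\<in>{0..<int q}. (if a = 1 then 1 else 0) * chi a))\<^sup>2)" unfolding one ..
  also have "\<dots> \<le> real q * (\<Sum>a\<in>{0..<int q}. (norm (if a = 1 then 1 else 0 :: complex))\<^sup>2)"
    using q by (intro dirichlet_character_Bessel X) auto
  also have "(\<Sum>a\<in>{0..<int q}. (norm (if a = 1 then 1 else 0 :: complex))\<^sup>2) = (\<Sum>a\<in>{0..<int q}. if a = 1 then 1 else 0)"
    by (intro sum.cong refl) auto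
  also have "\<dots> = 1" using q by simp
  finally show ?thesis by simp
qed

section \<open>The bilinear part over all blocks and the combined mean square\<close>

context L_family
begin

definition ramare_coeff :: "nat \<Rightarrow> nat \<Rightarrow> nat \<Rightarrow> complex" where
  "ramare_coeff a b m = lam F m / of_nat (range_omega a b m + 1)"

definition ramare_term :: "nat \<Rightarrow> nat \<Rightarrow> nat \<Rightarrow> (int \<Rightarrow> complex) \<Rightarrow> nat \<Rightarrow> nat \<Rightarrow> complex" where
  "ramare_term q a b chi n m = prime_coeff chi n * (ramare_coeff a b m * chi (int m)) *
     of_real (real (n * m) powr (-1/2)) * afe_weight (chi (-1)) 1 (real (n * m) / cond_root q)"

lemma norm_ramare_coeff_le: "norm (ramare_coeff a b m) \<le> norm (lam F m)"
proof -
  have "norm (lam F m) / real (range_omega a b m + 1) \<le> norm (lam F m) / 1" by (intro divide_left_mono) auto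
  then show ?thesis by (simp only: ramare_coeff_def norm_divide norm_of_nat div_by_1)
qed

text \<open>The substitution n = p m separates the variables, up to the condition p m < 2 ^ J that
  still couples them.\<close>

lemma afe_sum_ramare:
  assumes chi: "dirichlet_character q chi"
  shows "afe_sum q chi (ramare_part a b) {1..<2^J} =
     (\<Sum>p\<in>prime_range a b. \<Sum>m | m \<in> {1..<2^J} \<and> p * m < 2^J. ramare_term q a b chi p m)"
proof -
  let ?W = "\<lambda>n. afe_weight (chi (-1)) 1 (real n / cond_root q)"
  have term_eq: "lam F p * lam F (n div p) / of_nat (range_omega a b (n div p) + 1) * (chi (int n) * of_real (real n powr (-1/2)) * ?W n) =
      ramare_term q a b chi p (n div p)" if p: "p \<in> prime_range a b" and dvd: "p dvd n" for p n
  proof -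
    have np: "p * (n div p) = n" using dvd by simp
    have "chi (int p * int (n div p)) = chi (int p) * chi (int (n div p))" using chi by (simp add: dirichlet_character_def)
    then have "chi (int n) = chi (int p) * chi (int (n div p))" by (metis np of_nat_mult)
    moreover have "prime_coeff chi p = lam F p * chi (int p)" using p by (simp add: prime_coeff_def prime_range_def)
    ultimately show ?thesis unfolding ramare_term_def ramare_coeff_def np by simp
  qed
  have "afe_sum q chi (ramare_part a b) {1..<2^J} =
      (\<Sum>n\<in>{1..<2^J}. \<Sum>p | p \<in> prime_range a b \<and> p dvd n. ramare_term q a b chi p (n div p))"
    unfolding afe_sum_def ramare_part_def sum_distrib_right
    by (intro sum.cong refl, subst term_eq[symmetric]) (auto simp: mult.assoc)
  also have "\<dots> = (\<Sum>n\<in>{1..<2^J}. \<Sum>p\<in>prime_range a b. if p dvd n then ramare_term q a b chi p (n div p) else 0)"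
    by (rule sum.cong[OF refl]) (rule sum.inter_filter[OF finite_prime_range])
  also have "\<dots> = (\<Sum>p\<in>prime_range a b. \<Sum>n\<in>{1..<2^J}. if p dvd n then ramare_term q a b chi p (n div p) else 0)"
    by (rule sum.swap)
  also have "\<dots> = (\<Sum>p\<in>prime_range a b. \<Sum>m | m \<in> {1..<2^J} \<and> p * m < 2^J. ramare_term q a b chi p m)"
  proof (rule sum.cong[OF refl])
    fix p assume "p \<in> prime_range a b"
    then have p: "p > 0" by (auto simp: prime_range_def prime_gt_0_nat)
    have "(\<Sum>n\<in>{1..<2^J}. if p dvd n then ramare_term q a b chi p (n div p) else 0) =
        (\<Sum>n | n \<in> {1..<2^J} \<and> p dvd n. ramare_term q a b chi p (n div p))"
      by (simp add: sum.inter_filter[symmetric])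
    also have "\<dots> = (\<Sum>m | m \<in> {1..<2^J} \<and> p * m < 2^J. ramare_term q a b chi p m)"
    proof (rule sum.reindex_bij_witness[where i = "\<lambda>m. p * m" and j = "\<lambda>n. n div p"])
      fix n :: nat assume n: "n \<in> {n \<in> {1..<2^J}. p dvd n}"
      then have np: "p * (n div p) = n" by simp
      then show "p * (n div p) = n" .
      have "n div p > 0" using n np by (intro gr0I) auto
      moreover have "n div p < 2 ^ J" using n by (intro le_less_trans[OF div_le_dividend]) simp
      ultimately show "n div p \<in> {m \<in> {1..<2^J}. p * m < 2^J}" using n np by auto
      show "ramare_term q a b chi p (n div p) = ramare_term q a b chi p (n div p)" ..
    next
      fix m :: nat assume m: "m \<in> {m \<in> {1..<2^J}. p * m < 2^J}"
      show "p * m div p = m" using p by simp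
      show "p * m \<in> {n \<in> {1..<2^J}. p dvd n}" using m p by auto
    qed
    finally show "(\<Sum>n\<in>{1..<2^J}. if p dvd n then ramare_term q a b chi p (n div p) else 0) =
        (\<Sum>m | m \<in> {1..<2^J} \<and> p * m < 2^J. ramare_term q a b chi p m)" .
  qed
  finally show ?thesis .
qed

lemma sum_ramare_blocks:
  assumes ab: "a \<le> b"
  shows "(\<Sum>i\<in>{a..<b}. \<Sum>k\<in>{..<J}. \<Sum>n\<in>{2^i..<2^Suc i}. \<Sum>m\<in>{2^k..<2^Suc k}. ramare_term q a b chi n m) =
     (\<Sum>p\<in>prime_range a b. \<Sum>m\<in>{1..<2^J}. ramare_term q a b chi p m)"
proof -
  have "(\<Sum>i\<in>{a..<b}. \<Sum>k\<in>{..<J}. \<Sum>n\<in>{2^i..<2^Suc i}. \<Sum>m\<in>{2^k..<2^Suc k}. ramare_term q a b chi n m) =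
      (\<Sum>i\<in>{a..<b}. \<Sum>n\<in>{2^i..<2^Suc i}. \<Sum>k\<in>{..<J}. \<Sum>m\<in>{2^k..<2^Suc k}. ramare_term q a b chi n m)"
    by (intro sum.cong refl sum.swap)
  also have "\<dots> = (\<Sum>n\<in>{2^a..<2^b}. \<Sum>k\<in>{..<J}. \<Sum>m\<in>{2^k..<2^Suc k}. ramare_term q a b chi n m)"
    by (rule sum_dyadic_blocks[OF ab])
  also have "\<dots> = (\<Sum>n\<in>{2^a..<2^b}. \<Sum>m\<in>{1..<2^J}. ramare_term q a b chi n m)"
  proof (rule sum.cong[OF refl])
    fix n
    show "(\<Sum>k\<in>{..<J}. \<Sum>m\<in>{2^k..<2^Suc k}. ramare_term q a b chi n m) = (\<Sum>m\<in>{1..<2^J}. ramare_term q a b chi n m)"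
      using sum_dyadic_blocks[of 0 J "ramare_term q a b chi n"] by (simp only: lessThan_atLeast0 power_0 le0)
  qed
  also have "\<dots> = (\<Sum>p\<in>prime_range a b. \<Sum>m\<in>{1..<2^J}. ramare_term q a b chi p m)"
  proof (rule sum.mono_neutral_right)
    show "prime_range a b \<subseteq> {2^a..<2^b}" by (auto simp: prime_range_def)
    show "\<forall>n\<in>{2^a..<2^b} - prime_range a b. (\<Sum>m\<in>{1..<2^J}. ramare_term q a b chi n m) = 0"
      by (auto simp: prime_range_def ramare_term_def prime_coeff_def intro!: sum.neutral)
  qed simp
  finally show ?thesis .
qed

lemma norm_ramare_term_le:
  assumes chi: "dirichlet_character q chi" "q > 0" and e: "chi (-1) \<in> {1, -1}" and N: "conductor F q > 0"
    and p: "p > 0" and m: "m > 0" and J: "2 ^ J \<le> p * m"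
  shows "norm (ramare_term q a b chi p m) \<le>
    real d * kernel_const * pi * (real (conductor F q) / 2 ^ J) * (norm (lam F m) / real m powr (3/2))"
proof -
  let ?R = "cond_root q"
  define x where "x = real (p * m)"
  have x0: "x > 0" using p m by (simp add: x_def)
  have xm: "x \<ge> real m" using p mult_right_mono[of 1 "real p" "real m"] by (simp add: x_def)
  have xJ: "x \<ge> 2 ^ J" using J unfolding x_def by (metis of_nat_le_iff of_nat_numeral of_nat_power)
  have R: "?R > 0" using N by simp
  have "norm (afe_weight (chi (-1)) 1 (x / ?R)) \<le> kernel_const * pi * (x / ?R) powr (-2)"
  proof -
    have "afe_weight (chi (-1)) 2 (x / ?R) = afe_weight (chi (-1)) 1 (x / ?R)"
      using x0 R by (intro afe_weight_shift[OF e]) auto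
    then show ?thesis using norm_afe_weight_le[OF e, of 2 "x / ?R"] x0 R by simp
  qed
  also have "(x / ?R) powr (-2) = real (conductor F q) * x powr (-2)"
  proof -
    have "y powr (-2) = 1 / y\<^sup>2" if "y > 0" for y :: real
      using that powr_minus_divide[of y 2] by (simp add: powr_numeral)
    then show ?thesis using x0 R by (simp add: power_divide)
  qed
  finally have W: "norm (afe_weight (chi (-1)) 1 (x / ?R)) \<le> kernel_const * pi * (real (conductor F q) * x powr (-2))" .
  \<comment> \<open>Of the exponent 5/2 one unit is spent on x \<ge> 2 ^ J and 3/2 on the
    convergence of the sum over m.\<close>
  have "x powr (-1/2) * x powr (-2) = x powr (-1) * x powr (-3/2)"
  proof -
    have "(-1/2) + (-2) = (-1) + (-3/2 :: real)" by simp
    then show ?thesis by (simp only: powr_add[symmetric])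
  qed
  also have "\<dots> \<le> (1 / 2 ^ J) * (1 / real m powr (3/2))"
  proof (intro mult_mono)
    have "x powr (-1) = 1 / x" using x0 by (simp add: powr_minus_divide)
    also have "\<dots> \<le> 1 / 2 ^ J" using xJ x0 by (intro divide_left_mono) auto
    finally show "x powr (-1) \<le> 1 / 2 ^ J" .
    have "x powr (-3/2) \<le> real m powr (-3/2)" using xm m by (intro powr_mono2') auto
    also have "\<dots> = 1 / real m powr (3/2)" using powr_minus_divide[of "real m" "3/2"] by simp
    finally show "x powr (-3/2) \<le> 1 / real m powr (3/2)" .
  qed auto
  finally have pw: "x powr (-1/2) * x powr (-2) \<le> (1 / 2 ^ J) * (1 / real m powr (3/2))" .
  have pc: "norm (prime_coeff chi p) \<le> real d" by (rule norm_prime_coeff_le[OF chi])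
  have gc: "norm (ramare_coeff a b m * chi (int m)) \<le> norm (lam F m)"
    using mult_mono[OF norm_ramare_coeff_le[of a b m] dirichlet_character_norm_le[OF chi, of "int m"]] by (simp add: norm_mult)
  have "norm (ramare_term q a b chi p m) = norm (prime_coeff chi p) * norm (ramare_coeff a b m * chi (int m)) * (x powr (-1/2) * norm (afe_weight (chi (-1)) 1 (x / ?R)))"
    unfolding ramare_term_def x_def[symmetric] by (simp only: norm_mult norm_of_real abs_of_nonneg[OF powr_ge_zero] mult.assoc)
  also have "\<dots> \<le> real d * norm (lam F m) * (x powr (-1/2) * (kernel_const * pi * (real (conductor F q) * x powr (-2))))"
    using kernel_const_pos by (intro mult_mono pc gc W mult_nonneg_nonneg) auto
  also have "\<dots> = real d * norm (lam F m) * kernel_const * pi * real (conductor F q) * (x powr (-1/2) * x powr (-2))" by (simp only: mult_ac)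
  also have "\<dots> \<le> real d * norm (lam F m) * kernel_const * pi * real (conductor F q) * ((1 / 2 ^ J) * (1 / real m powr (3/2)))"
    using kernel_const_pos by (intro mult_left_mono pw mult_nonneg_nonneg) auto
  finally show ?thesis by (simp add: mult_ac)
qed

text \<open>Dropping the condition p m < 2 ^ J adds terms far beyond the length of the sum. There
  the line c = 2 gives N / 2 ^ J for each of at most 2 ^ b primes, which is bounded by the
  hypothesis on J.\<close>

lemma afe_sum_ramare_tail:
  assumes good: "good q chi" and ab: "a \<le> b" and J: "conductor F q * 2 ^ b \<le> 2 ^ J"
  shows "norm (afe_sum q chi (ramare_part a b) {1..<2^J} -
     (\<Sum>i\<in>{a..<b}. \<Sum>k\<in>{..<J}. \<Sum>n\<in>{2^i..<2^Suc i}. \<Sum>m\<in>{2^k..<2^Suc k}. ramare_term q a b chi n m)) \<le>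
     real d * kernel_const * pi * lam_sum (3/2)"
proof -
  have chi: "dirichlet_character q chi" "q > 0" and N: "conductor F q > 0" using good by (auto simp: good_def)
  have e: "chi (-1) \<in> {1, -1}" using dirichlet_character_minus_one[OF chi(1)] by auto
  let ?t = "ramare_term q a b chi" and ?c = "real d * kernel_const * pi * (real (conductor F q) / 2 ^ J)"
  have c0: "?c \<ge> 0" using kernel_const_pos by simp
  have diff: "(\<Sum>m\<in>{1..<2^J}. ?t p m) = (\<Sum>m | m \<in> {1..<2^J} \<and> p * m < 2^J. ?t p m) + (\<Sum>m | m \<in> {1..<2^J} \<and> \<not> p * m < 2^J. ?t p m)" for p
    by (subst sum.union_disjoint[symmetric]) (auto intro!: sum.cong)
  have "norm (afe_sum q chi (ramare_part a b) {1..<2^J} -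
     (\<Sum>i\<in>{a..<b}. \<Sum>k\<in>{..<J}. \<Sum>n\<in>{2^i..<2^Suc i}. \<Sum>m\<in>{2^k..<2^Suc k}. ?t n m)) =
     norm (\<Sum>p\<in>prime_range a b. \<Sum>m | m \<in> {1..<2^J} \<and> \<not> p * m < 2^J. ?t p m)"
    unfolding sum_ramare_blocks[OF ab] afe_sum_ramare[OF chi(1)] diff sum.distrib by (simp add: norm_minus_commute)
  also have "\<dots> \<le> (\<Sum>p\<in>prime_range a b. \<Sum>m | m \<in> {1..<2^J} \<and> \<not> p * m < 2^J. ?c * (norm (lam F m) / real m powr (3/2)))"
  proof (intro sum_norm_le)
    fix p m assume p: "p \<in> prime_range a b" and m: "m \<in> {m \<in> {1..<2^J}. \<not> p * m < 2^J}"
    have "p > 0" using p by (auto simp: prime_range_def prime_gt_0_nat)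
    then show "norm (?t p m) \<le> ?c * (norm (lam F m) / real m powr (3/2))"
      using m by (intro norm_ramare_term_le chi e N) auto
  qed
  also have "\<dots> \<le> (\<Sum>p\<in>prime_range a b. ?c * lam_sum (3/2))"
  proof (rule sum_mono)
    fix p
    have "(\<Sum>m | m \<in> {1..<2^J} \<and> \<not> p * m < 2^J. ?c * (norm (lam F m) / real m powr (3/2))) \<le>
        (\<Sum>m\<in>{1..<2^J}. ?c * (norm (lam F m) / real m powr (3/2)))"
    proof (rule sum_mono2)
      show "0 \<le> ?c * (norm (lam F m) / real m powr (3/2))" for m by (intro mult_nonneg_nonneg c0) simp
    qed auto
    also have "\<dots> = ?c * (\<Sum>n<2^J - 1. norm (lam F (Suc n)) / real (Suc n) powr (3/2))"
    proof -
      have "(\<Sum>m\<in>{1..<2^J}. norm (lam F m) / real m powr (3/2)) = (\<Sum>n\<in>{0..<2^J - 1}. norm (lam F (Suc n)) / real (Suc n) powr (3/2))"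
        by (rule sum.reindex_bij_witness[where i = Suc and j = "\<lambda>m. m - 1"]) auto
      then show ?thesis unfolding sum_distrib_left[symmetric] lessThan_atLeast0 by (simp only:)
    qed
    also have "\<dots> \<le> ?c * lam_sum (3/2)"
      unfolding lam_sum_def by (intro mult_left_mono c0 sum_le_suminf summ) auto
    finally show "(\<Sum>m | m \<in> {1..<2^J} \<and> \<not> p * m < 2^J. ?c * (norm (lam F m) / real m powr (3/2))) \<le> ?c * lam_sum (3/2)" .
  qed
  also have "\<dots> = real (card (prime_range a b)) * ?c * lam_sum (3/2)" by simp
  also have "\<dots> \<le> 2 ^ b * ?c * lam_sum (3/2)"
  proof (intro mult_right_mono c0 lam_sum_nonneg)
    have "card (prime_range a b) \<le> card {..<2^b::nat}" by (intro card_mono) (auto simp: prime_range_def)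
    then show "real (card (prime_range a b)) \<le> 2 ^ b" by (metis card_lessThan of_nat_le_iff of_nat_numeral of_nat_power)
  qed simp
  also have "\<dots> = real d * kernel_const * pi * lam_sum (3/2) * (real (conductor F q) * 2 ^ b / 2 ^ J)" by (simp only: mult_ac times_divide_eq_left times_divide_eq_right)
  also have "\<dots> \<le> real d * kernel_const * pi * lam_sum (3/2) * 1"
  proof (intro mult_left_mono)
    have "real (conductor F q * 2 ^ b) \<le> real (2 ^ J)" using J by (simp only: of_nat_le_iff)
    then show "real (conductor F q) * 2 ^ b / 2 ^ J \<le> 1" by simp
  qed (use kernel_const_pos lam_sum_nonneg[of "3/2"] in auto)
  finally show ?thesis by simp
qed

lemma block_second_moment:
  assumes "\<And>n. norm (c n) \<le> norm (lam F n)" "\<And>N. (\<Sum>n\<in>{1..N}. (norm (lam F n))\<^sup>2) \<le> K * real N"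
  shows "(\<Sum>n\<in>{2^j..<2^Suc j}. (norm (c n))\<^sup>2) \<le> 2 * K * 2 ^ j"
proof -
  have "(\<Sum>n\<in>{2^j..<2^Suc j}. (norm (c n))\<^sup>2) \<le> (\<Sum>n\<in>{2^j..<2^Suc j}. (norm (lam F n))\<^sup>2)"
    by (intro sum_mono power_mono assms) auto
  also have "\<dots> \<le> (\<Sum>n\<in>{1..2^Suc j}. (norm (lam F n))\<^sup>2)"
    by (intro sum_mono2) (auto simp: Suc_le_eq intro: less_le_trans[OF zero_less_power])
  also have "\<dots> \<le> 2 * K * 2 ^ j" using assms(2)[of "2 ^ Suc j"] by simp
  finally show ?thesis .
qed

text \<open>For each prime block i the sum over k is again a sum of dyadic weights, in j = i + k,
  peaking at the length. The factor b counts the prime blocks and has to be paid for by the saving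
  \<beta>.\<close>

lemma L2_ramare:
  assumes X: "finite X" "\<And>chi. chi \<in> X \<Longrightarrow> good q chi" "\<And>chi. chi \<in> X \<Longrightarrow> chi (-1) = e"
    and e: "e \<in> {1, -1}" and q: "q \<ge> 2" and N: "conductor F q > 0" and ab: "a \<le> b"
    and J: "conductor F q * 2 ^ b \<le> 2 ^ J" and \<beta>: "\<beta> \<ge> 0"
    and K: "\<And>N. (\<Sum>n\<in>{1..N}. (norm (lam F n))\<^sup>2) \<le> K * real N"
    and pc: "\<And>chi i m. chi \<in> X \<Longrightarrow> a \<le> i \<Longrightarrow> i < b \<Longrightarrow> 2 ^ i - 1 \<le> m \<Longrightarrow> m < 2 ^ Suc i \<Longrightarrow>
        norm (\<Sum>n\<le>m. prime_coeff chi n) \<le> \<beta> * 2 ^ i"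
  shows "L2_set (\<lambda>chi. norm (afe_sum q chi (ramare_part a b) {1..<2^J})) X \<le>
     kernel_const * pi * (5 * \<beta>) * sqrt (2 * K) * (real b * (sqrt (real q) * sqrt (2 ^ b) * (geom_const * cond_root q powr (1/8)) + peak_const * sqrt (cond_root q)))
     + real d * kernel_const * pi * lam_sum (3/2) * sqrt (real q)"
proof -
  let ?R = "cond_root q" and ?T = "real d * kernel_const * pi * lam_sum (3/2)"
  let ?c = "kernel_const * pi * (5 * \<beta>) * sqrt (2 * K)"
  let ?B = "sqrt (real q) * sqrt (2 ^ b) * (geom_const * ?R powr (1/8)) + peak_const * sqrt ?R"
  have R: "?R \<ge> 1" using N by simp
  have K0: "K \<ge> 0" using order.trans[OF sum_nonneg K[of 1]] by simp
  have c0: "?c \<ge> 0" using kernel_const_pos \<beta> K0 by simp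
  have T0: "?T \<ge> 0" using kernel_const_pos lam_sum_nonneg[of "3/2"] by simp
  have B0: "?B \<ge> 0" using geom_const_pos peak_const_pos R by simp
  have dc: "dirichlet_character q chi" if "chi \<in> X" for chi using X(2)[OF that] by (simp add: good_def)
  have q0: "q > 0" using q by simp
  define D where "D i k chi = (\<Sum>n\<in>{2^i..<2^Suc i}. \<Sum>m\<in>{2^k..<2^Suc k}. ramare_term q a b chi n m)" for i k chi
  define S where "S chi = (\<Sum>i\<in>{a..<b}. \<Sum>k\<in>{..<J}. D i k chi)" for chi
  have block: "L2_set (\<lambda>chi. norm (D i k chi)) X \<le> ?c * sqrt ((real q + 2 ^ k) * 2 ^ i) * dyadic_weight ?R (i + k)"
    if i: "i \<in> {a..<b}" for i k
  proof -
    have "L2_set (\<lambda>chi. norm (D i k chi)) X = L2_set (\<lambda>chi. norm (\<Sum>n\<in>{2^i..<2^Suc i}. \<Sum>m\<in>{2^k..<2^Suc k}. prime_coeff chi n * (ramare_coeff a b m * chi (int m)) *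
       of_real (real (n * m) powr (-1/2)) * afe_weight e 1 (real (n * m) / ?R))) X"
      unfolding D_def ramare_term_def by (rule L2_set_cong[OF refl]) (simp only: X(3))
    also have "\<dots> \<le> ?c * sqrt ((real q + 2 ^ k) * 2 ^ i) * dyadic_weight ?R (i + k)"
    proof (rule L2_bilinear_block[OF e _ X(1) dc q0 _ \<beta>])
      show "norm (\<Sum>n\<le>m. prime_coeff chi n) \<le> \<beta> * 2 ^ i" if "chi \<in> X" "2 ^ i - 1 \<le> m" "m < 2 ^ Suc i" for chi m
        using i by (intro pc that) auto
      show "(\<Sum>m\<in>{2^k..<2^Suc k}. (norm (ramare_coeff a b m))\<^sup>2) \<le> 2 * K * 2 ^ k"
        by (rule block_second_moment[OF norm_ramare_coeff_le K])
    qed (use R in auto)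
    finally show ?thesis .
  qed
  have row: "(\<Sum>k\<in>{..<J}. sqrt ((real q + 2 ^ k) * 2 ^ i) * dyadic_weight ?R (i + k)) \<le> ?B" if i: "i \<in> {a..<b}" for i
  proof -
    have sq: "sqrt ((real q + 2 ^ k) * 2 ^ i) \<le> sqrt (real q) * sqrt (2 ^ b) + sqrt (2 ^ (k + i))" for k
    proof -
      have "(2 ^ i :: real) \<le> 2 ^ b" using i by (intro power_increasing) auto
      have "sqrt ((real q + 2 ^ k) * 2 ^ i) \<le> sqrt (real q * 2 ^ i) + sqrt (2 ^ (k + i))"
        unfolding distrib_right power_add by (intro sqrt_add_le_add_sqrt) auto
      also have "sqrt (real q * 2 ^ i) \<le> sqrt (real q * 2 ^ b)"
        using \<open>(2 ^ i :: real) \<le> 2 ^ b\<close> by (intro real_sqrt_le_mono mult_left_mono) auto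
      finally show ?thesis by (simp add: real_sqrt_mult)
    qed
    have shift: "(\<Sum>k\<in>{..<J}. h (k + i)) = (\<Sum>j\<in>{i..<i+J}. h j)" for h :: "nat \<Rightarrow> real"
      using sum.shift_bounds_nat_ivl[of h 0 i J] by (simp add: lessThan_atLeast0 add.commute)
    have "(\<Sum>k\<in>{..<J}. sqrt ((real q + 2 ^ k) * 2 ^ i) * dyadic_weight ?R (i + k)) \<le>
        (\<Sum>k\<in>{..<J}. (sqrt (real q) * sqrt (2 ^ b) + sqrt (2 ^ (k + i))) * dyadic_weight ?R (k + i))"
      unfolding add.commute[of i] by (intro sum_mono mult_right_mono sq dyadic_weight_nonneg)
    also have "\<dots> = (\<Sum>j\<in>{i..<i+J}. (sqrt (real q) * sqrt (2 ^ b) + sqrt (2 ^ j)) * dyadic_weight ?R j)"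
      by (rule shift)
    also have "\<dots> = sqrt (real q) * sqrt (2 ^ b) * (\<Sum>j\<in>{i..<i+J}. dyadic_weight ?R j) + (\<Sum>j\<in>{i..<i+J}. sqrt (2 ^ j) * dyadic_weight ?R j)"
      by (simp only: distrib_right sum.distrib sum_distrib_left)
    also have "\<dots> \<le> ?B" using R by (intro add_mono mult_left_mono sum_dyadic_weight_le sum_sqrt_dyadic_weight_le) auto
    finally show ?thesis .
  qed
  have "L2_set (\<lambda>chi. norm (S chi)) X \<le> (\<Sum>i\<in>{a..<b}. \<Sum>k\<in>{..<J}. L2_set (\<lambda>chi. norm (D i k chi)) X)"
  proof -
    have "L2_set (\<lambda>chi. norm (S chi)) X \<le> (\<Sum>i\<in>{a..<b}. L2_set (\<lambda>chi. norm (\<Sum>k\<in>{..<J}. D i k chi)) X)"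
      unfolding S_def by (rule L2_set_norm_sum_le) simp
    also have "\<dots> \<le> (\<Sum>i\<in>{a..<b}. \<Sum>k\<in>{..<J}. L2_set (\<lambda>chi. norm (D i k chi)) X)"
      by (intro sum_mono L2_set_norm_sum_le) simp
    finally show ?thesis .
  qed
  also have "\<dots> \<le> (\<Sum>i\<in>{a..<b}. \<Sum>k\<in>{..<J}. ?c * (sqrt ((real q + 2 ^ k) * 2 ^ i) * dyadic_weight ?R (i + k)))"
    unfolding mult.assoc[of ?c, symmetric] by (intro sum_mono block)
  also have "\<dots> \<le> (\<Sum>i\<in>{a..<b}. ?c * ?B)"
    unfolding sum_distrib_left[symmetric, of ?c] by (intro mult_left_mono sum_mono row c0)
  also have "\<dots> = real (b - a) * (?c * ?B)" by simp
  also have "\<dots> \<le> real b * (?c * ?B)" using c0 B0 by (intro mult_right_mono) auto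
  finally have main: "L2_set (\<lambda>chi. norm (S chi)) X \<le> ?c * (real b * ?B)" by (simp only: mult.left_commute)
  have "L2_set (\<lambda>chi. norm (afe_sum q chi (ramare_part a b) {1..<2^J} - S chi)) X \<le> L2_set (\<lambda>chi. ?T) X"
    unfolding S_def D_def by (intro L2_set_mono afe_sum_ramare_tail X(2) ab J) auto
  also have "\<dots> = sqrt (real (card X)) * ?T" by (simp only: L2_set_constant abs_of_nonneg[OF T0])
  also have "\<dots> \<le> sqrt (real q) * ?T"
    using card_characters_le[OF X(1) dc q] by (intro mult_right_mono T0) auto
  finally have tail: "L2_set (\<lambda>chi. norm (afe_sum q chi (ramare_part a b) {1..<2^J} - S chi)) X \<le> ?T * sqrt (real q)"
    by (simp only: mult.commute)
  have "L2_set (\<lambda>chi. norm (afe_sum q chi (ramare_part a b) {1..<2^J})) X =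
      L2_set (\<lambda>chi. norm (S chi + (afe_sum q chi (ramare_part a b) {1..<2^J} - S chi))) X" by simp
  also have "\<dots> \<le> L2_set (\<lambda>chi. norm (S chi)) X + L2_set (\<lambda>chi. norm (afe_sum q chi (ramare_part a b) {1..<2^J} - S chi)) X"
    by (rule L2_set_norm_add_le)
  also have "\<dots> \<le> ?c * (real b * ?B) + ?T * sqrt (real q)" by (rule add_mono[OF main tail])
  finally show ?thesis .
qed

text \<open>The main size \<open>sqrt (cond_root q)\<close> carries the three savings: sqrt (a / b)
  from the sieve, 2 ^ (- a / 2) from the square part, \<beta> b from the prime sums. Everything
  governed by the modulus goes into the first term.\<close>

lemma L2_nonexceptional:
  assumes K: "\<And>N. (\<Sum>n\<in>{1..N}. (norm (lam F n))\<^sup>2) \<le> K * real N"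
    and Kr: "\<And>a b N. 1 \<le> a \<Longrightarrow> 2 \<le> b \<Longrightarrow> a \<le> b \<Longrightarrow> 2 ^ b \<le> N \<Longrightarrow>
       (\<Sum>n\<in>{1..N}. (norm (rough_part a b n))\<^sup>2) \<le> Kr * real N * (real a / real b)" and Kr0: "Kr \<ge> 0"
  obtains C where "C > 0" "\<And>q X e a b \<beta>. finite X \<Longrightarrow> (\<And>chi. chi \<in> X \<Longrightarrow> good q chi) \<Longrightarrow> (\<And>chi. chi \<in> X \<Longrightarrow> chi (-1) = e) \<Longrightarrow>
     e \<in> {1, -1} \<Longrightarrow> q \<ge> 2 \<Longrightarrow> conductor F q > 0 \<Longrightarrow> 1 \<le> a \<Longrightarrow> 2 \<le> b \<Longrightarrow> a \<le> b \<Longrightarrow> \<beta> \<ge> 0 \<Longrightarrow> \<beta> * real b \<le> 1 \<Longrightarrow>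
     (\<And>chi i m. chi \<in> X \<Longrightarrow> a \<le> i \<Longrightarrow> i < b \<Longrightarrow> 2 ^ i - 1 \<le> m \<Longrightarrow> m < 2 ^ Suc i \<Longrightarrow>
        norm (\<Sum>n\<le>m. prime_coeff chi n) \<le> \<beta> * 2 ^ i) \<Longrightarrow>
     L2_set (\<lambda>chi. norm (L_fun F chi (1/2))) X \<le>
       C * (sqrt (real q) * sqrt (2 ^ b) * cond_root q powr (1/8) + sqrt (cond_root q) * (sqrt (real a / real b) + sqrt (1 / 2 ^ a) + \<beta> * real b))"
proof -
  obtain C0 where C0: "C0 > 0" "\<And>q chi Y. good q chi \<Longrightarrow> Y \<ge> 1 \<Longrightarrow> norm (L_fun F chi (1/2)) \<le>
     C0 * (norm (afe_sum q chi (lam F) {1..<Y}) + sqrt (real (conductor F q)) * real Y powr (-1/4))"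
    using approximate_functional_equation by blast
  define Ks where "Ks = 8 * K * (1 + real d)\<^sup>2 * square_const"
  define M where "M = sqrt (2 * K) + sqrt (2 * Kr) + sqrt (2 * Ks)"
  define D where "D = kernel_const * pi * M * (geom_const + peak_const)"
  define T where "T = real d * kernel_const * pi * lam_sum (3/2)"
  have K0: "K \<ge> 0" using order.trans[OF sum_nonneg K[of 1]] by simp
  have Ks0: "Ks \<ge> 0"
    unfolding Ks_def square_const_def using K0 by (intro mult_nonneg_nonneg suminf_nonneg summable_square_const) auto
  have T0: "T \<ge> 0" unfolding T_def using kernel_const_pos lam_sum_nonneg[of "3/2"] by simp
  have M: "sqrt (2 * K) \<le> M" "sqrt (2 * Kr) \<le> M" "sqrt (2 * Ks) \<le> M" "M \<ge> 0"
    unfolding M_def using K0 Kr0 Ks0 by auto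
  have D0: "D \<ge> 0" unfolding D_def using kernel_const_pos geom_const_pos peak_const_pos M by simp
  have split: "kernel_const * pi * x * (y * geom_const + z * peak_const) \<le> D * (y + z)" if "0 \<le> x" "x \<le> M" "0 \<le> y" "0 \<le> z" for x y z
  proof -
    have "y * geom_const + z * peak_const \<le> (geom_const + peak_const) * (y + z)"
      using that geom_const_pos peak_const_pos by (simp add: algebra_simps)
    then have "kernel_const * pi * x * (y * geom_const + z * peak_const) \<le> kernel_const * pi * M * ((geom_const + peak_const) * (y + z))"
      using that kernel_const_pos geom_const_pos peak_const_pos by (intro mult_mono mult_nonneg_nonneg add_nonneg_nonneg) auto
    then show ?thesis by (simp add: D_def mult.assoc)
  qed
  show ?thesis
  proof (rule that[of "C0 * (9 * D + T + 1)"])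
    show "C0 * (9 * D + T + 1) > 0" using C0 D0 T0 by simp
    fix q and X :: "(int \<Rightarrow> complex) set" and e a b \<beta>
    assume X: "finite X" "\<And>chi. chi \<in> X \<Longrightarrow> good q chi" "\<And>chi. chi \<in> X \<Longrightarrow> chi (-1) = e"
      and e: "e \<in> {1, -1}" and q: "q \<ge> 2" and N: "conductor F q > 0" and a: "1 \<le> a" and b: "2 \<le> b" and ab: "a \<le> b"
      and \<beta>: "\<beta> \<ge> 0" "\<beta> * real b \<le> 1"
      and pc: "\<And>chi i m. chi \<in> X \<Longrightarrow> a \<le> i \<Longrightarrow> i < b \<Longrightarrow> 2 ^ i - 1 \<le> m \<Longrightarrow> m < 2 ^ Suc i \<Longrightarrow>
        norm (\<Sum>n\<le>m. prime_coeff chi n) \<le> \<beta> * 2 ^ i"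
    let ?R = "cond_root q" and ?r = "cond_root q powr (1/8)"
    define E where "E = sqrt (real q) * sqrt (2 ^ b) * ?r"
    define S where "S = sqrt ?R"
    define sa where "sa = sqrt (real a / real b)"
    define sd where "sd = sqrt (1 / 2 ^ a)"
    have R: "?R \<ge> 1" using N by simp
    have r1: "?r \<ge> 1" using R by (intro ge_one_powr_ge_zero) auto
    have s2: "sqrt (2 ^ b) \<ge> (1::real)" by simp
    have E1: "sqrt (real q) * ?r \<le> E"
      unfolding E_def using mult_left_mono[OF s2, of "sqrt (real q)"] by (intro mult_right_mono) auto
    have E2: "sqrt (real q) \<le> E" using mult_left_mono[OF r1, of "sqrt (real q)"] E1 by simp
    have E0: "E \<ge> 0" unfolding E_def by simp
    have S0: "S \<ge> 0" unfolding S_def using R by simp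
    have sa: "0 \<le> sa" "sa \<le> 1" unfolding sa_def using a ab by auto
    have sd: "0 \<le> sd" "sd \<le> 1" unfolding sd_def by auto
    have q0: "q > 0" using q by simp
    \<comment> \<open>No bound depends on J, so a crude choice with 2 ^ J \<ge> N^2 2 ^ b will do,
      obtained from y \<le> 2 ^ y. It serves the truncation error, which needs N^2, and the tail of
      the bilinear form, which needs N 2 ^ b.\<close>
    define J where "J = (conductor F q)\<^sup>2 * 2 ^ b"
    have J1: "(conductor F q)\<^sup>2 * 2 ^ b \<le> 2 ^ J" unfolding J_def by (intro less_imp_le less_exp)
    have J2: "conductor F q * 2 ^ b \<le> 2 ^ J"
      using J1 N by (intro order.trans[OF mult_right_mono J1]) (auto simp: power2_eq_square)
    have J3: "(conductor F q)\<^sup>2 \<le> 2 ^ J" by (rule order.trans[OF _ J1]) simp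
    have J4: "b \<le> J"
    proof -
      have "2 ^ b \<le> (2 ^ J :: nat)" by (rule order.trans[OF _ J1]) (use N in simp)
      then show ?thesis by simp
    qed
    \<comment> \<open>(A3) requires 2 ^ b to be at most the length of the sum. Below 2 ^ b the full
      second moment is used; so short a range counts for little against the modulus.\<close>
    have rough: "L2_set (\<lambda>chi. norm (afe_sum q chi (rough_part a b) {2^0..<2^b})) X \<le> D * (2 * E)"
    proof -
      have "L2_set (\<lambda>chi. norm (afe_sum q chi (rough_part a b) {2^0..<2^b})) X \<le>
          kernel_const * pi * sqrt (2 * K) * (sqrt (real q + 2 ^ b) * (geom_const * ?r))"
        using K0 by (intro L2_afe_blocks_short[where e = e] X e q0 N block_second_moment K) (auto simp: rough_part_def)
      also have "\<dots> \<le> kernel_const * pi * sqrt (2 * K) * (2 * E * geom_const + 0 * peak_const)"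
      proof (intro mult_left_mono)
        have "real q + 2 ^ b \<le> 2 * (real q * 2 ^ b)"
        proof -
          have "(real q - 1) * (2 ^ b - 1) \<ge> 0" using q by (intro mult_nonneg_nonneg) auto
          moreover have "real q * 2 ^ b \<ge> 1 * 1" using q by (intro mult_mono) auto
          ultimately show ?thesis by (simp add: algebra_simps)
        qed
        also have "\<dots> \<le> 2\<^sup>2 * (real q * 2 ^ b)" by simp
        finally have "sqrt (real q + 2 ^ b) \<le> sqrt (2\<^sup>2 * (real q * 2 ^ b))" by (rule real_sqrt_le_mono)
        also have "\<dots> = 2 * (sqrt (real q) * sqrt (2 ^ b))" by (simp only: real_sqrt_mult real_sqrt_abs abs_numeral)
        finally have "sqrt (real q + 2 ^ b) * (geom_const * ?r) \<le> 2 * (sqrt (real q) * sqrt (2 ^ b)) * (geom_const * ?r)"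
          using geom_const_pos by (intro mult_right_mono) auto
        then show "sqrt (real q + 2 ^ b) * (geom_const * ?r) \<le> 2 * E * geom_const + 0 * peak_const"
          by (simp add: E_def mult_ac)
      qed (use kernel_const_pos K0 in auto)
      also have "\<dots> \<le> D * (2 * E + 0)" using K0 E0 M by (intro split) auto
      finally show ?thesis by simp
    qed
    have long: "L2_set (\<lambda>chi. norm (afe_sum q chi c {2^u..<2^J})) X \<le> D * (E + S * s)"
      if uJ: "u \<le> J" and s: "0 \<le> s" "s \<le> 1" and \<kappa>: "0 \<le> \<kappa>" "sqrt (2 * \<kappa>) \<le> M"
        and c: "\<And>j. u \<le> j \<Longrightarrow> (\<Sum>n\<in>{2^j..<2^Suc j}. (norm (c n))\<^sup>2) \<le> 2 * \<kappa> * s\<^sup>2 * 2 ^ j" for c u s \<kappa>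
    proof -
      have "L2_set (\<lambda>chi. norm (afe_sum q chi c {2^u..<2^J})) X \<le>
         kernel_const * pi * sqrt (2 * \<kappa> * s\<^sup>2) * (sqrt (real q) * (geom_const * ?r) + peak_const * sqrt ?R)"
        using \<kappa> by (intro L2_afe_blocks_long[where e = e] X e q0 N uJ c) auto
      also have "\<dots> = kernel_const * pi * sqrt (2 * \<kappa>) * ((s * (sqrt (real q) * ?r)) * geom_const + (S * s) * peak_const)"
        using s by (simp add: real_sqrt_mult S_def algebra_simps)
      also have "\<dots> \<le> D * (s * (sqrt (real q) * ?r) + S * s)" using \<kappa> s S0 by (intro split) auto
      also have "\<dots> \<le> D * (E + S * s)"
      proof (rule mult_left_mono[OF add_right_mono D0])
        have "s * (sqrt (real q) * ?r) \<le> 1 * (sqrt (real q) * ?r)" using s by (intro mult_right_mono) auto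
        then show "s * (sqrt (real q) * ?r) \<le> E" using E1 by simp
      qed
      finally show ?thesis .
    qed
    have tail_sum: "(\<Sum>n\<in>{2^j..<2^Suc j}. (norm (c n))\<^sup>2) \<le> (\<Sum>n\<in>{1..2^Suc j}. (norm (c n))\<^sup>2)" for c :: "nat \<Rightarrow> complex" and j
      by (intro sum_mono2) (auto simp: Suc_le_eq intro: less_le_trans[OF zero_less_power])
    have rough': "L2_set (\<lambda>chi. norm (afe_sum q chi (rough_part a b) {2^b..<2^J})) X \<le> D * (E + S * sa)"
    proof (rule long[OF J4 sa Kr0 M(2)])
      fix j assume "b \<le> j"
      then have bj: "(2::nat) ^ b \<le> 2 ^ Suc j" by (intro power_increasing) auto
      have sq: "sa\<^sup>2 = real a / real b" unfolding sa_def by simp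
      show "(\<Sum>n\<in>{2^j..<2^Suc j}. (norm (rough_part a b n))\<^sup>2) \<le> 2 * Kr * sa\<^sup>2 * 2 ^ j"
        unfolding sq using order.trans[OF tail_sum Kr[OF a b ab bj]] by (simp add: mult_ac)
    qed
    have square: "L2_set (\<lambda>chi. norm (afe_sum q chi (square_part a b) {2^0..<2^J})) X \<le> D * (E + S * sd)"
    proof (rule long[OF le0 sd Ks0 M(3)])
      fix j
      have sq: "sd\<^sup>2 = 1 / 2 ^ a" unfolding sd_def by simp
      show "(\<Sum>n\<in>{2^j..<2^Suc j}. (norm (square_part a b n))\<^sup>2) \<le> 2 * Ks * sd\<^sup>2 * 2 ^ j"
        unfolding sq using order.trans[OF tail_sum sum_square_part_le[OF K, of a b "2 ^ Suc j"]] by (simp add: Ks_def mult_ac)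
    qed
    have ramare: "L2_set (\<lambda>chi. norm (afe_sum q chi (ramare_part a b) {2^0..<2^J})) X \<le> D * (5 * E + 5 * (S * (\<beta> * real b))) + T * E"
    proof -
      have "L2_set (\<lambda>chi. norm (afe_sum q chi (ramare_part a b) {1..<2^J})) X \<le>
       kernel_const * pi * (5 * \<beta>) * sqrt (2 * K) * (real b * (sqrt (real q) * sqrt (2 ^ b) * (geom_const * ?r) + peak_const * sqrt ?R)) + T * sqrt (real q)"
        unfolding T_def by (intro L2_ramare[where e = e and K = K] X e q N ab J2 \<beta>(1) K pc)
      also have "kernel_const * pi * (5 * \<beta>) * sqrt (2 * K) * (real b * (sqrt (real q) * sqrt (2 ^ b) * (geom_const * ?r) + peak_const * sqrt ?R)) =
         kernel_const * pi * sqrt (2 * K) * ((5 * (\<beta> * real b * E)) * geom_const + (5 * (S * (\<beta> * real b))) * peak_const)"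
        by (simp add: E_def S_def algebra_simps)
      also have "\<dots> \<le> D * (5 * (\<beta> * real b * E) + 5 * (S * (\<beta> * real b)))"
        using K0 M E0 S0 \<beta> by (intro split) auto
      also have "\<dots> \<le> D * (5 * E + 5 * (S * (\<beta> * real b)))"
        using mult_right_mono[OF \<beta>(2) E0] by (intro mult_left_mono D0) auto
      finally show ?thesis using mult_left_mono[OF E2 T0] by simp
    qed
    have decomp: "afe_sum q chi (lam F) {1..<2^J} =
        (afe_sum q chi (rough_part a b) {2^0..<2^b} + afe_sum q chi (rough_part a b) {2^b..<2^J}) +
        (afe_sum q chi (ramare_part a b) {2^0..<2^J} + afe_sum q chi (square_part a b) {2^0..<2^J})" for chi
    proof -
      have "{2^0..<2^J} = {2^0..<2^b} \<union> {2^b..<2^J::nat}"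
        using J4 by (intro ivl_disj_un_two(3)[symmetric]) (auto intro: power_increasing)
      then have "afe_sum q chi (rough_part a b) {2^0..<2^J} = afe_sum q chi (rough_part a b) {2^0..<2^b} + afe_sum q chi (rough_part a b) {2^b..<2^J}"
        unfolding afe_sum_def by (simp only:) (intro sum.union_disjoint, auto)
      moreover have "afe_sum q chi (lam F) {1..<2^J} = afe_sum q chi (rough_part a b) {2^0..<2^J} +
          (afe_sum q chi (ramare_part a b) {2^0..<2^J} + afe_sum q chi (square_part a b) {2^0..<2^J})"
        unfolding afe_sum_def sum.distrib[symmetric] power_0 distrib_right[symmetric]
        by (intro sum.cong refl) (simp add: square_part_def)
      ultimately show ?thesis by (simp only:)
    qed
    have lam: "L2_set (\<lambda>chi. norm (afe_sum q chi (lam F) {1..<2^J})) X \<le>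
        (D * (2 * E) + D * (E + S * sa)) + ((D * (5 * E + 5 * (S * (\<beta> * real b))) + T * E) + D * (E + S * sd))"
      unfolding decomp
      by (intro order.trans[OF L2_set_norm_add_le] add_mono order.trans[OF L2_set_norm_add_le[of "\<lambda>chi. afe_sum q chi (rough_part a b) {2^0..<2^b}"]]
          order.trans[OF L2_set_norm_add_le[of "\<lambda>chi. afe_sum q chi (ramare_part a b) {2^0..<2^J}"]] rough rough' ramare square)
    have Y: "?R * real (2 ^ J) powr (-1/4) \<le> 1"
    proof -
      have "real ((conductor F q)\<^sup>2) \<le> real (2 ^ J)" using J3 by (simp only: of_nat_le_iff)
      then have "real (2 ^ J) powr (-1/4) \<le> real ((conductor F q)\<^sup>2) powr (-1/4)"
        using N by (intro powr_mono2') auto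
      also have "real ((conductor F q)\<^sup>2) = real (conductor F q) powr 2" using N by (simp add: powr_numeral)
      also have "(real (conductor F q) powr 2) powr (-1/4) = real (conductor F q) powr (2 * (-1/4))" by (rule powr_powr)
      also have "\<dots> = 1 / ?R" using N powr_minus_divide[of "real (conductor F q)" "1/2"] by (simp add: powr_half_sqrt)
      finally have "?R * real (2 ^ J) powr (-1/4) \<le> ?R * (1 / ?R)" using R by (intro mult_left_mono) auto
      then show ?thesis using R by simp
    qed
    have "L2_set (\<lambda>chi. norm (L_fun F chi (1/2))) X \<le> L2_set (\<lambda>chi. C0 * (norm (afe_sum q chi (lam F) {1..<2^J}) + 1)) X"
    proof (rule L2_set_mono)
      fix chi assume "chi \<in> X"
      then have "norm (L_fun F chi (1/2)) \<le> C0 * (norm (afe_sum q chi (lam F) {1..<2^J}) + ?R * real (2 ^ J) powr (-1/4))"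
        by (intro C0(2) X(2)) auto
      also have "\<dots> \<le> C0 * (norm (afe_sum q chi (lam F) {1..<2^J}) + 1)"
        using C0 Y by (intro mult_left_mono add_left_mono) auto
      finally show "norm (L_fun F chi (1/2)) \<le> C0 * (norm (afe_sum q chi (lam F) {1..<2^J}) + 1)" .
    qed simp
    also have "\<dots> = C0 * L2_set (\<lambda>chi. norm (afe_sum q chi (lam F) {1..<2^J}) + 1) X"
      using C0 by (intro L2_set_right_distrib[symmetric]) auto
    also have "\<dots> \<le> C0 * (L2_set (\<lambda>chi. norm (afe_sum q chi (lam F) {1..<2^J})) X + L2_set (\<lambda>chi. 1) X)"
      using C0 by (intro mult_left_mono L2_set_triangle_ineq) auto
    also have "L2_set (\<lambda>chi. 1::real) X \<le> E"
    proof -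
      have "L2_set (\<lambda>chi. 1::real) X = sqrt (real (card X))" by (subst L2_set_constant) auto
      also have "\<dots> \<le> sqrt (real q)"
        using card_characters_le[OF X(1) _ q] X(2) by (simp add: good_def)
      finally show ?thesis using E2 by linarith
    qed
    also have "C0 * (L2_set (\<lambda>chi. norm (afe_sum q chi (lam F) {1..<2^J})) X + E) \<le>
        C0 * ((9 * D + T + 1) * (E + S * (sa + sd + \<beta> * real b)))"
    proof (intro mult_left_mono)
      \<comment> \<open>The coefficient 9 = 2 + 1 + 5 + 1 adds up the shares of D E in the short
        rough, long rough, bilinear and square parts; T and 1 belong to the bilinear tail and the
        truncation.\<close>
      have "(9 * D + T + 1) * (E + S * (sa + sd + \<beta> * real b)) -
        ((D * (2 * E) + D * (E + S * sa)) + ((D * (5 * E + 5 * (S * (\<beta> * real b))) + T * E) + D * (E + S * sd)) + E) =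
        8 * (D * (S * sa)) + 8 * (D * (S * sd)) + 4 * (D * (S * (\<beta> * real b))) + (T + 1) * (S * (sa + sd + \<beta> * real b))"
        by (simp add: algebra_simps)
      also have "\<dots> \<ge> 0" using D0 S0 T0 sa sd \<beta> by simp
      finally show "L2_set (\<lambda>chi. norm (afe_sum q chi (lam F) {1..<2^J})) X + E \<le> (9 * D + T + 1) * (E + S * (sa + sd + \<beta> * real b))"
        using lam by linarith
    qed (use C0 in auto)
    finally show "L2_set (\<lambda>chi. norm (L_fun F chi (1/2))) X \<le>
       C0 * (9 * D + T + 1) * (sqrt (real q) * sqrt (2 ^ b) * ?r + sqrt ?R * (sqrt (real a / real b) + sqrt (1 / 2 ^ a) + \<beta> * real b))"
      by (simp only: E_def S_def sa_def sd_def mult.assoc) (use C0 in simp)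
  qed
qed

end

section \<open>The second moment\<close>

context L_family
begin

text \<open>\<open>zero_count\<close> is a sum over a set and would be 0 if that set were infinite.
  Finiteness holds because the zeros lie in a compact rectangle, the Euler product excluding Re s >
  1.\<close>

lemma zero_count_pos:
  assumes good: "good q chi" and s: "L_fun F chi s = 0" "Re s \<ge> \<sigma>" "\<bar>Im s\<bar> \<le> T"
  shows "zero_count F \<sigma> T chi \<ge> 1"
proof -
  let ?f = "L_fun F chi" and ?Z = "{s. L_fun F chi s = 0 \<and> Re s \<ge> \<sigma> \<and> \<bar>Im s\<bar> \<le> T}"
  have hol: "?f holomorphic_on UNIV" using L_fun_holomorphic[OF good] by (rule holomorphic_on_subset) simp
  have nz: "?f 2 \<noteq> 0" by (rule L_fun_nonzero[OF good]) simp
  have "\<not> ?f constant_on UNIV"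
    using s(1) nz unfolding constant_on_def by (metis UNIV_I)
  then have fin: "finite {z \<in> cbox (Complex \<sigma> (-T)) (Complex 1 T). ?f z = 0}"
    using hol by (intro holomorphic_compact_finite_zeros[of ?f UNIV]) auto
  have "?Z \<subseteq> {z \<in> cbox (Complex \<sigma> (-T)) (Complex 1 T). ?f z = 0}"
  proof
    fix z assume z: "z \<in> ?Z"
    then have "Re z \<le> 1" using L_fun_nonzero[OF good, of z] by (cases "Re z > 1") auto
    then show "z \<in> {z \<in> cbox (Complex \<sigma> (-T)) (Complex 1 T). ?f z = 0}" using z by (auto simp: in_cbox_complex_iff)
  qed
  then have finZ: "finite ?Z" using fin by (rule finite_subset)
  have "zorder ?f s > 0"
    using zorder_exist_zero[OF hol open_UNIV connected_UNIV UNIV_I, of s] s(1) nz by auto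
  then have "1 \<le> nat (zorder ?f s)" by simp
  also have "\<dots> \<le> (\<Sum>z\<in>?Z. nat (zorder ?f z))"
    using s by (intro member_le_sum finZ) auto
  finally show ?thesis unfolding zero_count_def .
qed

text \<open>The cut-off exponents u = 1 - \<delta> + \<epsilon> and w = 1 - \<epsilon> satisfy 0 < u
  < w < 1 by the choice of \<epsilon>. Each condition is then a comparison of powers and
  exponentials of L.\<close>

lemma eventually_parameters:
  fixes \<delta> \<eta> \<epsilon> A A' c L0 :: real
  assumes \<delta>: "0 < \<delta>" "\<delta> < 1" and \<eta>: "0 < \<eta>" "\<eta> < \<delta>" and \<epsilon>: "\<epsilon> = (\<delta> - \<eta>) / 2" and A: "A > 0" "A' > 0" "c > 0"
  shows "\<forall>\<^sub>F L in at_top. L \<ge> L0 \<and> L \<ge> 1 \<and> 2 \<le> L powr (1 - \<delta> + \<epsilon>) \<and> L powr (1 - \<delta> + \<epsilon>) + 3 \<le> L powr (1 - \<epsilon>)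
    \<and> L powr (1 - \<epsilon>) \<le> L / 16 \<and> L powr \<eta> \<le> 2 powr (L powr (1 - \<delta> + \<epsilon>)) \<and> 2 * A * L powr (\<eta> / 2) \<le> L \<and> L powr (\<eta> / 2) \<le> exp (L / 32)
    \<and> L ^ 10 \<le> exp L \<and> c * L powr (\<delta> - 1) < 1 / 2024 \<and> L powr (A' + \<eta>) \<le> exp (L powr \<delta>)"
proof (intro eventually_conj)
  define u w where "u = 1 - \<delta> + \<epsilon>" and "w = 1 - \<epsilon>"
  have uw: "0 < u" "u < w" "w < 1" using \<delta> \<eta> \<epsilon> by (auto simp: u_def w_def field_simps)
  show "\<forall>\<^sub>F L in at_top. L0 \<le> L" "\<forall>\<^sub>F L in at_top. 1 \<le> (L::real)" by (rule eventually_ge_at_top)+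
  show "\<forall>\<^sub>F L in at_top. 2 \<le> L powr (1 - \<delta> + \<epsilon>)" unfolding u_def[symmetric] using uw by real_asymp
  show "\<forall>\<^sub>F L in at_top. L powr (1 - \<delta> + \<epsilon>) + 3 \<le> L powr (1 - \<epsilon>)" unfolding u_def[symmetric] w_def[symmetric] using uw by real_asymp
  show "\<forall>\<^sub>F L in at_top. L powr (1 - \<epsilon>) \<le> L / 16" unfolding w_def[symmetric] using uw by real_asymp
  show "\<forall>\<^sub>F L in at_top. L powr \<eta> \<le> 2 powr (L powr (1 - \<delta> + \<epsilon>))" unfolding u_def[symmetric] using uw \<eta> by real_asymp
  show "\<forall>\<^sub>F L in at_top. 2 * A * L powr (\<eta> / 2) \<le> L" using \<eta> \<delta> A by real_asymp
  show "\<forall>\<^sub>F L in at_top. L powr (\<eta> / 2) \<le> exp (L / 32)" using \<eta> by real_asymp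
  show "\<forall>\<^sub>F L::real in at_top. L ^ 10 \<le> exp L" by real_asymp
  show "\<forall>\<^sub>F L in at_top. c * L powr (\<delta> - 1) < 1 / 2024" using \<delta> A by real_asymp
  have "A' + \<eta> > 0" using A \<eta> by simp
  then show "\<forall>\<^sub>F L in at_top. L powr (A' + \<eta>) \<le> exp (L powr \<delta>)" using \<delta> by real_asymp
qed

text \<open>Each exceptional character contributes at least 1 to the zero count, which therefore
  bounds their number.\<close>

lemma sum_exceptional_le:
  assumes good: "\<And>chi. chi \<in> X \<Longrightarrow> good q chi" and X: "finite X"
    and zeros: "(\<Sum>chi\<in>X. real (zero_count F \<sigma> T chi)) \<le> B"
    and bound: "\<And>chi. chi \<in> X \<Longrightarrow> norm (L_fun F chi (1/2)) \<le> M"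
  shows "(\<Sum>chi | chi \<in> X \<and> (\<exists>s. L_fun F chi s = 0 \<and> Re s \<ge> \<sigma> \<and> \<bar>Im s\<bar> \<le> T). (norm (L_fun F chi (1/2)))\<^sup>2) \<le> B * M\<^sup>2"
proof -
  let ?X = "{chi \<in> X. \<exists>s. L_fun F chi s = 0 \<and> Re s \<ge> \<sigma> \<and> \<bar>Im s\<bar> \<le> T}"
  have "real (card ?X) = (\<Sum>chi\<in>?X. 1)" by simp
  also have "\<dots> \<le> (\<Sum>chi\<in>?X. real (zero_count F \<sigma> T chi))"
  proof (rule sum_mono)
    fix chi assume "chi \<in> ?X"
    then show "1 \<le> real (zero_count F \<sigma> T chi)" using zero_count_pos[OF good] by fastforce
  qed
  also have "\<dots> \<le> (\<Sum>chi\<in>X. real (zero_count F \<sigma> T chi))" using X by (intro sum_mono2) auto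
  finally have card: "real (card ?X) \<le> B" using zeros by simp
  have "(\<Sum>chi\<in>?X. (norm (L_fun F chi (1/2)))\<^sup>2) \<le> (\<Sum>chi\<in>?X. M\<^sup>2)"
    by (intro sum_mono power_mono) (auto intro: bound)
  also have "\<dots> = real (card ?X) * M\<^sup>2" by simp
  also have "\<dots> \<le> B * M\<^sup>2" by (intro mult_right_mono card) auto
  finally show ?thesis .
qed

end

text \<open>Rounding at most doubles a and halves b. So a / b is at most 4 L powr (u - w) = 4 L powr
  -\<eta>, and its square root 2 / L powr (\<eta> / 2).\<close>

lemma cutoff_bounds:
  fixes L u w \<eta> :: real
  assumes u: "2 \<le> L powr u" and w: "L powr u + 3 \<le> L powr w" and L: "L \<ge> 1" "w \<le> 1"
    and diff: "u - w = - \<eta>" and e: "L powr \<eta> \<le> 2 powr (L powr u)"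
    and ab: "a = nat \<lceil>L powr u\<rceil>" "b = nat \<lfloor>L powr w\<rfloor>"
  shows "2 \<le> a" "a \<le> b" "real b \<le> L powr w" "L powr u \<le> real a"
    "sqrt (real a / real b) \<le> 2 / L powr (\<eta> / 2)" "sqrt (1 / 2 ^ a) \<le> 1 / L powr (\<eta> / 2)"
proof -
  have a1: "L powr u \<le> real a" "real a \<le> L powr u + 1"
    unfolding ab using u by linarith+
  have b1: "real b \<le> L powr w" "L powr w \<le> real b + 1"
    unfolding ab using u w by linarith+
  show "L powr u \<le> real a" "real b \<le> L powr w" by (rule a1 b1)+
  have "real 2 \<le> real a" using a1 u by simp
  then show a2: "2 \<le> a" by (simp only: of_nat_le_iff)
  have "real a \<le> real b" using a1 b1 w by simp
  then show "a \<le> b" by (simp only: of_nat_le_iff)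
  have h: "(L powr (\<eta> / 2))\<^sup>2 = L powr \<eta>" by (simp add: power2_eq_square flip: powr_add)
  have h0: "L powr (\<eta> / 2) > 0" using L by simp
  have w0: "L powr w > 0" using L by simp
  have "real a / real b \<le> (2 * L powr u) / (L powr w / 2)"
    using a1 b1 u w w0 by (intro frac_le) auto
  also have "\<dots> = 4 * (L powr u / L powr w)" by simp
  also have "L powr u / L powr w = 1 / L powr \<eta>"
    using powr_diff[of L u w] powr_minus_divide[of L \<eta>] by (simp add: diff)
  also have "4 * (1 / L powr \<eta>) = (2 / L powr (\<eta> / 2))\<^sup>2" by (simp add: power_divide h)
  finally have "sqrt (real a / real b) \<le> sqrt ((2 / L powr (\<eta> / 2))\<^sup>2)" by (rule real_sqrt_le_mono)
  also have "\<dots> = 2 / L powr (\<eta> / 2)" using h0 by (simp only: real_sqrt_abs) simp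
  finally show "sqrt (real a / real b) \<le> 2 / L powr (\<eta> / 2)" .
  have "L powr \<eta> \<le> 2 powr (real a)" using e a1 by (meson order.trans powr_mono one_le_numeral)
  also have "\<dots> = 2 ^ a" by (simp add: powr_realpow)
  finally have "1 / 2 ^ a \<le> 1 / L powr \<eta>" using L by (intro divide_left_mono) auto
  also have "\<dots> = (1 / L powr (\<eta> / 2))\<^sup>2" by (simp add: power_divide h)
  finally have "sqrt (1 / 2 ^ a) \<le> sqrt ((1 / L powr (\<eta> / 2))\<^sup>2)" by (rule real_sqrt_le_mono)
  also have "\<dots> = 1 / L powr (\<eta> / 2)" using h0 by (simp only: real_sqrt_abs) simp
  finally show "sqrt (1 / 2 ^ a) \<le> 1 / L powr (\<eta> / 2)" .
qed

text \<open>The first bound is where d \<ge> 3 enters. With b \<le> ln x / 16 the exponent of x is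
  1/2 + 1/32 + d/16. It is at most d/4 - 1/32 as soon as 3 d \<ge> 9, with equality for d = 3; this
  fixes the admissible sizes of b and of the exponent 1/8.\<close>

lemma main_term_bounds:
  fixes x K' :: real and b d N :: nat
  assumes x: "x > 0" and N: "N > 0" "real N \<le> K' * x ^ d" and K': "K' > 0" and d: "d \<ge> 3" and b: "real b \<le> ln x / 16"
    and L: "ln x > 0"
  shows "sqrt x * sqrt (2 ^ b) * sqrt (real N) powr (1/8) \<le> K' powr (1/16) * exp (real d * ln x / 4) * exp (- (ln x / 32))"
    and "sqrt (sqrt (real N)) \<le> K' powr (1/4) * exp (real d * ln x / 4)"
proof -
  define L where "L = ln x"
  have xL: "x = exp L" using x by (simp add: L_def)
  have sqrt_exp: "sqrt (exp y) = exp (y / 2)" for y :: real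
  proof (rule real_sqrt_unique)
    show "(exp (y / 2))\<^sup>2 = exp y" by (simp add: power2_eq_square flip: exp_add)
  qed simp
  have Np: "real N powr c \<le> K' powr c * exp (real d * L * c)" if "c > 0" for c
  proof -
    have "real N powr c \<le> (K' * x ^ d) powr c" using N that by (intro powr_mono2) auto
    also have "\<dots> = K' powr c * (x ^ d) powr c" using K' x by (simp add: powr_mult)
    also have "(x ^ d) powr c = exp (real d * L * c)" using x by (simp add: powr_def ln_realpow L_def mult_ac)
    finally show ?thesis .
  qed
  have "sqrt (sqrt (real N)) = real N powr (1/4)"
    using powr_half_sqrt[of "real N"] powr_half_sqrt[of "sqrt (real N)"] powr_powr[of "real N" "1/2" "1/2"] by simp
  then show "sqrt (sqrt (real N)) \<le> K' powr (1/4) * exp (real d * ln x / 4)" using Np[of "1/4"] by (simp add: L_def)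
  have R: "sqrt (real N) powr (1/8) = real N powr (1/16)"
    using powr_half_sqrt[of "real N"] powr_powr[of "real N" "1/2" "1/8"] by simp
  have "(2::real) ^ b = exp (real b * ln 2)" by (simp add: powr_realpow[symmetric] powr_def)
  also have "\<dots> \<le> exp (L / 16)"
  proof -
    have "ln 2 \<le> (1::real)" using ln_le_minus_one[of "2::real"] by simp
    then have "real b * ln 2 \<le> real b * 1" by (intro mult_left_mono) auto
    then show ?thesis using b by (simp add: L_def)
  qed
  finally have "sqrt (2 ^ b) \<le> exp (L / 32)" using real_sqrt_le_mono[of "2 ^ b" "exp (L / 16)"] by (simp add: sqrt_exp)
  then have "sqrt x * sqrt (2 ^ b) * sqrt (real N) powr (1/8) \<le> exp (L / 2) * exp (L / 32) * (K' powr (1/16) * exp (real d * L * (1/16)))"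
    unfolding R using Np[of "1/16"] by (intro mult_mono) (auto simp: xL sqrt_exp)
  also have "\<dots> = K' powr (1/16) * exp (L / 2 + L / 32 + real d * L * (1/16))" by (simp only: exp_add mult_ac)
  also have "\<dots> \<le> K' powr (1/16) * exp (real d * L / 4 + - (L / 32))"
  proof (intro mult_left_mono)
    have "3 * L \<le> real d * L" using d L by (intro mult_right_mono) (auto simp: L_def)
    then show "exp (L / 2 + L / 32 + real d * L * (1/16)) \<le> exp (real d * L / 4 + - (L / 32))" by simp
  qed simp
  finally show "sqrt x * sqrt (2 ^ b) * sqrt (real N) powr (1/8) \<le> K' powr (1/16) * exp (real d * ln x / 4) * exp (- (ln x / 32))"
    by (simp only: L_def exp_add mult.assoc)
qed

context L_family
begin

text \<open>The characters are divided into exceptional ones and the two parities of the others.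
  Each class is compared with the square of \<open>Z\<close> = q powr (d / 4), up to L powr \<eta>;
  the norms over the parities are saved by h = L powr (\<eta> / 2).\<close>

lemma large_modulus_bound:
  assumes d: "d \<ge> 3" and \<delta>: "0 < \<delta>" "\<delta> < 1" and \<eta>: "0 < \<eta>" "\<eta> < \<delta>" and K': "K' > 0"
    and K: "\<And>N. (\<Sum>n\<in>{1..N}. (norm (lam F n))\<^sup>2) \<le> K * real N"
    and Kr: "\<And>a b N. 1 \<le> a \<Longrightarrow> 2 \<le> b \<Longrightarrow> a \<le> b \<Longrightarrow> 2 ^ b \<le> N \<Longrightarrow>
       (\<Sum>n\<in>{1..N}. (norm (rough_part a b n))\<^sup>2) \<le> Kr * real N * (real a / real b)" and Kr0: "Kr \<ge> 0"
    and good: "\<And>q chi. q \<in> Q \<Longrightarrow> chi \<in> primitive_characters q \<Longrightarrow> good q chi"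
    and zeros: "\<And>q \<sigma> T. q \<in> Q \<Longrightarrow> 1 - 1 / 2024 < \<sigma> \<Longrightarrow> \<sigma> < 1 \<Longrightarrow> 1 \<le> T \<Longrightarrow> T \<le> real q \<Longrightarrow>
       (\<Sum>chi\<in>primitive_characters q. real (zero_count F \<sigma> T chi)) \<le> K5 * (real q powr (C * (1 - \<sigma>)) * ln (real q) powr A)"
    and C: "C > 0" and A: "A > 0"
    and half: "\<And>q chi. q \<in> Q \<Longrightarrow> chi \<in> primitive_characters q \<Longrightarrow>
       norm (L_fun F chi (1 / 2)) \<le> K6 * (real q powr (real d / 4) / exp (ln (real q) powr \<delta>))"
  obtains B L1 where "B \<ge> 0" "L1 \<ge> 1" "\<And>q. q \<in> Q \<Longrightarrow> q \<ge> 2 \<Longrightarrow> conductor F q > 0 \<Longrightarrow> real (conductor F q) \<le> K' * real q ^ d \<Longrightarrow>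
     ln (real q) \<ge> L1 \<Longrightarrow> (\<Sum>chi\<in>primitive_characters q. (norm (L_fun F chi (1 / 2)))\<^sup>2)
           \<le> B * (real q powr (real d / 2) / ln (real q) powr \<eta>)"
proof -
  define \<epsilon> where "\<epsilon> = (\<delta> - \<eta>) / 2"
  have \<epsilon>: "\<epsilon> > 0" using \<eta> by (simp add: \<epsilon>_def)
  \<comment> \<open>Then C (1 - \<sigma>) ln q equals L powr \<delta>, half of the exponent which
    the square of the pointwise bound saves.\<close>
  define c where "c = 1 / C"
  have c: "c > 0" using C by (simp add: c_def)
  obtain Ap L0 where Ap: "Ap > 0" and primes: "\<And>q chi m. good q chi \<Longrightarrow> ln (real q) \<ge> L0 \<Longrightarrow> real (conductor F q) \<le> K' * real q ^ d \<Longrightarrow>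
       (\<And>s. Re s \<ge> 1 - c * ln (real q) powr (\<delta> - 1) \<Longrightarrow> \<bar>Im s\<bar> \<le> ln (real q) ^ 10 \<Longrightarrow> L_fun F chi s \<noteq> 0) \<Longrightarrow>
       1/3 * ln (real q) powr (1 - \<delta> + \<epsilon>) \<le> ln (real m) \<Longrightarrow> m > 0 \<Longrightarrow> real m \<le> sqrt (real q) \<Longrightarrow>
       norm (\<Sum>n\<le>m. prime_coeff chi n) \<le> Ap * real m / ln (real q) ^ 2"
    using prime_sum_saving[OF c _ \<epsilon> \<delta>, of "1/3" K'] by auto
  obtain CL where CL: "CL > 0" "\<And>q X e a b \<beta>. finite X \<Longrightarrow> (\<And>chi. chi \<in> X \<Longrightarrow> good q chi) \<Longrightarrow> (\<And>chi. chi \<in> X \<Longrightarrow> chi (-1) = e) \<Longrightarrow>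
     e \<in> {1, -1} \<Longrightarrow> q \<ge> 2 \<Longrightarrow> conductor F q > 0 \<Longrightarrow> 1 \<le> a \<Longrightarrow> 2 \<le> b \<Longrightarrow> a \<le> b \<Longrightarrow> \<beta> \<ge> 0 \<Longrightarrow> \<beta> * real b \<le> 1 \<Longrightarrow>
     (\<And>chi i m. chi \<in> X \<Longrightarrow> a \<le> i \<Longrightarrow> i < b \<Longrightarrow> 2 ^ i - 1 \<le> m \<Longrightarrow> m < 2 ^ Suc i \<Longrightarrow>
        norm (\<Sum>n\<le>m. prime_coeff chi n) \<le> \<beta> * 2 ^ i) \<Longrightarrow>
     L2_set (\<lambda>chi. norm (L_fun F chi (1/2))) X \<le>
       CL * (sqrt (real q) * sqrt (2 ^ b) * cond_root q powr (1/8) + sqrt (cond_root q) * (sqrt (real a / real b) + sqrt (1 / 2 ^ a) + \<beta> * real b))"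
    using L2_nonexceptional[OF K Kr Kr0] by blast
  obtain L1 where L1: "\<And>L. L \<ge> L1 \<Longrightarrow> L \<ge> L0 \<and> L \<ge> 1 \<and> 2 \<le> L powr (1 - \<delta> + \<epsilon>) \<and> L powr (1 - \<delta> + \<epsilon>) + 3 \<le> L powr (1 - \<epsilon>)
    \<and> L powr (1 - \<epsilon>) \<le> L / 16 \<and> L powr \<eta> \<le> 2 powr (L powr (1 - \<delta> + \<epsilon>)) \<and> 2 * Ap * L powr (\<eta> / 2) \<le> L \<and> L powr (\<eta> / 2) \<le> exp (L / 32)
    \<and> L ^ 10 \<le> exp L \<and> c * L powr (\<delta> - 1) < 1 / 2024 \<and> L powr (A + \<eta>) \<le> exp (L powr \<delta>)"
    using eventually_parameters[OF \<delta> \<eta> \<epsilon>_def Ap A c] unfolding eventually_at_top_linorder by blast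
  define k where "k = CL * (K' powr (1/16) + 4 * K' powr (1/4))"
  have k0: "k \<ge> 0" using CL by (simp add: k_def)
  show ?thesis
  proof (rule that[of "2 * k\<^sup>2 + \<bar>K5\<bar> * K6\<^sup>2" "max L1 1"])
    fix q assume q: "q \<in> Q" "q \<ge> 2" and N: "conductor F q > 0" "real (conductor F q) \<le> K' * real q ^ d" and Lq: "max L1 1 \<le> ln (real q)"
    define L where "L = ln (real q)"
    have LL: "L \<ge> L1" using Lq by (simp add: L_def)
    note par = L1[OF LL]
    have qL: "real q = exp L" using q by (simp add: L_def)
    have L: "L \<ge> 1" using par by blast
    let ?P = "primitive_characters q"
    define Z where "Z = exp (real d * L / 4)"
    define h where "h = L powr (\<eta> / 2)"
    have h0: "h > 0" using L by (simp add: h_def)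
    have h2: "h\<^sup>2 = L powr \<eta>" by (simp add: h_def power2_eq_square flip: powr_add)
    have Z0: "Z > 0" by (simp add: Z_def)
    have Z1: "real q powr (real d / 4) = Z" by (simp add: qL powr_def Z_def)
    have Z2: "real q powr (real d / 2) = Z\<^sup>2" by (simp add: qL powr_def Z_def power2_eq_square flip: exp_add)
    have finP: "finite ?P" using q by (intro finite_primitive_characters) simp
    define \<sigma> where "\<sigma> = 1 - c * L powr (\<delta> - 1)"
    define bad where "bad = {chi \<in> ?P. \<exists>s. L_fun F chi s = 0 \<and> Re s \<ge> \<sigma> \<and> \<bar>Im s\<bar> \<le> L ^ 10}"
    define X where "X e = {chi \<in> ?P. chi (-1) = e \<and> chi \<notin> bad}" for e
    define a where "a = nat \<lceil>L powr (1 - \<delta> + \<epsilon>)\<rceil>"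
    define b where "b = nat \<lfloor>L powr (1 - \<epsilon>)\<rfloor>"
    have "(1 - \<delta> + \<epsilon>) - (1 - \<epsilon>) = - \<eta>" unfolding \<epsilon>_def by (simp add: field_simps)
    moreover have "2 \<le> L powr (1 - \<delta> + \<epsilon>)" "L powr (1 - \<delta> + \<epsilon>) + 3 \<le> L powr (1 - \<epsilon>)"
      "L powr \<eta> \<le> 2 powr (L powr (1 - \<delta> + \<epsilon>))" using par by blast+
    moreover have "1 - \<epsilon> \<le> 1" using \<epsilon> by simp
    ultimately have cut: "2 \<le> a" "a \<le> b" "real b \<le> L powr (1 - \<epsilon>)" "L powr (1 - \<delta> + \<epsilon>) \<le> real a"
      "sqrt (real a / real b) \<le> 2 / h" "sqrt (1 / 2 ^ a) \<le> 1 / h"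
      using cutoff_bounds[OF _ _ L _ _ _ a_def b_def] unfolding h_def by blast+
    have bL: "real b \<le> L / 16" using cut(3) par by linarith
    \<comment> \<open>The factor 2 comes from m < 2 * 2 ^ i. As b \<le> L, one power of L pays for
      the number of blocks and the other one for h.\<close>
    define \<beta> where "\<beta> = 2 * Ap / L ^ 2"
    have \<beta>0: "\<beta> \<ge> 0" using Ap by (simp add: \<beta>_def)
    have \<beta>b: "\<beta> * real b \<le> 1 / h"
    proof -
      have "\<beta> * real b \<le> \<beta> * L" using bL L by (intro mult_left_mono \<beta>0) simp
      also have "\<dots> = 2 * Ap / L" by (simp add: \<beta>_def power2_eq_square)
      also have "\<dots> \<le> 1 / h" using par L h0 by (simp add: h_def field_simps)
      finally show ?thesis .
    qed
    have h1: "h \<ge> 1" unfolding h_def using L \<eta> by (intro ge_one_powr_ge_zero) auto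
    have "1 / h \<le> 1" using h1 by simp
    then have \<beta>b1: "\<beta> * real b \<le> 1" using \<beta>b by linarith
    have nonexc: "(\<Sum>chi\<in>X e. (norm (L_fun F chi (1/2)))\<^sup>2) \<le> k\<^sup>2 * (Z\<^sup>2 / L powr \<eta>)" if e: "e \<in> {1, -1}" for e
    proof -
      have "L2_set (\<lambda>chi. norm (L_fun F chi (1/2))) (X e) \<le>
         CL * (sqrt (real q) * sqrt (2 ^ b) * cond_root q powr (1/8) + sqrt (cond_root q) * (sqrt (real a / real b) + sqrt (1 / 2 ^ a) + \<beta> * real b))"
      proof (rule CL(2)[where e = e])
        show "finite (X e)" unfolding X_def using finP by simp
        show "good q chi" if "chi \<in> X e" for chi using that good[OF q(1)] by (simp add: X_def)
        show "chi (-1) = e" if "chi \<in> X e" for chi using that by (simp add: X_def)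
        show "norm (\<Sum>n\<le>m. prime_coeff chi n) \<le> \<beta> * 2 ^ i"
          if chi: "chi \<in> X e" and i: "a \<le> i" "i < b" and m: "2 ^ i - 1 \<le> m" "m < 2 ^ Suc i" for chi i m
        proof -
          have chiP: "chi \<in> ?P" "chi \<notin> bad" using chi by (auto simp: X_def)
          \<comment> \<open>Partial summation also needs the sum up to m = 2 ^ i - 1, so only m
            \<ge> 2 ^ (a - 1) is available. The factor 1/3 comes from (a - 1) ln 2 \<ge> (a / 2) (2
            / 3).\<close>
          have "(2::nat) ^ a \<le> 2 ^ i" using i by (intro power_increasing) auto
          moreover have "(2::nat) ^ a = 2 * 2 ^ (a - 1)" using cut(1) by (simp add: power_eq_if)
          moreover have "(1::nat) \<le> 2 ^ (a - 1)" by simp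
          ultimately have ma: "2 ^ (a - 1) \<le> m" using m(1) by linarith
          then have m0: "m > 0" by (intro gr0I) auto
          have "1/3 * L powr (1 - \<delta> + \<epsilon>) \<le> 1/3 * real a" using cut(4) by simp
          also have "\<dots> \<le> real (a - 1) * (2/3)" using cut(1) by (simp add: of_nat_diff)
          also have "\<dots> \<le> real (a - 1) * ln 2" using ln2_ge_two_thirds by (intro mult_left_mono) auto
          also have "\<dots> = ln (2 ^ (a - 1))" by (simp add: ln_realpow)
          also have "\<dots> \<le> ln (real m)"
          proof -
            have "real (2 ^ (a - 1)) \<le> real m" using ma by (simp only: of_nat_le_iff)
            then show ?thesis using m0 by simp
          qed
          finally have lnm: "1/3 * L powr (1 - \<delta> + \<epsilon>) \<le> ln (real m)" .
          have mq: "real m \<le> sqrt (real q)"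
          proof -
            have "(2::nat) ^ Suc i \<le> 2 ^ b" using i by (intro power_increasing) auto
            then have "m \<le> 2 ^ b" using m(2) by linarith
            then have "real m \<le> real (2 ^ b)" by (simp only: of_nat_le_iff)
            also have "\<dots> = exp (real b * ln 2)" by (simp add: powr_realpow[symmetric] powr_def)
            also have "\<dots> \<le> exp (L / 2)"
            proof -
              have "ln 2 \<le> (1::real)" using ln_le_minus_one[of "2::real"] by simp
              then have "real b * ln 2 \<le> real b * 1" by (intro mult_left_mono) auto
              then show ?thesis using bL L by simp
            qed
            also have "\<dots> = sqrt (real q)"
              by (rule real_sqrt_unique[symmetric]) (simp_all add: qL power2_eq_square flip: exp_add)
            finally show ?thesis .
          qed
          have "norm (\<Sum>n\<le>m. prime_coeff chi n) \<le> Ap * real m / L ^ 2"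
            unfolding L_def
          proof (rule primes[OF good[OF q(1) chiP(1)] _ N(2)])
            show "L0 \<le> ln (real q)" using par by (simp add: L_def)
            show "L_fun F chi s \<noteq> 0" if "1 - c * ln (real q) powr (\<delta> - 1) \<le> Re s" "\<bar>Im s\<bar> \<le> ln (real q) ^ 10" for s
              using that chiP unfolding bad_def \<sigma>_def L_def by blast
          qed (use lnm m0 mq in \<open>simp_all add: L_def\<close>)
          also have "\<dots> \<le> Ap * (2 * 2 ^ i) / L ^ 2"
          proof (intro divide_right_mono mult_left_mono)
            have "real m \<le> real (2 ^ Suc i)" using m(2) by (simp only: of_nat_le_iff less_imp_le)
            then show "real m \<le> 2 * 2 ^ i" by simp
          qed (use Ap in auto)
          finally show ?thesis by (simp add: \<beta>_def mult_ac)
        qed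
      qed (use e q N cut \<beta>0 \<beta>b1 in auto)
      also have "\<dots> \<le> CL * (K' powr (1/16) * Z * (1 / h) + K' powr (1/4) * Z * (2 / h + 1 / h + 1 / h))"
      proof -
        have "1 / exp (L / 32) \<le> 1 / h" using par h0 by (intro divide_left_mono) (auto simp: h_def)
        then have ex: "exp (- (L / 32)) \<le> 1 / h" by (simp add: exp_minus inverse_eq_divide)
        have "sqrt (real q) * sqrt (2 ^ b) * cond_root q powr (1/8) \<le> K' powr (1/16) * Z * exp (- (L / 32))"
          unfolding Z_def L_def using q N K' d bL L by (intro main_term_bounds) (auto simp: L_def)
        also have "\<dots> \<le> K' powr (1/16) * Z * (1 / h)" using Z0 by (intro mult_left_mono ex) auto
        finally have t1: "sqrt (real q) * sqrt (2 ^ b) * cond_root q powr (1/8) \<le> K' powr (1/16) * Z * (1 / h)" .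
        have t2: "sqrt (cond_root q) \<le> K' powr (1/4) * Z"
          unfolding Z_def L_def using q N K' d bL L by (intro main_term_bounds(2)) (auto simp: L_def)
        have t3: "sqrt (real a / real b) + sqrt (1 / 2 ^ a) + \<beta> * real b \<le> 2 / h + 1 / h + 1 / h"
          by (intro add_mono cut \<beta>b)
        show ?thesis
          by (rule mult_left_mono[OF add_mono[OF t1 mult_mono[OF t2 t3]]]) (use CL \<beta>0 Z0 in auto)
      qed
      also have "\<dots> = k * (Z / h)" unfolding k_def by (simp add: algebra_simps add_divide_distrib)
      finally have le: "L2_set (\<lambda>chi. norm (L_fun F chi (1/2))) (X e) \<le> k * (Z / h)" .
      have "(\<Sum>chi\<in>X e. (norm (L_fun F chi (1/2)))\<^sup>2) = (L2_set (\<lambda>chi. norm (L_fun F chi (1/2))) (X e))\<^sup>2"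
        unfolding L2_set_def by (simp add: sum_nonneg)
      also have "\<dots> \<le> (k * (Z / h))\<^sup>2" by (intro power_mono le L2_set_nonneg)
      finally show ?thesis by (simp add: power_mult_distrib power_divide h2)
    qed
    have exc: "(\<Sum>chi\<in>bad. (norm (L_fun F chi (1/2)))\<^sup>2) \<le> \<bar>K5\<bar> * K6\<^sup>2 * (Z\<^sup>2 / L powr \<eta>)"
    proof -
      have \<sigma>: "1 - 1 / 2024 < \<sigma>" "\<sigma> < 1" using par c L by (auto simp: \<sigma>_def)
      have "real q powr (C * (1 - \<sigma>)) = exp (C * c * (L * L powr (\<delta> - 1)))"
        unfolding \<sigma>_def by (simp add: qL powr_def mult_ac)
      also have "C * c * (L * L powr (\<delta> - 1)) = L powr \<delta>" using C L by (simp add: c_def powr_diff)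
      finally have qC: "real q powr (C * (1 - \<sigma>)) = exp (L powr \<delta>)" .
      have "(\<Sum>chi\<in>?P. real (zero_count F \<sigma> (L ^ 10) chi)) \<le> K5 * (real q powr (C * (1 - \<sigma>)) * ln (real q) powr A)"
      proof (rule zeros[OF q(1) \<sigma>])
        show "1 \<le> L ^ 10" using L by (rule one_le_power)
        show "L ^ 10 \<le> real q" using par by (simp add: qL)
      qed
      also have "\<dots> \<le> \<bar>K5\<bar> * (exp (L powr \<delta>) * L powr A)" unfolding qC L_def by (intro mult_right_mono) auto
      finally have "(\<Sum>chi\<in>bad. (norm (L_fun F chi (1/2)))\<^sup>2) \<le> \<bar>K5\<bar> * (exp (L powr \<delta>) * L powr A) * (K6 * (Z / exp (L powr \<delta>)))\<^sup>2"
        unfolding bad_def using half[OF q(1)] good[OF q(1)] finP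
        by (intro sum_exceptional_le) (auto simp: Z1 L_def)
      also have "\<dots> = \<bar>K5\<bar> * K6\<^sup>2 * Z\<^sup>2 * (L powr A / exp (L powr \<delta>))" by (simp add: power_mult_distrib power_divide power2_eq_square)
      \<comment> \<open>The remaining exp (- L powr \<delta>) absorbs the power of the logarithm in
        the zero density bound together with L powr \<eta>.\<close>
      also have "\<dots> \<le> \<bar>K5\<bar> * K6\<^sup>2 * Z\<^sup>2 * (1 / L powr \<eta>)"
      proof (intro mult_left_mono)
        have "L powr A * L powr \<eta> \<le> exp (L powr \<delta>)" using par by (simp add: powr_add)
        then show "L powr A / exp (L powr \<delta>) \<le> 1 / L powr \<eta>" using L by (simp add: field_simps)
      qed auto
      finally show ?thesis by simp
    qed
    have P: "?P = X 1 \<union> X (-1) \<union> bad"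
    proof
      show "?P \<subseteq> X 1 \<union> X (-1) \<union> bad"
      proof
        fix chi assume chi: "chi \<in> ?P"
        then have "chi (-1) \<in> {1, -1}" using good[OF q(1) chi] by (intro dirichlet_character_minus_one[of q]) (simp add: good_def)
        then show "chi \<in> X 1 \<union> X (-1) \<union> bad" using chi by (auto simp: X_def)
      qed
    qed (auto simp: X_def bad_def)
    have "(\<Sum>chi\<in>?P. (norm (L_fun F chi (1/2)))\<^sup>2) = (\<Sum>chi\<in>X 1 \<union> X (-1). (norm (L_fun F chi (1/2)))\<^sup>2) + (\<Sum>chi\<in>bad. (norm (L_fun F chi (1/2)))\<^sup>2)"
      unfolding P by (rule sum.union_disjoint) (use finP in \<open>auto simp: X_def bad_def\<close>)
    also have "(\<Sum>chi\<in>X 1 \<union> X (-1). (norm (L_fun F chi (1/2)))\<^sup>2) = (\<Sum>chi\<in>X 1. (norm (L_fun F chi (1/2)))\<^sup>2) + (\<Sum>chi\<in>X (-1). (norm (L_fun F chi (1/2)))\<^sup>2)"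
      by (rule sum.union_disjoint) (use finP in \<open>auto simp: X_def\<close>)
    also have "\<dots> + (\<Sum>chi\<in>bad. (norm (L_fun F chi (1/2)))\<^sup>2) \<le> k\<^sup>2 * (Z\<^sup>2 / L powr \<eta>) + k\<^sup>2 * (Z\<^sup>2 / L powr \<eta>) + \<bar>K5\<bar> * K6\<^sup>2 * (Z\<^sup>2 / L powr \<eta>)"
      by (intro add_mono nonexc exc) auto
    also have "\<dots> = (2 * k\<^sup>2 + \<bar>K5\<bar> * K6\<^sup>2) * (Z\<^sup>2 / L powr \<eta>)" by (simp add: algebra_simps)
    finally show "(\<Sum>chi\<in>?P. (norm (L_fun F chi (1 / 2)))\<^sup>2) \<le> (2 * k\<^sup>2 + \<bar>K5\<bar> * K6\<^sup>2) * (real q powr (real d / 2) / ln (real q) powr \<eta>)"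
      unfolding Z2 L_def .
  qed auto
qed

end

theorem theorem1p4:
  fixes F :: L_data and d :: nat and Q :: "nat set" and \<delta> \<eta> :: real
  assumes "L_degree F = d" and "d \<ge> 3"
    and "\<forall>q\<in>Q. q \<ge> 2"
    and "0 < \<delta>" and "\<delta> < 1"
    and framework: "L_framework F Q"
    and A1: "\<forall>n\<ge>1. norm (lam F n) \<le> real (divisor_tau d n)"
    and A2: "\<exists>\<epsilon>>0. \<exists>K X\<^sub>0. \<forall>X Y :: real.
               X \<ge> 2 \<and> X \<ge> X\<^sub>0 \<and> X powr (1 - \<epsilon>) \<le> Y \<and> Y \<le> X \<longrightarrow>
               (\<Sum>n | X \<le> real n \<and> real n \<le> X + Y. (norm (lam F n))\<^sup>2) \<le> K * Y"
    and A3: "\<exists>K. \<forall>P\<^sub>1 P\<^sub>2 X :: real. 2 \<le> P\<^sub>1 \<and> P\<^sub>1 \<le> P\<^sub>2 \<and> P\<^sub>2 \<le> X \<longrightarrow>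
               (\<Sum>n | 1 \<le> n \<and> real n \<le> X \<and>
                      coprime n (\<Prod>p | prime p \<and> P\<^sub>1 \<le> real p \<and> real p \<le> P\<^sub>2. p).
                  (norm (lam F n))\<^sup>2)
               \<le> K * (X * ln P\<^sub>1 / ln P\<^sub>2)"
    and A5: "\<exists>C\<^sub>F>0. \<exists>A>0. \<exists>K. \<forall>q\<in>Q. \<forall>\<sigma> T :: real.
               1 - 1 / 2024 < \<sigma> \<and> \<sigma> < 1 \<and> 1 \<le> T \<and> T \<le> real q \<longrightarrow>
               (\<Sum>chi\<in>primitive_characters q. real (zero_count F \<sigma> T chi))
               \<le> K * (real q powr (C\<^sub>F * (1 - \<sigma>)) * ln (real q) powr A)"
    and A6: "\<exists>K. \<forall>q\<in>Q. \<forall>chi\<in>primitive_characters q.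
               norm (L_fun F chi (1 / 2)) \<le>
                 K * (real q powr (real d / 4) / exp (ln (real q) powr \<delta>))"
    and "\<eta> < \<delta>"
  shows "\<exists>K. \<forall>q\<in>Q. (\<Sum>chi\<in>primitive_characters q. (norm (L_fun F chi (1 / 2)))\<^sup>2)
           \<le> K * (real q powr (real d / 2) / ln (real q) powr \<eta>)"
proof -
  note fw1 = framework[unfolded L_framework_def assms(1)]
  note fw2 = conjunct2[OF fw1] note fw3 = conjunct2[OF fw2] note fw4 = conjunct2[OF fw3]
  note fw5 = conjunct2[OF fw4] note fw6 = conjunct2[OF fw5] note fw7 = conjunct2[OF fw6]
  obtain \<theta> where \<theta>: "1 / (2 * real d) < \<theta>"
      "\<And>e j. e \<in> {1, -1} \<Longrightarrow> j < d \<Longrightarrow> Re (shift F e j) \<ge> -1 + \<theta>"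
    using conjunct1[OF fw4] by blast
  have \<theta>0: "\<theta> > 0" using \<theta>(1) by (rule le_less_trans[rotated]) simp
  have euler: "abs_convergent_euler_product F (\<lambda>_. 1)" by (rule conjunct1[OF fw3])
  interpret L_family F d
  proof
    show "L_degree F = d" by (rule assms(1))
    show "lam F (m * n) = lam F m * lam F n" if "m > 0" "n > 0" "coprime m n" for m n
      using conjunct1[OF fw1] that by blast
    show "lam F (p ^ r) = complete_homogeneous (\<lambda>j. satake F j p) d r" if "prime p" for p r
      using conjunct1[OF fw2] that unfolding complete_homogeneous_def by blast
    show "norm (lam F n) \<le> real (divisor_tau d n)" if "n \<ge> 1" for n using A1 that by blast
    show "d > 0" using assms(2) by simp
    show "Re (shift F e j) > -1" if "e \<in> {1, -1}" "j < d" for e j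
      using \<theta>(2)[of e j] that \<theta>0 by simp
    \<comment> \<open>Absolute convergence of the untwisted series at real \<sigma>, that is, the
      framework clause with the constant function 1 in place of a character.\<close>
    show "summable (\<lambda>n. norm (lam F (Suc n)) / real (Suc n) powr \<sigma>)" if "\<sigma> > 1" for \<sigma>
    proof -
      have "summable (\<lambda>n. norm (L_term F (\<lambda>_. 1) (of_real \<sigma>) (Suc n)))"
        using euler that unfolding abs_convergent_euler_product_def by simp
      moreover have "norm (L_term F (\<lambda>_. 1) (of_real \<sigma>) (Suc n)) = norm (lam F (Suc n)) / real (Suc n) powr \<sigma>" for n
        by (simp add: L_term_def norm_divide norm_of_nat_powr del: of_nat_Suc)
      ultimately show ?thesis by (simp only:)
    qed
  qed
  have good: "good q chi" if "q \<in> Q" "chi \<in> primitive_characters q" for q chi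
  proof -
    have "q \<ge> 2" using assms(3) that by blast
    moreover have "dirichlet_character q chi" using that by (simp add: primitive_characters_def)
    moreover have "conductor F q > 0" using conjunct1[OF fw5] that by blast
    moreover have "abs_convergent_euler_product F chi \<and>
        is_entire_extension (completed_series F q chi) (completed_L F q chi) \<and>
        entire_order (completed_L F q chi) = 1 \<and>
        (\<exists>\<kappa>. norm \<kappa> = 1 \<and>
           (\<forall>s. completed_L F q chi s =
                \<kappa> * completed_L (dual F) q (\<lambda>a. cnj (chi a)) (1 - s)))"
      using conjunct1[OF fw6] that by blast
    ultimately show ?thesis unfolding good_def by blast
  qed
  obtain K\<^sub>c q\<^sub>0 where K\<^sub>c: "\<And>q. q \<in> Q \<Longrightarrow> q \<ge> q\<^sub>0 \<Longrightarrow> real (conductor F q) \<le> K\<^sub>c * real q ^ d"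
    using fw7 by blast
  define K' where "K' = max K\<^sub>c 1"
  have K'0: "K' > 0" by (simp add: K'_def)
  have K': "real (conductor F q) \<le> K' * real q ^ d" if "q \<in> Q" "q \<ge> q\<^sub>0" for q
    using K\<^sub>c[OF that] mult_right_mono[of K\<^sub>c K' "real q ^ d"] by (simp add: K'_def)
  obtain K2 where K2: "K2 > 0" "\<And>N. (\<Sum>n\<in>{1..N}. (norm (lam F n))\<^sup>2) \<le> K2 * real N"
    using second_moment[OF A2] by blast
  obtain K3 where K3: "K3 > 0" "\<And>a b N. 1 \<le> a \<Longrightarrow> 2 \<le> b \<Longrightarrow> a \<le> b \<Longrightarrow> 2 ^ b \<le> N \<Longrightarrow>
     (\<Sum>n\<in>{1..N}. (norm (rough_part a b n))\<^sup>2) \<le> K3 * real N * (real a / real b)"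
    using rough_second_moment[OF A3] by blast
  obtain C A K5 where C: "C > 0" "A > 0" and K5: "\<And>q \<sigma> T. q \<in> Q \<Longrightarrow> 1 - 1 / 2024 < \<sigma> \<Longrightarrow> \<sigma> < 1 \<Longrightarrow> 1 \<le> T \<Longrightarrow> T \<le> real q \<Longrightarrow>
       (\<Sum>chi\<in>primitive_characters q. real (zero_count F \<sigma> T chi)) \<le> K5 * (real q powr (C * (1 - \<sigma>)) * ln (real q) powr A)"
    using A5 by blast
  obtain K6 where K6: "\<And>q chi. q \<in> Q \<Longrightarrow> chi \<in> primitive_characters q \<Longrightarrow>
       norm (L_fun F chi (1 / 2)) \<le> K6 * (real q powr (real d / 4) / exp (ln (real q) powr \<delta>))"
    using A6 by blast
  \<comment> \<open>The estimates for large moduli call for a positive exponent, whereas \<eta> may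
    be zero or negative. A larger exponent gives a stronger bound once ln q \<ge> 1.\<close>
  define \<eta>' where "\<eta>' = max \<eta> (\<delta> / 2)"
  have \<eta>': "0 < \<eta>'" "\<eta>' < \<delta>" "\<eta> \<le> \<eta>'" using \<open>0 < \<delta>\<close> \<open>\<eta> < \<delta>\<close> by (auto simp: \<eta>'_def)
  obtain B L1 where B: "B \<ge> 0" and L1: "L1 \<ge> 1" and large: "\<And>q. q \<in> Q \<Longrightarrow> q \<ge> 2 \<Longrightarrow> conductor F q > 0 \<Longrightarrow>
     real (conductor F q) \<le> K' * real q ^ d \<Longrightarrow> ln (real q) \<ge> L1 \<Longrightarrow>
     (\<Sum>chi\<in>primitive_characters q. (norm (L_fun F chi (1 / 2)))\<^sup>2) \<le> B * (real q powr (real d / 2) / ln (real q) powr \<eta>')"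
    using large_modulus_bound[OF \<open>d \<ge> 3\<close> \<open>0 < \<delta>\<close> \<open>\<delta> < 1\<close> \<eta>'(1,2) K'0 K2(2) K3(2) less_imp_le[OF K3(1)] good K5 C K6] by blast
  let ?S = "\<lambda>q. \<Sum>chi\<in>primitive_characters q. (norm (L_fun F chi (1 / 2)))\<^sup>2"
  let ?V = "\<lambda>q. real q powr (real d / 2) / ln (real q) powr \<eta>"
  define q1 where "q1 = max q\<^sub>0 (nat \<lceil>exp L1\<rceil>)"
  \<comment> \<open>Each of the finitely many small moduli satisfies the bound with its own quotient
    as the constant, and the sum of these nonnegative quotients dominates all of them.\<close>
  define B' where "B' = (\<Sum>q\<in>Q \<inter> {..<q1}. ?S q / ?V q)"
  have V0: "?V q > 0" if "q \<in> Q" for q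
  proof -
    have "q \<ge> 2" using assms(3) that by blast
    then show ?thesis by simp
  qed
  have S0: "?S q \<ge> 0" for q by (intro sum_nonneg) simp
  have B': "B' \<ge> 0" unfolding B'_def using V0 S0 by (intro sum_nonneg divide_nonneg_pos) auto
  show ?thesis
  proof (intro exI[of _ "B + B'"] ballI)
    fix q assume q: "q \<in> Q"
    have q2: "q \<ge> 2" using assms(3) q by blast
    show "?S q \<le> (B + B') * ?V q"
    proof (cases "q < q1")
      case True
      have "?S q / ?V q \<le> B'"
        unfolding B'_def using True q V0 S0 by (intro member_le_sum[where f = "\<lambda>q. ?S q / ?V q"] divide_nonneg_pos) auto
      also have "\<dots> \<le> B + B'" using B by simp
      finally show ?thesis using V0[OF q] by (simp only: pos_divide_le_eq)
    next
      case False
      then have "q \<ge> q\<^sub>0" "nat \<lceil>exp L1\<rceil> \<le> q" by (simp_all only: q1_def not_less max.bounded_iff)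
      have "exp L1 \<le> real (nat \<lceil>exp L1\<rceil>)" by (rule real_nat_ceiling_ge)
      also have "\<dots> \<le> real q" using \<open>nat \<lceil>exp L1\<rceil> \<le> q\<close> by (simp only: of_nat_le_iff)
      finally have "exp L1 \<le> real q" .
      then have L: "ln (real q) \<ge> L1" using q2 by (simp add: ln_ge_iff)
      have N: "conductor F q > 0" using conjunct1[OF fw5] q by blast
      have "?S q \<le> B * (real q powr (real d / 2) / ln (real q) powr \<eta>')"
        by (rule large[OF q q2 N K'[OF q \<open>q \<ge> q\<^sub>0\<close>] L])
      also have "\<dots> \<le> B * ?V q"
      proof (intro mult_left_mono divide_left_mono B)
        show "ln (real q) powr \<eta> \<le> ln (real q) powr \<eta>'" using L L1 \<eta>' by (intro powr_mono) auto
      qed (use L L1 in auto)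
      also have "\<dots> \<le> (B + B') * ?V q" using B' V0[OF q] by (intro mult_right_mono) auto
      finally show ?thesis .
    qed
  qed
qed

end
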